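(* Let $\Sigma$ be a Riemann surface, let $\varphi:\Sigma\to S^6\subset\mathbb{R}^7$ be a conformal harmonic immersion and let $F:\Sigma\to\mathbb{R}^7$ be such that $dF=\varphi\times *d\varphi$. Then $F$ is isotropic if, and only if, $F$ is pseudo-umbilical and $\varphi_2$ is isotropic (that is, either $\varphi_2=\{0\}$ or $\varphi_2$ is an isotropic line bundle). In particular, if $F$ is isotropic, then, up to change of orientation of $\Sigma$, one of the following statements holds: (1) $\varphi$ is an almost complex curve; (2) $\varphi=R_{\mathbf{v}}(\beta)\tilde\varphi$ for some unit vector $\mathbf{v}\in\mathbb{R}^7$, some angle $\beta$ and some almost complex curve $\tilde\varphi$ of type (III) with $\tilde\varphi(\Sigma)\subset S^6\cap\mathbf{v}^\perp$; (3) $\varphi$ is totally geodesic; (4) $\varphi$ is superminimal in $S^4=S^6\cap W$, for some $5$-dimensional vector subspace $W$ of $\mathbb{R}^7$.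
   Context: $\times$ is the $7$-dimensional cross product on $\mathbb{R}^7$: the bilinear antisymmetric product with $\mathbf{e}_i\times\mathbf{e}_j=\mathbf{e}_k$ for $(i,j,k)$ equal to, or a cyclic permutation of, one of $(1,2,3),(1,4,5),(1,7,6),(2,4,6),(2,5,7),(3,4,7),(3,6,5)$. $S^6$ is the unit sphere of $\mathbb{R}^7$; $\cdot$ is the inner product, extended complex bilinearly to $\mathbb{C}^7$. With a local conformal coordinate $z=x+iy$, $dF=\varphi\times *d\varphi$ means $F_x=\varphi\times\varphi_y$, $F_y=-\varphi\times\varphi_x$ ($F$ exists if $\Sigma$ is simply connected, and is unique up to an additive constant; it is a conformal immersion). $\mathbf{I}_F$, $\mathbf{I\!I}_F$ are the first and second fundamental forms, $\mathbf{h}_F=\frac12\mathrm{tr}\,\mathbf{I}_F^{-1}\mathbf{I\!I}_F$ is the mean curvature vector. $F$ is pseudo-umbilical if $\mathbf{I\!I}_F\cdot\mathbf{h}_F=\lambda\,\mathbf{I}_F$ for some smooth function $\lambda$ on $\Sigma$. The immersion $F$ is isotropic if at each point all its normal curvature vectors $\mathbf{I\!I}_F(\mathbf{u},\mathbf{u})$, $\mathbf{u}$ a unit tangent vector, have the same length. Harmonic sequence: $\varphi$ is identified with the line subbundle $\varphi_0=\varphi$ it spans in $\Sigma\times\mathbb{C}^7$. For $j\ge0$, $\varphi_{j+1}$ is the image bundle (extended across isolated singularities) of $A'_{\varphi_j}(v)=P^{\perp_h}_{\varphi_j}(\partial v/\partial z)$, where $v$ is a section of $\varphi_j$ and $P^{\perp_h}_{\varphi_j}$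 is the projection onto the orthogonal bundle of $\varphi_j$ for the standard Hermitian product; $\varphi_{-j}=\overline{\varphi_j}$. $\varphi_2$ is isotropic if $s\cdot s=0$ for all its local sections $s$. The map $\varphi$ is superminimal if $\varphi_j=\{0\}$ for some $j>0$. An almost complex curve is a non-constant smooth map $\varphi:\Sigma\to S^6$ whose differential is complex linear with respect to $J\mathbf{u}=\mathbf{x}\times\mathbf{u}$ ($\mathbf{u}\in T_{\mathbf{x}}S^6$), i.e. $\varphi_y=\varphi\times\varphi_x$. It is of type (III) if it is linearly full in some totally geodesic $S^5$ in $S^6$ (i.e. its image lies in $S^6\cap U$ for some $6$-dimensional linear subspace $U$ and in no smaller linear subspace). For a unit vector $\mathbf{v}$ and an angle $\beta$, $R_{\mathbf{v}}(\beta)\in SO(7)$ is the rotation with $R_{\mathbf{v}}(\beta)\mathbf{v}=\mathbf{v}$ and $R_{\mathbf{v}}(\beta)\mathbf{x}=\cos\beta\,\mathbf{x}+\sin\beta\,\mathbf{v}\times\mathbf{x}$ for $\mathbf{x}\in S^6\cap\mathbf{v}^\perp$. "Up to change of orientation of $\Sigma$" means after possibly replacing the complex structure of $\Sigma$ by the conjugate one. *)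

theory Defs
  imports "HOL-Analysis.Analysis"
begin

subsection \<open>The cross product of seven-space\<close>

definition cross7_triples :: "(7 \<times> 7 \<times> 7) list" where
  "cross7_triples = [(1,2,3), (1,4,5), (1,7,6), (2,4,6), (2,5,7), (3,4,7), (3,6,5)]"

definition cross7 :: "real^7 \<Rightarrow> real^7 \<Rightarrow> real^7"  (infixr "\<times>\<^sub>7" 80) where
  "x \<times>\<^sub>7 y = (\<Sum>(i,j,k) \<leftarrow> cross7_triples.
      (x$i * y$j - x$j * y$i) *\<^sub>R axis k 1
    + (x$j * y$k - x$k * y$j) *\<^sub>R axis i 1
    + (x$k * y$i - x$i * y$k) *\<^sub>R axis j 1)"

lemma cross7_skew: "x \<times>\<^sub>7 y = - (y \<times>\<^sub>7 x)"
  unfolding cross7_def uminus_sum_list_map o_def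
  by (rule arg_cong[where f = sum_list], rule map_cong[OF refl]) (auto simp: algebra_simps)

lemma bilinear_cross7: "bilinear (\<times>\<^sub>7)"
proof -
  have sl: "linear (\<lambda>x. \<Sum>t\<leftarrow>ts. f t x)" if "\<And>t. linear (f t)"
    for ts :: "(7 \<times> 7 \<times> 7) list" and f :: "_ \<Rightarrow> real^7 \<Rightarrow> real^7"
    by (induction ts) (use that in \<open>auto intro: linear_compose_add module_hom_zero\<close>)
  have "linear (\<lambda>x. x \<times>\<^sub>7 y)" for y
    unfolding cross7_def
    by (rule sl) (auto intro!: linearI simp: algebra_simps)
  moreover from this have "linear (\<lambda>y. x \<times>\<^sub>7 y)" for x
    by (subst cross7_skew) (intro linear_compose_neg)
  ultimately show ?thesis by (simp add: bilinear_def)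
qed

lemma cross7_axis:
  "\<forall>(i,j,k) \<in> set cross7_triples.
     axis i 1 \<times>\<^sub>7 axis j 1 = axis k 1 \<and>
     axis j 1 \<times>\<^sub>7 axis k 1 = axis i 1 \<and>
     axis k 1 \<times>\<^sub>7 axis i 1 = axis j 1"
  by (simp add: cross7_triples_def) (simp add: cross7_def cross7_triples_def axis_def)

text \<open>The linear extension to \<open>\<real>\<^sup>7\<close> of the rotation about a unit vector \<open>v\<close> that is
  prescribed on \<open>v\<close> and on the unit sphere of its orthogonal complement.\<close>

definition rot7 :: "real^7 \<Rightarrow> real \<Rightarrow> real^7 \<Rightarrow> real^7" where
  "rot7 v \<beta> x = (x \<bullet> v) *\<^sub>R v + cos \<beta> *\<^sub>R (x - (x \<bullet> v) *\<^sub>R v) + sin \<beta> *\<^sub>R (v \<times>\<^sub>7 x)"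

lemma linear_rot7: "linear (rot7 v \<beta>)"
proof -
  have "linear (\<lambda>x. v \<times>\<^sub>7 x)" using bilinear_cross7 by (simp add: bilinear_def)
  then show ?thesis
    by (auto intro!: linearI simp: rot7_def linear_add linear_scale inner_add_left algebra_simps)
qed

lemma rot7_axis: "norm v = 1 \<Longrightarrow> rot7 v \<beta> v = v"
proof -
  assume "norm v = 1"
  moreover have "v \<times>\<^sub>7 v = 0" using cross7_skew[of v v] by (simp add: vec_eq_iff)
  ultimately show ?thesis by (simp add: rot7_def dot_square_norm)
qed

lemma rot7_orthogonal: "x \<bullet> v = 0 \<Longrightarrow> rot7 v \<beta> x = cos \<beta> *\<^sub>R x + sin \<beta> *\<^sub>R (v \<times>\<^sub>7 x)"
  by (simp add: rot7_def)

subsection \<open>Smooth functions of one complex variable\<close>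

definition dir_deriv :: "complex \<Rightarrow> (complex \<Rightarrow> 'b::real_normed_vector) \<Rightarrow> complex \<Rightarrow> 'b" where
  "dir_deriv u g w = frechet_derivative g (at w) u"

primrec Ck_on :: "nat \<Rightarrow> complex set \<Rightarrow> (complex \<Rightarrow> 'b::real_normed_vector) \<Rightarrow> bool" where
  "Ck_on 0 S g \<longleftrightarrow> continuous_on S g"
| "Ck_on (Suc k) S g \<longleftrightarrow>
     (\<forall>w\<in>S. g differentiable (at w)) \<and> Ck_on k S (dir_deriv 1 g) \<and> Ck_on k S (dir_deriv \<i> g)"

definition smooth_on :: "complex set \<Rightarrow> (complex \<Rightarrow> 'b::real_normed_vector) \<Rightarrow> bool" where
  "smooth_on S g \<longleftrightarrow> (\<forall>k. Ck_on k S g)"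

subsection \<open>Riemann surfaces\<close>

text \<open>A chart is a pair of its domain and its coordinate function; the values of the coordinate
  function outside the domain are irrelevant.\<close>

type_synonym 'a chart = "'a set \<times> ('a \<Rightarrow> complex)"

definition riemann_surface :: "'a topology \<Rightarrow> 'a chart set \<Rightarrow> bool" where
  "riemann_surface X A \<longleftrightarrow>
     topspace X \<noteq> {} \<and> connected_space X \<and> Hausdorff_space X \<and>
     (\<Union>(U,z)\<in>A. U) = topspace X \<and>
     (\<forall>(U,z)\<in>A. openin X U \<and> open (z ` U) \<and>
        homeomorphic_map (subtopology X U) (top_of_set (z ` U)) z) \<and>
     (\<forall>(U,z)\<in>A. \<forall>(V,w)\<in>A. (w \<circ> inv_into U z) holomorphic_on z ` (U \<inter> V))"

definition conj_atlas :: "'a chart set \<Rightarrow> 'a chart set" where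
  "conj_atlas A = (\<lambda>(U,z). (U, cnj \<circ> z)) ` A"

definition in_chart :: "'a set \<Rightarrow> ('a \<Rightarrow> complex) \<Rightarrow> ('a \<Rightarrow> 'b) \<Rightarrow> complex \<Rightarrow> 'b" where
  "in_chart U z f = f \<circ> inv_into U z"

definition smooth_map_on ::
    "'a chart set \<Rightarrow> 'a set \<Rightarrow> ('a \<Rightarrow> 'b::real_normed_vector) \<Rightarrow> bool" where
  "smooth_map_on A V f \<longleftrightarrow> (\<forall>(U,z)\<in>A. smooth_on (z ` (U \<inter> V)) (in_chart U z f))"

text \<open>\<open>P g w\<close> is a property of coordinate representations \<open>g\<close> at points \<open>w\<close>; below it is always
  invariant under holomorphic changes of coordinates.\<close>

definition pointwise ::
    "'a chart set \<Rightarrow> ((complex \<Rightarrow> 'b) \<Rightarrow> complex \<Rightarrow> bool) \<Rightarrow> ('a \<Rightarrow> 'b) \<Rightarrow> bool" where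
  "pointwise A P f \<longleftrightarrow> (\<forall>(U,z)\<in>A. \<forall>p\<in>U. P (in_chart U z f) (z p))"

subsection \<open>Fundamental forms\<close>

definition first_form ::
    "(complex \<Rightarrow> 'b::euclidean_space) \<Rightarrow> complex \<Rightarrow> complex \<Rightarrow> complex \<Rightarrow> real" where
  "first_form g w u v = dir_deriv u g w \<bullet> dir_deriv v g w"

definition tangent_plane :: "(complex \<Rightarrow> 'b::euclidean_space) \<Rightarrow> complex \<Rightarrow> 'b set" where
  "tangent_plane g w = range (\<lambda>u. dir_deriv u g w)"

definition normal_part :: "'b::euclidean_space set \<Rightarrow> 'b \<Rightarrow> 'b" where
  "normal_part T x = (THE n. n \<in> orthogonal_comp T \<and> x - n \<in> T)"

definition second_form ::
    "(complex \<Rightarrow> 'b::euclidean_space) \<Rightarrow> complex \<Rightarrow> complex \<Rightarrow> complex \<Rightarrow> 'b" where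
  "second_form g w u v = normal_part (tangent_plane g w) (dir_deriv u (dir_deriv v g) w)"

text \<open>Half the trace of \<open>I\<^sup>-\<^sup>1 II\<close>, with the \<open>2 \<times> 2\<close> Gram matrix of the coordinate basis inverted
  explicitly.\<close>

definition mean_curvature :: "(complex \<Rightarrow> 'b::euclidean_space) \<Rightarrow> complex \<Rightarrow> 'b" where
  "mean_curvature g w =
     (let a = first_form g w 1 1; b = first_form g w 1 \<i>; c = first_form g w \<i> \<i>
      in (1 / (2 * (a * c - b\<^sup>2))) *\<^sub>R
           (c *\<^sub>R second_form g w 1 1 - (2 * b) *\<^sub>R second_form g w 1 \<i> + a *\<^sub>R second_form g w \<i> \<i>))"

definition pseudo_umbilical ::
    "'a topology \<Rightarrow> 'a chart set \<Rightarrow> ('a \<Rightarrow> 'b::euclidean_space) \<Rightarrow> bool" where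
  "pseudo_umbilical X A F \<longleftrightarrow>
     (\<exists>\<mu>::'a \<Rightarrow> real. smooth_map_on A (topspace X) \<mu> \<and>
        (\<forall>(U,z)\<in>A. \<forall>p\<in>U. \<forall>u v.
           second_form (in_chart U z F) (z p) u v \<bullet> mean_curvature (in_chart U z F) (z p)
           = \<mu> p * first_form (in_chart U z F) (z p) u v))"

definition isotropic_immersion :: "'a chart set \<Rightarrow> ('a \<Rightarrow> 'b::euclidean_space) \<Rightarrow> bool" where
  "isotropic_immersion A = pointwise A (\<lambda>g w.
     \<exists>r. \<forall>u. first_form g w u u = 1 \<longrightarrow> norm (second_form g w u u) = r)"

definition conformal_immersion :: "'a chart set \<Rightarrow> ('a \<Rightarrow> 'b::euclidean_space) \<Rightarrow> bool" where
  "conformal_immersion A = pointwise A (\<lambda>g w.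
     inj (\<lambda>u. dir_deriv u g w) \<and> (\<exists>c. \<forall>u v. first_form g w u v = c * (u \<bullet> v)))"

subsection \<open>Maps into the unit sphere\<close>

text \<open>Tangential part at \<open>x\<close>: it turns flat second derivatives of a map into the sphere into
  covariant ones.\<close>

definition sphere_tangential :: "'b::euclidean_space \<Rightarrow> 'b \<Rightarrow> 'b" where
  "sphere_tangential x y = y - (y \<bullet> x) *\<^sub>R x"

definition sphere_harmonic :: "'a chart set \<Rightarrow> ('a \<Rightarrow> 'b::euclidean_space) \<Rightarrow> bool" where
  "sphere_harmonic A = pointwise A (\<lambda>g w.
     sphere_tangential (g w)
       (dir_deriv 1 (dir_deriv 1 g) w + dir_deriv \<i> (dir_deriv \<i> g) w) = 0)"

text \<open>Vanishing of the second fundamental form relative to the sphere.\<close>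

definition sphere_totally_geodesic :: "'a chart set \<Rightarrow> ('a \<Rightarrow> 'b::euclidean_space) \<Rightarrow> bool" where
  "sphere_totally_geodesic A = pointwise A (\<lambda>g w. \<forall>u v.
     normal_part (tangent_plane g w) (sphere_tangential (g w) (dir_deriv u (dir_deriv v g) w)) = 0)"

text \<open>\<open>dF = \<phi> \<times> *d\<phi>\<close>, with the sign convention \<open>*dx = dy\<close> read off from
  \<open>F\<^sub>x = \<phi> \<times> \<phi>\<^sub>y\<close> and \<open>F\<^sub>y = - \<phi> \<times> \<phi>\<^sub>x\<close>.\<close>

definition cross_star_primitive ::
    "'a chart set \<Rightarrow> ('a \<Rightarrow> real^7) \<Rightarrow> ('a \<Rightarrow> real^7) \<Rightarrow> bool" where
  "cross_star_primitive A \<phi> F \<longleftrightarrow>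
     (\<forall>(U,z)\<in>A. \<forall>p\<in>U.
        dir_deriv 1 (in_chart U z F) (z p) = \<phi> p \<times>\<^sub>7 dir_deriv \<i> (in_chart U z \<phi>) (z p) \<and>
        dir_deriv \<i> (in_chart U z F) (z p) = - (\<phi> p \<times>\<^sub>7 dir_deriv 1 (in_chart U z \<phi>) (z p)))"

definition almost_complex_curve ::
    "'a topology \<Rightarrow> 'a chart set \<Rightarrow> ('a \<Rightarrow> real^7) \<Rightarrow> bool" where
  "almost_complex_curve X A \<phi> \<longleftrightarrow>
     \<phi> ` topspace X \<subseteq> sphere 0 1 \<and> smooth_map_on A (topspace X) \<phi> \<and>
     \<not> (\<exists>c. \<forall>p\<in>topspace X. \<phi> p = c) \<and>
     pointwise A (\<lambda>g w. \<forall>u. dir_deriv (\<i> * u) g w = g w \<times>\<^sub>7 dir_deriv u g w) \<phi>"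

definition linearly_full_in :: "'b::euclidean_space set \<Rightarrow> 'b set \<Rightarrow> bool" where
  "linearly_full_in U M \<longleftrightarrow>
     subspace U \<and> M \<subseteq> U \<and> \<not> (\<exists>U'. subspace U' \<and> U' \<subset> U \<and> M \<subseteq> U')"

definition almost_complex_type_III ::
    "'a topology \<Rightarrow> 'a chart set \<Rightarrow> ('a \<Rightarrow> real^7) \<Rightarrow> bool" where
  "almost_complex_type_III X A \<phi> \<longleftrightarrow>
     almost_complex_curve X A \<phi> \<and> (\<exists>U. dim U = 6 \<and> linearly_full_in U (\<phi> ` topspace X))"

subsection \<open>The harmonic sequence\<close>

definition herm :: "complex^'n \<Rightarrow> complex^'n \<Rightarrow> complex" where
  "herm x y = (\<Sum>i\<in>UNIV. x$i * cnj (y$i))"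

definition cdot :: "complex^'n \<Rightarrow> complex^'n \<Rightarrow> complex" where
  "cdot x y = (\<Sum>i\<in>UNIV. x$i * y$i)"

definition herm_perp_proj :: "(complex^'n) set \<Rightarrow> complex^'n \<Rightarrow> complex^'n" where
  "herm_perp_proj L x = (THE n. (\<forall>l\<in>L. herm n l = 0) \<and> x - n \<in> L)"

definition d_dz :: "(complex \<Rightarrow> complex^'n) \<Rightarrow> complex \<Rightarrow> complex^'n" where
  "d_dz v w = (1/2) *s (dir_deriv 1 v w - \<i> *s dir_deriv \<i> v w)"

text \<open>Subbundles of the trivial bundle are represented by their families of fibres.\<close>

definition local_section ::
    "'a topology \<Rightarrow> 'a chart set \<Rightarrow> ('a \<Rightarrow> (complex^'n) set) \<Rightarrow> 'a set \<Rightarrow> ('a \<Rightarrow> complex^'n) \<Rightarrow> bool"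
  where
  "local_section X A L V s \<longleftrightarrow> openin X V \<and> smooth_map_on A V s \<and> (\<forall>q\<in>V. s q \<in> L q)"

text \<open>Pointwise image of \<open>v \<mapsto> P(\<partial>v/\<partial>z)\<close>, \<open>P\<close> being the projection onto the Hermitian orthogonal
  complement of \<open>L\<close>. A change of chart multiplies the value by a non-zero scalar, so admitting
  all charts around \<open>p\<close> does not enlarge the image.\<close>

definition dz_image ::
    "'a topology \<Rightarrow> 'a chart set \<Rightarrow> ('a \<Rightarrow> (complex^'n) set) \<Rightarrow> 'a \<Rightarrow> (complex^'n) set" where
  "dz_image X A L p =
     {herm_perp_proj (L p) (d_dz (in_chart U z v) (z p)) | U z V v.
        (U,z) \<in> A \<and> p \<in> U \<and> p \<in> V \<and> local_section X A L V v}"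

text \<open>Extension of a family of lines across its isolated zeros: there the new fibre is the limit
  of the neighbouring lines, i.e. the set of all limits of vectors taken from them. Where
  zeros accumulate, in particular where the family vanishes identically, this set is \<open>{0}\<close>.\<close>

definition extend_bundle ::
    "'a topology \<Rightarrow> ('a \<Rightarrow> (complex^'n) set) \<Rightarrow> 'a \<Rightarrow> (complex^'n) set" where
  "extend_bundle X E p =
     (if E p = {0} then {v. ((\<lambda>q. infdist v (E q)) \<longlongrightarrow> 0) (atin X p)} else E p)"

primrec harmonic_sequence ::
    "'a topology \<Rightarrow> 'a chart set \<Rightarrow> ('a \<Rightarrow> real^'n) \<Rightarrow> nat \<Rightarrow> 'a \<Rightarrow> (complex^'n) set" where
  "harmonic_sequence X A \<phi> 0 = (\<lambda>p. range (\<lambda>c. c *s (\<chi> i. complex_of_real (\<phi> p $ i))))"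
| "harmonic_sequence X A \<phi> (Suc j) = extend_bundle X (dz_image X A (harmonic_sequence X A \<phi> j))"

definition isotropic_bundle ::
    "'a topology \<Rightarrow> 'a chart set \<Rightarrow> ('a \<Rightarrow> (complex^'n) set) \<Rightarrow> bool" where
  "isotropic_bundle X A L \<longleftrightarrow> (\<forall>V s. local_section X A L V s \<longrightarrow> (\<forall>q\<in>V. cdot (s q) (s q) = 0))"

definition superminimal :: "'a topology \<Rightarrow> 'a chart set \<Rightarrow> ('a \<Rightarrow> real^'n) \<Rightarrow> bool" where
  "superminimal X A \<phi> \<longleftrightarrow> (\<exists>j>0. \<forall>p\<in>topspace X. harmonic_sequence X A \<phi> j p = {0})"

end

theory Submission imports Defs "HOL-Complex_Analysis.Complex_Analysis"
begin

text \<open>In a conformal chart let \<open>P\<close> and \<open>Q\<close> be the components of \<open>\<phi>\<^sub>x\<^sub>x\<close> and \<open>\<phi>\<^sub>x\<^sub>y\<close> normal to the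
  surface in the sphere. Where it does not vanish, \<open>P - i Q\<close> spans \<open>\<phi>\<^sub>2\<close>, while the second fundamental
  form of \<open>F\<close> is a combination of \<open>\<phi>\<^sub>x \<times> \<phi>\<^sub>y\<close>, \<open>\<phi> \<times> P\<close> and \<open>\<phi> \<times> Q\<close>. With \<open>\<nu> = \<phi> \<times> (\<phi>\<^sub>x \<times> \<phi>\<^sub>y)\<close>,
  pseudo-umbilicity thus means that \<open>P\<close> and \<open>Q\<close> are orthogonal to \<open>\<nu>\<close>, isotropy of \<open>\<phi>\<^sub>2\<close> means that
  they are orthogonal to each other and of equal length, and isotropy of \<open>F\<close> is the conjunction.

  If \<open>F\<close> is isotropic, then the Codazzi equations make the derivatives of \<open>P\<close> and \<open>Q\<close> orthogonal to
  \<open>\<nu>\<close> as well. If \<open>\<nu>\<close> vanishes, then \<open>\<phi>\<^sub>y = \<phi> \<times> \<phi>\<^sub>x\<close> or \<open>\<phi>\<^sub>y = - \<phi> \<times> \<phi>\<^sub>x\<close>. Otherwise, where the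
  derivatives of \<open>P\<close> leave the span of \<open>\<phi>, \<phi>\<^sub>x, \<phi>\<^sub>y, P, Q\<close>, the direction \<open>v\<close> of \<open>\<nu>\<close> is constant and a
  rotation about \<open>v\<close> turns \<open>\<phi>\<close> into an almost complex curve; where they stay in it, that span is
  parallel, so that \<open>\<phi>\<close> lies in a five-dimensional subspace. These local alternatives
  become global because \<open>\<phi>\<^sub>y - \<phi> \<times> \<phi>\<^sub>x\<close>, \<open>(P, - Q)\<close> and the heights \<open>\<phi> \<cdot> c\<close> satisfy perturbed
  Cauchy--Riemann systems, whose solutions have isolated zeros or vanish identically.\<close>

subsection \<open>Calculus of smooth functions\<close>

text \<open>All maps are merely smooth and no analyticity is invoked, so unique continuation has to
  be proved for \<open>g\<^sub>y = J g\<^sub>x + R\<close> with \<open>R\<close> controlled by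
  \<open>g\<close>. A zero of finite order is isolated because \<open>g\<close> has a leading term
  \<open>\<zeta>\<^sup>n c / n!\<close>; at a zero of infinite order a frequency function forces
  \<open>g\<close> to vanish nearby. Modulo \<open>\<nu>\<close> the derivatives of
  \<open>\<nu>\<close> are linear in \<open>P\<close> and \<open>Q\<close>, through cross products
  that are antisymmetric in \<open>P\<close> and \<open>Q\<close> once these are orthogonal. This
  second relation, of opposite sign to Codazzi, yields the orthogonality of the derivatives. The
  span of \<open>\<phi>, \<phi>\<^sub>x, \<phi>\<^sub>y, P, Q\<close> then has a complement spanned
  by \<open>\<nu>\<close> and one more direction \<open>n\<close>. Symmetry of second derivatives of
  \<open>P\<close> and \<open>Q\<close> gives a homogeneous 2 by 2 system for the
  \<open>n\<close>-components of the derivatives of \<open>\<nu>\<close>, whose determinant is the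
  squared size of the parts of \<open>P\<^sub>x, P\<^sub>y\<close> outside the span; hence the
  direction of \<open>\<nu>\<close> is constant wherever these do not vanish. Rotating two factors
  by \<open>d\<close> about \<open>v\<close> rotates their product by \<open>- 2 d\<close>, so an
  angle \<open>\<gamma>\<close> between \<open>\<phi> \<times> \<phi>\<^sub>x\<close> and
  \<open>\<phi>\<^sub>y\<close> is removed by \<open>d = \<gamma> / 3\<close>. The other orientation
  is treated through \<open>- \<phi>\<close>.\<close>

lemma dir_deriv_unique:
  assumes "(f has_derivative D) (at w)" shows "dir_deriv u f w = D u"
  using assms unfolding dir_deriv_def by (metis frechet_derivative_at)

lemma has_derivative_dir_deriv:
  assumes "f differentiable (at w)"
  shows "(f has_derivative (\<lambda>u. dir_deriv u f w)) (at w)"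
  using assms unfolding dir_deriv_def by (simp add: frechet_derivative_works)

lemma dir_deriv_expand:
  assumes "f differentiable (at w)"
  shows "dir_deriv u f w = Re u *\<^sub>R dir_deriv 1 f w + Im u *\<^sub>R dir_deriv \<i> f w"
proof -
  interpret linear "\<lambda>u. dir_deriv u f w"
    using has_derivative_dir_deriv[OF assms] has_derivative_linear by blast
  have "u = Re u *\<^sub>R 1 + Im u *\<^sub>R \<i>" by (simp add: complex_eq_iff)
  then show ?thesis by (metis add scale)
qed

lemma dir_deriv_cong:
  assumes "open S" "w \<in> S" "\<And>x. x \<in> S \<Longrightarrow> f x = g x"
  shows "dir_deriv u f w = dir_deriv u g w"
proof -
  have "(f has_derivative D) (at w) \<longleftrightarrow> (g has_derivative D) (at w)" for D
    using assms by (metis has_derivative_transform_within_open)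
  then show ?thesis unfolding dir_deriv_def frechet_derivative_def by simp
qed

lemma differentiable_cong_open:
  assumes "open S" "w \<in> S" "\<And>x. x \<in> S \<Longrightarrow> f x = g x"
  shows "f differentiable (at w) \<longleftrightarrow> g differentiable (at w)"
  using assms unfolding differentiable_def by (metis has_derivative_transform_within_open)

lemma dir_deriv_const [simp]: "dir_deriv u (\<lambda>w. c) w = 0"
  by (rule dir_deriv_unique) simp

lemma dir_deriv_add:
  assumes "f differentiable (at w)" "g differentiable (at w)"
  shows "dir_deriv u (\<lambda>w. f w + g w) w = dir_deriv u f w + dir_deriv u g w"
  by (rule dir_deriv_unique[OF has_derivative_add]) (intro has_derivative_dir_deriv assms)+

lemma dir_deriv_diff:
  assumes "f differentiable (at w)" "g differentiable (at w)"
  shows "dir_deriv u (\<lambda>w. f w - g w) w = dir_deriv u f w - dir_deriv u g w"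
  by (rule dir_deriv_unique[OF has_derivative_diff]) (intro has_derivative_dir_deriv assms)+

lemma dir_deriv_linear:
  assumes "bounded_linear L" "f differentiable (at w)"
  shows "dir_deriv u (\<lambda>w. L (f w)) w = L (dir_deriv u f w)"
  by (rule dir_deriv_unique[OF bounded_linear.has_derivative[OF assms(1)]])
     (intro has_derivative_dir_deriv assms)

lemma bounded_linear_differentiable:
  assumes "bounded_linear L" "f differentiable F" shows "(\<lambda>w. L (f w)) differentiable F"
  using assms bounded_linear.has_derivative[OF assms(1)] unfolding differentiable_def by blast

lemma dir_deriv_uminus:
  assumes "f differentiable (at w)"
  shows "dir_deriv u (\<lambda>w. - f w) w = - dir_deriv u f w"
  by (rule dir_deriv_linear[OF bounded_linear_minus[OF bounded_linear_ident] assms])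

lemma dir_deriv_bilinear:
  assumes "bounded_bilinear b" "f differentiable (at w)" "g differentiable (at w)"
  shows "dir_deriv u (\<lambda>w. b (f w) (g w)) w = b (f w) (dir_deriv u g w) + b (dir_deriv u f w) (g w)"
  by (rule dir_deriv_unique[OF bounded_bilinear.FDERIV[OF assms(1)]])
     (intro has_derivative_dir_deriv assms)+

lemma dir_deriv_inverse:
  fixes f :: "complex \<Rightarrow> real"
  assumes "f differentiable (at w)" "f w \<noteq> 0"
  shows "dir_deriv u (\<lambda>w. inverse (f w)) w = - (dir_deriv u f w * (inverse (f w) * inverse (f w)))"
proof -
  have "((\<lambda>w. inverse (f w)) has_derivative
      (\<lambda>u. - (inverse (f w) * dir_deriv u f w * inverse (f w)))) (at w)"
    by (intro Deriv.has_derivative_inverse has_derivative_dir_deriv assms)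
  then show ?thesis by (subst dir_deriv_unique) (auto simp: algebra_simps)
qed

lemma differentiable_compose_at:
  assumes "h differentiable (at w)" "g differentiable (at (h w))"
  shows "(\<lambda>x. g (h x)) differentiable (at w)"
  using differentiable_chain_at[OF assms] by (simp add: o_def)

lemma dir_deriv_compose:
  assumes "h differentiable (at w)" "g differentiable (at (h w))"
  shows "dir_deriv u (\<lambda>x. g (h x)) w = dir_deriv (dir_deriv u h w) g (h w)"
proof (rule dir_deriv_unique)
  show "((\<lambda>x. g (h x)) has_derivative (\<lambda>u. dir_deriv (dir_deriv u h w) g (h w))) (at w)"
    using diff_chain_at[OF has_derivative_dir_deriv[OF assms(1)] has_derivative_dir_deriv[OF assms(2)]]
    by (simp add: o_def)
qed

lemma Ck_on_cong:
  assumes "open S" "\<And>x. x \<in> S \<Longrightarrow> f x = g x"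
  shows "Ck_on k S f \<longleftrightarrow> Ck_on k S g"
  using assms(2)
proof (induction k arbitrary: f g)
  case 0
  then show ?case by (simp cong: continuous_on_cong)
next
  case (Suc k)
  have "dir_deriv u f x = dir_deriv u g x" if "x \<in> S" for u x
    using dir_deriv_cong[OF assms(1) that, of f g] Suc.prems by blast
  then show ?case
    using Suc.IH[of "dir_deriv 1 f" "dir_deriv 1 g"] Suc.IH[of "dir_deriv \<i> f" "dir_deriv \<i> g"]
      differentiable_cong_open[OF assms(1), of _ f g] Suc.prems by auto
qed

text \<open>The recursion asks for differentiability, not continuity, at each level; the base case
  is that differentiable functions are continuous.\<close>

lemma Ck_on_SucD: "Ck_on (Suc k) S f \<Longrightarrow> Ck_on k S f"
proof (induction k arbitrary: f)
  case 0
  then show ?case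
    by (auto intro!: continuous_at_imp_continuous_on differentiable_imp_continuous_within)
next
  case (Suc k)
  from Suc.prems have "\<forall>w\<in>S. f differentiable (at w)"
    "Ck_on (Suc k) S (dir_deriv 1 f)" "Ck_on (Suc k) S (dir_deriv \<i> f)"
    unfolding Ck_on.simps(2)[of "Suc k"] by blast+
  then show ?case using Suc.IH unfolding Ck_on.simps(2)[of k S f] by blast
qed

lemma Ck_on_subset: "Ck_on k S f \<Longrightarrow> T \<subseteq> S \<Longrightarrow> Ck_on k T f"
proof (induction k arbitrary: f)
  case (Suc k) then show ?case using subsetD[OF Suc.prems(2)] by simp
qed (simp add: continuous_on_subset)

lemma Ck_on_const: "Ck_on k S (\<lambda>w. c)"
proof (induction k arbitrary: c)
  case (Suc k)
  have "dir_deriv u (\<lambda>w. c) = (\<lambda>w. 0)" for u by (simp add: fun_eq_iff)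
  then show ?case using Suc by simp
qed simp

lemma Ck_on_add:
  assumes "open S" shows "Ck_on k S f \<Longrightarrow> Ck_on k S g \<Longrightarrow> Ck_on k S (\<lambda>w. f w + g w)"
proof (induction k arbitrary: f g)
  case (Suc k)
  have "Ck_on k S (dir_deriv u (\<lambda>w. f w + g w))" if "u = 1 \<or> u = \<i>" for u
    using Suc that by (subst Ck_on_cong[OF assms dir_deriv_add]) auto
  then show ?case using Suc by simp
qed (simp add: continuous_on_add)

lemma Ck_on_linear:
  assumes "open S" "bounded_linear L" shows "Ck_on k S f \<Longrightarrow> Ck_on k S (\<lambda>w. L (f w))"
proof (induction k arbitrary: f)
  case 0
  then show ?case using assms(2) by (simp add: bounded_linear.continuous_on)
next
  case (Suc k)
  have "Ck_on k S (dir_deriv u (\<lambda>w. L (f w)))" if "u = 1 \<or> u = \<i>" for u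
    using Suc that by (subst Ck_on_cong[OF assms(1) dir_deriv_linear[OF assms(2)]]) auto
  then show ?case using Suc.prems bounded_linear_differentiable[OF assms(2)] by (metis Ck_on.simps(2))
qed

lemma bounded_bilinear_differentiable:
  assumes "bounded_bilinear b" "f differentiable (at w within A)" "g differentiable (at w within A)"
  shows "(\<lambda>w. b (f w) (g w)) differentiable (at w within A)"
  using assms bounded_bilinear.FDERIV[OF assms(1)] unfolding differentiable_def by blast

lemma Ck_on_bilinear:
  assumes "open S" "bounded_bilinear b"
  shows "Ck_on k S f \<Longrightarrow> Ck_on k S g \<Longrightarrow> Ck_on k S (\<lambda>w. b (f w) (g w))"
proof (induction k arbitrary: f g)
  case 0
  then show ?case using assms(2) by (simp add: bounded_bilinear.continuous_on)
next
  case (Suc k)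
  have "Ck_on k S f" "Ck_on k S g" using Suc.prems Ck_on_SucD by blast+
  then have "Ck_on k S (dir_deriv u (\<lambda>w. b (f w) (g w)))" if "u = 1 \<or> u = \<i>" for u
    using Suc that assms(1)
    by (subst Ck_on_cong[OF assms(1) dir_deriv_bilinear[OF assms(2)]]) (auto intro!: Ck_on_add)
  then show ?case using Suc assms(2) by (auto intro: bounded_bilinear_differentiable)
qed

lemma Ck_on_inverse:
  fixes f :: "complex \<Rightarrow> real"
  assumes "open S" "\<And>w. w \<in> S \<Longrightarrow> f w \<noteq> 0"
  shows "Ck_on k S f \<Longrightarrow> Ck_on k S (\<lambda>w. inverse (f w))"
proof (induction k)
  case 0
  then show ?case using assms(2) by (simp add: continuous_on_inverse)
next
  case (Suc k)
  \<comment> \<open>The derivative formula contains the reciprocal itself undifferentiated, so its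
    regularity of order \<open>k\<close> is enough and the induction closes.\<close>
  have "Ck_on k S (\<lambda>w. inverse (f w))" using Suc Ck_on_SucD by blast
  then have "Ck_on k S (dir_deriv u (\<lambda>w. inverse (f w)))" if "u = 1 \<or> u = \<i>" for u
    using Suc.prems that assms
    by (subst Ck_on_cong[OF assms(1) dir_deriv_inverse])
      (auto intro!: Ck_on_linear[OF assms(1) bounded_linear_minus[OF bounded_linear_ident]]
         Ck_on_bilinear[OF assms(1) bounded_bilinear_mult])
  then show ?case using Suc.prems assms(2) by simp
qed

text \<open>The induction runs over all outer functions: by \<open>dir_deriv_expand\<close> the
  chain rule gives real multiples of \<open>dir_deriv 1 g\<close> and
  \<open>dir_deriv \<i> g\<close> composed with \<open>h\<close>, to which the hypothesis
  applies.\<close>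

lemma Ck_on_compose:
  assumes "open S" "open T" "h ` S \<subseteq> T"
  shows "Ck_on k S h \<Longrightarrow> Ck_on k T g \<Longrightarrow> Ck_on k S (\<lambda>w. g (h w))"
proof (induction k arbitrary: g)
  case 0
  then show ?case using assms by (auto intro: continuous_on_compose2)
next
  case (Suc k)
  have "Ck_on k S h" using Suc.prems Ck_on_SucD by blast
  then have IH: "Ck_on k S (\<lambda>w. dir_deriv 1 g (h w))" "Ck_on k S (\<lambda>w. dir_deriv \<i> g (h w))"
    using Suc by auto
  have "dir_deriv u (\<lambda>w. g (h w)) w = Re (dir_deriv u h w) *\<^sub>R dir_deriv 1 g (h w)
      + Im (dir_deriv u h w) *\<^sub>R dir_deriv \<i> g (h w)" if "w \<in> S" for u w
  proof -
    have "h differentiable (at w)" "g differentiable (at (h w))"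
      using Suc.prems that assms by auto
    then show ?thesis by (subst dir_deriv_compose) (auto intro: dir_deriv_expand)
  qed
  then have "Ck_on k S (dir_deriv u (\<lambda>w. g (h w)))" if "u = 1 \<or> u = \<i>" for u
    using IH Suc.prems that
    by (subst Ck_on_cong[OF assms(1), of _ "\<lambda>w. Re (dir_deriv u h w) *\<^sub>R dir_deriv 1 g (h w)
      + Im (dir_deriv u h w) *\<^sub>R dir_deriv \<i> g (h w)"])
       (auto intro!: Ck_on_add[OF assms(1)] Ck_on_bilinear[OF assms(1) bounded_bilinear_scaleR]
         Ck_on_linear[OF assms(1) bounded_linear_Re] Ck_on_linear[OF assms(1) bounded_linear_Im])
  moreover have "(\<lambda>w. g (h w)) differentiable (at w)" if "w \<in> S" for w
    using Suc.prems that assms by (auto intro!: differentiable_compose_at[of h w g])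
  ultimately show ?case by simp
qed

lemma Ck_on_holomorphic:
  assumes "open S" shows "h holomorphic_on S \<Longrightarrow> Ck_on k S h"
proof (induction k arbitrary: h)
  case 0
  then show ?case by (simp add: holomorphic_on_imp_continuous_on)
next
  case (Suc k)
  have D: "(h has_field_derivative deriv h w) (at w)" if "w \<in> S" for w
    using Suc.prems assms that holomorphic_derivI by blast
  then have "dir_deriv u h w = deriv h w * u" if "w \<in> S" for u w
    using that by (intro dir_deriv_unique) (simp add: has_field_derivative_def)
  moreover have "Ck_on k S (\<lambda>w. deriv h w * u)" for u
    using Suc.IH[OF holomorphic_deriv[OF Suc.prems assms]]
    by (intro Ck_on_bilinear[OF assms bounded_bilinear_mult] Ck_on_const)
  ultimately have "Ck_on k S (dir_deriv u h)" for u
    by (subst Ck_on_cong[OF assms]) auto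
  then show ?case using D field_differentiable_imp_differentiable field_differentiable_def by fastforce
qed

lemma smooth_on_cong:
  assumes "open S" "\<And>x. x \<in> S \<Longrightarrow> f x = g x"
  shows "smooth_on S f \<longleftrightarrow> smooth_on S g"
  unfolding smooth_on_def using Ck_on_cong[of S f g, OF assms] by simp

lemma smooth_on_eqI:
  assumes "open S" "smooth_on S g" "\<And>x. x \<in> S \<Longrightarrow> f x = g x"
  shows "smooth_on S f"
  using assms(2) smooth_on_cong[of S f g, OF assms(1,3)] by simp

lemma smooth_on_differentiable: "smooth_on S f \<Longrightarrow> w \<in> S \<Longrightarrow> f differentiable (at w)"
  unfolding smooth_on_def by (metis Ck_on.simps(2))

lemma smooth_on_continuous: "smooth_on S f \<Longrightarrow> continuous_on S f"
  unfolding smooth_on_def by (metis Ck_on.simps(1))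

lemma smooth_on_subset: "smooth_on S f \<Longrightarrow> T \<subseteq> S \<Longrightarrow> smooth_on T f"
  unfolding smooth_on_def using Ck_on_subset by blast

lemma smooth_on_const: "smooth_on S (\<lambda>w. c)"
  unfolding smooth_on_def using Ck_on_const by blast

lemma smooth_on_add:
  "open S \<Longrightarrow> smooth_on S f \<Longrightarrow> smooth_on S g \<Longrightarrow> smooth_on S (\<lambda>w. f w + g w)"
  unfolding smooth_on_def by (auto intro: Ck_on_add)

lemma smooth_on_linear:
  "open S \<Longrightarrow> bounded_linear L \<Longrightarrow> smooth_on S f \<Longrightarrow> smooth_on S (\<lambda>w. L (f w))"
  unfolding smooth_on_def by (auto intro: Ck_on_linear)

lemma smooth_on_uminus: "open S \<Longrightarrow> smooth_on S f \<Longrightarrow> smooth_on S (\<lambda>w. - f w)"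
  by (rule smooth_on_linear[OF _ bounded_linear_minus[OF bounded_linear_ident]])

lemma smooth_on_diff:
  "open S \<Longrightarrow> smooth_on S f \<Longrightarrow> smooth_on S g \<Longrightarrow> smooth_on S (\<lambda>w. f w - g w)"
  using smooth_on_add[OF _ _ smooth_on_uminus, of S f g] by simp

lemma smooth_on_bilinear:
  "open S \<Longrightarrow> bounded_bilinear b \<Longrightarrow> smooth_on S f \<Longrightarrow> smooth_on S g \<Longrightarrow> smooth_on S (\<lambda>w. b (f w) (g w))"
  unfolding smooth_on_def by (auto intro: Ck_on_bilinear)

lemmas smooth_on_inner = smooth_on_bilinear[OF _ bounded_bilinear_inner]
lemmas smooth_on_scaleR = smooth_on_bilinear[OF _ bounded_bilinear_scaleR]
lemmas smooth_on_mult = smooth_on_bilinear[OF _ bounded_bilinear_mult]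

lemma smooth_on_inverse:
  fixes f :: "complex \<Rightarrow> real"
  shows "open S \<Longrightarrow> (\<And>w. w \<in> S \<Longrightarrow> f w \<noteq> 0) \<Longrightarrow> smooth_on S f \<Longrightarrow> smooth_on S (\<lambda>w. inverse (f w))"
  unfolding smooth_on_def by (auto intro: Ck_on_inverse)

lemma smooth_on_divide:
  fixes f g :: "complex \<Rightarrow> real"
  shows "open S \<Longrightarrow> (\<And>w. w \<in> S \<Longrightarrow> g w \<noteq> 0) \<Longrightarrow> smooth_on S f \<Longrightarrow> smooth_on S g \<Longrightarrow> smooth_on S (\<lambda>w. f w / g w)"
  unfolding divide_inverse by (intro smooth_on_mult smooth_on_inverse)

lemma smooth_on_compose:
  "open S \<Longrightarrow> open T \<Longrightarrow> h ` S \<subseteq> T \<Longrightarrow> smooth_on S h \<Longrightarrow> smooth_on T g \<Longrightarrow> smooth_on S (\<lambda>w. g (h w))"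
  unfolding smooth_on_def by (auto intro: Ck_on_compose)

lemma smooth_on_holomorphic: "open S \<Longrightarrow> h holomorphic_on S \<Longrightarrow> smooth_on S h"
  unfolding smooth_on_def using Ck_on_holomorphic by blast

lemma smooth_on_cnj: "smooth_on S cnj"
proof -
  have D: "(cnj has_derivative cnj) (at w)" for w
    using bounded_linear.has_derivative[OF bounded_linear_cnj has_derivative_ident] by simp
  have "dir_deriv u cnj = (\<lambda>w. cnj u)" for u
    using dir_deriv_unique[OF D] by (simp add: fun_eq_iff)
  moreover have "cnj differentiable (at w)" for w using D differentiable_def by blast
  ultimately have "Ck_on k S cnj" for k
    by (cases k) (auto simp: Ck_on_const bounded_linear.continuous_on[OF bounded_linear_cnj] intro: continuous_on_cnj)
  then show ?thesis by (simp add: smooth_on_def)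
qed

lemma smooth_on_dir_deriv_basis:
  "smooth_on S f \<Longrightarrow> smooth_on S (dir_deriv 1 f)" "smooth_on S f \<Longrightarrow> smooth_on S (dir_deriv \<i> f)"
  unfolding smooth_on_def by (metis Ck_on.simps(2))+

lemma smooth_on_dir_deriv:
  assumes "open S" "smooth_on S f" shows "smooth_on S (dir_deriv u f)"
proof -
  have "smooth_on S (\<lambda>w. Re u *\<^sub>R dir_deriv 1 f w + Im u *\<^sub>R dir_deriv \<i> f w)"
    by (intro smooth_on_add smooth_on_scaleR smooth_on_const smooth_on_dir_deriv_basis assms)
  moreover have "dir_deriv u f w = Re u *\<^sub>R dir_deriv 1 f w + Im u *\<^sub>R dir_deriv \<i> f w"
    if "w \<in> S" for w
    using that assms by (intro dir_deriv_expand smooth_on_differentiable)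
  ultimately show ?thesis by (rule smooth_on_eqI[OF assms(1)])
qed

text \<open>The classical route to symmetry of mixed derivatives: two applications of the mean value
  theorem express the second difference over a parallelogram through one mixed derivative, while the
  second difference itself does not depend on the order of \<open>u\<close> and
  \<open>v\<close>.\<close>

lemma second_difference_mvt:
  fixes g :: "complex \<Rightarrow> real"
  assumes S: "open S" "smooth_on S g" and h: "h > 0"
    and sub: "\<And>a b. 0 \<le> a \<Longrightarrow> a \<le> h \<Longrightarrow> 0 \<le> b \<Longrightarrow> b \<le> h \<Longrightarrow> w + a *\<^sub>R u + b *\<^sub>R v \<in> S"
  shows "\<exists>a b. 0 < a \<and> a < h \<and> 0 < b \<and> b < h \<and>
    g (w + h *\<^sub>R u + h *\<^sub>R v) - g (w + h *\<^sub>R u) - g (w + h *\<^sub>R v) + g w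
      = h * (h * dir_deriv v (dir_deriv u g) (w + a *\<^sub>R u + b *\<^sub>R v))"
proof -
  have line: "((\<lambda>t. k (p + t *\<^sub>R d)) has_real_derivative dir_deriv d k (p + t *\<^sub>R d)) (at t)"
    if "k differentiable (at (p + t *\<^sub>R d))" for k :: "complex \<Rightarrow> real" and p d t
  proof -
    have "((\<lambda>t. p + t *\<^sub>R d) has_derivative (\<lambda>t. t *\<^sub>R d)) (at t)"
      by (auto intro!: derivative_eq_intros)
    from diff_chain_at[OF this has_derivative_dir_deriv[OF that]]
    have "((\<lambda>t. k (p + t *\<^sub>R d)) has_derivative (\<lambda>s. dir_deriv (s *\<^sub>R d) k (p + t *\<^sub>R d))) (at t)"
      by (simp add: o_def)
    moreover have "dir_deriv (s *\<^sub>R d) k (p + t *\<^sub>R d) = dir_deriv d k (p + t *\<^sub>R d) * s" for s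
      using linear_scale[OF has_derivative_linear[OF has_derivative_dir_deriv[OF that]]] by simp
    ultimately show ?thesis by (simp add: has_field_derivative_def)
  qed
  define \<phi> where "\<phi> t = g ((w + h *\<^sub>R v) + t *\<^sub>R u) - g (w + t *\<^sub>R u)" for t
  have d: "g differentiable (at (w + a *\<^sub>R u + b *\<^sub>R v))" "dir_deriv u g differentiable (at (w + a *\<^sub>R u + b *\<^sub>R v))"
    if "0 \<le> a" "a \<le> h" "0 \<le> b" "b \<le> h" for a b
    using sub[OF that] S smooth_on_differentiable smooth_on_dir_deriv by blast+
  have "\<exists>a>0. a < h \<and> \<phi> h - \<phi> 0
      = (h - 0) * (dir_deriv u g ((w + h *\<^sub>R v) + a *\<^sub>R u) - dir_deriv u g (w + a *\<^sub>R u))"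
    unfolding \<phi>_def
    by (rule MVT2[OF h]) (intro DERIV_diff line; use d[of _ h] d[of _ 0] h in \<open>simp add: add_ac\<close>)
  then obtain a where a: "0 < a" "a < h" "\<phi> h - \<phi> 0
      = h * (dir_deriv u g ((w + a *\<^sub>R u) + h *\<^sub>R v) - dir_deriv u g ((w + a *\<^sub>R u) + 0 *\<^sub>R v))"
    by (auto simp: add_ac)
  have "\<exists>b>0. b < h \<and> dir_deriv u g ((w + a *\<^sub>R u) + h *\<^sub>R v) - dir_deriv u g ((w + a *\<^sub>R u) + 0 *\<^sub>R v)
      = (h - 0) * dir_deriv v (dir_deriv u g) ((w + a *\<^sub>R u) + b *\<^sub>R v)"
    by (rule MVT2[OF h]) (intro line; use d(2)[of a] a h in simp)
  then obtain b where "0 < b" "b < h" "dir_deriv u g ((w + a *\<^sub>R u) + h *\<^sub>R v) - dir_deriv u g ((w + a *\<^sub>R u) + 0 *\<^sub>R v)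
      = h * dir_deriv v (dir_deriv u g) ((w + a *\<^sub>R u) + b *\<^sub>R v)" by auto
  then show ?thesis using a by (intro exI[of _ a] exI[of _ b]) (auto simp: \<phi>_def add_ac)
qed

lemma dir_deriv_commute_real:
  fixes g :: "complex \<Rightarrow> real"
  assumes S: "open S" "smooth_on S g" and w: "w \<in> S"
  shows "dir_deriv \<i> (dir_deriv 1 g) w = dir_deriv 1 (dir_deriv \<i> g) w"
proof (rule ccontr)
  define G where "G = dir_deriv \<i> (dir_deriv 1 g)"
  define H where "H = dir_deriv 1 (dir_deriv \<i> g)"
  assume "\<not> ?thesis"
  then have e: "\<bar>G w - H w\<bar> / 2 > 0" by (simp add: G_def H_def)
  have "isCont G w" "isCont H w"
    using S w smooth_on_dir_deriv smooth_on_continuous continuous_on_eq_continuous_at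
    unfolding G_def H_def by metis+
  then obtain d1 d2 where d: "d1 > 0" "\<And>x. dist x w < d1 \<Longrightarrow> dist (G x) (G w) < \<bar>G w - H w\<bar> / 2"
     "d2 > 0" "\<And>x. dist x w < d2 \<Longrightarrow> dist (H x) (H w) < \<bar>G w - H w\<bar> / 2"
    using e unfolding continuous_at_eps_delta by metis
  obtain r where r: "r > 0" "ball w r \<subseteq> S" using S(1) w openE by blast
  \<comment> \<open>Points of the parallelogram are within \<open>2 * h\<close> of its corner;
    dividing by 3 keeps it strictly inside all three neighbourhoods.\<close>
  define h where "h = min (min d1 d2) r / 3"
  have h: "h > 0" "2 * h < d1" "2 * h < d2" "2 * h < r" using d r by (auto simp: h_def)
  have nrm: "dist (w + a *\<^sub>R u + b *\<^sub>R v) w \<le> 2 * h"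
    if "0 \<le> a" "a \<le> h" "0 \<le> b" "b \<le> h" "cmod u = 1" "cmod v = 1" for a b u v
    using norm_triangle_ineq[of "a *\<^sub>R u" "b *\<^sub>R v"] that by (simp add: dist_norm add.assoc)
  have sub: "w + a *\<^sub>R u + b *\<^sub>R v \<in> S"
    if "0 \<le> a" "a \<le> h" "0 \<le> b" "b \<le> h" "cmod u = 1" "cmod v = 1" for a b u v
    using nrm[OF that] h r by (auto simp: dist_commute subset_iff)
  obtain a b where ab: "0 < a" "a < h" "0 < b" "b < h"
    "g (w + h *\<^sub>R 1 + h *\<^sub>R \<i>) - g (w + h *\<^sub>R 1) - g (w + h *\<^sub>R \<i>) + g w = h * (h * G (w + a *\<^sub>R 1 + b *\<^sub>R \<i>))"
    using second_difference_mvt[OF S h(1), of w 1 \<i>] sub unfolding G_def by auto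
  obtain a' b' where ab': "0 < a'" "a' < h" "0 < b'" "b' < h"
    "g (w + h *\<^sub>R \<i> + h *\<^sub>R 1) - g (w + h *\<^sub>R \<i>) - g (w + h *\<^sub>R 1) + g w = h * (h * H (w + a' *\<^sub>R \<i> + b' *\<^sub>R 1))"
    using second_difference_mvt[OF S h(1), of w \<i> 1] sub unfolding H_def by auto
  have "h * (h * G (w + a *\<^sub>R 1 + b *\<^sub>R \<i>)) = h * (h * H (w + a' *\<^sub>R \<i> + b' *\<^sub>R 1))"
    using ab(5) ab'(5) by (simp add: add_ac algebra_simps)
  then have "G (w + a *\<^sub>R 1 + b *\<^sub>R \<i>) = H (w + a' *\<^sub>R \<i> + b' *\<^sub>R 1)" using h by simp
  moreover have "dist (G (w + a *\<^sub>R 1 + b *\<^sub>R \<i>)) (G w) < \<bar>G w - H w\<bar> / 2"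
    using nrm[of a b 1 \<i>] ab h by (intro d) auto
  moreover have "dist (H (w + a' *\<^sub>R \<i> + b' *\<^sub>R 1)) (H w) < \<bar>G w - H w\<bar> / 2"
    using nrm[of a' b' \<i> 1] ab' h by (intro d) auto
  ultimately show False by (simp add: dist_real_def abs_if split: if_splits)
qed

text \<open>Pairing with fixed vectors reduces the coordinate directions to the real case; both
  sides are bilinear in \<open>u\<close> and \<open>v\<close>, which gives all directions.\<close>

lemma dir_deriv_commute:
  fixes f :: "complex \<Rightarrow> 'b::euclidean_space"
  assumes "open S" "smooth_on S f" "w \<in> S"
  shows "dir_deriv u (dir_deriv v f) w = dir_deriv v (dir_deriv u f) w"
proof -
  have *: "dir_deriv \<i> (dir_deriv 1 f) w = dir_deriv 1 (dir_deriv \<i> f) w"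
  proof (rule euclidean_eqI)
    fix b :: 'b
    note L = bounded_linear_inner_left[of b]
    have 1: "dir_deriv c (\<lambda>x. f x \<bullet> b) x = dir_deriv c f x \<bullet> b" if "x \<in> S" for c x
      by (intro dir_deriv_linear[OF L] smooth_on_differentiable[OF assms(2) that])
    have "dir_deriv d (dir_deriv c (\<lambda>x. f x \<bullet> b)) w = dir_deriv d (\<lambda>x. dir_deriv c f x \<bullet> b) w" for c d
      by (rule dir_deriv_cong[OF assms(1,3) 1])
    also have "dir_deriv d (\<lambda>x. dir_deriv c f x \<bullet> b) w = dir_deriv d (dir_deriv c f) w \<bullet> b" for c d
      by (intro dir_deriv_linear[OF L] smooth_on_differentiable[OF smooth_on_dir_deriv[OF assms(1,2)] assms(3)])
    finally show "dir_deriv \<i> (dir_deriv 1 f) w \<bullet> b = dir_deriv 1 (dir_deriv \<i> f) w \<bullet> b"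
      using dir_deriv_commute_real[OF assms(1) smooth_on_linear[OF assms(1) L assms(2)] assms(3)] by metis
  qed
  have **: "dir_deriv a (dir_deriv b f) w = Re b *\<^sub>R dir_deriv a (dir_deriv 1 f) w
      + Im b *\<^sub>R dir_deriv a (dir_deriv \<i> f) w" for a b
  proof -
    have "dir_deriv a (dir_deriv b f) w = dir_deriv a (\<lambda>w. Re b *\<^sub>R dir_deriv 1 f w + Im b *\<^sub>R dir_deriv \<i> f w) w"
      using smooth_on_differentiable[OF assms(2)]
      by (intro dir_deriv_cong[OF assms(1,3)] dir_deriv_expand) auto
    also have "\<dots> = Re b *\<^sub>R dir_deriv a (dir_deriv 1 f) w + Im b *\<^sub>R dir_deriv a (dir_deriv \<i> f) w"
      using smooth_on_differentiable[OF smooth_on_dir_deriv[OF assms(1,2)] assms(3)]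
      by (subst dir_deriv_add)
         (auto intro: differentiable_scaleR simp: dir_deriv_linear[OF bounded_linear_scaleR_right])
    finally show ?thesis .
  qed
  have ***: "dir_deriv a (dir_deriv b f) w = Re a *\<^sub>R dir_deriv 1 (dir_deriv b f) w
      + Im a *\<^sub>R dir_deriv \<i> (dir_deriv b f) w" for a b
    by (intro dir_deriv_expand smooth_on_differentiable[OF smooth_on_dir_deriv[OF assms(1,2)] assms(3)])
  show ?thesis
    unfolding **[of u v] **[of v u] ***[of u 1] ***[of u \<i>] ***[of v 1] ***[of v \<i>] *
    by (simp add: algebra_simps)
qed

subsection \<open>Algebra of the cross product\<close>

lemma UNIV_7: "(UNIV :: 7 set) = {1, 2, 3, 4, 5, 6, 7}"
  by (rule sym, rule card_subset_eq) auto

lemma sum_7: "sum f (UNIV :: 7 set) = f 1 + f 2 + f 3 + f 4 + f 5 + f 6 + f 7"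
  unfolding UNIV_7 by (simp add: add_ac)

lemma cross7_nth_1:
  "vec_nth (x \<times>\<^sub>7 y) 1 = (vec_nth x 2 * vec_nth y 3 - vec_nth x 3 * vec_nth y 2) + (vec_nth x 4 * vec_nth y 5 - vec_nth x 5 * vec_nth y 4) + (vec_nth x 7 * vec_nth y 6 - vec_nth x 6 * vec_nth y 7)"
  by (simp add: cross7_def cross7_triples_def axis_def)

lemma cross7_nth_2:
  "vec_nth (x \<times>\<^sub>7 y) 2 = (vec_nth x 3 * vec_nth y 1 - vec_nth x 1 * vec_nth y 3) + (vec_nth x 4 * vec_nth y 6 - vec_nth x 6 * vec_nth y 4) + (vec_nth x 5 * vec_nth y 7 - vec_nth x 7 * vec_nth y 5)"
  by (simp add: cross7_def cross7_triples_def axis_def)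

lemma cross7_nth_3:
  "vec_nth (x \<times>\<^sub>7 y) 3 = (vec_nth x 1 * vec_nth y 2 - vec_nth x 2 * vec_nth y 1) + (vec_nth x 4 * vec_nth y 7 - vec_nth x 7 * vec_nth y 4) + (vec_nth x 6 * vec_nth y 5 - vec_nth x 5 * vec_nth y 6)"
  by (simp add: cross7_def cross7_triples_def axis_def)

lemma cross7_nth_4:
  "vec_nth (x \<times>\<^sub>7 y) 4 = (vec_nth x 5 * vec_nth y 1 - vec_nth x 1 * vec_nth y 5) + (vec_nth x 6 * vec_nth y 2 - vec_nth x 2 * vec_nth y 6) + (vec_nth x 7 * vec_nth y 3 - vec_nth x 3 * vec_nth y 7)"
  by (simp add: cross7_def cross7_triples_def axis_def)

lemma cross7_nth_5:
  "vec_nth (x \<times>\<^sub>7 y) 5 = (vec_nth x 1 * vec_nth y 4 - vec_nth x 4 * vec_nth y 1) + (vec_nth x 7 * vec_nth y 2 - vec_nth x 2 * vec_nth y 7) + (vec_nth x 3 * vec_nth y 6 - vec_nth x 6 * vec_nth y 3)"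
  by (simp add: cross7_def cross7_triples_def axis_def)

lemma cross7_nth_6:
  "vec_nth (x \<times>\<^sub>7 y) 6 = (vec_nth x 1 * vec_nth y 7 - vec_nth x 7 * vec_nth y 1) + (vec_nth x 2 * vec_nth y 4 - vec_nth x 4 * vec_nth y 2) + (vec_nth x 5 * vec_nth y 3 - vec_nth x 3 * vec_nth y 5)"
  by (simp add: cross7_def cross7_triples_def axis_def)

lemma cross7_nth_7:
  "vec_nth (x \<times>\<^sub>7 y) 7 = (vec_nth x 6 * vec_nth y 1 - vec_nth x 1 * vec_nth y 6) + (vec_nth x 2 * vec_nth y 5 - vec_nth x 5 * vec_nth y 2) + (vec_nth x 3 * vec_nth y 4 - vec_nth x 4 * vec_nth y 3)"
  by (simp add: cross7_def cross7_triples_def axis_def)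

lemmas cross7_nth = cross7_nth_1 cross7_nth_2 cross7_nth_3 cross7_nth_4 cross7_nth_5 cross7_nth_6 cross7_nth_7

lemma bounded_bilinear_cross7: "bounded_bilinear (\<times>\<^sub>7)"
  using bilinear_cross7 by (simp add: bilinear_conv_bounded_bilinear)

interpretation cross7: bounded_bilinear "(\<times>\<^sub>7)" by (rule bounded_bilinear_cross7)

lemma cross7_self [simp]: "x \<times>\<^sub>7 x = 0"
  using cross7_skew[of x x] by (simp add: vec_eq_iff)

lemma cross7_cycle: "(x \<times>\<^sub>7 y) \<bullet> z = (y \<times>\<^sub>7 z) \<bullet> x"
  by (simp add: inner_vec_def sum_7 cross7_nth algebra_simps)

lemma cross7_swap: "(x \<times>\<^sub>7 y) \<bullet> z = - ((x \<times>\<^sub>7 z) \<bullet> y)"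
  by (metis cross7_cycle cross7_skew inner_minus_left)

lemma cross7_inner_self [simp]:
  "(x \<times>\<^sub>7 y) \<bullet> x = 0" "(x \<times>\<^sub>7 y) \<bullet> y = 0" "x \<bullet> (x \<times>\<^sub>7 y) = 0" "y \<bullet> (x \<times>\<^sub>7 y) = 0"
  by (metis cross7_cycle cross7_self inner_zero_left inner_commute)+

text \<open>With \<open>cross7_cycle\<close> this is where coordinates are used; the identities
  below follow from these two and antisymmetry by polarisation and duality.\<close>

lemma cross7_inner_square: "(x \<times>\<^sub>7 y) \<bullet> (x \<times>\<^sub>7 y) = (x \<bullet> x) * (y \<bullet> y) - (x \<bullet> y) * (x \<bullet> y)"
  unfolding inner_vec_def sum_7 cross7_nth inner_real_def by algebra

lemma cross7_inner_left: "(x \<times>\<^sub>7 y) \<bullet> (x \<times>\<^sub>7 z) = (x \<bullet> x) * (y \<bullet> z) - (x \<bullet> y) * (x \<bullet> z)"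
  using cross7_inner_square[of x y] cross7_inner_square[of x z] cross7_inner_square[of x "y + z"]
  by (simp add: cross7.add_right inner_add_left inner_add_right inner_commute algebra_simps)

lemma cross7_inner_polar:
  "(x \<times>\<^sub>7 y) \<bullet> (w \<times>\<^sub>7 z) + (w \<times>\<^sub>7 y) \<bullet> (x \<times>\<^sub>7 z)
    = 2 * (x \<bullet> w) * (y \<bullet> z) - (x \<bullet> y) * (w \<bullet> z) - (w \<bullet> y) * (x \<bullet> z)"
  using cross7_inner_left[of "x + w" y z] cross7_inner_left[of x y z] cross7_inner_left[of w y z]
  by (simp add: cross7.add_left inner_add_left inner_add_right inner_commute algebra_simps)

lemma cross7_double: "x \<times>\<^sub>7 (x \<times>\<^sub>7 y) = (x \<bullet> y) *\<^sub>R x - (x \<bullet> x) *\<^sub>R y"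
proof (rule vector_eq_ldot[THEN iffD1], intro allI)
  fix z
  have "z \<bullet> (x \<times>\<^sub>7 (x \<times>\<^sub>7 y)) = - ((x \<times>\<^sub>7 y) \<bullet> (x \<times>\<^sub>7 z))"
    by (metis cross7_swap inner_commute)
  then show "z \<bullet> (x \<times>\<^sub>7 (x \<times>\<^sub>7 y)) = z \<bullet> ((x \<bullet> y) *\<^sub>R x - (x \<bullet> x) *\<^sub>R y)"
    by (simp add: cross7_inner_left inner_diff_right inner_commute algebra_simps)
qed

text \<open>Polarisation of \<open>cross7_double\<close> in its repeated factor. It stands in for
  the Jacobi identity, which fails for this product: \<open>x\<close> and \<open>y\<close> may be
  exchanged up to a sign and terms with inner products.\<close>

lemma cross7_polar:
  "x \<times>\<^sub>7 (y \<times>\<^sub>7 z) = (x \<bullet> z) *\<^sub>R y + (y \<bullet> z) *\<^sub>R x - (2 * (x \<bullet> y)) *\<^sub>R z - y \<times>\<^sub>7 (x \<times>\<^sub>7 z)"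
  using cross7_double[of "x + y" z] cross7_double[of x z] cross7_double[of y z]
  by (simp add: cross7.add_left cross7.add_right inner_add_left inner_add_right inner_commute algebra_simps)

text \<open>Frames are lists so that concrete ones can be checked entry by entry; distinctness
  follows from orthogonality of non-zero vectors, and seven independent vectors span.\<close>

lemma orthogonal_seven_zero:
  fixes x :: "real^7"
  assumes "length bs = 7" "\<forall>b\<in>set bs. b \<noteq> 0 \<and> x \<bullet> b = 0"
    and "\<forall>i<7. \<forall>j<i. bs ! i \<bullet> bs ! j = 0"
  shows "x = 0"
proof -
  have ne: "bs ! i \<noteq> bs ! j" if "i < 7" "j < i" for i j
  proof -
    have "bs ! i \<in> set bs" using that assms(1) by simp
    then show ?thesis using that assms(2,3) by (metis inner_eq_zero_iff)
  qed
  have "distinct bs"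
    unfolding distinct_conv_nth assms(1) by (metis linorder_neqE_nat ne)
  then have card: "card (set bs) = 7" using assms(1) distinct_card by metis
  have "pairwise orthogonal (set bs)"
  proof (rule pairwiseI)
    fix a b assume ab: "a \<in> set bs" "b \<in> set bs" "a \<noteq> b"
    then obtain i j where "i < 7" "bs ! i = a" "j < 7" "bs ! j = b"
      by (metis in_set_conv_nth assms(1))
    then show "orthogonal a b"
      using assms(3) ab(3) unfolding orthogonal_def by (metis inner_commute linorder_neqE_nat)
  qed
  moreover have "0 \<notin> set bs" using assms(2) by blast
  ultimately have "independent (set bs)" by (rule pairwise_orthogonal_independent)
  then have "span (set bs) = UNIV"
    using card card_eq_dim[of "set bs" UNIV] by (simp add: dim_UNIV card_le_dim_spanning top.extremum_uniqueI)
  moreover have "x \<bullet> y = 0" if "y \<in> span (set bs)" for y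
    using that by (induction rule: span_induct_alt) (use assms(2) in \<open>auto simp: inner_add_right\<close>)
  ultimately show ?thesis by (metis UNIV_I inner_eq_zero_iff)
qed

text \<open>A unit vector \<open>w\<close> off the span of the six completes them to a frame, and
  \<open>x - (x \<bullet> w) *\<^sub>R w\<close> is orthogonal to all seven members.\<close>

lemma orthogonal_six_line:
  fixes bs :: "(real^7) list"
  assumes "length bs = 6" "\<forall>b\<in>set bs. b \<noteq> 0" "\<forall>i<6. \<forall>j<i. bs ! i \<bullet> bs ! j = 0"
  obtains w where "norm w = 1" "\<And>b. b \<in> set bs \<Longrightarrow> w \<bullet> b = 0" "\<And>x. (\<forall>b\<in>set bs. x \<bullet> b = 0) \<Longrightarrow> x = (x \<bullet> w) *\<^sub>R w"
proof -
  have "dim (span (set bs)) \<le> 6" using assms(1) dim_le_card'[of "set bs"] card_length[of bs] by simp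
  then have "dim (span (set bs)) < DIM(real^7)" by simp
  then have "span (set bs) \<subset> UNIV" by (metis dim_eq_full dim_span less_irrefl span_span top.not_eq_extremum)
  then obtain w0 where w0: "w0 \<noteq> 0" "\<And>x. x \<in> span (set bs) \<Longrightarrow> orthogonal w0 x"
    using orthogonal_to_subspace_exists_gen[of "set bs" UNIV] by auto
  define w where "w = w0 /\<^sub>R norm w0"
  have w: "norm w = 1" "w \<bullet> w = 1" "\<And>b. b \<in> set bs \<Longrightarrow> w \<bullet> b = 0"
    using w0 span_base[of _ "set bs"] by (auto simp: w_def orthogonal_def dot_square_norm power2_eq_square)
  show ?thesis
  proof
    fix x assume x: "\<forall>b\<in>set bs. x \<bullet> b = 0"
    have "x - (x \<bullet> w) *\<^sub>R w = 0"
    proof (rule orthogonal_seven_zero[of "w # bs"])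
      show "\<forall>i<7. \<forall>j<i. (w # bs) ! i \<bullet> (w # bs) ! j = 0"
      proof (intro allI impI)
        fix i j :: nat assume "i < 7" "j < i"
        then obtain i' where i': "i = Suc i'" "i' < 6" by (cases i) auto
        then show "(w # bs) ! i \<bullet> (w # bs) ! j = 0"
          using \<open>j < i\<close> assms w(3)[of "bs ! i'"] by (cases j) (auto simp: inner_commute)
      qed
    qed (use assms x w in \<open>auto simp: inner_diff_left\<close>)
    then show "x = (x \<bullet> w) *\<^sub>R w" by simp
  qed (use w in auto)
qed

subsection \<open>Jets and order of vanishing\<close>

text \<open>Only the real direction is iterated: along a Cauchy--Riemann system the imaginary
  derivative can be traded for the real one and the error term.\<close>

definition dx_iter :: "nat \<Rightarrow> (complex \<Rightarrow> 'b::real_normed_vector) \<Rightarrow> complex \<Rightarrow> 'b" where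
  "dx_iter n f = (dir_deriv 1 ^^ n) f"

lemma dx_iter_0 [simp]: "dx_iter 0 f = f"
  and dx_iter_Suc: "dx_iter (Suc n) f = dir_deriv 1 (dx_iter n f)"
  and dx_iter_Suc': "dx_iter (Suc n) f = dx_iter n (dir_deriv 1 f)"
  by (simp_all add: dx_iter_def funpow_swap1)

lemma smooth_on_dx_iter: "smooth_on S f \<Longrightarrow> smooth_on S (dx_iter n f)"
  by (induction n) (auto simp: dx_iter_Suc smooth_on_dir_deriv_basis)

lemma dx_iter_cong:
  assumes "open S" "\<And>x. x \<in> S \<Longrightarrow> f x = g x" "x \<in> S"
  shows "dx_iter n f x = dx_iter n g x"
  using assms(3)
proof (induction n arbitrary: x)
  case (Suc n)
  show ?case unfolding dx_iter_Suc by (rule dir_deriv_cong[OF assms(1) Suc.prems Suc.IH])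
qed (use assms(2) in simp)

lemma dx_iter_add:
  assumes "open S" "smooth_on S f" "smooth_on S g" "x \<in> S"
  shows "dx_iter n (\<lambda>w. f w + g w) x = dx_iter n f x + dx_iter n g x"
  using assms(4)
proof (induction n arbitrary: x)
  case (Suc n)
  have "dir_deriv 1 (dx_iter n (\<lambda>w. f w + g w)) x = dir_deriv 1 (\<lambda>w. dx_iter n f w + dx_iter n g w) x"
    by (rule dir_deriv_cong[OF assms(1) Suc.prems Suc.IH])
  also have "\<dots> = dir_deriv 1 (dx_iter n f) x + dir_deriv 1 (dx_iter n g) x"
    by (intro dir_deriv_add smooth_on_differentiable[OF smooth_on_dx_iter[OF assms(2)] Suc.prems]
        smooth_on_differentiable[OF smooth_on_dx_iter[OF assms(3)] Suc.prems])
  finally show ?case unfolding dx_iter_Suc .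
qed simp

lemma dx_iter_linear:
  assumes "open S" "bounded_linear L" "smooth_on S f" "x \<in> S"
  shows "dx_iter n (\<lambda>w. L (f w)) x = L (dx_iter n f x)"
  using assms(4)
proof (induction n arbitrary: x)
  case (Suc n)
  have "dir_deriv 1 (dx_iter n (\<lambda>w. L (f w))) x = dir_deriv 1 (\<lambda>w. L (dx_iter n f w)) x"
    by (rule dir_deriv_cong[OF assms(1) Suc.prems Suc.IH])
  also have "\<dots> = L (dir_deriv 1 (dx_iter n f) x)"
    by (rule dir_deriv_linear[OF assms(2) smooth_on_differentiable[OF smooth_on_dx_iter[OF assms(3)] Suc.prems]])
  finally show ?case unfolding dx_iter_Suc .
qed simp

lemma dx_iter_dir_deriv:
  fixes f :: "complex \<Rightarrow> 'b::euclidean_space"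
  assumes "open S" "smooth_on S f" "x \<in> S"
  shows "dx_iter n (dir_deriv u f) x = dir_deriv u (dx_iter n f) x"
  using assms(3)
proof (induction n arbitrary: x)
  case (Suc n)
  have "dir_deriv 1 (dx_iter n (dir_deriv u f)) x = dir_deriv 1 (dir_deriv u (dx_iter n f)) x"
    by (rule dir_deriv_cong[OF assms(1) Suc.prems Suc.IH])
  then show ?case unfolding dx_iter_Suc
    using dir_deriv_commute[OF assms(1) smooth_on_dx_iter[OF assms(2)] Suc.prems] by metis
qed simp

definition jet_size :: "(complex \<Rightarrow> 'b::real_normed_vector) \<Rightarrow> nat \<Rightarrow> complex \<Rightarrow> real" where
  "jet_size g k w = (\<Sum>j\<le>k. norm (dx_iter j g w))"

lemma jet_size_nonneg [simp]: "0 \<le> jet_size g k w"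
  by (simp add: jet_size_def sum_nonneg)

lemma jet_size_mono: "k \<le> l \<Longrightarrow> jet_size g k w \<le> jet_size g l w"
  unfolding jet_size_def by (intro sum_mono2) auto

text \<open>Expresses that \<open>f\<close> depends on \<open>g\<close> through real derivatives of
  order at most \<open>k\<close>, stably under further differentiation. Constant and neighbourhood
  may vary with \<open>i\<close>, since finitely many orders are used at a time.\<close>

definition jet_dominated ::
    "complex set \<Rightarrow> complex \<Rightarrow> (complex \<Rightarrow> 'b::real_normed_vector) \<Rightarrow> nat \<Rightarrow> (complex \<Rightarrow> 'c::real_normed_vector) \<Rightarrow> bool"
  where "jet_dominated S w0 g k f \<longleftrightarrow> smooth_on S f \<and>
    (\<forall>i. \<exists>C\<ge>0. \<forall>\<^sub>F w in nhds w0. norm (dx_iter i f w) \<le> C * jet_size g (k + i) w)"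

lemma jet_dominatedD:
  assumes "jet_dominated S w0 g k f"
  obtains C where "C \<ge> 0" "\<forall>\<^sub>F w in nhds w0. norm (dx_iter i f w) \<le> C * jet_size g (k + i) w"
  using assms unfolding jet_dominated_def by blast

lemma jet_dominated_smooth: "jet_dominated S w0 g k f \<Longrightarrow> smooth_on S f"
  by (simp add: jet_dominated_def)

lemma jet_dominated_self: "smooth_on S g \<Longrightarrow> jet_dominated S w0 g 0 g"
  unfolding jet_dominated_def jet_size_def
  by (auto intro!: exI[of _ 1] always_eventually member_le_sum[where f = "\<lambda>j. norm (dx_iter j g _)"])

lemma jet_dominated_dx:
  assumes "jet_dominated S w0 g k f"
  shows "jet_dominated S w0 g (Suc k) (dir_deriv 1 f)"
  unfolding jet_dominated_def
proof (intro conjI allI)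
  show "smooth_on S (dir_deriv 1 f)" by (rule smooth_on_dir_deriv_basis(1)[OF jet_dominated_smooth[OF assms]])
  fix i
  show "\<exists>C\<ge>0. \<forall>\<^sub>F w in nhds w0. norm (dx_iter i (dir_deriv 1 f) w) \<le> C * jet_size g (Suc k + i) w"
    using assms[unfolded jet_dominated_def, THEN conjunct2, THEN spec, of "Suc i"]
    unfolding dx_iter_Suc' by simp
qed

lemma jet_dominated_add:
  assumes S: "open S" "w0 \<in> S" and f: "jet_dominated S w0 g k f" "jet_dominated S w0 g k f'"
  shows "jet_dominated S w0 g k (\<lambda>w. f w + f' w)"
  unfolding jet_dominated_def
proof (intro conjI allI)
  show "smooth_on S (\<lambda>w. f w + f' w)" by (intro smooth_on_add S jet_dominated_smooth[OF f(1)] jet_dominated_smooth[OF f(2)])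
  fix i
  obtain C where C: "C \<ge> 0" "\<forall>\<^sub>F w in nhds w0. norm (dx_iter i f w) \<le> C * jet_size g (k + i) w"
    using jet_dominatedD[OF f(1)] by blast
  obtain C' where C': "C' \<ge> 0" "\<forall>\<^sub>F w in nhds w0. norm (dx_iter i f' w) \<le> C' * jet_size g (k + i) w"
    using jet_dominatedD[OF f(2)] by blast
  have "\<forall>\<^sub>F w in nhds w0. w \<in> S" using S by (simp add: eventually_nhds_in_open)
  with C(2) C'(2) have "\<forall>\<^sub>F w in nhds w0. norm (dx_iter i (\<lambda>w. f w + f' w) w) \<le> (C + C') * jet_size g (k + i) w"
  proof eventually_elim
    case (elim w)
    then show ?case
      using norm_triangle_ineq[of "dx_iter i f w" "dx_iter i f' w"]
      by (simp add: dx_iter_add[OF S(1) jet_dominated_smooth[OF f(1)] jet_dominated_smooth[OF f(2)]] algebra_simps)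
  qed
  then show "\<exists>C\<ge>0. \<forall>\<^sub>F w in nhds w0. norm (dx_iter i (\<lambda>w. f w + f' w) w) \<le> C * jet_size g (k + i) w"
    using C C' by (intro exI[of _ "C + C'"]) auto
qed

lemma jet_dominated_linear:
  assumes S: "open S" "w0 \<in> S" and L: "bounded_linear L" and f: "jet_dominated S w0 g k f"
  shows "jet_dominated S w0 g k (\<lambda>w. L (f w))"
  unfolding jet_dominated_def
proof (intro conjI allI)
  show "smooth_on S (\<lambda>w. L (f w))" by (rule smooth_on_linear[OF S(1) L jet_dominated_smooth[OF f]])
  fix i
  obtain C where C: "C \<ge> 0" "\<forall>\<^sub>F w in nhds w0. norm (dx_iter i f w) \<le> C * jet_size g (k + i) w"
    using jet_dominatedD[OF f] by blast
  obtain K where K: "0 < K" "\<And>x. norm (L x) \<le> norm x * K"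
    using bounded_linear.pos_bounded[OF L] by auto
  have "\<forall>\<^sub>F w in nhds w0. w \<in> S" using S by (simp add: eventually_nhds_in_open)
  with C(2) have "\<forall>\<^sub>F w in nhds w0. norm (dx_iter i (\<lambda>w. L (f w)) w) \<le> (C * K) * jet_size g (k + i) w"
  proof eventually_elim
    case (elim w)
    have "norm (L (dx_iter i f w)) \<le> norm (dx_iter i f w) * K" by (rule K)
    also have "\<dots> \<le> (C * jet_size g (k + i) w) * K" using elim K by (intro mult_right_mono) auto
    finally show ?case
      using elim by (simp add: dx_iter_linear[OF S(1) L jet_dominated_smooth[OF f]] mult_ac)
  qed
  then show "\<exists>C\<ge>0. \<forall>\<^sub>F w in nhds w0. norm (dx_iter i (\<lambda>w. L (f w)) w) \<le> C * jet_size g (k + i) w"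
    using C K by (intro exI[of _ "C * K"]) auto
qed

lemma eventually_norm_bounded:
  fixes f :: "complex \<Rightarrow> 'b::real_normed_vector"
  assumes "open S" "w0 \<in> S" "continuous_on S f"
  shows "\<forall>\<^sub>F w in nhds w0. norm (f w) \<le> norm (f w0) + 1"
proof -
  have "isCont f w0" using assms by (simp add: continuous_on_eq_continuous_at)
  then have "((\<lambda>w. norm (f w)) \<longlongrightarrow> norm (f w0)) (nhds w0)"
    unfolding isCont_def by (intro tendsto_norm) (simp add: tendsto_nhds_iff)
  then have "\<forall>\<^sub>F w in nhds w0. norm (f w) < norm (f w0) + 1"
    by (rule order_tendstoD) simp
  then show ?thesis by eventually_elim simp
qed

text \<open>The Leibniz rule puts a derivative on either factor, so the induction on
  \<open>i\<close> leaves \<open>\<beta>\<close>, \<open>f\<close> and \<open>k\<close> arbitrary: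
  differentiating \<open>f\<close> raises \<open>k\<close> by one, differentiating
  \<open>\<beta>\<close> costs only monotonicity of \<open>jet_size\<close>.\<close>

lemma jet_dominated_bilinear:
  assumes S: "open S" "w0 \<in> S" and b: "bounded_bilinear b"
    and "smooth_on S \<beta>" "jet_dominated S w0 g k f"
  shows "jet_dominated S w0 g k (\<lambda>w. b (\<beta> w) (f w))"
  unfolding jet_dominated_def
proof (intro conjI allI)
  show "smooth_on S (\<lambda>w. b (\<beta> w) (f w))"
    by (rule smooth_on_bilinear[OF S(1) b assms(4) jet_dominated_smooth[OF assms(5)]])
  fix i
  from assms(4,5) show "\<exists>C\<ge>0. \<forall>\<^sub>F w in nhds w0. norm (dx_iter i (\<lambda>w. b (\<beta> w) (f w)) w) \<le> C * jet_size g (k + i) w"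
  proof (induction i arbitrary: \<beta> f k)
    case 0
    obtain C where C: "C \<ge> 0" "\<forall>\<^sub>F w in nhds w0. norm (dx_iter 0 f w) \<le> C * jet_size g (k + 0) w"
      using jet_dominatedD[OF 0(2)] by blast
    obtain K where K: "0 < K" "\<And>x y. norm (b x y) \<le> norm x * norm y * K"
      using bounded_bilinear.pos_bounded[OF b] by blast
    define B where "B = norm (\<beta> w0) + 1"
    have "\<forall>\<^sub>F w in nhds w0. norm (\<beta> w) \<le> B"
      unfolding B_def by (intro eventually_norm_bounded[OF S] smooth_on_continuous 0)
    with C(2) have "\<forall>\<^sub>F w in nhds w0. norm (b (\<beta> w) (f w)) \<le> (B * C * K) * jet_size g k w"
    proof eventually_elim
      case (elim w)
      have "norm (b (\<beta> w) (f w)) \<le> norm (\<beta> w) * norm (f w) * K" by (rule K)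
      also have "\<dots> \<le> B * (C * jet_size g k w) * K"
        using elim K by (intro mult_right_mono mult_mono) (auto simp: B_def add_nonneg_pos less_imp_le)
      finally show ?case by (simp add: mult_ac)
    qed
    then show ?case using C K by (intro exI[of _ "B * C * K"]) (auto simp: B_def)
  next
    case (Suc i)
    note \<beta> = Suc.prems(1) and f = Suc.prems(2)
    note sm = jet_dominated_smooth[OF f]
    have 1: "dx_iter (Suc i) (\<lambda>w. b (\<beta> w) (f w)) w
       = dx_iter i (\<lambda>w. b (\<beta> w) (dir_deriv 1 f w)) w + dx_iter i (\<lambda>w. b (dir_deriv 1 \<beta> w) (f w)) w"
      if "w \<in> S" for w
    proof -
      have "dx_iter i (dir_deriv 1 (\<lambda>w. b (\<beta> w) (f w))) w
          = dx_iter i (\<lambda>w. b (\<beta> w) (dir_deriv 1 f w) + b (dir_deriv 1 \<beta> w) (f w)) w"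
        by (intro dx_iter_cong[OF S(1) _ that] dir_deriv_bilinear[OF b]
            smooth_on_differentiable[OF \<beta>] smooth_on_differentiable[OF sm])
      then show ?thesis
        unfolding dx_iter_Suc'
        by (simp add: dx_iter_add[OF S(1) _ _ that] smooth_on_bilinear[OF S(1) b] \<beta> sm smooth_on_dir_deriv_basis)
    qed
    obtain C where C: "C \<ge> 0" "\<forall>\<^sub>F w in nhds w0. norm (dx_iter i (\<lambda>w. b (\<beta> w) (dir_deriv 1 f w)) w) \<le> C * jet_size g (Suc k + i) w"
      using Suc.IH[OF \<beta> jet_dominated_dx[OF f]] by blast
    obtain C' where C': "C' \<ge> 0" "\<forall>\<^sub>F w in nhds w0. norm (dx_iter i (\<lambda>w. b (dir_deriv 1 \<beta> w) (f w)) w) \<le> C' * jet_size g (k + i) w"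
      using Suc.IH[OF smooth_on_dir_deriv_basis(1)[OF \<beta>] f] by blast
    have "\<forall>\<^sub>F w in nhds w0. w \<in> S" using S by (simp add: eventually_nhds_in_open)
    with C(2) C'(2) have "\<forall>\<^sub>F w in nhds w0. norm (dx_iter (Suc i) (\<lambda>w. b (\<beta> w) (f w)) w) \<le> (C + C') * jet_size g (k + Suc i) w"
    proof eventually_elim
      case (elim w)
      have "C' * jet_size g (k + i) w \<le> C' * jet_size g (k + Suc i) w"
        using C' by (intro mult_left_mono jet_size_mono) auto
      with elim show ?case
        unfolding 1[OF elim(3)]
        by (intro order_trans[OF norm_triangle_ineq]) (simp add: algebra_simps)
    qed
    then show ?case using C C' by (intro exI[of _ "C + C'"]) auto
  qed
qed

definition vanishes_to_order :: "nat \<Rightarrow> complex \<Rightarrow> (complex \<Rightarrow> 'b::real_normed_vector) \<Rightarrow> bool" where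
  "vanishes_to_order k w0 f \<longleftrightarrow> (\<exists>C\<ge>0. \<forall>\<^sub>F w in nhds w0. norm (f w) \<le> C * norm (w - w0) ^ k)"

lemma vanishes_to_order_0:
  assumes "open S" "w0 \<in> S" "continuous_on S f" shows "vanishes_to_order 0 w0 f"
  using eventually_norm_bounded[OF assms] unfolding vanishes_to_order_def
  by (intro exI[of _ "norm (f w0) + 1"]) simp

lemma vanishes_to_order_le:
  assumes "vanishes_to_order k w0 f" "\<forall>\<^sub>F w in nhds w0. norm (h w) \<le> B * norm (f w)"
  shows "vanishes_to_order k w0 h"
proof -
  obtain C where C: "C \<ge> 0" "\<forall>\<^sub>F w in nhds w0. norm (f w) \<le> C * norm (w - w0) ^ k"
    using assms(1) unfolding vanishes_to_order_def by blast
  from C(2) assms(2) have "\<forall>\<^sub>F w in nhds w0. norm (h w) \<le> \<bar>B\<bar> * C * norm (w - w0) ^ k"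
  proof eventually_elim
    case (elim w)
    have "norm (h w) \<le> \<bar>B\<bar> * norm (f w)"
      by (rule order_trans[OF elim(2)]) (simp add: mult_right_mono)
    also have "\<dots> \<le> \<bar>B\<bar> * (C * norm (w - w0) ^ k)" using elim by (intro mult_left_mono) auto
    finally show ?case by (simp add: mult_ac)
  qed
  then show ?thesis unfolding vanishes_to_order_def using C by (intro exI[of _ "\<bar>B\<bar> * C"]) auto
qed

lemma vanishes_to_order_add:
  assumes "vanishes_to_order k w0 f" "vanishes_to_order k w0 h"
  shows "vanishes_to_order k w0 (\<lambda>w. f w + h w)"
proof -
  obtain C C' where C: "C \<ge> 0" "\<forall>\<^sub>F w in nhds w0. norm (f w) \<le> C * norm (w - w0) ^ k"
    "C' \<ge> 0" "\<forall>\<^sub>F w in nhds w0. norm (h w) \<le> C' * norm (w - w0) ^ k"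
    using assms unfolding vanishes_to_order_def by blast
  from C(2,4) have "\<forall>\<^sub>F w in nhds w0. norm (f w + h w) \<le> (C + C') * norm (w - w0) ^ k"
    by eventually_elim (rule order_trans[OF norm_triangle_ineq], simp add: algebra_simps)
  then show ?thesis unfolding vanishes_to_order_def using C by (intro exI[of _ "C + C'"]) auto
qed

lemma vanishes_to_order_sum:
  assumes "finite I" "\<And>i. i \<in> I \<Longrightarrow> vanishes_to_order k w0 (f i)"
  shows "vanishes_to_order k w0 (\<lambda>w. \<Sum>i\<in>I. f i w)"
  using assms
proof (induction I rule: finite_induct)
  case empty
  then show ?case unfolding vanishes_to_order_def by (auto intro: exI[of _ 0])
qed (simp add: vanishes_to_order_add)

text \<open>Mean value inequality on the closed disc about \<open>w0\<close> through
  \<open>w\<close>: with \<open>r\<close> its radius, both partial derivatives are bounded by a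
  multiple of \<open>r ^ k\<close> there, and the segment has length \<open>r\<close>.\<close>

lemma vanishes_to_order_integrate:
  assumes S: "open S" "w0 \<in> S" and f: "\<And>w. w \<in> S \<Longrightarrow> f differentiable (at w)" "f w0 = 0"
    and d: "vanishes_to_order k w0 (dir_deriv 1 f)" "vanishes_to_order k w0 (dir_deriv \<i> f)"
  shows "vanishes_to_order (Suc k) w0 f"
proof -
  obtain C C' where C: "C \<ge> 0" "\<forall>\<^sub>F w in nhds w0. norm (dir_deriv 1 f w) \<le> C * norm (w - w0) ^ k"
    "C' \<ge> 0" "\<forall>\<^sub>F w in nhds w0. norm (dir_deriv \<i> f w) \<le> C' * norm (w - w0) ^ k"
    using d unfolding vanishes_to_order_def by blast
  have "\<forall>\<^sub>F w in nhds w0. w \<in> S" using S by (simp add: eventually_nhds_in_open)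
  with C(2,4) have "\<forall>\<^sub>F w in nhds w0. w \<in> S \<and> norm (dir_deriv 1 f w) \<le> C * norm (w - w0) ^ k
      \<and> norm (dir_deriv \<i> f w) \<le> C' * norm (w - w0) ^ k" by eventually_elim simp
  then obtain e where e: "e > 0" "\<And>w. dist w w0 < e \<Longrightarrow> w \<in> S \<and> norm (dir_deriv 1 f w) \<le> C * norm (w - w0) ^ k
      \<and> norm (dir_deriv \<i> f w) \<le> C' * norm (w - w0) ^ k"
    unfolding eventually_nhds_metric by blast
  have "norm (f w) \<le> (C + C') * norm (w - w0) ^ Suc k" if w: "dist w w0 < e" for w
  proof -
    define r where "r = norm (w - w0)"
    have in_S: "x \<in> S" "norm (dir_deriv 1 f x) \<le> C * r ^ k" "norm (dir_deriv \<i> f x) \<le> C' * r ^ k"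
      if "x \<in> cball w0 r" for x
    proof -
      have x: "dist x w0 < e" "norm (x - w0) \<le> r"
        using that w unfolding r_def by (auto simp: dist_norm norm_minus_commute)
      have "norm (x - w0) ^ k \<le> r ^ k" using x by (intro power_mono) auto
      then show "x \<in> S" "norm (dir_deriv 1 f x) \<le> C * r ^ k" "norm (dir_deriv \<i> f x) \<le> C' * r ^ k"
        using e(2)[OF x(1)] C(1,3) by (auto intro: order_trans[OF _ mult_left_mono])
    qed
    have "norm (f w - f w0) \<le> ((C + C') * r ^ k) * norm (w - w0)"
    proof (rule differentiable_bound[of "cball w0 r" f "\<lambda>x u. dir_deriv u f x"])
      fix x assume x: "x \<in> cball w0 r"
      show "(f has_derivative (\<lambda>u. dir_deriv u f x)) (at x within cball w0 r)"
        using has_derivative_dir_deriv[OF f(1)[OF in_S(1)[OF x]]] has_derivative_at_withinI by blast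
      show "onorm (\<lambda>u. dir_deriv u f x) \<le> (C + C') * r ^ k"
      proof (rule onorm_le)
        fix u
        have "norm (dir_deriv u f x) \<le> \<bar>Re u\<bar> * norm (dir_deriv 1 f x) + \<bar>Im u\<bar> * norm (dir_deriv \<i> f x)"
          using norm_triangle_ineq[of "Re u *\<^sub>R dir_deriv 1 f x" "Im u *\<^sub>R dir_deriv \<i> f x"]
          unfolding dir_deriv_expand[OF f(1)[OF in_S(1)[OF x]], of u] by simp
        also have "\<dots> \<le> norm u * (C * r ^ k) + norm u * (C' * r ^ k)"
          using in_S[OF x] by (intro add_mono mult_mono abs_Re_le_cmod abs_Im_le_cmod) auto
        finally show "norm (dir_deriv u f x) \<le> (C + C') * r ^ k * norm u" by (simp add: algebra_simps)
      qed
    qed (auto simp: r_def dist_norm norm_minus_commute)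
    then show ?thesis using f(2) by (simp add: r_def mult_ac)
  qed
  then show ?thesis unfolding vanishes_to_order_def eventually_nhds_metric using e(1) C
    by (intro exI[of _ "C + C'"]) auto
qed

subsection \<open>Perturbed Cauchy--Riemann systems\<close>

text \<open>For \<open>J\<close> multiplication by the imaginary unit and \<open>R = 0\<close> the
  last condition is holomorphy of \<open>g\<close>. Allowing any orthogonal complex structure lets
  pairs of real vectors serve as values.\<close>

locale cr_system =
  fixes S :: "complex set" and g R :: "complex \<Rightarrow> 'b::euclidean_space" and J :: "'b \<Rightarrow> 'b"
  assumes open_S: "open S" and smooth_g: "smooth_on S g" and linear_J: "bounded_linear J"
    and J_J: "J (J v) = - v" and J_inner: "J a \<bullet> J b = a \<bullet> b"
    and cr: "w \<in> S \<Longrightarrow> dir_deriv \<i> g w = J (dir_deriv 1 g w) + R w"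
begin

lemma norm_J [simp]: "norm (J v) = norm v"
  by (simp add: norm_eq_sqrt_inner J_inner)

lemma J_skew: "J a \<bullet> b = - (a \<bullet> J b)"
  using J_inner[of a "J b"] by (simp add: J_J)

lemma dy_dx_iter:
  assumes "w \<in> S" "smooth_on S R"
  shows "dir_deriv \<i> (dx_iter n g) w = J (dx_iter (Suc n) g w) + dx_iter n R w"
proof -
  have "dir_deriv \<i> (dx_iter n g) w = dx_iter n (dir_deriv \<i> g) w"
    using dx_iter_dir_deriv[OF open_S smooth_g assms(1)] by metis
  also have "\<dots> = dx_iter n (\<lambda>w. J (dir_deriv 1 g w) + R w) w"
    by (rule dx_iter_cong[OF open_S cr assms(1)])
  also have "\<dots> = dx_iter n (\<lambda>w. J (dir_deriv 1 g w)) w + dx_iter n R w"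
    by (rule dx_iter_add[OF open_S smooth_on_linear[OF open_S linear_J smooth_on_dir_deriv_basis(1)[OF smooth_g]] assms(2,1)])
  also have "dx_iter n (\<lambda>w. J (dir_deriv 1 g w)) w = J (dx_iter n (dir_deriv 1 g) w)"
    by (rule dx_iter_linear[OF open_S linear_J smooth_on_dir_deriv_basis(1)[OF smooth_g] assms(1)])
  finally show ?thesis by (simp add: dx_iter_Suc')
qed

context
  fixes w0 assumes w0: "w0 \<in> S" and R: "jet_dominated S w0 g 0 R"
begin

lemma smooth_R: "smooth_on S R" using R by (rule jet_dominated_smooth)

lemma in_S: "\<forall>\<^sub>F w in nhds w0. w \<in> S"
  using w0 open_S by (simp add: eventually_nhds_in_open)

lemma vanishes_dx_iter_R:
  assumes "\<And>j. j \<le> i \<Longrightarrow> vanishes_to_order k w0 (dx_iter j g)"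
  shows "vanishes_to_order k w0 (dx_iter i R)"
proof -
  have "vanishes_to_order k w0 (\<lambda>w. norm (dx_iter j g w))" if "j \<le> i" for j
    by (rule vanishes_to_order_le[OF assms[OF that], of _ 1]) simp
  then have "vanishes_to_order k w0 (jet_size g i)"
    unfolding jet_size_def by (intro vanishes_to_order_sum) auto
  moreover obtain C where C: "C \<ge> 0" "\<forall>\<^sub>F w in nhds w0. norm (dx_iter i R w) \<le> C * jet_size g (0 + i) w"
    using jet_dominatedD[OF R] by blast
  from C(2) have "\<forall>\<^sub>F w in nhds w0. norm (dx_iter i R w) \<le> C * norm (jet_size g i w)"
    by eventually_elim simp
  ultimately show ?thesis by (rule vanishes_to_order_le)
qed

text \<open>The imaginary derivative of \<open>dx_iter i g\<close> is \<open>J\<close> of the next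
  iterate plus an iterate of \<open>R\<close>, and both have order \<open>k\<close> by induction. So
  a vanishing real jet already forces vanishing in all directions.\<close>

lemma vanishes_dx_iter:
  assumes "\<And>i. i < n \<Longrightarrow> dx_iter i g w0 = 0"
  shows "i + k \<le> n \<Longrightarrow> vanishes_to_order k w0 (dx_iter i g)"
proof (induction k arbitrary: i)
  case 0
  show ?case
    by (rule vanishes_to_order_0[OF open_S w0 smooth_on_continuous[OF smooth_on_dx_iter[OF smooth_g]]])
next
  case (Suc k)
  have dx: "vanishes_to_order k w0 (dir_deriv 1 (dx_iter i g))"
    using Suc.IH[of "Suc i"] Suc.prems by (simp add: dx_iter_Suc)
  have "vanishes_to_order k w0 (dx_iter i R)"
    using Suc by (intro vanishes_dx_iter_R) simp
  moreover have "vanishes_to_order k w0 (\<lambda>w. J (dx_iter (Suc i) g w))"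
    using vanishes_to_order_le[OF dx, of "\<lambda>w. J (dx_iter (Suc i) g w)" 1] by (simp add: dx_iter_Suc)
  ultimately have dy: "vanishes_to_order k w0 (\<lambda>w. dx_iter i R w + J (dx_iter (Suc i) g w))"
    by (rule vanishes_to_order_add)
  have "vanishes_to_order k w0 (dir_deriv \<i> (dx_iter i g))"
    by (rule vanishes_to_order_le[OF dy, of _ 1], use in_S in eventually_elim)
       (simp add: dy_dx_iter[OF _ smooth_R] add.commute)
  with dx show ?case
    using assms[of i] Suc.prems
    by (intro vanishes_to_order_integrate[OF open_S w0])
       (auto intro: smooth_on_differentiable[OF smooth_on_dx_iter[OF smooth_g]])
qed

text \<open>\<open>cmul\<close> is multiplication by complex scalars for the complex structure \<open>J\<close>, and \<open>cpow c k \<zeta>\<close> is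
  \<open>\<zeta>\<^sup>k c / k!\<close>.\<close>

definition cmul :: "complex \<Rightarrow> 'b \<Rightarrow> 'b" where "cmul \<zeta> v = Re \<zeta> *\<^sub>R v + Im \<zeta> *\<^sub>R J v"

primrec cpow :: "'b \<Rightarrow> nat \<Rightarrow> complex \<Rightarrow> 'b" where
  "cpow c 0 \<zeta> = c"
| "cpow c (Suc k) \<zeta> = (1 / real (Suc k)) *\<^sub>R cmul \<zeta> (cpow c k \<zeta>)"

lemma cmul_simps:
  "cmul \<zeta> (r *\<^sub>R v) = r *\<^sub>R cmul \<zeta> v" "cmul \<zeta> (v + v') = cmul \<zeta> v + cmul \<zeta> v'"
  "cmul \<zeta> (cmul \<xi> v) = cmul \<xi> (cmul \<zeta> v)" "cmul 0 v = 0" "cmul 1 v = v" "cmul \<i> v = J v"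
proof -
  interpret J: bounded_linear J by (rule linear_J)
  show "cmul \<zeta> (r *\<^sub>R v) = r *\<^sub>R cmul \<zeta> v" "cmul \<zeta> (v + v') = cmul \<zeta> v + cmul \<zeta> v'"
    "cmul \<zeta> (cmul \<xi> v) = cmul \<xi> (cmul \<zeta> v)" "cmul 0 v = 0" "cmul 1 v = v" "cmul \<i> v = J v"
    by (simp_all add: cmul_def J.add J.scale J_J algebra_simps)
qed

text \<open>Because \<open>v\<close> and \<open>J v\<close> are orthogonal and of equal
  length.\<close>

lemma norm_cmul: "norm (cmul \<zeta> v) = norm \<zeta> * norm v"
proof -
  have "v \<bullet> J v = 0" using J_skew[of v v] by (simp add: inner_commute)
  then have "(norm (cmul \<zeta> v))\<^sup>2 = (norm \<zeta> * norm v)\<^sup>2"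
    unfolding power_mult_distrib cmod_power2 unfolding power2_norm_eq_inner cmul_def
    by (simp add: inner_add_left inner_add_right J_inner inner_commute power2_eq_square algebra_simps)
  then show ?thesis by (simp add: power2_eq_iff_nonneg)
qed

lemma norm_cpow: "norm (cpow c k \<zeta>) = norm \<zeta> ^ k * norm c / fact k"
proof (induction k)
  case (Suc k)
  have "norm (cpow c (Suc k) \<zeta>) = \<bar>1 / real (Suc k)\<bar> * (norm \<zeta> * norm (cpow c k \<zeta>))"
    by (simp only: cpow.simps norm_scaleR norm_cmul)
  then show ?case unfolding Suc.IH by simp
qed simp

lemma cpow_has_derivative: "(cpow c (Suc k) has_derivative (\<lambda>u. cmul u (cpow c k \<zeta>))) (at \<zeta>)"
proof (induction k)
  case 0
  have "cpow c (Suc 0) = (\<lambda>\<zeta>. cmul \<zeta> c)" by (simp add: fun_eq_iff)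
  then show ?case by (auto simp: cmul_def[abs_def] simp del: cpow.simps(2) intro!: derivative_eq_intros)
next
  case (Suc k)
  define q where "q = cpow c (Suc k)"
  have q: "(q has_derivative (\<lambda>u. cmul u (cpow c k \<zeta>))) (at \<zeta>)" using Suc unfolding q_def .
  have "((\<lambda>\<zeta>. (1 / real (Suc (Suc k))) *\<^sub>R cmul \<zeta> (q \<zeta>)) has_derivative
      (\<lambda>u. (1 / real (Suc (Suc k))) *\<^sub>R (cmul u (q \<zeta>) + cmul \<zeta> (cmul u (cpow c k \<zeta>))))) (at \<zeta>)"
    unfolding cmul_def[of _ "q _"]
    by (rule derivative_eq_intros bounded_linear.has_derivative[OF linear_J] q refl)+
      (auto simp: cmul_def algebra_simps)
  moreover have "cmul \<zeta> (cmul u (cpow c k \<zeta>)) = real (Suc k) *\<^sub>R cmul u (q \<zeta>)" for u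
    by (simp add: q_def cmul_simps(1,3)[of \<zeta>] cmul_simps(1)[of u])
  moreover have "(1 / real (Suc (Suc k))) *\<^sub>R (x + real (Suc k) *\<^sub>R x) = x" for x :: 'b
  proof -
    have "x + real (Suc k) *\<^sub>R x = real (Suc (Suc k)) *\<^sub>R x" by (simp add: scaleR_2 algebra_simps)
    then show ?thesis by simp
  qed
  moreover have "cpow c (Suc (Suc k)) = (\<lambda>\<zeta>. (1 / real (Suc (Suc k))) *\<^sub>R cmul \<zeta> (q \<zeta>))"
    by (simp add: fun_eq_iff q_def)
  ultimately show ?case unfolding q_def by (simp only:)
qed

lemma dir_deriv_cpow:
  "(\<lambda>w. cpow c (Suc k) (w - w0)) differentiable (at w)"
  "dir_deriv u (\<lambda>w. cpow c (Suc k) (w - w0)) w = cmul u (cpow c k (w - w0))"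
proof -
  have "((\<lambda>w. w - w0) has_derivative (\<lambda>u. u)) (at w)" by (auto intro!: derivative_eq_intros)
  from diff_chain_at[OF this cpow_has_derivative]
  have D: "((\<lambda>w. cpow c (Suc k) (w - w0)) has_derivative (\<lambda>u. cmul u (cpow c k (w - w0)))) (at w)"
    by (simp only: o_def)
  show "(\<lambda>w. cpow c (Suc k) (w - w0)) differentiable (at w)"
    using D unfolding differentiable_def by blast
  show "dir_deriv u (\<lambda>w. cpow c (Suc k) (w - w0)) w = cmul u (cpow c k (w - w0))"
    by (rule dir_deriv_unique[OF D])
qed

text \<open>Integration from order \<open>n\<close> downwards. The comparison function
  \<open>cpow c k\<close> solves the unperturbed system exactly, so the difference has both partial
  derivatives one order smaller, the error from \<open>R\<close> being controlled by
  \<open>vanishes_dx_iter\<close>. The case \<open>k = n\<close> is the leading term of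
  \<open>g\<close> itself.\<close>

lemma dx_iter_leading_term:
  assumes "\<And>i. i < n \<Longrightarrow> dx_iter i g w0 = 0" and c: "c = dx_iter n g w0"
  shows "k \<le> n \<Longrightarrow> vanishes_to_order (Suc k) w0 (\<lambda>w. dx_iter (n - k) g w - cpow c k (w - w0))"
proof (induction k)
  case 0
  note sm = smooth_on_diff[OF open_S smooth_on_dx_iter[OF smooth_g] smooth_on_const, of n c]
  show ?case
    unfolding cpow.simps diff_zero
    by (intro vanishes_to_order_integrate[OF open_S w0] vanishes_to_order_0[OF open_S w0]
        smooth_on_continuous smooth_on_dir_deriv_basis sm smooth_on_differentiable[OF sm])
       (auto simp: c)
next
  case (Suc k)
  define i where "i = n - Suc k"
  have i: "n - k = Suc i" "i < n" "i + Suc k \<le> n" using Suc.prems by (auto simp: i_def)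
  have IH: "vanishes_to_order (Suc k) w0 (\<lambda>w. dx_iter (Suc i) g w - cpow c k (w - w0))"
    using Suc by (simp add: i(1))
  have Rv: "vanishes_to_order (Suc k) w0 (dx_iter i R)"
    by (intro vanishes_dx_iter_R vanishes_dx_iter[OF assms(1)]) (use i in auto)
  have JIH: "vanishes_to_order (Suc k) w0 (\<lambda>w. J (dx_iter (Suc i) g w - cpow c k (w - w0)))"
    by (rule vanishes_to_order_le[OF IH, of _ 1]) simp
  have diff: "dx_iter i g differentiable (at w)" if "w \<in> S" for w
    using that by (rule smooth_on_differentiable[OF smooth_on_dx_iter[OF smooth_g]])
  interpret J: bounded_linear J by (rule linear_J)
  have "vanishes_to_order (Suc (Suc k)) w0 (\<lambda>w. dx_iter i g w - cpow c (Suc k) (w - w0))"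
  proof (rule vanishes_to_order_integrate[OF open_S w0])
    show "vanishes_to_order (Suc k) w0 (dir_deriv 1 (\<lambda>w. dx_iter i g w - cpow c (Suc k) (w - w0)))"
      by (rule vanishes_to_order_le[OF IH, of _ 1], use in_S in eventually_elim)
         (simp del: cpow.simps add: dir_deriv_diff diff dir_deriv_cpow cmul_simps dx_iter_Suc)
    show "vanishes_to_order (Suc k) w0 (dir_deriv \<i> (\<lambda>w. dx_iter i g w - cpow c (Suc k) (w - w0)))"
      by (rule vanishes_to_order_le[OF vanishes_to_order_add[OF JIH Rv], of _ 1], use in_S in eventually_elim)
         (simp del: cpow.simps add: dir_deriv_diff diff dir_deriv_cpow cmul_simps dy_dx_iter[OF _ smooth_R]
           J.diff algebra_simps)
    show "(\<lambda>w. dx_iter i g w - cpow c (Suc k) (w - w0)) differentiable (at w)" if "w \<in> S" for w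
      by (intro differentiable_diff diff dir_deriv_cpow(1) that)
  qed (use assms(1)[OF i(2)] in \<open>simp add: cmul_simps\<close>)
  then show ?case unfolding i_def .
qed

lemma isolated_zero_finite_order:
  assumes "dx_iter n g w0 \<noteq> 0"
  shows "\<forall>\<^sub>F w in at w0. g w \<noteq> 0"
proof -
  \<comment> \<open>With the first non-zero real derivative the leading term has size exactly
    \<open>q * norm (w - w0) ^ m\<close>, against an error of one order more.\<close>
  define m where "m = (LEAST m. dx_iter m g w0 \<noteq> 0)"
  have m: "dx_iter m g w0 \<noteq> 0" "\<And>i. i < m \<Longrightarrow> dx_iter i g w0 = 0"
    using LeastI[of "\<lambda>m. dx_iter m g w0 \<noteq> 0", OF assms] not_less_Least[of _ "\<lambda>m. dx_iter m g w0 \<noteq> 0"]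
    unfolding m_def by auto
  define c where "c = dx_iter m g w0"
  have "vanishes_to_order (Suc m) w0 (\<lambda>w. dx_iter (m - m) g w - cpow c m (w - w0))"
    by (rule dx_iter_leading_term[OF m(2) c_def]) auto
  then obtain C where C: "C \<ge> 0" "\<forall>\<^sub>F w in nhds w0. norm (g w - cpow c m (w - w0)) \<le> C * norm (w - w0) ^ Suc m"
    unfolding vanishes_to_order_def by auto
  define q where "q = norm c / fact m"
  have q: "q > 0" using m(1) by (simp add: q_def c_def)
  have "((\<lambda>w. C * norm (w - w0)) \<longlongrightarrow> C * norm (w0 - w0)) (at w0)"
    by (intro tendsto_intros)
  then have "\<forall>\<^sub>F w in at w0. C * norm (w - w0) < q" by (rule order_tendstoD) (simp add: q)
  moreover have "\<forall>\<^sub>F w in at w0. norm (g w - cpow c m (w - w0)) \<le> C * norm (w - w0) ^ Suc m"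
    using C(2) by (auto simp: eventually_at_filter elim: eventually_mono)
  moreover have "\<forall>\<^sub>F w in at w0. w \<noteq> w0" by (simp add: eventually_at_filter)
  ultimately show ?thesis
  proof eventually_elim
    case (elim w)
    show "g w \<noteq> 0"
    proof
      assume "g w = 0"
      then have "norm (w - w0) ^ m * q \<le> norm (w - w0) ^ m * (C * norm (w - w0))"
        using elim(2) by (simp add: norm_cpow q_def mult_ac)
      moreover have "norm (w - w0) ^ m > 0" using elim(3) by simp
      ultimately show False using elim(1) by (simp add: mult_le_cancel_left_pos)
    qed
  qed
qed

end
end

text \<open>The frequency \<open>K / N\<close> is increasing up to a bounded error, so \<open>N\<close> cannot decay faster than every
  exponential as \<open>s\<close> tends to minus infinity. In \<open>flat_imp_zero\<close>, \<open>N s\<close> is the integral of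
  \<open>\<bar>g\<bar>\<^sup>2\<close> over the circle of radius \<open>exp s\<close>.\<close>

lemma frequency_lower_bound:
  fixes N K N' K' :: "real \<Rightarrow> real"
  assumes s0: "s0 < a" "N s0 > 0" and C: "C \<ge> 0"
    and dN: "\<And>s. s < a \<Longrightarrow> (N has_real_derivative N' s) (at s)"
    and dK: "\<And>s. s < a \<Longrightarrow> (K has_real_derivative K' s) (at s)"
    and N0: "\<And>s. s < a \<Longrightarrow> N s \<ge> 0"
    and ineqK: "\<And>s. s < a \<Longrightarrow> N s > 0 \<Longrightarrow> K s * N' s - K' s * N s \<le> 2 * C\<^sup>2 * exp (2 * s) * (N s)\<^sup>2"
    and ineqN: "\<And>s. s < a \<Longrightarrow> N' s \<le> 2 * K s + 4 * C * exp s * N s"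
  shows "\<exists>c>0. \<exists>\<kappa>. \<forall>s\<le>s0. c * exp (\<kappa> * s) \<le> N s"
proof -
  \<comment> \<open>An upper bound for \<open>K / N\<close> to the left of \<open>s0\<close>: the
    derivative of the added term \<open>C\<^sup>2 * exp (2 * s)\<close> is exactly the error allowed
    by \<open>ineqK\<close>, so the sum is monotone. Then \<open>\<kappa>\<close> bounds the
    logarithmic derivative of \<open>N\<close>.\<close>
  define L where "L = K s0 / N s0 + C\<^sup>2 * exp (2 * s0)"
  define \<kappa> where "\<kappa> = 2 * L + 4 * C * exp s0"
  define c where "c = N s0 * exp (- \<kappa> * s0)"
  have c: "c > 0" using s0 by (simp add: c_def)
  have main: "c * exp (\<kappa> * s1) \<le> N s1" if s1: "s1 \<le> s0" and pos: "\<And>s. s1 \<le> s \<Longrightarrow> s \<le> s0 \<Longrightarrow> N s > 0" for s1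
  proof -
    have Lam: "K s / N s \<le> L" if s: "s1 \<le> s" "s \<le> s0" for s
    proof -
      have "K s / N s + C\<^sup>2 * exp (2 * s) \<le> K s0 / N s0 + C\<^sup>2 * exp (2 * s0)"
      proof (rule DERIV_nonneg_imp_nondecreasing[OF s(2)])
        fix x assume x: "s \<le> x" "x \<le> s0"
        have xa: "x < a" and Nx: "N x > 0" using x s0 pos s by auto
        have "((\<lambda>s. K s / N s + C\<^sup>2 * exp (2 * s)) has_real_derivative
            (K' x * N x - K x * N' x) / (N x * N x) + 2 * C\<^sup>2 * exp (2 * x)) (at x)"
          using Nx by (auto intro!: derivative_eq_intros dN dK xa)
        moreover have "(K' x * N x - K x * N' x) / (N x * N x) + 2 * C\<^sup>2 * exp (2 * x) \<ge> 0"
        proof -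
          have "(K x * N' x - K' x * N x) / (N x * N x) \<le> 2 * C\<^sup>2 * exp (2 * x)"
            using ineqK[OF xa Nx] Nx by (simp add: pos_divide_le_eq power2_eq_square)
          moreover have "(K' x * N x - K x * N' x) / (N x * N x) = - ((K x * N' x - K' x * N x) / (N x * N x))"
            by (simp add: minus_divide_left)
          ultimately show ?thesis by linarith
        qed
        ultimately show "\<exists>y. ((\<lambda>s. K s / N s + C\<^sup>2 * exp (2 * s)) has_real_derivative y) (at x) \<and> y \<ge> 0"
          by blast
      qed
      moreover have "C\<^sup>2 * exp (2 * s) \<ge> 0" by simp
      ultimately show ?thesis unfolding L_def by linarith
    qed
    have "N s1 * exp (- \<kappa> * s1) \<ge> N s0 * exp (- \<kappa> * s0)"
    proof (rule DERIV_nonpos_imp_nonincreasing[OF s1])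
      fix x assume x: "s1 \<le> x" "x \<le> s0"
      have xa: "x < a" and Nx: "N x > 0" using x s0 pos by auto
      have "((\<lambda>s. N s * exp (- \<kappa> * s)) has_real_derivative (N' x - \<kappa> * N x) * exp (- \<kappa> * x)) (at x)"
        by (auto intro!: derivative_eq_intros dN xa simp: algebra_simps)
      moreover have "N' x \<le> \<kappa> * N x"
      proof -
        have "K x \<le> L * N x" using Lam[OF x] Nx by (simp add: pos_divide_le_eq)
        moreover have "C * exp x * N x \<le> C * exp s0 * N x"
          using x C Nx by (intro mult_right_mono mult_left_mono) auto
        ultimately show ?thesis using ineqN[OF xa] unfolding \<kappa>_def by (simp add: algebra_simps)
      qed
      ultimately show "\<exists>y. ((\<lambda>s. N s * exp (- \<kappa> * s)) has_real_derivative y) (at x) \<and> y \<le> 0"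
        by (intro exI[of _ "(N' x - \<kappa> * N x) * exp (- \<kappa> * x)"]) (simp add: mult_le_0_iff)
    qed
    then have "c * exp (\<kappa> * s1) \<le> N s1 * exp (- \<kappa> * s1) * exp (\<kappa> * s1)"
      unfolding c_def by (intro mult_right_mono) auto
    then show ?thesis by (simp add: exp_minus field_simps)
  qed
  \<comment> \<open>Otherwise there is a last zero \<open>s1\<close> before \<open>s0\<close>. The
    bound of \<open>main\<close> holds to its right and passes to the limit, contradicting
    \<open>N s1 = 0\<close>.\<close>
  have pos: "N s > 0" if "s \<le> s0" for s
  proof (rule ccontr)
    assume "\<not> N s > 0"
    then have Ns: "N s = 0" using N0[of s] that s0 by auto
    have cont: "continuous_on {s..s0} N"
      using s0 by (intro continuous_at_imp_continuous_on ballI DERIV_isCont[OF dN]) auto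
    have "closed {x \<in> {s..s0}. N x = 0}"
      by (intro continuous_closed_preimage_constant cont) auto
    then have "compact {x \<in> {s..s0}. N x = 0}"
      by (auto simp: compact_eq_bounded_closed intro: bounded_subset[of "{s..s0}"])
    moreover have "s \<in> {x \<in> {s..s0}. N x = 0}" using Ns that by simp
    ultimately obtain s1 where s1: "s1 \<in> {s..s0}" "N s1 = 0" "\<And>x. x \<in> {s..s0} \<Longrightarrow> N x = 0 \<Longrightarrow> x \<le> s1"
      using compact_attains_sup[of "{x \<in> {s..s0}. N x = 0}"] by blast
    have "s1 < s0" using s1 s0 by (cases "s1 = s0") auto
    have "c * exp (\<kappa> * x) \<le> N x" if x: "s1 < x" "x \<le> s0" for x
    proof (rule main[OF x(2)])
      fix y assume "x \<le> y" "y \<le> s0"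
      then show "N y > 0" using s1 x N0[of y] s0 by (metis atLeastAtMost_iff le_less_trans less_eq_real_def not_le order.trans)
    qed
    then have "\<forall>\<^sub>F x in at_right s1. c * exp (\<kappa> * x) \<le> N x"
      unfolding eventually_at_right_field using \<open>s1 < s0\<close> by (intro exI[of _ s0]) auto
    moreover have "(N \<longlongrightarrow> N s1) (at_right s1)"
      using DERIV_isCont[OF dN[of s1]] s1 s0 by (auto simp: isCont_def intro: tendsto_within_subset)
    moreover have "((\<lambda>x. c * exp (\<kappa> * x)) \<longlongrightarrow> c * exp (\<kappa> * s1)) (at_right s1)"
      by (intro tendsto_intros)
    ultimately have "c * exp (\<kappa> * s1) \<le> N s1"
      by (intro tendsto_le[of "at_right s1" N "N s1" "\<lambda>x. c * exp (\<kappa> * x)"]) auto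
    then show False using s1 c by (simp add: mult_le_0_iff)
  qed
  have "\<forall>s\<le>s0. c * exp (\<kappa> * s) \<le> N s" using main pos by blast
  then show ?thesis using c by blast
qed

section \<open>Integrals over circles in logarithmic coordinates\<close>

definition circle_integral :: "(complex \<Rightarrow> real) \<Rightarrow> real \<Rightarrow> real" where
  "circle_integral \<phi> s = integral {0..2*pi} (\<lambda>y. \<phi> (Complex s y))"

lemma open_Re_less: "open {\<zeta>. Re \<zeta> < a}"
  by (simp add: open_halfspace_Re_lt)

lemma continuous_on_vertical:
  assumes "continuous_on {\<zeta>. Re \<zeta> < a} \<phi>" "s < a"
  shows "continuous_on X (\<lambda>y. \<phi> (Complex s y))"
  using assms by (intro continuous_on_compose2[OF assms(1)]) (auto simp: Complex_eq intro!: continuous_intros)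

lemma circle_integral_has_integral:
  assumes "continuous_on {\<zeta>. Re \<zeta> < a} \<phi>" "s < a"
  shows "((\<lambda>y. \<phi> (Complex s y)) has_integral circle_integral \<phi> s) {0..2*pi}"
  unfolding circle_integral_def
  by (intro integrable_integral integrable_continuous_interval continuous_on_vertical[OF assms])

lemma circle_integral_deriv:
  assumes "smooth_on {\<zeta>. Re \<zeta> < a} \<phi>" "s < a"
  shows "(circle_integral \<phi> has_real_derivative circle_integral (dir_deriv 1 \<phi>) s) (at s)"
proof -
  have "((\<lambda>s. integral (cbox 0 (2*pi)) (\<lambda>y. \<phi> (Complex s y))) has_field_derivative
     integral (cbox 0 (2*pi)) (\<lambda>y. dir_deriv 1 \<phi> (Complex s y))) (at s within {..<a})"
  proof (rule leibniz_rule_field_derivative)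
    fix x y :: real assume x: "x \<in> {..<a}"
    have "((\<lambda>x. Complex x y) has_derivative (\<lambda>t. complex_of_real t)) (at x)"
      unfolding Complex_eq by (auto intro!: derivative_eq_intros)
    moreover have "\<phi> differentiable (at (Complex x y))"
      using x by (intro smooth_on_differentiable[OF assms(1)]) simp
    ultimately have "((\<lambda>x. \<phi> (Complex x y)) has_derivative (\<lambda>t. dir_deriv (complex_of_real t) \<phi> (Complex x y))) (at x)"
      using diff_chain_at[OF _ has_derivative_dir_deriv] by (fastforce simp: o_def)
    moreover have "dir_deriv (complex_of_real t) \<phi> (Complex x y) = dir_deriv 1 \<phi> (Complex x y) * t" for t
      using dir_deriv_expand[OF \<open>\<phi> differentiable (at (Complex x y))\<close>, of "complex_of_real t"] by simp
    ultimately show "((\<lambda>x. \<phi> (Complex x y)) has_field_derivative dir_deriv 1 \<phi> (Complex x y)) (at x within {..<a})"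
      by (simp add: has_field_derivative_def has_derivative_at_withinI)
  next
    fix x :: real assume "x \<in> {..<a}"
    then show "(\<lambda>y. \<phi> (Complex x y)) integrable_on cbox 0 (2 * pi)"
      by (auto intro!: integrable_continuous_interval continuous_on_vertical[OF smooth_on_continuous[OF assms(1)]])
  next
    show "continuous_on ({..<a} \<times> cbox 0 (2*pi)) (\<lambda>(x, y). dir_deriv 1 \<phi> (Complex x y))"
      unfolding split_beta
      by (intro continuous_on_compose2[OF smooth_on_continuous[OF smooth_on_dir_deriv_basis(1)[OF assms(1)]]])
         (auto simp: Complex_eq intro!: continuous_intros)
  qed (use assms in auto)
  moreover have "at s within {..<a} = at s" using assms(2) by (intro at_within_open) auto
  ultimately show ?thesis by (simp add: circle_integral_def[abs_def])
qed

lemma circle_integral_dy: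
  assumes "smooth_on {\<zeta>. Re \<zeta> < a} \<phi>" "s < a" "\<phi> (Complex s (2*pi)) = \<phi> (Complex s 0)"
  shows "circle_integral (dir_deriv \<i> \<phi>) s = 0"
proof -
  have "((\<lambda>y. dir_deriv \<i> \<phi> (Complex s y)) has_integral (\<phi> (Complex s (2*pi)) - \<phi> (Complex s 0))) {0..2*pi}"
  proof (rule fundamental_theorem_of_calculus)
    fix y :: real
    have "((\<lambda>y. Complex s y) has_derivative (\<lambda>t. \<i> * complex_of_real t)) (at y)"
      unfolding Complex_eq by (auto intro!: derivative_eq_intros)
    moreover have "\<phi> differentiable (at (Complex s y))"
      using assms(2) by (intro smooth_on_differentiable[OF assms(1)]) simp
    ultimately have "((\<lambda>y. \<phi> (Complex s y)) has_derivative (\<lambda>t. dir_deriv (\<i> * complex_of_real t) \<phi> (Complex s y))) (at y)"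
      using diff_chain_at[OF _ has_derivative_dir_deriv] by (fastforce simp: o_def)
    moreover have "dir_deriv (\<i> * complex_of_real t) \<phi> (Complex s y) = t *\<^sub>R dir_deriv \<i> \<phi> (Complex s y)" for t
      using dir_deriv_expand[OF \<open>\<phi> differentiable (at (Complex s y))\<close>, of "\<i> * complex_of_real t"] by simp
    ultimately show "((\<lambda>y. \<phi> (Complex s y)) has_vector_derivative dir_deriv \<i> \<phi> (Complex s y)) (at y within {0..2*pi})"
      by (simp add: has_vector_derivative_def has_derivative_at_withinI)
  qed simp
  then show ?thesis using assms(3) by (simp add: circle_integral_def integral_unique)
qed

section \<open>Zeros of infinite order\<close>

context cr_system
begin

text \<open>In the coordinate \<open>\<zeta>\<close> with \<open>w = w0 + exp \<zeta>\<close>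
  circles become vertical segments and the system keeps its form: \<open>A\<close> is what the real
  derivative of \<open>h\<close> would be without error, and the error \<open>T\<close> picks up the
  decaying factor \<open>exp (Re \<zeta>)\<close>. The frequency bound keeps \<open>N\<close> above
  some exponential, while flatness puts it below every one.\<close>

lemma flat_imp_zero:
  assumes w0: "w0 \<in> S" and flat: "\<And>k. vanishes_to_order k w0 g"
    and C: "C \<ge> 0" and \<rho>: "\<rho> > 0" "ball w0 \<rho> \<subseteq> S"
    and RC: "\<And>w. w \<in> ball w0 \<rho> \<Longrightarrow> norm (R w) \<le> C * norm (g w)"
  shows "\<forall>\<^sub>F w in nhds w0. g w = 0"
proof -
  interpret J: bounded_linear J by (rule linear_J)
  define a where "a = ln \<rho>"
  define H where "H = {\<zeta>. Re \<zeta> < a}"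
  define h where "h \<zeta> = g (w0 + exp \<zeta>)" for \<zeta>
  have open_H: "open H" unfolding H_def by (rule open_Re_less)
  have in_ball: "w0 + exp \<zeta> \<in> ball w0 \<rho>" if "\<zeta> \<in> H" for \<zeta>
    using that \<rho>(1) by (simp add: H_def a_def dist_norm) (metis exp_less_mono exp_ln)
  then have in_S': "w0 + exp \<zeta> \<in> S" if "\<zeta> \<in> H" for \<zeta> using that \<rho>(2) by blast
  have D: "((\<lambda>\<zeta>. w0 + exp \<zeta>) has_derivative (\<lambda>u. exp \<zeta> * u)) (at \<zeta>)" for \<zeta> :: complex
    by (auto intro!: derivative_eq_intros simp: mult.commute)
  have hol: "(\<lambda>\<zeta>. w0 + exp \<zeta>) holomorphic_on H" by (intro holomorphic_intros)
  have sm_h: "smooth_on H h" unfolding h_def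
    using in_S' by (intro smooth_on_compose[OF open_H open_S _ smooth_on_holomorphic[OF open_H hol] smooth_g]) auto
  note sm_hx = smooth_on_dir_deriv_basis(1)[OF sm_h] and sm_hy = smooth_on_dir_deriv_basis(2)[OF sm_h]
  have dh: "dir_deriv u h \<zeta> = dir_deriv (exp \<zeta> * u) g (w0 + exp \<zeta>)" if "\<zeta> \<in> H" for u \<zeta>
  proof -
    have "(\<lambda>\<zeta>. w0 + exp \<zeta>) differentiable (at \<zeta>)" using D differentiable_def by blast
    moreover have "g differentiable (at (w0 + exp \<zeta>))"
      using in_S'[OF that] smooth_g by (rule smooth_on_differentiable[rotated])
    ultimately show ?thesis unfolding h_def
      using dir_deriv_compose[of "\<lambda>\<zeta>. w0 + exp \<zeta>" \<zeta> g u] dir_deriv_unique[OF D] by simp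
  qed
  define A where "A \<zeta> = - J (dir_deriv \<i> h \<zeta>)" for \<zeta>
  define T where "T \<zeta> = dir_deriv 1 h \<zeta> - A \<zeta>" for \<zeta>
  have sm_A: "smooth_on H A" unfolding A_def
    by (rule smooth_on_uminus[OF open_H smooth_on_linear[OF open_H linear_J sm_hy]])
  \<comment> \<open>Turning the directions by \<open>exp \<zeta>\<close> respects the unperturbed
    equation, so only terms with \<open>R\<close> survive in \<open>T\<close>, each multiplied by a
    component of \<open>exp \<zeta>\<close>.\<close>
  have T_bound: "norm (T \<zeta>) \<le> 2 * C * exp (Re \<zeta>) * norm (h \<zeta>)" if \<zeta>: "\<zeta> \<in> H" for \<zeta>
  proof -
    define e where "e = exp \<zeta>"
    define w where "w = w0 + e"
    have w: "w \<in> S" "w \<in> ball w0 \<rho>" using in_S'[OF \<zeta>] in_ball[OF \<zeta>] by (auto simp: w_def e_def)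
    have gw: "g differentiable (at w)" by (rule smooth_on_differentiable[OF smooth_g w(1)])
    have hx: "dir_deriv 1 h \<zeta> = Re e *\<^sub>R dir_deriv 1 g w + Im e *\<^sub>R (J (dir_deriv 1 g w) + R w)"
      using dh[OF \<zeta>, of 1] dir_deriv_expand[OF gw, of e] cr[OF w(1)] by (simp add: w_def e_def)
    have hy: "dir_deriv \<i> h \<zeta> = - Im e *\<^sub>R dir_deriv 1 g w + Re e *\<^sub>R (J (dir_deriv 1 g w) + R w)"
      using dh[OF \<zeta>, of \<i>] dir_deriv_expand[OF gw, of "e * \<i>"] cr[OF w(1)] by (simp add: w_def e_def)
    have "T \<zeta> = Im e *\<^sub>R R w + Re e *\<^sub>R J (R w)"
      unfolding T_def A_def hx hy by (simp add: J.add J.scale J.diff J.neg J_J algebra_simps)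
    then have "norm (T \<zeta>) \<le> \<bar>Im e\<bar> * norm (R w) + \<bar>Re e\<bar> * norm (R w)"
      using norm_triangle_ineq[of "Im e *\<^sub>R R w" "Re e *\<^sub>R J (R w)"] by simp
    also have "\<dots> \<le> cmod e * norm (R w) + cmod e * norm (R w)"
      by (intro add_mono mult_right_mono abs_Im_le_cmod abs_Re_le_cmod) auto
    also have "\<dots> \<le> 2 * (exp (Re \<zeta>) * (C * norm (h \<zeta>)))"
    proof -
      have "norm (R w) \<le> C * norm (h \<zeta>)" using RC[OF w(2)] by (simp add: w_def e_def h_def)
      then have "exp (Re \<zeta>) * norm (R w) \<le> exp (Re \<zeta>) * (C * norm (h \<zeta>))" by (intro mult_left_mono) auto
      then show ?thesis by (simp add: e_def)
    qed
    finally show ?thesis by (simp add: mult_ac)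
  qed
  define \<phi>N where "\<phi>N \<zeta> = h \<zeta> \<bullet> h \<zeta>" for \<zeta>
  define \<phi>K where "\<phi>K \<zeta> = A \<zeta> \<bullet> h \<zeta>" for \<zeta>
  define \<phi>P where "\<phi>P \<zeta> = dir_deriv 1 h \<zeta> \<bullet> J (h \<zeta>)" for \<zeta>
  have sm: "smooth_on {\<zeta>. Re \<zeta> < a} \<phi>N" "smooth_on {\<zeta>. Re \<zeta> < a} \<phi>K" "smooth_on {\<zeta>. Re \<zeta> < a} \<phi>P"
    unfolding \<phi>N_def \<phi>K_def \<phi>P_def H_def[symmetric]
    by (intro smooth_on_inner[OF open_H] sm_h sm_A sm_hx smooth_on_linear[OF open_H linear_J sm_h])+
  define N where "N = circle_integral \<phi>N"
  define K where "K = circle_integral \<phi>K"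
  define N' where "N' = circle_integral (dir_deriv 1 \<phi>N)"
  define K' where "K' = circle_integral (dir_deriv 1 \<phi>K)"
  have dfb: "h differentiable (at \<zeta>)" "dir_deriv 1 h differentiable (at \<zeta>)" "dir_deriv \<i> h differentiable (at \<zeta>)"
    "A differentiable (at \<zeta>)" if "\<zeta> \<in> H" for \<zeta>
    using that sm_h sm_hx sm_hy sm_A by (auto intro: smooth_on_differentiable)
  have dNf: "dir_deriv 1 \<phi>N \<zeta> = 2 * (h \<zeta> \<bullet> dir_deriv 1 h \<zeta>)" if "\<zeta> \<in> H" for \<zeta>
    using dir_deriv_bilinear[OF bounded_bilinear_inner dfb(1)[OF that] dfb(1)[OF that], of 1]
    unfolding \<phi>N_def[abs_def] by (simp add: inner_commute)
  \<comment> \<open>As mixed derivatives commute and \<open>J\<close> is skew, the second-order term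
    is another copy of \<open>A \<zeta> \<bullet> dir_deriv 1 h \<zeta>\<close> plus an imaginary
    derivative, which integrates to zero over a period of the exponential.\<close>
  have dKf: "dir_deriv 1 \<phi>K \<zeta> = 2 * (A \<zeta> \<bullet> dir_deriv 1 h \<zeta>) + dir_deriv \<i> \<phi>P \<zeta>" if \<zeta>: "\<zeta> \<in> H" for \<zeta>
  proof -
    have 1: "dir_deriv 1 \<phi>K \<zeta> = A \<zeta> \<bullet> dir_deriv 1 h \<zeta> + dir_deriv 1 A \<zeta> \<bullet> h \<zeta>"
      using dir_deriv_bilinear[OF bounded_bilinear_inner dfb(4)[OF \<zeta>] dfb(1)[OF \<zeta>], of 1]
      unfolding \<phi>K_def[abs_def] .
    have "dir_deriv 1 A \<zeta> = - J (dir_deriv 1 (dir_deriv \<i> h) \<zeta>)"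
      unfolding A_def[abs_def]
      by (subst dir_deriv_uminus) (auto intro: bounded_linear_differentiable[OF linear_J] dfb[OF \<zeta>]
          simp: dir_deriv_linear[OF linear_J dfb(3)[OF \<zeta>]])
    then have 2: "dir_deriv 1 A \<zeta> = - J (dir_deriv \<i> (dir_deriv 1 h) \<zeta>)"
      using dir_deriv_commute[OF open_H sm_h \<zeta>, of 1 \<i>] by simp
    have 3: "dir_deriv \<i> \<phi>P \<zeta> = dir_deriv 1 h \<zeta> \<bullet> J (dir_deriv \<i> h \<zeta>) + dir_deriv \<i> (dir_deriv 1 h) \<zeta> \<bullet> J (h \<zeta>)"
      unfolding \<phi>P_def[abs_def]
      by (subst dir_deriv_bilinear[OF bounded_bilinear_inner dfb(2)[OF \<zeta>]])
         (auto intro: bounded_linear_differentiable[OF linear_J] dfb[OF \<zeta>]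
          simp: dir_deriv_linear[OF linear_J dfb(1)[OF \<zeta>]])
    show ?thesis unfolding 1 2 3 A_def by (simp add: J_skew inner_commute)
  qed
  have per: "\<phi>P (Complex s (2*pi)) = \<phi>P (Complex s 0)" if "s < a" for s
  proof -
    have "Complex s (2*pi) \<in> H" "Complex s 0 \<in> H" using that by (auto simp: H_def)
    moreover have "exp (Complex s (2*pi)) = exp (Complex s 0)"
      by (simp add: Complex_eq exp_add exp_two_pi_i'[unfolded mult.commute[of "of_real pi" 2]])
    ultimately show ?thesis unfolding \<phi>P_def by (simp add: dh h_def)
  qed
  have hiN: "((\<lambda>y. \<phi>N (Complex s y)) has_integral N s) {0..2*pi}"
    and hiK: "((\<lambda>y. \<phi>K (Complex s y)) has_integral K s) {0..2*pi}"
    and hiN': "((\<lambda>y. 2 * (h (Complex s y) \<bullet> dir_deriv 1 h (Complex s y))) has_integral N' s) {0..2*pi}"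
    and hiK': "((\<lambda>y. 2 * (A (Complex s y) \<bullet> dir_deriv 1 h (Complex s y))) has_integral K' s) {0..2*pi}"
    if s: "s < a" for s
  proof -
    have inH: "Complex s y \<in> H" for y using s by (simp add: H_def)
    show "((\<lambda>y. \<phi>N (Complex s y)) has_integral N s) {0..2*pi}"
      "((\<lambda>y. \<phi>K (Complex s y)) has_integral K s) {0..2*pi}"
      unfolding N_def K_def
      by (rule circle_integral_has_integral[OF smooth_on_continuous[OF sm(1)] s]
          circle_integral_has_integral[OF smooth_on_continuous[OF sm(2)] s])+
    have "((\<lambda>y. dir_deriv 1 \<phi>N (Complex s y)) has_integral N' s) {0..2*pi}"
      unfolding N'_def
      by (rule circle_integral_has_integral[OF smooth_on_continuous[OF smooth_on_dir_deriv_basis(1)[OF sm(1)]] s])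
    then show "((\<lambda>y. 2 * (h (Complex s y) \<bullet> dir_deriv 1 h (Complex s y))) has_integral N' s) {0..2*pi}"
      by (simp add: dNf[OF inH])
    have "((\<lambda>y. dir_deriv 1 \<phi>K (Complex s y)) has_integral K' s) {0..2*pi}"
      unfolding K'_def
      by (rule circle_integral_has_integral[OF smooth_on_continuous[OF smooth_on_dir_deriv_basis(1)[OF sm(2)]] s])
    moreover have "((\<lambda>y. dir_deriv \<i> \<phi>P (Complex s y)) has_integral 0) {0..2*pi}"
      using circle_integral_has_integral[OF smooth_on_continuous[OF smooth_on_dir_deriv_basis(2)[OF sm(3)]] s]
      unfolding circle_integral_dy[OF sm(3) s per[OF s]] .
    ultimately have "((\<lambda>y. dir_deriv 1 \<phi>K (Complex s y) - dir_deriv \<i> \<phi>P (Complex s y)) has_integral K' s - 0) {0..2*pi}"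
      by (rule has_integral_diff)
    then show "((\<lambda>y. 2 * (A (Complex s y) \<bullet> dir_deriv 1 h (Complex s y))) has_integral K' s) {0..2*pi}"
      by (simp add: dKf[OF inH])
  qed
  have N_nonneg: "N s \<ge> 0" if "s < a" for s
    by (rule has_integral_nonneg[OF hiN[OF that]]) (simp add: \<phi>N_def)
  \<comment> \<open>Cauchy--Schwarz in integrated form: the integrand dominates the square of
    \<open>A - l *\<^sub>R h + (1/2) *\<^sub>R T\<close>, where half of \<open>T\<close> absorbs the
    mixed error terms. Taking \<open>l\<close> to be the frequency makes the terms with
    \<open>K\<close> combine after multiplication by \<open>2 * N s\<close>.\<close>
  have ineqK: "K s * N' s - K' s * N s \<le> 2 * C\<^sup>2 * exp (2 * s) * (N s)\<^sup>2" if s: "s < a" and pos: "N s > 0" for s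
  proof -
    define l where "l = K s / N s"
    define q where "q = 2 * C * exp s"
    let ?z = "\<lambda>y. Complex s y"
    have "((\<lambda>y. (1/2) * (2 * (A (?z y) \<bullet> dir_deriv 1 h (?z y))) - l * \<phi>K (?z y)
        - (l/2) * (2 * (h (?z y) \<bullet> dir_deriv 1 h (?z y))) + (l\<^sup>2 + q\<^sup>2/4) * \<phi>N (?z y))
        has_integral ((1/2) * K' s - l * K s - (l/2) * N' s + (l\<^sup>2 + q\<^sup>2/4) * N s)) {0..2*pi}"
      by (intro has_integral_add has_integral_diff has_integral_mult_right hiN hiK hiN' hiK' s)
    then have "(1/2) * K' s - l * K s - (l/2) * N' s + (l\<^sup>2 + q\<^sup>2/4) * N s \<ge> 0"
    proof (rule has_integral_nonneg)
      fix y
      have z: "?z y \<in> H" using s by (simp add: H_def)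
      have hx: "dir_deriv 1 h (?z y) = A (?z y) + T (?z y)" by (simp add: T_def)
      have "norm (T (?z y)) ^ 2 \<le> (q * norm (h (?z y)))^2"
        using T_bound[OF z] by (intro power_mono) (auto simp: q_def)
      then have Tq: "T (?z y) \<bullet> T (?z y) \<le> q\<^sup>2 * \<phi>N (?z y)"
        by (simp add: power_mult_distrib \<phi>N_def power2_norm_eq_inner)
      have "0 \<le> (A (?z y) - l *\<^sub>R h (?z y) + (1/2) *\<^sub>R T (?z y)) \<bullet> (A (?z y) - l *\<^sub>R h (?z y) + (1/2) *\<^sub>R T (?z y))"
        by simp
      also have "\<dots> = (1/2) * (2 * (A (?z y) \<bullet> dir_deriv 1 h (?z y))) - l * \<phi>K (?z y)
        - (l/2) * (2 * (h (?z y) \<bullet> dir_deriv 1 h (?z y))) + l\<^sup>2 * \<phi>N (?z y) + (1/4) * (T (?z y) \<bullet> T (?z y))"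
        unfolding hx \<phi>K_def \<phi>N_def
        by (simp add: inner_add_left inner_add_right inner_diff_left inner_diff_right inner_commute
            power2_eq_square algebra_simps)
      finally show "0 \<le> (1/2) * (2 * (A (?z y) \<bullet> dir_deriv 1 h (?z y))) - l * \<phi>K (?z y)
        - (l/2) * (2 * (h (?z y) \<bullet> dir_deriv 1 h (?z y))) + (l\<^sup>2 + q\<^sup>2/4) * \<phi>N (?z y)"
        using Tq by (simp add: algebra_simps)
    qed
    then have "0 \<le> 2 * N s * ((1/2) * K' s - l * K s - (l/2) * N' s + (l\<^sup>2 + q\<^sup>2/4) * N s)"
      using pos by simp
    also have "\<dots> = K' s * N s - 2 * K s * (l * N s) - (l * N s) * N' s + 2 * (l * N s)\<^sup>2 + q\<^sup>2/2 * (N s)\<^sup>2"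
      by (simp add: algebra_simps power2_eq_square)
    also have "l * N s = K s" using pos by (simp add: l_def)
    finally have "K s * N' s - K' s * N s \<le> q\<^sup>2/2 * (N s)\<^sup>2" by (simp add: power2_eq_square algebra_simps)
    moreover have "q\<^sup>2/2 = 2 * C\<^sup>2 * exp (2 * s)"
      by (simp add: q_def power_mult_distrib exp_double)
    ultimately show ?thesis by simp
  qed
  have ineqN: "N' s \<le> 2 * K s + 4 * C * exp s * N s" if s: "s < a" for s
  proof -
    let ?z = "\<lambda>y. Complex s y"
    have "((\<lambda>y. 2 * \<phi>K (?z y) + (4 * C * exp s) * \<phi>N (?z y)) has_integral 2 * K s + (4 * C * exp s) * N s) {0..2*pi}"
      by (intro has_integral_add has_integral_mult_right hiN hiK s)
    with hiN'[OF s] show ?thesis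
    proof (rule has_integral_le)
      fix y
      have z: "?z y \<in> H" using s by (simp add: H_def)
      have "h (?z y) \<bullet> T (?z y) \<le> norm (h (?z y)) * norm (T (?z y))" by (rule norm_cauchy_schwarz)
      also have "\<dots> \<le> norm (h (?z y)) * (2 * C * exp s * norm (h (?z y)))"
        using T_bound[OF z] by (intro mult_left_mono) auto
      also have "\<dots> = 2 * C * exp s * \<phi>N (?z y)"
        by (simp add: \<phi>N_def power2_norm_eq_inner[symmetric] power2_eq_square)
      finally show "2 * (h (?z y) \<bullet> dir_deriv 1 h (?z y)) \<le> 2 * \<phi>K (?z y) + (4 * C * exp s) * \<phi>N (?z y)"
        by (simp add: T_def \<phi>K_def inner_diff_right inner_commute algebra_simps)
    qed
  qed
  have dN: "(N has_real_derivative N' s) (at s)" and dK: "(K has_real_derivative K' s) (at s)" if "s < a" for s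
    unfolding N_def N'_def K_def K'_def
    by (rule circle_integral_deriv[OF sm(1) that] circle_integral_deriv[OF sm(2) that])+
  have N_zero: "N s0 = 0" if s0: "s0 < a" for s0
  proof (rule ccontr)
    assume "N s0 \<noteq> 0"
    then have "N s0 > 0" using N_nonneg[OF s0] by simp
    then obtain c \<kappa> where c: "c > 0" "\<And>s. s \<le> s0 \<Longrightarrow> c * exp (\<kappa> * s) \<le> N s"
      using frequency_lower_bound[OF s0 _ C dN dK N_nonneg ineqK ineqN] by blast
    \<comment> \<open>Flatness to order \<open>k\<close> bounds \<open>N s\<close> by a multiple of
      \<open>exp (2 * real k * s)\<close>; for \<open>s \<le> 0\<close> this choice gains at least a
      factor \<open>exp s\<close> over \<open>exp (\<kappa> * s)\<close>.\<close>
    define k where "k = nat \<lceil>\<bar>\<kappa>\<bar>\<rceil> + 1"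
    have k: "2 * real k - \<kappa> \<ge> 1"
      using real_nat_ceiling_ge[of "\<bar>\<kappa>\<bar>"] unfolding k_def of_nat_add of_nat_1 by argo
    obtain B where B: "B \<ge> 0" "\<forall>\<^sub>F w in nhds w0. norm (g w) \<le> B * norm (w - w0) ^ k"
      using flat[of k] unfolding vanishes_to_order_def by blast
    then obtain d where d: "d > 0" "\<And>w. dist w w0 < d \<Longrightarrow> norm (g w) \<le> B * norm (w - w0) ^ k"
      unfolding eventually_nhds_metric by blast
    define E where "E = 2 * pi * B\<^sup>2 + 1"
    have E: "E > 0" unfolding E_def using pi_gt_zero by (simp add: add_nonneg_pos)
    \<comment> \<open>So far to the left that the flatness estimate holds on the circle and
      \<open>exp s\<close> beats the constant \<open>E / c\<close>; subtracting 1 makes the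
      inequalities strict.\<close>
    define s where "s = min (min s0 0) (min (ln d) (ln (c / E))) - 1"
    have s: "s \<le> s0" "s \<le> 0" "s < ln d" "s < ln (c / E)" "s < a" using s0 by (auto simp: s_def)
    have es: "exp s < d" "exp s < c / E"
      using s(3,4) d(1) c(1) E by (metis exp_less_mono exp_ln, metis divide_pos_pos exp_less_mono exp_ln)
    have "N s \<le> (2 * pi) * (B * exp s ^ k)\<^sup>2"
    proof -
      have "((\<lambda>y::real. (B * exp s ^ k)\<^sup>2) has_integral (2 * pi - 0) *\<^sub>R (B * exp s ^ k)\<^sup>2) {0..2*pi}"
        using has_integral_const_real[of "(B * exp s ^ k)\<^sup>2" 0 "2*pi"] by simp
      with hiN[OF s(5)] have "N s \<le> (2 * pi - 0) *\<^sub>R (B * exp s ^ k)\<^sup>2"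
      proof (rule has_integral_le)
        fix y
        have "norm (h (Complex s y)) \<le> B * exp s ^ k"
          using d(2)[of "w0 + exp (Complex s y)"] es(1) by (simp add: h_def dist_norm)
        then have "norm (h (Complex s y)) ^ 2 \<le> (B * exp s ^ k)\<^sup>2" by (intro power_mono) auto
        then show "\<phi>N (Complex s y) \<le> (B * exp s ^ k)\<^sup>2" by (simp add: \<phi>N_def power2_norm_eq_inner)
      qed
      then show ?thesis by simp
    qed
    also have "(B * exp s ^ k)\<^sup>2 = B\<^sup>2 * exp (2 * real k * s)"
      using exp_of_nat_mult[of "2 * k" s] by (simp add: power_mult_distrib power_mult[symmetric] mult_ac)
    finally have "c * exp (\<kappa> * s) \<le> 2 * pi * (B\<^sup>2 * exp (2 * real k * s))" using c(2)[OF s(1)] by simp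
    also have "exp (2 * real k * s) = exp ((2 * real k - \<kappa>) * s) * exp (\<kappa> * s)"
      by (simp add: exp_add[symmetric] algebra_simps)
    finally have "c * exp (\<kappa> * s) \<le> (2 * pi * B\<^sup>2 * exp ((2 * real k - \<kappa>) * s)) * exp (\<kappa> * s)" by (simp add: mult_ac)
    then have "c \<le> 2 * pi * B\<^sup>2 * exp ((2 * real k - \<kappa>) * s)" by simp
    also have "\<dots> \<le> E * exp s"
    proof (intro mult_mono)
      have "(2 * real k - \<kappa>) * s \<le> 1 * s" using k s(2) by (intro mult_right_mono_neg) auto
      then show "exp ((2 * real k - \<kappa>) * s) \<le> exp s" by simp
    qed (auto simp: E_def add_nonneg_nonneg)
    also have "\<dots> < c" using es(2) E by (simp add: pos_less_divide_eq mult.commute)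
    finally show False by simp
  qed
  have "g w0 = 0"
    using flat[of 1] unfolding vanishes_to_order_def eventually_nhds_metric by (metis dist_self diff_self mult_zero_right norm_le_zero_iff norm_zero power_one_right)
  \<comment> \<open>Polar coordinates put each point of the punctured disc on a circle where a
    continuous non-negative function has integral zero.\<close>
  moreover have "g w = 0" if w: "w \<in> ball w0 \<rho>" "w \<noteq> w0" for w
  proof -
    define s where "s = ln (norm (w - w0))"
    define y where "y = Arg2pi (w - w0)"
    have ne: "norm (w - w0) > 0" using w(2) by simp
    have "norm (w - w0) < \<rho>" using w(1) by (simp add: dist_norm norm_minus_commute)
    then have s: "s < a" unfolding s_def a_def using ne \<rho>(1) by simp
    have "w - w0 = exp (Complex s y)"
      using Arg2pi[of "w - w0"] ne unfolding s_def y_def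
      by (simp add: Complex_eq exp_add exp_of_real is_Arg_def)
    then have gw: "g w = h (Complex s y)" unfolding h_def by (simp add: algebra_simps)
    have "\<forall>y\<in>{0..2*pi}. \<phi>N (Complex s y) = 0"
      using N_zero[OF s] integral_eq_0_iff[OF continuous_on_vertical[OF smooth_on_continuous[OF sm(1)] s], of 0 "2*pi"]
      by (simp add: N_def circle_integral_def \<phi>N_def)
    moreover have "y \<in> {0..2*pi}" using Arg2pi[of "w - w0"] by (simp add: y_def)
    ultimately show ?thesis using gw by (simp add: \<phi>N_def)
  qed
  ultimately show ?thesis
    unfolding eventually_nhds_metric using \<rho>(1) by (intro exI[of _ \<rho>]) (metis dist_commute mem_ball)
qed

text \<open>Either some real derivative at \<open>w0\<close> is non-zero and the leading term
  decides, or \<open>g\<close> is flat there and the frequency estimate applies, the order zero of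
  the domination giving the pointwise bound on \<open>R\<close>.\<close>

theorem isolated_or_locally_zero:
  assumes w0: "w0 \<in> S" and R: "jet_dominated S w0 g 0 R"
  shows "(\<forall>\<^sub>F w in nhds w0. g w = 0) \<or> (\<forall>\<^sub>F w in at w0. g w \<noteq> 0)"
proof (cases "\<exists>n. dx_iter n g w0 \<noteq> 0")
  case True
  then show ?thesis using isolated_zero_finite_order[OF w0 R] by blast
next
  case False
  then have flat: "vanishes_to_order k w0 g" for k
    using vanishes_dx_iter[OF w0 R, of k 0 k] by simp
  obtain C where C: "C \<ge> 0" "\<forall>\<^sub>F w in nhds w0. norm (dx_iter 0 R w) \<le> C * jet_size g (0 + 0) w"
    using jet_dominatedD[OF R] by blast
  with in_S[OF w0 R] have "\<forall>\<^sub>F w in nhds w0. w \<in> S \<and> norm (R w) \<le> C * norm (g w)"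
    by (simp add: jet_size_def eventually_conj)
  then obtain \<rho> where "\<rho> > 0" "\<And>w. dist w w0 < \<rho> \<Longrightarrow> w \<in> S \<and> norm (R w) \<le> C * norm (g w)"
    unfolding eventually_nhds_metric by blast
  then show ?thesis
    using flat_imp_zero[OF w0 flat C(1), of \<rho>] by (force simp: dist_commute)
qed

end

section \<open>Product rules for smooth maps\<close>

lemma smooth_on_cross7:
  "open S \<Longrightarrow> smooth_on S f \<Longrightarrow> smooth_on S g \<Longrightarrow> smooth_on S (\<lambda>w. f w \<times>\<^sub>7 g w)"
  by (rule smooth_on_bilinear[OF _ bounded_bilinear_cross7])

lemma dir_deriv_inner_smooth:
  assumes "smooth_on S a" "smooth_on S b" "w \<in> S"
  shows "dir_deriv u (\<lambda>w. a w \<bullet> b w) w = a w \<bullet> dir_deriv u b w + dir_deriv u a w \<bullet> b w"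
  using assms by (intro dir_deriv_bilinear[OF bounded_bilinear_inner] smooth_on_differentiable)

lemma dir_deriv_scaleR_smooth:
  assumes "smooth_on S a" "smooth_on S b" "w \<in> S"
  shows "dir_deriv u (\<lambda>w. a w *\<^sub>R b w) w = a w *\<^sub>R dir_deriv u b w + dir_deriv u a w *\<^sub>R b w"
  using assms by (intro dir_deriv_bilinear[OF bounded_bilinear_scaleR] smooth_on_differentiable)

lemma dir_deriv_cross7_smooth:
  assumes "smooth_on S a" "smooth_on S b" "w \<in> S"
  shows "dir_deriv u (\<lambda>w. a w \<times>\<^sub>7 b w) w = a w \<times>\<^sub>7 dir_deriv u b w + dir_deriv u a w \<times>\<^sub>7 b w"
  using assms by (intro dir_deriv_bilinear[OF bounded_bilinear_cross7] smooth_on_differentiable)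

lemma dir_deriv_add_smooth:
  assumes "smooth_on S a" "smooth_on S b" "w \<in> S"
  shows "dir_deriv u (\<lambda>w. a w + b w) w = dir_deriv u a w + dir_deriv u b w"
  using assms by (intro dir_deriv_add smooth_on_differentiable)

lemma dir_deriv_diff_smooth:
  assumes "smooth_on S a" "smooth_on S b" "w \<in> S"
  shows "dir_deriv u (\<lambda>w. a w - b w) w = dir_deriv u a w - dir_deriv u b w"
  using assms by (intro dir_deriv_diff smooth_on_differentiable)

lemma dir_deriv_eq_zero:
  assumes "open S" "w \<in> S" "\<And>x. x \<in> S \<Longrightarrow> a x = c"
  shows "dir_deriv u a w = 0"
  using dir_deriv_cong[OF assms(1,2), of a "\<lambda>w. c" u] assms(3) by simp

lemma inner_const_deriv:
  assumes "open S" "smooth_on S a" "smooth_on S b" "\<And>x. x \<in> S \<Longrightarrow> a x \<bullet> b x = c" "w \<in> S"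
  shows "a w \<bullet> dir_deriv u b w = - (dir_deriv u a w \<bullet> b w)"
  using dir_deriv_inner_smooth[OF assms(2,3,5), of u] dir_deriv_eq_zero[OF assms(1,5,4), where u = u] by simp

lemma scaleR_double: "(2 * a) *\<^sub>R v = a *\<^sub>R v + a *\<^sub>R (v :: 'a::real_vector)"
  by (simp add: scaleR_add_left[symmetric])

subsection \<open>Conformal harmonic maps into the sphere\<close>

text \<open>Formulated on an arbitrary open set and not only on a full chart image, so that later
  case distinctions can pass to smaller open sets by \<open>restrict\<close>.\<close>

locale conformal_harmonic =
  fixes S :: "complex set" and f :: "complex \<Rightarrow> real^7"
  assumes open_S: "open S" and smooth_f: "smooth_on S f"
    and unit: "w \<in> S \<Longrightarrow> f w \<bullet> f w = 1"
    and conf1: "w \<in> S \<Longrightarrow> dir_deriv \<i> f w \<bullet> dir_deriv \<i> f w = dir_deriv 1 f w \<bullet> dir_deriv 1 f w"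
    and conf2: "w \<in> S \<Longrightarrow> dir_deriv 1 f w \<bullet> dir_deriv \<i> f w = 0"
    and immersed: "w \<in> S \<Longrightarrow> dir_deriv 1 f w \<noteq> 0"
    and harmonic: "w \<in> S \<Longrightarrow> sphere_tangential (f w)
       (dir_deriv 1 (dir_deriv 1 f) w + dir_deriv \<i> (dir_deriv \<i> f) w) = 0"
begin

abbreviation "fx \<equiv> dir_deriv 1 f"
abbreviation "fy \<equiv> dir_deriv \<i> f"
abbreviation "fxx \<equiv> dir_deriv 1 (dir_deriv 1 f)"
abbreviation "fxy \<equiv> dir_deriv \<i> (dir_deriv 1 f)"
abbreviation "fyy \<equiv> dir_deriv \<i> (dir_deriv \<i> f)"

text \<open>\<open>E\<close> is the conformal factor, and \<open>al\<close>, \<open>be\<close> are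
  half of its logarithmic derivatives (see \<open>E_deriv\<close>), that is, the Christoffel symbols
  of the induced metric; they give the tangential parts removed in \<open>P\<close> and
  \<open>Q\<close>.\<close>

definition "E w = fx w \<bullet> fx w"
definition "al w = (fxx w \<bullet> fx w) / E w"
definition "be w = (fxy w \<bullet> fx w) / E w"
definition "P w = fxx w + E w *\<^sub>R f w - al w *\<^sub>R fx w + be w *\<^sub>R fy w"
definition "Q w = fxy w - be w *\<^sub>R fx w - al w *\<^sub>R fy w"
definition "eta w = fx w \<times>\<^sub>7 fy w"
definition "nu w = f w \<times>\<^sub>7 eta w"

lemma E_pos: "w \<in> S \<Longrightarrow> E w > 0"
  using immersed by (simp add: E_def)

lemma smooth_fx: "smooth_on S fx" and smooth_fy: "smooth_on S fy"
  by (intro smooth_on_dir_deriv_basis smooth_f)+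

lemma smooth_fxx: "smooth_on S fxx" and smooth_fxy: "smooth_on S fxy" and smooth_fyy: "smooth_on S fyy"
  by (intro smooth_on_dir_deriv_basis smooth_f)+

lemma smooth_E: "smooth_on S E"
  unfolding E_def[abs_def] by (intro smooth_on_inner smooth_fx open_S)

lemma smooth_al: "smooth_on S al" and smooth_be: "smooth_on S be"
  unfolding al_def[abs_def] be_def[abs_def] using E_pos
  by (intro smooth_on_divide smooth_on_inner smooth_fx smooth_fxx smooth_fxy smooth_E open_S; force)+

lemma smooth_P: "smooth_on S P"
  unfolding P_def[abs_def]
  by (intro smooth_on_add smooth_on_diff smooth_on_scaleR smooth_fxx smooth_E smooth_f smooth_al smooth_be
      smooth_fx smooth_fy open_S)

lemma smooth_Q: "smooth_on S Q"
  unfolding Q_def[abs_def]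
  by (intro smooth_on_diff smooth_on_scaleR smooth_fxy smooth_al smooth_be smooth_fx smooth_fy open_S)

lemma smooth_eta: "smooth_on S eta"
  unfolding eta_def[abs_def] by (intro smooth_on_cross7 smooth_fx smooth_fy open_S)

lemma smooth_nu: "smooth_on S nu"
  unfolding nu_def[abs_def] by (intro smooth_on_cross7 smooth_f smooth_eta open_S)

lemma fyx: "w \<in> S \<Longrightarrow> dir_deriv 1 fy w = fxy w"
  using dir_deriv_commute[OF open_S smooth_f] by metis

lemma f_fx [simp]: "w \<in> S \<Longrightarrow> f w \<bullet> fx w = 0" and f_fy [simp]: "w \<in> S \<Longrightarrow> f w \<bullet> fy w = 0"
  using inner_const_deriv[OF open_S smooth_f smooth_f unit, of w 1]
    inner_const_deriv[OF open_S smooth_f smooth_f unit, of w \<i>] by (simp_all add: inner_commute)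

lemma fx_f [simp]: "w \<in> S \<Longrightarrow> fx w \<bullet> f w = 0" and fy_f [simp]: "w \<in> S \<Longrightarrow> fy w \<bullet> f w = 0"
  by (simp_all add: inner_commute)

lemma fx_fx [simp]: "w \<in> S \<Longrightarrow> fx w \<bullet> fx w = E w" by (simp add: E_def)

lemma fy_fy [simp]: "w \<in> S \<Longrightarrow> fy w \<bullet> fy w = E w" by (simp add: conf1)

lemma fx_fy [simp]: "w \<in> S \<Longrightarrow> fx w \<bullet> fy w = 0" by (rule conf2)

lemma fy_fx [simp]: "w \<in> S \<Longrightarrow> fy w \<bullet> fx w = 0" using conf2 by (simp add: inner_commute)

lemma f_fxx: "w \<in> S \<Longrightarrow> f w \<bullet> fxx w = - E w" and f_fxy: "w \<in> S \<Longrightarrow> f w \<bullet> fxy w = 0"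
  and f_fyy: "w \<in> S \<Longrightarrow> f w \<bullet> fyy w = - E w"
  using inner_const_deriv[OF open_S smooth_f smooth_fx f_fx, of w 1]
    inner_const_deriv[OF open_S smooth_f smooth_fx f_fx, of w \<i>]
    inner_const_deriv[OF open_S smooth_f smooth_fy f_fy, of w \<i>]
  by simp_all

lemma fyy_eq: "w \<in> S \<Longrightarrow> fyy w = - (2 * E w) *\<^sub>R f w - fxx w"
proof -
  assume w: "w \<in> S"
  have s: "(fxx w + fyy w) \<bullet> f w = - (2 * E w)"
    using f_fxx[OF w] f_fyy[OF w] by (simp add: inner_add_left inner_add_right inner_commute)
  have "fxx w + fyy w = ((fxx w + fyy w) \<bullet> f w) *\<^sub>R f w"
    using harmonic[OF w] by (simp add: sphere_tangential_def)
  then have "fxx w + fyy w = - (2 * E w) *\<^sub>R f w" unfolding s .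
  then show ?thesis by (metis add_diff_cancel_left')
qed

lemma fx_fxx: "w \<in> S \<Longrightarrow> fx w \<bullet> fxx w = al w * E w" and fx_fxy: "w \<in> S \<Longrightarrow> fx w \<bullet> fxy w = be w * E w"
  using E_pos[of w] by (simp_all add: al_def be_def inner_commute)

lemma fy_fxy: "w \<in> S \<Longrightarrow> fy w \<bullet> fxy w = al w * E w"
proof -
  assume w: "w \<in> S"
  have "dir_deriv 1 (\<lambda>w. fy w \<bullet> fy w) w = dir_deriv 1 (\<lambda>w. fx w \<bullet> fx w) w"
    by (rule dir_deriv_cong[OF open_S w conf1])
  then show ?thesis
    using fx_fxx[OF w] fyx[OF w]
    by (simp add: dir_deriv_inner_smooth[OF smooth_fx smooth_fx w] dir_deriv_inner_smooth[OF smooth_fy smooth_fy w]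
        inner_commute)
qed

lemma fy_fxx: "w \<in> S \<Longrightarrow> fy w \<bullet> fxx w = - (be w * E w)"
  using inner_const_deriv[OF open_S smooth_fx smooth_fy fx_fy, of w 1] fyx[of w] fx_fxy[of w]
  by (simp add: inner_commute)

lemma E_deriv:
  assumes "w \<in> S"
  shows "dir_deriv 1 E w = 2 * al w * E w" "dir_deriv \<i> E w = 2 * be w * E w"
proof -
  have "E = (\<lambda>w. fx w \<bullet> fx w)" by (rule ext) (rule E_def)
  then have "dir_deriv u E w = 2 * (fx w \<bullet> dir_deriv u fx w)" for u
    using dir_deriv_inner_smooth[OF smooth_fx smooth_fx assms, of u] by (simp add: inner_commute)
  then show "dir_deriv 1 E w = 2 * al w * E w" "dir_deriv \<i> E w = 2 * be w * E w"
    using fx_fxx[OF assms] fx_fxy[OF assms] by simp_all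
qed

lemma P_orth [simp]:
  assumes "w \<in> S"
  shows "P w \<bullet> f w = 0" "P w \<bullet> fx w = 0" "P w \<bullet> fy w = 0" "f w \<bullet> P w = 0" "fx w \<bullet> P w = 0" "fy w \<bullet> P w = 0"
  using assms f_fxx[OF assms] fx_fxx[OF assms] fy_fxx[OF assms] unit[OF assms]
  by (simp_all add: P_def inner_add_left inner_add_right inner_diff_left inner_diff_right inner_commute)

lemma Q_orth [simp]:
  assumes "w \<in> S"
  shows "Q w \<bullet> f w = 0" "Q w \<bullet> fx w = 0" "Q w \<bullet> fy w = 0" "f w \<bullet> Q w = 0" "fx w \<bullet> Q w = 0" "fy w \<bullet> Q w = 0"
  using assms f_fxy[OF assms] fx_fxy[OF assms] fy_fxy[OF assms]
  by (simp_all add: Q_def inner_diff_left inner_diff_right inner_commute)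

text \<open>The Gauss formulas; harmonicity appears as the opposite normal parts of
  \<open>fxx\<close> and \<open>fyy\<close>.\<close>

lemma structure_eqs:
  assumes "w \<in> S"
  shows "fxx w = - E w *\<^sub>R f w + al w *\<^sub>R fx w - be w *\<^sub>R fy w + P w"
    "fxy w = be w *\<^sub>R fx w + al w *\<^sub>R fy w + Q w"
    "fyy w = - E w *\<^sub>R f w - al w *\<^sub>R fx w + be w *\<^sub>R fy w - P w"
  unfolding fyy_eq[OF assms] by (simp_all add: P_def Q_def scaleR_double algebra_simps)

lemma P_fxx: "w \<in> S \<Longrightarrow> P w \<bullet> fxx w = P w \<bullet> P w" and P_fxy: "w \<in> S \<Longrightarrow> P w \<bullet> fxy w = P w \<bullet> Q w"
  and P_fyy: "w \<in> S \<Longrightarrow> P w \<bullet> fyy w = - (P w \<bullet> P w)" and Q_fxx: "w \<in> S \<Longrightarrow> Q w \<bullet> fxx w = P w \<bullet> Q w"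
  and Q_fxy: "w \<in> S \<Longrightarrow> Q w \<bullet> fxy w = Q w \<bullet> Q w" and Q_fyy: "w \<in> S \<Longrightarrow> Q w \<bullet> fyy w = - (P w \<bullet> Q w)"
  by (simp_all add: structure_eqs inner_add_right inner_diff_right inner_commute)

lemma P_deriv_tangential:
  assumes "w \<in> S"
  shows "dir_deriv u P w \<bullet> f w = 0"
    "dir_deriv 1 P w \<bullet> fx w = - (P w \<bullet> P w)" "dir_deriv 1 P w \<bullet> fy w = - (P w \<bullet> Q w)"
    "dir_deriv \<i> P w \<bullet> fx w = - (P w \<bullet> Q w)" "dir_deriv \<i> P w \<bullet> fy w = P w \<bullet> P w"
proof -
  have "dir_deriv u f w \<bullet> P w = 0"
    using assms by (simp add: dir_deriv_expand[OF smooth_on_differentiable[OF smooth_f assms], of u] inner_add_left)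
  then show "dir_deriv u P w \<bullet> f w = 0"
    using inner_const_deriv[OF open_S smooth_P smooth_f P_orth(1) assms, of u] by (simp add: inner_commute)
  show "dir_deriv 1 P w \<bullet> fx w = - (P w \<bullet> P w)" "dir_deriv 1 P w \<bullet> fy w = - (P w \<bullet> Q w)"
    "dir_deriv \<i> P w \<bullet> fx w = - (P w \<bullet> Q w)" "dir_deriv \<i> P w \<bullet> fy w = P w \<bullet> P w"
    using inner_const_deriv[OF open_S smooth_P smooth_fx P_orth(2) assms, of 1]
      inner_const_deriv[OF open_S smooth_P smooth_fy P_orth(3) assms, of 1]
      inner_const_deriv[OF open_S smooth_P smooth_fx P_orth(2) assms, of \<i>]
      inner_const_deriv[OF open_S smooth_P smooth_fy P_orth(3) assms, of \<i>]
    by (simp_all add: fyx assms P_fxx P_fxy P_fyy)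
qed

lemma Q_deriv_tangential:
  assumes "w \<in> S"
  shows "dir_deriv 1 Q w \<bullet> fx w = - (P w \<bullet> Q w)" "dir_deriv 1 Q w \<bullet> fy w = - (Q w \<bullet> Q w)"
    "dir_deriv \<i> Q w \<bullet> fx w = - (Q w \<bullet> Q w)" "dir_deriv \<i> Q w \<bullet> fy w = P w \<bullet> Q w"
proof -
  show "dir_deriv 1 Q w \<bullet> fx w = - (P w \<bullet> Q w)" "dir_deriv 1 Q w \<bullet> fy w = - (Q w \<bullet> Q w)"
    "dir_deriv \<i> Q w \<bullet> fx w = - (Q w \<bullet> Q w)" "dir_deriv \<i> Q w \<bullet> fy w = P w \<bullet> Q w"
    using inner_const_deriv[OF open_S smooth_Q smooth_fx Q_orth(2) assms, of 1]
      inner_const_deriv[OF open_S smooth_Q smooth_fy Q_orth(3) assms, of 1]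
      inner_const_deriv[OF open_S smooth_Q smooth_fx Q_orth(2) assms, of \<i>]
      inner_const_deriv[OF open_S smooth_Q smooth_fy Q_orth(3) assms, of \<i>]
    by (simp_all add: fyx assms Q_fxx Q_fxy Q_fyy)
qed

lemma tangential_combination:
  assumes "w \<in> S" "v = a *\<^sub>R fx w + b *\<^sub>R fy w"
  shows "v = ((v \<bullet> fx w) / E w) *\<^sub>R fx w + ((v \<bullet> fy w) / E w) *\<^sub>R fy w"
  using assms E_pos[OF assms(1)] by (simp add: inner_add_left)

lemma P_deriv: "w \<in> S \<Longrightarrow> dir_deriv u P w = dir_deriv u fxx w + (E w *\<^sub>R dir_deriv u f w + dir_deriv u E w *\<^sub>R f w)
    - (al w *\<^sub>R dir_deriv u fx w + dir_deriv u al w *\<^sub>R fx w) + (be w *\<^sub>R dir_deriv u fy w + dir_deriv u be w *\<^sub>R fy w)"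
  unfolding P_def[abs_def]
  by (simp add: dir_deriv_add_smooth[where S = S] dir_deriv_diff_smooth[where S = S] dir_deriv_scaleR_smooth[where S = S]
      smooth_on_add smooth_on_diff smooth_on_scaleR smooth_fxx smooth_E smooth_f smooth_al smooth_be smooth_fx smooth_fy open_S)

lemma Q_deriv: "w \<in> S \<Longrightarrow> dir_deriv u Q w = dir_deriv u fxy w
    - (be w *\<^sub>R dir_deriv u fx w + dir_deriv u be w *\<^sub>R fx w) - (al w *\<^sub>R dir_deriv u fy w + dir_deriv u al w *\<^sub>R fy w)"
  unfolding Q_def[abs_def]
  by (simp add: dir_deriv_diff_smooth[where S = S] dir_deriv_scaleR_smooth[where S = S]
      smooth_on_diff smooth_on_scaleR smooth_fxy smooth_al smooth_be smooth_fx smooth_fy open_S)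

definition "kap w = (P w \<bullet> P w + Q w \<bullet> Q w) / E w"

text \<open>In \<open>P\<^sub>x + Q\<^sub>y\<close> and \<open>P\<^sub>y - Q\<^sub>x\<close> the
  third derivatives of \<open>f\<close> cancel by harmonicity and equality of mixed derivatives,
  leaving tangential vectors. Their coefficients are read off by pairing with \<open>fx\<close> and
  \<open>fy\<close> instead of being computed from \<open>al\<close> and \<open>be\<close>, which
  avoids the Gauss equation.\<close>

lemma codazzi:
  assumes w: "w \<in> S"
  shows "dir_deriv \<i> Q w = - kap w *\<^sub>R fx w - dir_deriv 1 P w"
    "dir_deriv 1 Q w = dir_deriv \<i> P w - kap w *\<^sub>R fy w"
proof -
  have lap: "dir_deriv u fxx w + dir_deriv u fyy w = - (2 * E w) *\<^sub>R dir_deriv u f w - (2 * dir_deriv u E w) *\<^sub>R f w" for u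
  proof -
    have "dir_deriv u (\<lambda>w. fxx w + fyy w) w = dir_deriv u (\<lambda>w. (- 2) *\<^sub>R (E w *\<^sub>R f w)) w"
      by (rule dir_deriv_cong[OF open_S w]) (simp add: fyy_eq)
    also have "\<dots> = (- 2) *\<^sub>R dir_deriv u (\<lambda>w. E w *\<^sub>R f w) w"
      by (rule dir_deriv_linear[OF bounded_linear_scaleR_right])
         (intro smooth_on_differentiable[OF smooth_on_scaleR[OF open_S smooth_E smooth_f] w])
    also have "dir_deriv u (\<lambda>w. E w *\<^sub>R f w) w = E w *\<^sub>R dir_deriv u f w + dir_deriv u E w *\<^sub>R f w"
      by (rule dir_deriv_scaleR_smooth[OF smooth_E smooth_f w])
    finally show ?thesis
      unfolding dir_deriv_add_smooth[OF smooth_fxx smooth_fyy w] by (simp add: scaleR_add_right)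
  qed
  have fxyy: "dir_deriv \<i> fxy w = dir_deriv 1 fyy w"
  proof -
    have "dir_deriv \<i> fxy w = dir_deriv \<i> (dir_deriv 1 fy) w"
      by (rule dir_deriv_cong[OF open_S w]) (simp add: fyx)
    then show ?thesis using dir_deriv_commute[OF open_S smooth_fy w, of \<i> 1] by simp
  qed
  have fxxy: "dir_deriv 1 fxy w = dir_deriv \<i> fxx w"
    by (rule dir_deriv_commute[OF open_S smooth_fx w])
  have 1: "dir_deriv 1 fyy w = - (2 * E w) *\<^sub>R fx w - (2 * (2 * al w * E w)) *\<^sub>R f w - dir_deriv 1 fxx w"
    using lap[of 1] unfolding E_deriv(1)[OF w] by (metis add_diff_cancel_left')
  have "dir_deriv 1 P w + dir_deriv \<i> Q w
      = - (E w + dir_deriv 1 al w + dir_deriv \<i> be w) *\<^sub>R fx w + (dir_deriv 1 be w - dir_deriv \<i> al w) *\<^sub>R fy w"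
    unfolding P_deriv[OF w] Q_deriv[OF w] fxyy 1 fyx[OF w] fyy_eq[OF w] E_deriv[OF w]
    by (rule vector_eq_rdot[THEN iffD1], rule allI,
        simp only: inner_add_left inner_diff_left inner_minus_left inner_scaleR_left)
      (simp add: algebra_simps)
  moreover have "((dir_deriv 1 P w + dir_deriv \<i> Q w) \<bullet> fx w) / E w = - kap w"
      "((dir_deriv 1 P w + dir_deriv \<i> Q w) \<bullet> fy w) / E w = 0"
    by (simp_all add: inner_add_left P_deriv_tangential[OF w] Q_deriv_tangential[OF w] kap_def minus_divide_left)
  ultimately have "dir_deriv 1 P w + dir_deriv \<i> Q w = - kap w *\<^sub>R fx w"
    using tangential_combination[OF w] by fastforce
  then show "dir_deriv \<i> Q w = - kap w *\<^sub>R fx w - dir_deriv 1 P w"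
    by (metis add_diff_cancel_left')
  have "dir_deriv \<i> P w - dir_deriv 1 Q w
      = (dir_deriv 1 be w - dir_deriv \<i> al w) *\<^sub>R fx w + (E w + dir_deriv \<i> be w + dir_deriv 1 al w) *\<^sub>R fy w"
    unfolding P_deriv[OF w] Q_deriv[OF w] fxxy fyx[OF w] fyy_eq[OF w] E_deriv[OF w]
    by (rule vector_eq_rdot[THEN iffD1], rule allI,
        simp only: inner_add_left inner_diff_left inner_minus_left inner_scaleR_left)
      (simp add: algebra_simps)
  moreover have "((dir_deriv \<i> P w - dir_deriv 1 Q w) \<bullet> fx w) / E w = 0"
      "((dir_deriv \<i> P w - dir_deriv 1 Q w) \<bullet> fy w) / E w = kap w"
    by (simp_all add: inner_diff_left P_deriv_tangential[OF w] Q_deriv_tangential[OF w] kap_def)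
  ultimately have "dir_deriv \<i> P w - dir_deriv 1 Q w = kap w *\<^sub>R fy w"
    using tangential_combination[OF w] by fastforce
  then show "dir_deriv 1 Q w = dir_deriv \<i> P w - kap w *\<^sub>R fy w"
    by (simp add: diff_eq_eq eq_diff_eq add.commute)
qed

lemma eta_deriv:
  assumes w: "w \<in> S"
  shows "dir_deriv 1 eta w = (2 * al w) *\<^sub>R eta w - E w *\<^sub>R (f w \<times>\<^sub>7 fy w) + P w \<times>\<^sub>7 fy w + fx w \<times>\<^sub>7 Q w"
    "dir_deriv \<i> eta w = (2 * be w) *\<^sub>R eta w - E w *\<^sub>R (fx w \<times>\<^sub>7 f w) + Q w \<times>\<^sub>7 fy w - fx w \<times>\<^sub>7 P w"
  unfolding eta_def[abs_def] dir_deriv_cross7_smooth[OF smooth_fx smooth_fy w] fyx[OF w] structure_eqs[OF w]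
  by (simp_all add: cross7.add_left cross7.add_right cross7.diff_left cross7.diff_right cross7.scaleR_left
      cross7.scaleR_right cross7.minus_left cross7.minus_right scaleR_double algebra_simps)

text \<open>Two multiples of a tangent vector, one from the derivative of \<open>eta\<close> and one
  from that of \<open>f\<close>, cancel by \<open>cross7_double\<close>; what remains is linear in
  \<open>P\<close> and \<open>Q\<close> modulo \<open>nu\<close>.\<close>

lemma nu_deriv:
  assumes w: "w \<in> S"
  shows "dir_deriv 1 nu w = (2 * al w) *\<^sub>R nu w + f w \<times>\<^sub>7 (P w \<times>\<^sub>7 fy w + fx w \<times>\<^sub>7 Q w)"
    "dir_deriv \<i> nu w = (2 * be w) *\<^sub>R nu w + f w \<times>\<^sub>7 (Q w \<times>\<^sub>7 fy w - fx w \<times>\<^sub>7 P w)"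
proof -
  have d: "dir_deriv u nu w = f w \<times>\<^sub>7 dir_deriv u eta w + dir_deriv u f w \<times>\<^sub>7 eta w" for u
    unfolding nu_def[abs_def] by (rule dir_deriv_cross7_smooth[OF smooth_f smooth_eta w])
  have "fx w \<times>\<^sub>7 eta w = - E w *\<^sub>R fy w" "f w \<times>\<^sub>7 (f w \<times>\<^sub>7 fy w) = - fy w"
    using w unit[OF w] by (simp_all add: eta_def cross7_double)
  then show "dir_deriv 1 nu w = (2 * al w) *\<^sub>R nu w + f w \<times>\<^sub>7 (P w \<times>\<^sub>7 fy w + fx w \<times>\<^sub>7 Q w)"
    unfolding d eta_deriv[OF w] nu_def
    by (simp add: cross7.add_right cross7.diff_right cross7.scaleR_right algebra_simps)
  have "fy w \<times>\<^sub>7 eta w = E w *\<^sub>R fx w"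
    using w cross7_double[of "fy w" "fx w"] unfolding eta_def cross7_skew[of "fx w" "fy w"]
    by (simp add: cross7.minus_right)
  moreover have "f w \<times>\<^sub>7 (fx w \<times>\<^sub>7 f w) = fx w"
    using w unit[OF w] cross7_double[of "f w" "fx w"] unfolding cross7_skew[of "fx w" "f w"]
    by (simp add: cross7.minus_right)
  ultimately show "dir_deriv \<i> nu w = (2 * be w) *\<^sub>R nu w + f w \<times>\<^sub>7 (Q w \<times>\<^sub>7 fy w - fx w \<times>\<^sub>7 P w)"
    unfolding d eta_deriv[OF w] nu_def
    by (simp add: cross7.add_right cross7.diff_right cross7.scaleR_right algebra_simps)
qed

lemma nu_orth [simp]:
  assumes "w \<in> S"
  shows "nu w \<bullet> f w = 0" "nu w \<bullet> fx w = 0" "nu w \<bullet> fy w = 0"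
proof -
  show "nu w \<bullet> f w = 0" by (simp add: nu_def)
  have "(f w \<times>\<^sub>7 (fx w \<times>\<^sub>7 fy w)) \<bullet> fx w = (fx w \<times>\<^sub>7 f w) \<bullet> (fx w \<times>\<^sub>7 fy w)"
    by (metis cross7_cycle)
  then show "nu w \<bullet> fx w = 0" using assms by (simp add: nu_def eta_def cross7_inner_left)
  have "(f w \<times>\<^sub>7 (fx w \<times>\<^sub>7 fy w)) \<bullet> fy w = - ((fy w \<times>\<^sub>7 f w) \<bullet> (fy w \<times>\<^sub>7 fx w))"
    by (metis cross7_cycle cross7_skew inner_minus_right)
  then show "nu w \<bullet> fy w = 0" using assms by (simp add: nu_def eta_def cross7_inner_left)
qed

end

lemma dir_deriv_Pair:
  assumes "a differentiable (at w)" "b differentiable (at w)"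
  shows "dir_deriv u (\<lambda>w. (a w, b w)) w = (dir_deriv u a w, dir_deriv u b w)"
  by (rule dir_deriv_unique[OF has_derivative_Pair]) (intro has_derivative_dir_deriv assms)+

lemma smooth_on_Pair:
  assumes "open S" "smooth_on S a" "smooth_on S b" shows "smooth_on S (\<lambda>w. (a w, b w))"
proof -
  have "smooth_on S (\<lambda>w. (a w, 0) + (0, b w))"
    by (intro smooth_on_add assms(1) smooth_on_linear[OF assms(1) _ assms(2)] smooth_on_linear[OF assms(1) _ assms(3)]
        bounded_linear_Pair bounded_linear_ident bounded_linear_zero)
  then show ?thesis by simp
qed

section \<open>First-order systems attached to the immersion\<close>

context conformal_harmonic
begin

text \<open>\<open>D1\<close> is the defect in the almost complex equation (see
  \<open>D1_zero_iff\<close>). Its partner \<open>D2\<close>, equal to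
  \<open>f \<times>\<^sub>7 D1\<close>, is added because the pair obeys a first-order
  system.\<close>

definition "D1 w = fy w - f w \<times>\<^sub>7 fx w"
definition "D2 w = fx w + f w \<times>\<^sub>7 fy w"

lemma smooth_D1: "smooth_on S D1" and smooth_D2: "smooth_on S D2"
  unfolding D1_def[abs_def] D2_def[abs_def]
  by (intro smooth_on_add smooth_on_diff smooth_on_cross7 smooth_f smooth_fx smooth_fy open_S)+

lemma D2_eq: "w \<in> S \<Longrightarrow> D2 w = f w \<times>\<^sub>7 D1 w"
  by (simp add: D1_def D2_def cross7.diff_right cross7_double unit)

lemma D_deriv:
  assumes w: "w \<in> S"
  shows "dir_deriv 1 D1 w = dir_deriv \<i> D2 w" "dir_deriv \<i> D1 w = - dir_deriv 1 D2 w + 2 *\<^sub>R (fx w \<times>\<^sub>7 D1 w)"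
proof -
  note sm = smooth_on_cross7[OF open_S smooth_f smooth_fx] smooth_on_cross7[OF open_S smooth_f smooth_fy]
  have d1: "dir_deriv u D1 w = dir_deriv u fy w - (f w \<times>\<^sub>7 dir_deriv u fx w + dir_deriv u f w \<times>\<^sub>7 fx w)" for u
    unfolding D1_def[abs_def] dir_deriv_diff_smooth[OF smooth_fy sm(1) w]
      dir_deriv_cross7_smooth[OF smooth_f smooth_fx w] ..
  have d2: "dir_deriv u D2 w = dir_deriv u fx w + (f w \<times>\<^sub>7 dir_deriv u fy w + dir_deriv u f w \<times>\<^sub>7 fy w)" for u
    unfolding D2_def[abs_def] dir_deriv_add_smooth[OF smooth_fx sm(2) w]
      dir_deriv_cross7_smooth[OF smooth_f smooth_fy w] ..
  show "dir_deriv 1 D1 w = dir_deriv \<i> D2 w"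
    unfolding d1 d2 fyx[OF w] fyy_eq[OF w] by (simp add: cross7.diff_right cross7.minus_right cross7.scaleR_right)
  have "fx w \<times>\<^sub>7 (f w \<times>\<^sub>7 fx w) = E w *\<^sub>R f w"
    using w cross7_double[of "fx w" "f w"] unfolding cross7_skew[of "f w" "fx w"] by (simp add: cross7.minus_right)
  then have 3: "fx w \<times>\<^sub>7 D1 w = fx w \<times>\<^sub>7 fy w - E w *\<^sub>R f w" by (simp add: D1_def cross7.diff_right)
  show "dir_deriv \<i> D1 w = - dir_deriv 1 D2 w + 2 *\<^sub>R (fx w \<times>\<^sub>7 D1 w)"
    unfolding d1 d2 3 fyx[OF w] fyy_eq[OF w] cross7_skew[of "fy w" "fx w"]
    by (rule vector_eq_rdot[THEN iffD1], rule allI,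
        simp only: inner_add_left inner_diff_left inner_minus_left inner_scaleR_left)
      (simp add: algebra_simps)
qed

lemma D1_isolated_or_zero:
  assumes w0: "w0 \<in> S"
  shows "(\<forall>\<^sub>F w in nhds w0. D1 w = 0) \<or> (\<forall>\<^sub>F w in at w0. D1 w \<noteq> 0)"
proof -
  define g where "g w = (D1 w, D2 w)" for w
  define R where "R w = (2 *\<^sub>R (fx w \<times>\<^sub>7 D1 w), 0 :: real^7)" for w
  define J where "J p = (- snd p, fst p)" for p :: "(real^7) \<times> (real^7)"
  have sm: "smooth_on S g" unfolding g_def by (intro smooth_on_Pair open_S smooth_D1 smooth_D2)
  have dg: "dir_deriv u g w = (dir_deriv u D1 w, dir_deriv u D2 w)" if "w \<in> S" for u w
    unfolding g_def using that
    by (intro dir_deriv_Pair smooth_on_differentiable[OF smooth_D1] smooth_on_differentiable[OF smooth_D2])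
  interpret cr_system S g R J
  proof (rule cr_system.intro)
    show "bounded_linear J" unfolding J_def
      by (intro bounded_linear_Pair bounded_linear_minus bounded_linear_fst bounded_linear_snd)
  qed (auto simp: open_S sm dg D_deriv R_def J_def inner_Pair)
  have "jet_dominated S w0 g 0 (\<lambda>w. fst (g w))"
    by (rule jet_dominated_linear[OF open_S w0 bounded_linear_fst jet_dominated_self[OF sm]])
  then have "jet_dominated S w0 g 0 (\<lambda>w. fx w \<times>\<^sub>7 fst (g w))"
    by (rule jet_dominated_bilinear[OF open_S w0 bounded_bilinear_cross7 smooth_fx])
  then have "jet_dominated S w0 g 0 (\<lambda>w. (2 *\<^sub>R (fx w \<times>\<^sub>7 fst (g w)), 0 :: real^7))"
    by (rule jet_dominated_linear[OF open_S w0, rotated])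
      (intro bounded_linear_Pair bounded_linear_scaleR_right bounded_linear_zero)
  then have "jet_dominated S w0 g 0 R" by (simp add: R_def[abs_def] g_def)
  from isolated_or_locally_zero[OF w0 this]
  show ?thesis
  proof
    assume "\<forall>\<^sub>F w in nhds w0. g w = 0"
    then have "\<forall>\<^sub>F w in nhds w0. D1 w = 0" by eventually_elim (simp add: g_def prod_eq_iff)
    then show ?thesis ..
  next
    assume "\<forall>\<^sub>F w in at w0. g w \<noteq> 0"
    moreover have "\<forall>\<^sub>F w in at w0. w \<in> S" using w0 open_S by (rule eventually_at_in_open'[rotated])
    ultimately have "\<forall>\<^sub>F w in at w0. D1 w \<noteq> 0"
      by eventually_elim (auto simp: g_def D2_eq prod_eq_iff cross7.zero_right)
    then show ?thesis ..
  qed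
qed

lemma PQ_isolated_or_zero:
  assumes w0: "w0 \<in> S"
  shows "(\<forall>\<^sub>F w in nhds w0. P w = 0 \<and> Q w = 0) \<or> (\<forall>\<^sub>F w in at w0. \<not> (P w = 0 \<and> Q w = 0))"
proof -
  define g where "g w = (P w, - Q w)" for w
  define R where "R w = (kap w *\<^sub>R fy w, kap w *\<^sub>R fx w)" for w
  define J where "J p = (- snd p, fst p)" for p :: "(real^7) \<times> (real^7)"
  note smQ = smooth_on_uminus[OF open_S smooth_Q]
  have sm: "smooth_on S g" unfolding g_def by (intro smooth_on_Pair open_S smooth_P smQ)
  have dg: "dir_deriv u g w = (dir_deriv u P w, - dir_deriv u Q w)" if "w \<in> S" for u w
    unfolding g_def using dir_deriv_Pair[OF smooth_on_differentiable[OF smooth_P that] smooth_on_differentiable[OF smQ that]]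
      dir_deriv_uminus[OF smooth_on_differentiable[OF smooth_Q that]] by simp
  interpret cr_system S g R J
  proof (rule cr_system.intro)
    show "bounded_linear J" unfolding J_def
      by (intro bounded_linear_Pair bounded_linear_minus bounded_linear_fst bounded_linear_snd)
  qed (auto simp: open_S sm dg codazzi R_def J_def inner_Pair)
  \<comment> \<open>\<open>kap\<close> is \<open>g \<bullet> g\<close> divided by \<open>E\<close>,
    so the error is quadratic in \<open>g\<close>; treating one factor as a smooth coefficient
    brings it under the linear estimate.\<close>
  have 1: "jet_dominated S w0 g 0 (\<lambda>w. g w \<bullet> g w)"
    by (rule jet_dominated_bilinear[OF open_S w0 bounded_bilinear_inner sm jet_dominated_self[OF sm]])
  define \<beta> where "\<beta> w = inverse (E w) *\<^sub>R (fy w, fx w)" for w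
  have "smooth_on S (\<lambda>w. inverse (E w))"
    by (rule smooth_on_inverse[OF open_S _ smooth_E]) (use E_pos in force)
  then have sm\<beta>: "smooth_on S \<beta>" unfolding \<beta>_def
    by (intro smooth_on_scaleR smooth_on_Pair open_S smooth_fx smooth_fy)
  have "jet_dominated S w0 g 0 (\<lambda>w. (g w \<bullet> g w) *\<^sub>R \<beta> w)"
    by (rule jet_dominated_bilinear[OF open_S w0 bounded_bilinear.flip[OF bounded_bilinear_scaleR] sm\<beta> 1])
  then have "jet_dominated S w0 g 0 R"
    by (simp add: R_def[abs_def] \<beta>_def g_def kap_def inner_Pair divide_inverse)
  from isolated_or_locally_zero[OF w0 this] show ?thesis by (simp add: g_def prod_eq_iff)
qed

text \<open>The height \<open>f \<bullet> c\<close> has Laplacian \<open>- 2 * E\<close> times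
  itself. Pairing it with twice its complex derivative turns this into a first-order system; the
  price is that a zero of \<open>g\<close> is a zero of the height together with its gradient, hence
  the asymmetric alternatives.\<close>

lemma inner_isolated_or_zero:
  assumes w0: "w0 \<in> S"
  shows "(\<forall>\<^sub>F w in nhds w0. f w \<bullet> c = 0)
    \<or> (\<forall>\<^sub>F w in at w0. \<not> (f w \<bullet> c = 0 \<and> fx w \<bullet> c = 0 \<and> fy w \<bullet> c = 0))"
proof -
  define g where "g w = (complex_of_real (f w \<bullet> c), Complex (fx w \<bullet> c) (- (fy w \<bullet> c)))" for w
  define R where "R w = (- \<i> * cnj (snd (g w)), E w *\<^sub>R (2 * \<i> * fst (g w)))" for w
  define J where "J p = (\<i> * fst p, \<i> * snd p)" for p :: "complex \<times> complex"
  define L where "L a b = (complex_of_real (a \<bullet> c), complex_of_real (fst b \<bullet> c) - \<i> * complex_of_real (snd b \<bullet> c))"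
    for a :: "real^7" and b :: "(real^7) \<times> (real^7)"
  define L' where "L' p = L (fst p) (snd p)" for p
  have L: "bounded_linear L'" unfolding L'_def[abs_def] L_def
    by (intro bounded_linear_Pair bounded_linear_sub bounded_linear_compose[OF bounded_linear_of_real]
        bounded_linear_compose[OF bounded_linear_mult_right] bounded_linear_compose[OF bounded_linear_inner_left]
        bounded_linear_compose[OF bounded_linear_fst] bounded_linear_compose[OF bounded_linear_snd]
        bounded_linear_fst bounded_linear_snd)
  have g_L: "g w = L' (f w, fx w, fy w)" for w
    by (simp add: g_def L'_def L_def complex_eq_iff)
  note smt = smooth_on_Pair[OF open_S smooth_f smooth_on_Pair[OF open_S smooth_fx smooth_fy]]
  have sm: "smooth_on S g" unfolding g_L by (rule smooth_on_linear[OF open_S L smt])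
  have dg: "dir_deriv u g w = L' (dir_deriv u f w, dir_deriv u fx w, dir_deriv u fy w)" if w: "w \<in> S" for u w
  proof -
    note d = smooth_on_differentiable[OF smooth_f w] smooth_on_differentiable[OF smooth_fx w]
      smooth_on_differentiable[OF smooth_fy w]
    have "dir_deriv u (\<lambda>w. L' (f w, fx w, fy w)) w = L' (dir_deriv u (\<lambda>w. (f w, fx w, fy w)) w)"
      by (rule dir_deriv_linear[OF L smooth_on_differentiable[OF smt w]])
    also have "dir_deriv u (\<lambda>w. (f w, fx w, fy w)) w = (dir_deriv u f w, dir_deriv u fx w, dir_deriv u fy w)"
      using dir_deriv_Pair[OF d(1) smooth_on_differentiable[OF smooth_on_Pair[OF open_S smooth_fx smooth_fy] w], of u]
        dir_deriv_Pair[OF d(2,3), of u] by simp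
    finally show ?thesis unfolding g_L[abs_def] .
  qed
  interpret cr_system S g R J
  proof (rule cr_system.intro)
    show "bounded_linear J" unfolding J_def
      by (intro bounded_linear_Pair bounded_linear_compose[OF bounded_linear_mult_right] bounded_linear_fst bounded_linear_snd)
    show "dir_deriv \<i> g w = J (dir_deriv 1 g w) + R w" if w: "w \<in> S" for w
      unfolding dg[OF w] fyx[OF w] fyy_eq[OF w]
      by (simp add: L'_def L_def J_def R_def g_def complex_eq_iff inner_diff_left)
  qed (auto simp: open_S sm J_def inner_Pair inner_complex_def)
  have self: "jet_dominated S w0 g 0 g" by (rule jet_dominated_self[OF sm])
  have "jet_dominated S w0 g 0 (\<lambda>w. (- \<i> * cnj (snd (g w)), 0 :: complex))"
    by (rule jet_dominated_linear[OF open_S w0 _ self])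
      (intro bounded_linear_Pair bounded_linear_zero bounded_linear_compose[OF bounded_linear_mult_right]
        bounded_linear_compose[OF bounded_linear_cnj] bounded_linear_snd)
  moreover have "jet_dominated S w0 g 0 (\<lambda>w. (0 :: complex, 2 * \<i> * fst (g w)))"
    by (rule jet_dominated_linear[OF open_S w0 _ self])
      (intro bounded_linear_Pair bounded_linear_zero bounded_linear_compose[OF bounded_linear_mult_right] bounded_linear_fst)
  then have "jet_dominated S w0 g 0 (\<lambda>w. E w *\<^sub>R (0 :: complex, 2 * \<i> * fst (g w)))"
    by (rule jet_dominated_bilinear[OF open_S w0 bounded_bilinear_scaleR smooth_E])
  ultimately have "jet_dominated S w0 g 0 (\<lambda>w. (- \<i> * cnj (snd (g w)), 0 :: complex) + E w *\<^sub>R (0 :: complex, 2 * \<i> * fst (g w)))"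
    by (rule jet_dominated_add[OF open_S w0])
  then have "jet_dominated S w0 g 0 R" by (simp add: R_def[abs_def])
  from isolated_or_locally_zero[OF w0 this] show ?thesis
  proof
    assume "\<forall>\<^sub>F w in nhds w0. g w = 0"
    then have "\<forall>\<^sub>F w in nhds w0. f w \<bullet> c = 0" by eventually_elim (simp add: g_def prod_eq_iff)
    then show ?thesis ..
  next
    assume "\<forall>\<^sub>F w in at w0. g w \<noteq> 0"
    then have "\<forall>\<^sub>F w in at w0. \<not> (f w \<bullet> c = 0 \<and> fx w \<bullet> c = 0 \<and> fy w \<bullet> c = 0)"
      by eventually_elim (auto simp: g_def prod_eq_iff complex_eq_iff)
    then show ?thesis ..
  qed
qed

text \<open>Isotropy of \<open>\<phi>\<^sub>2\<close> (\<open>isotropic_bundle_iff\<close>) and pseudo-umbilicity of \<open>F\<close> (\<open>G_umbilical\<close>) at a point.\<close>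

definition "iso_at w \<longleftrightarrow> P w \<bullet> P w = Q w \<bullet> Q w \<and> P w \<bullet> Q w = 0"
definition "umb_at w \<longleftrightarrow> P w \<bullet> nu w = 0 \<and> Q w \<bullet> nu w = 0"

text \<open>Differentiating \<open>P \<bullet> nu = 0\<close> and \<open>Q \<bullet> nu = 0\<close>
  leaves products such as \<open>(P \<times>\<^sub>7 f) \<bullet> (Q \<times>\<^sub>7 fx)\<close>,
  which by \<open>cross7_inner_polar\<close> change sign when the orthogonal vectors
  \<open>P\<close> and \<open>Q\<close> are exchanged. Hence
  \<open>Q\<^sub>y \<bullet> nu = P\<^sub>x \<bullet> nu\<close>, whereas Codazzi gives the
  negative, so both vanish; for \<open>Q\<^sub>x\<close> and \<open>P\<^sub>y\<close> the two signs
  are interchanged.\<close>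

lemma nu_orth_deriv:
  assumes iso: "\<And>w. w \<in> S \<Longrightarrow> iso_at w" and umb: "\<And>w. w \<in> S \<Longrightarrow> umb_at w" and w: "w \<in> S"
  shows "dir_deriv 1 P w \<bullet> nu w = 0" "dir_deriv \<i> P w \<bullet> nu w = 0"
    "dir_deriv 1 Q w \<bullet> nu w = 0" "dir_deriv \<i> Q w \<bullet> nu w = 0"
proof -
  have PQ: "P w \<bullet> Q w = 0" "P w \<bullet> nu w = 0" "Q w \<bullet> nu w = 0"
    using iso[OF w] umb[OF w] by (auto simp: iso_at_def umb_at_def)
  have u: "P x \<bullet> nu x = 0" "Q x \<bullet> nu x = 0" if "x \<in> S" for x
    using umb[OF that] by (auto simp: umb_at_def)
  have tri: "(f w \<times>\<^sub>7 X) \<bullet> Y = (Y \<times>\<^sub>7 f w) \<bullet> X" for X Y by (metis cross7_cycle)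
  have s: "fx w \<times>\<^sub>7 Y = - (Y \<times>\<^sub>7 fx w)" for Y by (rule cross7_skew)
  have pol: "(P w \<times>\<^sub>7 f w) \<bullet> (Q w \<times>\<^sub>7 fx w) + (Q w \<times>\<^sub>7 f w) \<bullet> (P w \<times>\<^sub>7 fx w) = 0"
    "(P w \<times>\<^sub>7 f w) \<bullet> (Q w \<times>\<^sub>7 fy w) + (Q w \<times>\<^sub>7 f w) \<bullet> (P w \<times>\<^sub>7 fy w) = 0"
    using PQ w cross7_inner_polar[of "P w" "f w" "Q w" "fx w"] cross7_inner_polar[of "P w" "f w" "Q w" "fy w"]
    by simp_all
  have sq: "(X \<times>\<^sub>7 f w) \<bullet> (X \<times>\<^sub>7 fx w) = 0" "(X \<times>\<^sub>7 f w) \<bullet> (X \<times>\<^sub>7 fy w) = 0" if "X \<bullet> f w = 0" for X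
    using w that by (simp_all add: cross7_inner_left)
  have d: "dir_deriv u P w \<bullet> nu w = - (dir_deriv u nu w \<bullet> P w)" "dir_deriv u Q w \<bullet> nu w = - (dir_deriv u nu w \<bullet> Q w)" for u
    using inner_const_deriv[OF open_S smooth_P smooth_nu u(1) w, of u]
      inner_const_deriv[OF open_S smooth_Q smooth_nu u(2) w, of u] by (simp_all add: inner_commute)
  have nuPQ: "nu w \<bullet> P w = 0" "nu w \<bullet> Q w = 0" using PQ by (simp_all add: inner_commute)
  have e: "dir_deriv 1 P w \<bullet> nu w = (P w \<times>\<^sub>7 f w) \<bullet> (Q w \<times>\<^sub>7 fx w)"
    "dir_deriv \<i> Q w \<bullet> nu w = - ((Q w \<times>\<^sub>7 f w) \<bullet> (P w \<times>\<^sub>7 fx w))"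
    "dir_deriv \<i> P w \<bullet> nu w = - ((P w \<times>\<^sub>7 f w) \<bullet> (Q w \<times>\<^sub>7 fy w))"
    "dir_deriv 1 Q w \<bullet> nu w = - ((Q w \<times>\<^sub>7 f w) \<bullet> (P w \<times>\<^sub>7 fy w))"
    unfolding d nu_deriv[OF w] s inner_add_left inner_scaleR_left nuPQ tri
    using w by (simp_all add: inner_add_right inner_diff_right sq)
  have c: "dir_deriv \<i> Q w \<bullet> nu w = - (dir_deriv 1 P w \<bullet> nu w)" "dir_deriv 1 Q w \<bullet> nu w = dir_deriv \<i> P w \<bullet> nu w"
    unfolding codazzi[OF w] using nu_orth[OF w] by (simp_all add: inner_diff_left inner_diff_right inner_commute)
  show "dir_deriv 1 P w \<bullet> nu w = 0" "dir_deriv \<i> P w \<bullet> nu w = 0"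
    "dir_deriv 1 Q w \<bullet> nu w = 0" "dir_deriv \<i> Q w \<bullet> nu w = 0"
    using e c pol by linarith+
qed

end

subsection \<open>Fundamental forms\<close>

lemma dir_deriv_twice_expand:
  fixes g :: "complex \<Rightarrow> 'b::euclidean_space"
  assumes "open S" "smooth_on S g" "w \<in> S"
  shows "dir_deriv u (dir_deriv v g) w
    = (Re u * Re v) *\<^sub>R dir_deriv 1 (dir_deriv 1 g) w
    + (Re u * Im v + Im u * Re v) *\<^sub>R dir_deriv \<i> (dir_deriv 1 g) w
    + (Im u * Im v) *\<^sub>R dir_deriv \<i> (dir_deriv \<i> g) w"
proof -
  have e: "dir_deriv a (dir_deriv b g) w = Re a *\<^sub>R dir_deriv 1 (dir_deriv b g) w + Im a *\<^sub>R dir_deriv \<i> (dir_deriv b g) w"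
    for a b
    by (intro dir_deriv_expand smooth_on_differentiable[OF smooth_on_dir_deriv[OF assms(1,2)] assms(3)])
  have c: "dir_deriv a (dir_deriv b g) w = dir_deriv b (dir_deriv a g) w" for a b
    by (rule dir_deriv_commute[OF assms])
  show ?thesis
    unfolding e[of u v] c[of 1 v] c[of \<i> v] e[of v 1] e[of v \<i>] c[of 1 \<i>]
    by (simp add: scaleR_add_right scaleR_add_left)
qed

lemma tangent_plane_eq:
  assumes "g differentiable (at w)"
  shows "tangent_plane g w = {a *\<^sub>R dir_deriv 1 g w + b *\<^sub>R dir_deriv \<i> g w | a b. True}"
proof (intro set_eqI iffI)
  fix x assume "x \<in> tangent_plane g w"
  then obtain u where "x = dir_deriv u g w" unfolding tangent_plane_def by auto
  then show "x \<in> {a *\<^sub>R dir_deriv 1 g w + b *\<^sub>R dir_deriv \<i> g w | a b. True}"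
    using dir_deriv_expand[OF assms, of u] by blast
next
  fix x assume "x \<in> {a *\<^sub>R dir_deriv 1 g w + b *\<^sub>R dir_deriv \<i> g w | a b. True}"
  then obtain a b where "x = a *\<^sub>R dir_deriv 1 g w + b *\<^sub>R dir_deriv \<i> g w" by blast
  then have "x = dir_deriv (Complex a b) g w" using dir_deriv_expand[OF assms, of "Complex a b"] by simp
  then show "x \<in> tangent_plane g w" unfolding tangent_plane_def by blast
qed

text \<open>Replaces the definite description by a decomposition to be exhibited; the difference of
  two candidates is both normal and tangential.\<close>

lemma normal_part_tangent_plane:
  assumes g: "g differentiable (at w)" and n: "n \<bullet> dir_deriv 1 g w = 0" "n \<bullet> dir_deriv \<i> g w = 0"
    and x: "x = n + (a *\<^sub>R dir_deriv 1 g w + b *\<^sub>R dir_deriv \<i> g w)"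
  shows "normal_part (tangent_plane g w) x = n"
  unfolding normal_part_def tangent_plane_eq[OF g]
proof (rule the_equality)
  let ?T = "{a *\<^sub>R dir_deriv 1 g w + b *\<^sub>R dir_deriv \<i> g w | a b. True}"
  have oc: "m \<in> orthogonal_comp ?T \<longleftrightarrow> m \<bullet> dir_deriv 1 g w = 0 \<and> m \<bullet> dir_deriv \<i> g w = 0" for m
  proof
    assume m: "m \<in> orthogonal_comp ?T"
    have "dir_deriv 1 g w \<in> ?T" by (intro CollectI exI[of _ 1] exI[of _ 0]) simp
    moreover have "dir_deriv \<i> g w \<in> ?T" by (intro CollectI exI[of _ 0] exI[of _ 1]) simp
    ultimately have "dir_deriv 1 g w \<bullet> m = 0" "dir_deriv \<i> g w \<bullet> m = 0"
      using m unfolding orthogonal_comp_def orthogonal_def by blast+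
    then show "m \<bullet> dir_deriv 1 g w = 0 \<and> m \<bullet> dir_deriv \<i> g w = 0" by (simp add: inner_commute)
  next
    assume "m \<bullet> dir_deriv 1 g w = 0 \<and> m \<bullet> dir_deriv \<i> g w = 0"
    then show "m \<in> orthogonal_comp ?T"
      unfolding orthogonal_comp_def orthogonal_def by (auto simp: inner_add_right inner_add_left inner_commute)
  qed
  show "n \<in> orthogonal_comp ?T \<and> x - n \<in> ?T" unfolding oc using n x by auto
  fix m assume m: "m \<in> orthogonal_comp ?T \<and> x - m \<in> ?T"
  then obtain c d where cd: "x - m = c *\<^sub>R dir_deriv 1 g w + d *\<^sub>R dir_deriv \<i> g w" by auto
  have "n - m = (c - a) *\<^sub>R dir_deriv 1 g w + (d - b) *\<^sub>R dir_deriv \<i> g w"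
    using x cd by (simp add: algebra_simps)
  then have "(n - m) \<bullet> (n - m) = (n - m) \<bullet> ((c - a) *\<^sub>R dir_deriv 1 g w + (d - b) *\<^sub>R dir_deriv \<i> g w)" by simp
  also have "\<dots> = 0" using m n unfolding oc by (simp add: inner_add_right inner_diff_left)
  finally show "m = n" by simp
qed

section \<open>The fundamental forms of \<open>F\<close>\<close>

context conformal_harmonic
begin

lemma eta_inner [simp]:
  assumes "w \<in> S"
  shows "eta w \<bullet> eta w = E w * E w"
    "eta w \<bullet> (f w \<times>\<^sub>7 x) = - (x \<bullet> nu w)" "(f w \<times>\<^sub>7 x) \<bullet> eta w = - (x \<bullet> nu w)"
proof -
  show "eta w \<bullet> eta w = E w * E w" using assms by (simp add: eta_def cross7_inner_left)
  show "eta w \<bullet> (f w \<times>\<^sub>7 x) = - (x \<bullet> nu w)" for x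
    using cross7_swap[of "f w" x "eta w"] by (simp add: nu_def inner_commute)
  then show "(f w \<times>\<^sub>7 x) \<bullet> eta w = - (x \<bullet> nu w)" by (simp add: inner_commute)
qed

context
  fixes G assumes smooth_G: "smooth_on S G"
    and Gx: "w \<in> S \<Longrightarrow> dir_deriv 1 G w = f w \<times>\<^sub>7 fy w"
    and Gy: "w \<in> S \<Longrightarrow> dir_deriv \<i> G w = - (f w \<times>\<^sub>7 fx w)"
begin

text \<open>Multiplication by the unit vector \<open>f\<close> is isometric on vectors orthogonal to
  \<open>f\<close>, so the primitive inherits the conformal factor.\<close>

lemma G_first_form: "w \<in> S \<Longrightarrow> first_form G w u v = E w * (Re u * Re v + Im u * Im v)"
  by (simp add: first_form_def dir_deriv_expand[OF smooth_on_differentiable[OF smooth_G], of w u]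
      dir_deriv_expand[OF smooth_on_differentiable[OF smooth_G], of w v] Gx Gy inner_add_left inner_add_right
      inner_diff_left inner_diff_right cross7_inner_left unit algebra_simps)

lemma G_second_derivs:
  assumes w: "w \<in> S"
  shows "dir_deriv 1 (dir_deriv 1 G) w = f w \<times>\<^sub>7 fxy w + eta w"
    "dir_deriv \<i> (dir_deriv 1 G) w = f w \<times>\<^sub>7 fyy w"
    "dir_deriv \<i> (dir_deriv \<i> G) w = eta w - f w \<times>\<^sub>7 fxy w"
proof -
  have 1: "dir_deriv u (dir_deriv 1 G) w = f w \<times>\<^sub>7 dir_deriv u fy w + dir_deriv u f w \<times>\<^sub>7 fy w" for u
    using dir_deriv_cong[OF open_S w Gx, where u = u] dir_deriv_cross7_smooth[OF smooth_f smooth_fy w, of u] by simp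
  show "dir_deriv 1 (dir_deriv 1 G) w = f w \<times>\<^sub>7 fxy w + eta w"
    "dir_deriv \<i> (dir_deriv 1 G) w = f w \<times>\<^sub>7 fyy w"
    unfolding 1 by (simp_all add: fyx w eta_def)
  have "dir_deriv \<i> (dir_deriv \<i> G) w = dir_deriv \<i> (\<lambda>w. - (f w \<times>\<^sub>7 fx w)) w"
    by (rule dir_deriv_cong[OF open_S w Gy])
  also have "\<dots> = - dir_deriv \<i> (\<lambda>w. f w \<times>\<^sub>7 fx w) w"
    by (intro dir_deriv_uminus smooth_on_differentiable[OF smooth_on_cross7[OF open_S smooth_f smooth_fx] w])
  also have "dir_deriv \<i> (\<lambda>w. f w \<times>\<^sub>7 fx w) w = f w \<times>\<^sub>7 fxy w + fy w \<times>\<^sub>7 fx w"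
    by (rule dir_deriv_cross7_smooth[OF smooth_f smooth_fx w])
  finally show "dir_deriv \<i> (dir_deriv \<i> G) w = eta w - f w \<times>\<^sub>7 fxy w"
    unfolding eta_def cross7_skew[of "fx w" "fy w"] by simp
qed

text \<open>The coefficients are the real part of \<open>u * cnj v\<close> and the real and
  imaginary parts of \<open>u * v\<close>: \<open>eta\<close> carries the trace,
  \<open>f \<times>\<^sub>7 Q\<close> and \<open>f \<times>\<^sub>7 P\<close> the trace-free part.
  All other terms are combinations of \<open>f \<times>\<^sub>7 fx\<close> and
  \<open>f \<times>\<^sub>7 fy\<close>, which span the tangent plane of \<open>G\<close>.\<close>

lemma G_second_form:
  assumes w: "w \<in> S"
  shows "second_form G w u v = (Re u * Re v + Im u * Im v) *\<^sub>R eta w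
     + (Re u * Re v - Im u * Im v) *\<^sub>R (f w \<times>\<^sub>7 Q w) - (Re u * Im v + Im u * Re v) *\<^sub>R (f w \<times>\<^sub>7 P w)"
    (is "_ = ?n")
  unfolding second_form_def
proof (rule normal_part_tangent_plane)
  show "G differentiable (at w)" by (rule smooth_on_differentiable[OF smooth_G w])
  have "fx w \<bullet> nu w = 0" "fy w \<bullet> nu w = 0" using nu_orth[OF w] by (simp_all add: inner_commute)
  then show "?n \<bullet> dir_deriv 1 G w = 0" "?n \<bullet> dir_deriv \<i> G w = 0"
    using w by (simp_all add: Gx Gy inner_add_left inner_diff_left cross7_inner_left)
  define t where "t = Re u * Re v - Im u * Im v"
  define s where "s = Re u * Im v + Im u * Re v"
  have a: "f w \<times>\<^sub>7 fxy w = be w *\<^sub>R (f w \<times>\<^sub>7 fx w) + al w *\<^sub>R (f w \<times>\<^sub>7 fy w) + f w \<times>\<^sub>7 Q w"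
    "f w \<times>\<^sub>7 fyy w = - al w *\<^sub>R (f w \<times>\<^sub>7 fx w) + be w *\<^sub>R (f w \<times>\<^sub>7 fy w) - f w \<times>\<^sub>7 P w"
    by (simp_all add: structure_eqs[OF w] cross7.add_right cross7.diff_right cross7.scaleR_right cross7.minus_right)
  show "dir_deriv u (dir_deriv v G) w
     = ?n + ((t * al w + s * be w) *\<^sub>R dir_deriv 1 G w + (s * al w - t * be w) *\<^sub>R dir_deriv \<i> G w)"
    unfolding dir_deriv_twice_expand[OF open_S smooth_G w, of u v] G_second_derivs[OF w] a Gx[OF w] Gy[OF w] t_def s_def
    by (rule vector_eq_rdot[THEN iffD1], rule allI,
        simp only: inner_add_left inner_diff_left inner_minus_left inner_scaleR_left)
      (simp add: algebra_simps)
qed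

lemma G_mean_curvature:
  assumes w: "w \<in> S" shows "mean_curvature G w = (1 / E w) *\<^sub>R eta w"
proof -
  have "E w *\<^sub>R (eta w + f w \<times>\<^sub>7 Q w) + E w *\<^sub>R (eta w - f w \<times>\<^sub>7 Q w) = (2 * E w) *\<^sub>R eta w"
    by (simp add: scaleR_double scaleR_add_right scaleR_diff_right)
  then show ?thesis
    using E_pos[OF w] unfolding mean_curvature_def Let_def G_first_form[OF w] G_second_form[OF w]
    by (simp add: power2_eq_square)
qed

text \<open>As \<open>eta\<close> has length \<open>E\<close>, the proportionality factor can only
  be 1, and the trace-free part pairs with \<open>eta\<close> to \<open>Q \<bullet> nu\<close> and
  \<open>P \<bullet> nu\<close> up to sign. The pairs \<open>(1, 1)\<close>,
  \<open>(\<i>, \<i>)\<close> and \<open>(1, \<i>)\<close> separate these.\<close>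

lemma G_umbilical:
  assumes w: "w \<in> S"
  shows "umb_at w \<Longrightarrow> second_form G w u v \<bullet> mean_curvature G w = first_form G w u v"
    "(\<And>u v. second_form G w u v \<bullet> mean_curvature G w = m * first_form G w u v) \<Longrightarrow> umb_at w"
proof -
  have *: "second_form G w u v \<bullet> mean_curvature G w = first_form G w u v
     - ((Re u * Re v - Im u * Im v) * (Q w \<bullet> nu w) - (Re u * Im v + Im u * Re v) * (P w \<bullet> nu w)) / E w" for u v
    unfolding G_second_form[OF w] G_mean_curvature[OF w] G_first_form[OF w]
    using w E_pos[OF w]
    by (simp add: inner_add_left inner_diff_left field_simps)
  show "umb_at w \<Longrightarrow> second_form G w u v \<bullet> mean_curvature G w = first_form G w u v"
    unfolding * by (simp add: umb_at_def)
  assume "\<And>u v. second_form G w u v \<bullet> mean_curvature G w = m * first_form G w u v"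
  note a = this[unfolded *, unfolded G_first_form[OF w]]
  show "umb_at w"
    using a[of 1 1] a[of \<i> \<i>] a[of 1 \<i>] E_pos[OF w] by (simp add: umb_at_def field_simps)
qed

text \<open>On unit vectors the squared length is, up to constants, a quadratic polynomial in the
  cosine and sine of twice the angle (\<open>V\<close> in the proof). It is constant on the circle
  exactly when its linear terms vanish and its quadratic part is a multiple of the identity.\<close>

lemma G_isotropic:
  assumes w: "w \<in> S"
  shows "(\<exists>r. \<forall>u. first_form G w u u = 1 \<longrightarrow> norm (second_form G w u u) = r) \<longleftrightarrow> iso_at w \<and> umb_at w"
proof -
  note Ep = E_pos[OF w]
  have n2: "(norm (second_form G w u u))\<^sup>2 = ((Re u)\<^sup>2 + (Im u)\<^sup>2)\<^sup>2 * (E w)\<^sup>2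
     + ((Re u)\<^sup>2 - (Im u)\<^sup>2)\<^sup>2 * (Q w \<bullet> Q w) + (2 * Re u * Im u)\<^sup>2 * (P w \<bullet> P w)
     - 2 * ((Re u)\<^sup>2 + (Im u)\<^sup>2) * ((Re u)\<^sup>2 - (Im u)\<^sup>2) * (Q w \<bullet> nu w)
     + 2 * ((Re u)\<^sup>2 + (Im u)\<^sup>2) * (2 * Re u * Im u) * (P w \<bullet> nu w)
     - 2 * ((Re u)\<^sup>2 - (Im u)\<^sup>2) * (2 * Re u * Im u) * (P w \<bullet> Q w)" for u
  proof -
    define s t r where "s = (Re u)\<^sup>2 + (Im u)\<^sup>2" and "t = (Re u)\<^sup>2 - (Im u)\<^sup>2" and "r = 2 * Re u * Im u"
    have "second_form G w u u = s *\<^sub>R eta w + t *\<^sub>R (f w \<times>\<^sub>7 Q w) - r *\<^sub>R (f w \<times>\<^sub>7 P w)"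
      unfolding G_second_form[OF w] s_def t_def r_def by (simp add: power2_eq_square)
    then have "(norm (second_form G w u u))\<^sup>2 = s\<^sup>2 * (E w)\<^sup>2 + t\<^sup>2 * (Q w \<bullet> Q w) + r\<^sup>2 * (P w \<bullet> P w)
      - 2 * s * t * (Q w \<bullet> nu w) + 2 * s * r * (P w \<bullet> nu w) - 2 * t * r * (P w \<bullet> Q w)"
      using w
      by (simp add: power2_norm_eq_inner inner_add_left inner_add_right inner_diff_left inner_diff_right
          cross7_inner_left unit inner_commute[of "Q w" "P w"])
         (simp add: power2_eq_square algebra_simps)
    then show ?thesis unfolding s_def t_def r_def .
  qed
  have ff: "first_form G w u u = E w * ((Re u)\<^sup>2 + (Im u)\<^sup>2)" for u
    by (simp add: G_first_form[OF w] power2_eq_square)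
  show ?thesis
  proof
    assume "iso_at w \<and> umb_at w"
    then have h: "Q w \<bullet> Q w = P w \<bullet> P w" "P w \<bullet> Q w = 0" "Q w \<bullet> nu w = 0" "P w \<bullet> nu w = 0"
      by (auto simp: iso_at_def umb_at_def)
    have "norm (second_form G w u u) = sqrt (1 + (P w \<bullet> P w) / (E w)\<^sup>2)" if "first_form G w u u = 1" for u
    proof -
      have s: "(Re u)\<^sup>2 + (Im u)\<^sup>2 = 1 / E w" using that Ep unfolding ff by (simp add: field_simps)
      have "(norm (second_form G w u u))\<^sup>2 = ((Re u)\<^sup>2 + (Im u)\<^sup>2)\<^sup>2 * (E w)\<^sup>2 + ((Re u)\<^sup>2 + (Im u)\<^sup>2)\<^sup>2 * (P w \<bullet> P w)"
        unfolding n2 h by (simp add: power2_eq_square algebra_simps)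
      also have "\<dots> = 1 + (P w \<bullet> P w) / (E w)\<^sup>2" unfolding s using Ep by (simp add: power2_eq_square)
      finally show ?thesis by (metis norm_ge_zero real_sqrt_unique)
    qed
    then show "\<exists>r. \<forall>u. first_form G w u u = 1 \<longrightarrow> norm (second_form G w u u) = r" by blast
  next
    assume "\<exists>r. \<forall>u. first_form G w u u = 1 \<longrightarrow> norm (second_form G w u u) = r"
    then obtain r where r: "\<And>u. first_form G w u u = 1 \<Longrightarrow> norm (second_form G w u u) = r" by blast
    define k where "k = 1 / sqrt (E w)"
    have k2: "k\<^sup>2 = 1 / E w" using Ep by (simp add: k_def power_divide)
    define V where "V t s = t\<^sup>2 * (Q w \<bullet> Q w) + s\<^sup>2 * (P w \<bullet> P w) - 2 * t * (Q w \<bullet> nu w) + 2 * s * (P w \<bullet> nu w)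
       - 2 * t * s * (P w \<bullet> Q w)" for t s
    have V: "V (a\<^sup>2 - b\<^sup>2) (2 * a * b) = (r\<^sup>2 - 1) * (E w)\<^sup>2" if ab: "a\<^sup>2 + b\<^sup>2 = 1" for a b
    proof -
      define u where "u = Complex (k * a) (k * b)"
      have u: "(Re u)\<^sup>2 + (Im u)\<^sup>2 = k\<^sup>2" "(Re u)\<^sup>2 - (Im u)\<^sup>2 = k\<^sup>2 * (a\<^sup>2 - b\<^sup>2)" "2 * Re u * Im u = k\<^sup>2 * (2 * a * b)"
        using ab by (simp_all add: u_def power_mult_distrib distrib_left[symmetric] right_diff_distrib) (simp add: power2_eq_square)
      have gen: "K\<^sup>2 * e\<^sup>2 + (K * A)\<^sup>2 * q + (K * B)\<^sup>2 * p - 2 * K * (K * A) * m + 2 * K * (K * B) * n - 2 * (K * A) * (K * B) * l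
          = K * K * (e\<^sup>2 + (A\<^sup>2 * q + B\<^sup>2 * p - 2 * A * m + 2 * B * n - 2 * A * B * l))" for K A B e q p m n l :: real
        by (simp add: power2_eq_square algebra_simps)
      have nr: "norm (second_form G w u u) = r" using Ep by (intro r) (simp add: ff u k2)
      have "r\<^sup>2 = k\<^sup>2 * k\<^sup>2 * ((E w)\<^sup>2 + V (a\<^sup>2 - b\<^sup>2) (2 * a * b))"
        using n2[of u] unfolding nr u gen V_def .
      then show ?thesis using Ep unfolding k2 by (simp add: field_simps power2_eq_square)
    qed
    have V1: "V 1 0 = V (-1) 0" using V[of 1 0] V[of 0 1] by simp
    \<comment> \<open>The 3-4-5 triangle supplies rational unit vectors, with double-angle values
      7/25 and 24/25; together with \<open>V1\<close> they isolate all four conditions.\<close>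
    have V2: "V (-7/25) (24/25) = V (-7/25) (-24/25)" "V (7/25) (24/25) = V (7/25) (-24/25)" "V 1 0 = V (7/25) (24/25)"
      using V[of "3/5" "4/5"] V[of "3/5" "-4/5"] V[of "4/5" "3/5"] V[of "4/5" "-3/5"] V[of 1 0]
      by (simp_all add: power2_eq_square)
    show "iso_at w \<and> umb_at w"
      using V1 V2 unfolding V_def iso_at_def umb_at_def by (simp add: power2_eq_square)
  qed
qed

end

lemma totally_geodesic_at:
  assumes w: "w \<in> S" and "P w = 0" "Q w = 0"
  shows "normal_part (tangent_plane f w) (sphere_tangential (f w) (dir_deriv u (dir_deriv v f) w)) = 0"
proof -
  define d where "d = dir_deriv u (dir_deriv v f) w"
  define t where "t = Re u * Re v - Im u * Im v"
  define s where "s = Re u * Im v + Im u * Re v"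
  have d: "d = - ((Re u * Re v + Im u * Im v) * E w) *\<^sub>R f w + ((t * al w + s * be w) *\<^sub>R fx w + (s * al w - t * be w) *\<^sub>R fy w)"
    unfolding d_def dir_deriv_twice_expand[OF open_S smooth_f w, of u v] structure_eqs[OF w] assms(2,3) t_def s_def
    by (rule vector_eq_rdot[THEN iffD1], rule allI,
        simp only: inner_add_left inner_diff_left inner_minus_left inner_scaleR_left)
      (simp add: algebra_simps)
  have df: "d \<bullet> f w = - ((Re u * Re v + Im u * Im v) * E w)"
    unfolding d using w by (simp add: inner_add_left inner_diff_left unit)
  have "sphere_tangential (f w) d = 0 + ((t * al w + s * be w) *\<^sub>R fx w + (s * al w - t * be w) *\<^sub>R fy w)"
    unfolding sphere_tangential_def df by (simp add: d)
  then show ?thesis unfolding d_def[symmetric]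
    by (intro normal_part_tangent_plane[OF smooth_on_differentiable[OF smooth_f w]]) auto
qed

end

subsection \<open>Riemann surfaces\<close>

locale rsurface =
  fixes X :: "'a topology" and A :: "'a chart set"
  assumes surface: "riemann_surface X A"
begin

lemma chart:
  assumes "(U,z) \<in> A"
  shows "openin X U" "open (z ` U)" "homeomorphic_map (subtopology X U) (top_of_set (z ` U)) z"
    "U \<subseteq> topspace X" "inj_on z U"
proof -
  show 1: "openin X U" "open (z ` U)" "homeomorphic_map (subtopology X U) (top_of_set (z ` U)) z"
    using surface assms unfolding riemann_surface_def by blast+
  show 2: "U \<subseteq> topspace X" using 1(1) by (rule openin_subset)
  show "inj_on z U" using homeomorphic_imp_injective_map[OF 1(3)] 2 by (simp add: Int_absorb1)
qed

lemma chart_at: assumes "p \<in> topspace X" obtains U z where "(U,z) \<in> A" "p \<in> U"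
  using surface assms unfolding riemann_surface_def by blast

lemma in_chart_at [simp]: "(U,z) \<in> A \<Longrightarrow> p \<in> U \<Longrightarrow> in_chart U z f (z p) = f p"
  by (simp add: in_chart_def inv_into_f_f chart(5))

lemma open_chart_image:
  assumes "(U,z) \<in> A" "openin X V" shows "open (z ` (U \<inter> V))"
proof -
  have "openin (subtopology X U) (U \<inter> V)"
    using assms(2) by (auto simp: openin_subtopology)
  then have "openin (top_of_set (z ` U)) (z ` (U \<inter> V))"
    using homeomorphic_map_openness_eq[OF chart(3)[OF assms(1)], of "U \<inter> V"] by simp
  then show ?thesis using chart(2)[OF assms(1)] openin_open_trans by blast
qed

lemma openin_chart_preimage:
  assumes "(U,z) \<in> A" "open T" shows "openin X {p \<in> U. z p \<in> T}"
proof -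
  have "continuous_map (subtopology X U) (top_of_set (z ` U)) z"
    using homeomorphic_imp_continuous_map[OF chart(3)[OF assms(1)]] .
  moreover have "openin (top_of_set (z ` U)) (z ` U \<inter> T)"
    using assms(2) by (simp add: openin_open_Int)
  ultimately have "openin (subtopology X U) {p \<in> topspace (subtopology X U). z p \<in> z ` U \<inter> T}"
    by (rule openin_continuous_map_preimage)
  moreover have "{p \<in> topspace (subtopology X U). z p \<in> z ` U \<inter> T} = {p \<in> U. z p \<in> T}"
    using chart(4)[OF assms(1)] by auto
  ultimately show ?thesis using chart(1)[OF assms(1)] openin_trans_full by fastforce
qed

lemma eventually_chart_nhds:
  assumes "(U,z) \<in> A" "p \<in> U" "\<forall>\<^sub>F w in nhds (z p). Pr w"
  obtains V where "openin X V" "p \<in> V" "V \<subseteq> U" "\<And>q. q \<in> V \<Longrightarrow> Pr (z q)"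
proof -
  obtain T where T: "open T" "z p \<in> T" "\<And>w. w \<in> T \<Longrightarrow> Pr w"
    using assms(3) unfolding eventually_nhds by blast
  show ?thesis
    using openin_chart_preimage[OF assms(1) T(1)] T assms(2) by (intro that[of "{p \<in> U. z p \<in> T}"]) auto
qed

lemma eventually_chart_at:
  assumes "(U,z) \<in> A" "p \<in> U" "\<forall>\<^sub>F w in at (z p). Pr w"
  obtains V where "openin X V" "p \<in> V" "V \<subseteq> U" "\<And>q. q \<in> V \<Longrightarrow> q \<noteq> p \<Longrightarrow> Pr (z q)"
proof -
  have "\<forall>\<^sub>F w in nhds (z p). w \<noteq> z p \<longrightarrow> Pr w"
    using assms(3) by (simp add: eventually_at_filter)
  from eventually_chart_nhds[OF assms(1,2) this]
  obtain V where V: "openin X V" "p \<in> V" "V \<subseteq> U" "\<And>q. q \<in> V \<Longrightarrow> z q \<noteq> z p \<longrightarrow> Pr (z q)"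
    by blast
  have "Pr (z q)" if "q \<in> V" "q \<noteq> p" for q
    using V(3,4) that chart(5)[OF assms(1)] assms(2) by (metis inj_onD subsetD)
  then show ?thesis using that V by blast
qed

lemma eventually_nhds_chart:
  assumes "(U,z) \<in> A" "p \<in> U" "openin X V" "p \<in> V" "\<And>q. q \<in> U \<Longrightarrow> q \<in> V \<Longrightarrow> Pr (z q)"
  shows "\<forall>\<^sub>F w in nhds (z p). Pr w"
  unfolding eventually_nhds
  using open_chart_image[OF assms(1,3)] assms(2,4,5) by (intro exI[of _ "z ` (U \<inter> V)"]) auto

lemma not_isolated:
  assumes "openin X V" "p \<in> V"
  obtains q where "q \<in> V" "q \<noteq> p"
proof -
  have "p \<in> topspace X" using assms openin_subset by blast
  then obtain U z where c: "(U,z) \<in> A" "p \<in> U" by (rule chart_at)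
  have "open (z ` (U \<inter> V))" by (rule open_chart_image[OF c(1) assms(1)])
  moreover have "z p \<in> z ` (U \<inter> V)" using c assms by blast
  ultimately have "z ` (U \<inter> V) \<noteq> {z p}" using not_open_singleton by metis
  then obtain q where "q \<in> U \<inter> V" "z q \<noteq> z p" using c(2) assms(2) by blast
  then show ?thesis using that by blast
qed

text \<open>Connectedness: the points near which \<open>Pr\<close> holds and those with a punctured
  neighbourhood where it fails form two open sets covering the space, disjoint because no point is
  isolated.\<close>

lemma everywhere_or_isolated:
  assumes "\<And>p. p \<in> topspace X \<Longrightarrow> (\<exists>V. openin X V \<and> p \<in> V \<and> (\<forall>q\<in>V. Pr q))
     \<or> (\<exists>V. openin X V \<and> p \<in> V \<and> (\<forall>q\<in>V - {p}. \<not> Pr q))"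
  shows "(\<forall>p\<in>topspace X. Pr p) \<or> (\<forall>p\<in>topspace X. \<exists>V. openin X V \<and> p \<in> V \<and> (\<forall>q\<in>V - {p}. \<not> Pr q))"
proof -
  define Z where "Z = {p \<in> topspace X. \<exists>V. openin X V \<and> p \<in> V \<and> (\<forall>q\<in>V. Pr q)}"
  define Y where "Y = {p \<in> topspace X. \<exists>V. openin X V \<and> p \<in> V \<and> (\<forall>q\<in>V - {p}. \<not> Pr q)}"
  have un: "Z \<union> Y = topspace X" using assms unfolding Z_def Y_def by blast
  have "Z \<inter> Y = {}"
  proof (rule ccontr)
    assume "Z \<inter> Y \<noteq> {}"
    then obtain p V V' where "openin X V" "p \<in> V" "\<forall>q\<in>V. Pr q" "openin X V'" "p \<in> V'" "\<forall>q\<in>V' - {p}. \<not> Pr q"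
      unfolding Z_def Y_def by blast
    then show False using not_isolated[of "V \<inter> V'" p] by (metis DiffI IntD1 IntD2 IntI openin_Int singletonD)
  qed
  moreover have "openin X Z"
  proof (subst openin_subopen, intro ballI)
    fix p assume "p \<in> Z"
    then obtain V where V: "openin X V" "p \<in> V" "\<forall>q\<in>V. Pr q" unfolding Z_def by blast
    then have "V \<subseteq> Z" unfolding Z_def using openin_subset[OF V(1)] by blast
    then show "\<exists>T. openin X T \<and> p \<in> T \<and> T \<subseteq> Z" using V by blast
  qed
  moreover have "openin X Y"
  proof (subst openin_subopen, intro ballI)
    fix p assume "p \<in> Y"
    then obtain V where V: "openin X V" "p \<in> V" "\<forall>q\<in>V - {p}. \<not> Pr q" unfolding Y_def by blast
    \<comment> \<open>It suffices that \<open>q\<close> is not in \<open>Z\<close>: an open set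
      around \<open>q\<close> on which \<open>Pr\<close> holds would contain a point of
      \<open>V - {p}\<close>.\<close>
    have "q \<in> Y" if q: "q \<in> V" for q
    proof -
      have "q \<notin> Z"
      proof
        assume "q \<in> Z"
        then obtain V' where V': "openin X V'" "q \<in> V'" "\<forall>q\<in>V'. Pr q" unfolding Z_def by blast
        then obtain r where "r \<in> V \<inter> V'" "r \<noteq> q" using not_isolated[of "V \<inter> V'" q] q V by blast
        then have "r = p" "q = p \<or> \<not> Pr q" using V V' q by auto
        then have "q = p" using V' by blast
        then show False using \<open>r = p\<close> \<open>r \<noteq> q\<close> by simp
      qed
      then show ?thesis using un q openin_subset[OF V(1)] by blast
    qed
    then show "\<exists>T. openin X T \<and> p \<in> T \<and> T \<subseteq> Y" using V by blast
  qed
  moreover have "connected_space X" using surface by (simp add: riemann_surface_def)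
  ultimately have "Z = {} \<or> Y = {}"
    unfolding connected_space_def using un by blast
  then show ?thesis
  proof
    assume "Y = {}"
    then show ?thesis using un unfolding Z_def by blast
  next
    assume "Z = {}"
    then show ?thesis using un unfolding Y_def by blast
  qed
qed

section \<open>Change of charts\<close>

definition chart_deriv where
  "chart_deriv U z U' z' q = deriv (z \<circ> inv_into U' z') (z' q)"

context
  fixes U z U' z' assumes c: "(U,z) \<in> A" and c': "(U',z') \<in> A"
begin

lemma transition_holomorphic: "(z \<circ> inv_into U' z') holomorphic_on z' ` (U' \<inter> U)"
  using surface c c' unfolding riemann_surface_def by blast

lemma transition_at: "q \<in> U' \<Longrightarrow> (z \<circ> inv_into U' z') (z' q) = z q"
  by (simp add: inv_into_f_f chart(5)[OF c'])

lemma open_overlap: "open (z' ` (U' \<inter> U))"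
  by (rule open_chart_image[OF c' chart(1)[OF c]])

lemma in_chart_transition:
  "w \<in> z' ` (U' \<inter> U) \<Longrightarrow> in_chart U' z' f w = in_chart U z f ((z \<circ> inv_into U' z') w)"
  using c c' transition_at by auto

lemma dir_deriv_chart_change:
  assumes "q \<in> U" "q \<in> U'" "in_chart U z f differentiable (at (z q))"
  shows "dir_deriv u (in_chart U' z' f) (z' q) = dir_deriv (chart_deriv U z U' z' q * u) (in_chart U z f) (z q)"
proof -
  have q: "z' q \<in> z' ` (U' \<inter> U)" using assms by blast
  have "((z \<circ> inv_into U' z') has_field_derivative chart_deriv U z U' z' q) (at (z' q))"
    unfolding chart_deriv_def using holomorphic_derivI[OF transition_holomorphic open_overlap q] .
  then have D: "((z \<circ> inv_into U' z') has_derivative (\<lambda>u. chart_deriv U z U' z' q * u)) (at (z' q))"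
    by (simp add: has_field_derivative_def)
  have "dir_deriv u (in_chart U' z' f) (z' q) = dir_deriv u (\<lambda>w. in_chart U z f ((z \<circ> inv_into U' z') w)) (z' q)"
    by (rule dir_deriv_cong[OF open_overlap q in_chart_transition])
  also have "\<dots> = dir_deriv (dir_deriv u (z \<circ> inv_into U' z') (z' q)) (in_chart U z f) ((z \<circ> inv_into U' z') (z' q))"
  proof (rule dir_deriv_compose)
    show "(z \<circ> inv_into U' z') differentiable (at (z' q))" using D differentiable_def by blast
    show "in_chart U z f differentiable (at ((z \<circ> inv_into U' z') (z' q)))"
      unfolding transition_at[OF assms(2)] by (rule assms(3))
  qed
  finally show ?thesis unfolding transition_at[OF assms(2)] dir_deriv_unique[OF D] .
qed

lemma smooth_chart_change:
  assumes "openin X V" "V \<subseteq> U" "smooth_on (z ` V) (in_chart U z f)"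
  shows "smooth_on (z' ` (U' \<inter> V)) (in_chart U' z' f)"
proof (rule smooth_on_eqI)
  show op: "open (z' ` (U' \<inter> V))" by (rule open_chart_image[OF c' assms(1)])
  have sub: "z' ` (U' \<inter> V) \<subseteq> z' ` (U' \<inter> U)" using assms(2) by blast
  show "in_chart U' z' f w = in_chart U z f ((z \<circ> inv_into U' z') w)" if "w \<in> z' ` (U' \<inter> V)" for w
    using that sub by (intro in_chart_transition) blast
  have "open (z ` V)" using open_chart_image[OF c assms(1)] assms(2) by (simp add: Int_absorb1)
  then show "smooth_on (z' ` (U' \<inter> V)) (\<lambda>w. in_chart U z f ((z \<circ> inv_into U' z') w))"
  proof (rule smooth_on_compose[OF op _ _ _ assms(3)])
    show "(z \<circ> inv_into U' z') ` z' ` (U' \<inter> V) \<subseteq> z ` V" using transition_at by auto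
    show "smooth_on (z' ` (U' \<inter> V)) (z \<circ> inv_into U' z')"
      by (rule smooth_on_holomorphic[OF op holomorphic_on_subset[OF transition_holomorphic sub]])
  qed
qed

end

text \<open>Transition maps are holomorphic, so one chart suffices; local sections are built in this
  way.\<close>

lemma smooth_map_onI:
  assumes "(U,z) \<in> A" "openin X V" "V \<subseteq> U" "smooth_on (z ` V) (in_chart U z f)"
  shows "smooth_map_on A V f"
  unfolding smooth_map_on_def using smooth_chart_change[OF assms(1) _ assms(2-4)] by blast

lemma smooth_map_onD:
  assumes "smooth_map_on A V f" "(U,z) \<in> A" shows "smooth_on (z ` (U \<inter> V)) (in_chart U z f)"
  using assms unfolding smooth_map_on_def by blast

lemma smooth_map_on_chart:
  assumes "smooth_map_on A (topspace X) f" "(U,z) \<in> A" shows "smooth_on (z ` U) (in_chart U z f)"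
  using smooth_map_onD[OF assms] chart(4)[OF assms(2)] by (simp add: Int_absorb2)

end

subsection \<open>The harmonic sequence\<close>

text \<open>The vector \<open>a + \<i> b\<close>. Keeping the two parts visible lets the real
  identities for \<open>P\<close> and \<open>Q\<close> be used directly.\<close>

definition cpx :: "real^'n \<Rightarrow> real^'n \<Rightarrow> complex^'n" where
  "cpx a b = (\<chi> i. Complex (vec_nth a i) (vec_nth b i))"

lemma cpx_nth [simp]: "vec_nth (cpx a b) i = Complex (vec_nth a i) (vec_nth b i)"
  by (simp add: cpx_def)

lemma bounded_linear_cpx: "bounded_linear (\<lambda>p. cpx (fst p) (snd p))"
  by (rule linear_conv_bounded_linear[THEN iffD1], rule linearI) (auto simp: vec_eq_iff complex_eq_iff)

lemma cpx_add: "cpx a b + cpx c d = cpx (a + c) (b + d)"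
  and cpx_diff: "cpx a b - cpx c d = cpx (a - c) (b - d)"
  by (auto simp: vec_eq_iff complex_eq_iff)

lemma Complex_scale_cpx: "Complex x y *s cpx a b = cpx (x *\<^sub>R a - y *\<^sub>R b) (x *\<^sub>R b + y *\<^sub>R a)"
  by (auto simp: vec_eq_iff complex_eq_iff)

lemma i_scale_cpx: "\<i> *s cpx a b = cpx (- b) a"
  by (auto simp: vec_eq_iff complex_eq_iff)

lemma half_scale_cpx: "(1/2) *s cpx a b = cpx ((1/2) *\<^sub>R a) ((1/2) *\<^sub>R b)"
  by (auto simp: vec_eq_iff complex_eq_iff)

lemma cpx_eq_0 [simp]: "cpx a b = 0 \<longleftrightarrow> a = 0 \<and> b = 0"
  by (auto simp: vec_eq_iff complex_eq_iff)

lemma herm_cpx: "herm (cpx a b) (cpx c d) = Complex (a \<bullet> c + b \<bullet> d) (b \<bullet> c - a \<bullet> d)"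
  by (simp add: herm_def complex_eq_iff inner_vec_def sum.distrib[symmetric] sum_subtractf[symmetric] Re_sum Im_sum)

lemma cdot_cpx: "cdot (cpx a b) (cpx c d) = Complex (a \<bullet> c - b \<bullet> d) (a \<bullet> d + b \<bullet> c)"
  by (simp add: cdot_def complex_eq_iff inner_vec_def sum.distrib[symmetric] sum_subtractf[symmetric] Re_sum Im_sum)

lemma cdot_scale: "cdot (c *s x) (d *s y) = c * d * cdot x y"
  by (simp add: cdot_def sum_distrib_left mult_ac)

lemma herm_linear: "herm (x + y) l = herm x l + herm y l" "herm (x - y) l = herm x l - herm y l"
  "herm (c *s x) l = c * herm x l" "herm x (c *s l) = cnj c * herm x l"
  by (simp_all add: herm_def sum.distrib[symmetric] sum_subtractf[symmetric] sum_distrib_left algebra_simps)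

lemma herm_self_eq_0: "herm l l = 0 \<longleftrightarrow> l = 0"
proof
  assume h: "herm l l = 0"
  have "herm l l = of_real (\<Sum>i\<in>UNIV. (cmod (vec_nth l i))\<^sup>2)"
    unfolding herm_def of_real_sum by (rule sum.cong) (simp_all only: complex_norm_square)
  then have "(\<Sum>i\<in>UNIV. (cmod (vec_nth l i))\<^sup>2) = 0" using h by (metis of_real_eq_0_iff)
  then show "l = 0" by (simp add: sum_nonneg_eq_0_iff vec_eq_iff)
qed (simp add: herm_def)

lemma bounded_bilinear_herm: "bounded_bilinear (herm :: complex^'n \<Rightarrow> complex^'n \<Rightarrow> complex)"
  by (rule bilinear_conv_bounded_bilinear[THEN iffD1])
    (auto simp: bilinear_def herm_def sum.distrib[symmetric] scaleR_sum_right algebra_simps intro!: linearI)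

lemma bounded_bilinear_vector_scale: "bounded_bilinear ((*s) :: complex \<Rightarrow> complex^'n \<Rightarrow> complex^'n)"
  by (rule bilinear_conv_bounded_bilinear[THEN iffD1])
    (auto simp: bilinear_def vec_eq_iff algebra_simps intro!: linearI)

lemma herm_perp_proj_line:
  assumes "l \<noteq> 0" "herm m l = 0"
  shows "herm_perp_proj (range (\<lambda>c. c *s l)) (a *s l + m) = m"
  unfolding herm_perp_proj_def
proof (rule the_equality)
  show "(\<forall>k\<in>range (\<lambda>c. c *s l). herm m k = 0) \<and> a *s l + m - m \<in> range (\<lambda>c. c *s l)"
    using assms by (auto simp: herm_linear)
  fix n assume n: "(\<forall>k\<in>range (\<lambda>c. c *s l). herm n k = 0) \<and> a *s l + m - n \<in> range (\<lambda>c. c *s l)"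
  then obtain b where b: "a *s l + m - n = b *s l" by blast
  then have nm: "n = m + (a - b) *s l" by (simp add: algebra_simps vector_sub_rdistrib)
  have "herm n (1 *s l) = 0" using n by blast
  then have "(a - b) * herm l l = 0" using assms(2) unfolding nm by (auto simp: herm_linear)
  then have "a - b = 0" using assms(1) by (simp add: herm_self_eq_0)
  then show "n = m" using nm by simp
qed

lemma d_dz_cong:
  assumes "open S" "w \<in> S" "\<And>x. x \<in> S \<Longrightarrow> f x = g x"
  shows "d_dz f w = d_dz g w"
  unfolding d_dz_def using dir_deriv_cong[OF assms(1,2), of f g 1] dir_deriv_cong[OF assms(1,2), of f g \<i>] assms(3)
  by simp

text \<open>Only the existence of \<open>b\<close> matters: the derivative of the coefficient
  contributes a multiple of \<open>l\<close>, which is lost modulo the line.\<close>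

lemma d_dz_scale:
  assumes "c differentiable (at w)" "l differentiable (at w)"
  shows "\<exists>b. d_dz (\<lambda>w. c w *s l w) w = b *s l w + c w *s d_dz l w"
proof -
  have d: "dir_deriv u (\<lambda>w. c w *s l w) w = c w *s dir_deriv u l w + dir_deriv u c w *s l w" for u
    by (rule dir_deriv_bilinear[OF bounded_bilinear_vector_scale assms])
  have "d_dz (\<lambda>w. c w *s l w) w = ((1/2) * (dir_deriv 1 c w - \<i> * dir_deriv \<i> c w)) *s l w + c w *s d_dz l w"
    unfolding d_dz_def d by (simp add: vec_eq_iff algebra_simps)
  then show ?thesis by blast
qed

lemma d_dz_cpx:
  assumes "a differentiable (at w)" "b differentiable (at w)"
  shows "d_dz (\<lambda>w. cpx (a w) (b w)) w
    = (1/2) *s cpx (dir_deriv 1 a w + dir_deriv \<i> b w) (dir_deriv 1 b w - dir_deriv \<i> a w)"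
proof -
  have ab: "(\<lambda>w. (a w, b w)) differentiable (at w)"
    using has_derivative_Pair[OF has_derivative_dir_deriv[OF assms(1)] has_derivative_dir_deriv[OF assms(2)]]
    unfolding differentiable_def by blast
  have "dir_deriv u (\<lambda>w. cpx (a w) (b w)) w = cpx (dir_deriv u a w) (dir_deriv u b w)" for u
    using dir_deriv_linear[OF bounded_linear_cpx ab, of u] dir_deriv_Pair[OF assms, of u] by simp
  then show ?thesis unfolding d_dz_def by (simp add: i_scale_cpx cpx_diff)
qed

lemma smooth_on_cpx:
  assumes "open S" "smooth_on S a" "smooth_on S b" shows "smooth_on S (\<lambda>w. cpx (a w) (b w))"
  using smooth_on_linear[OF assms(1) bounded_linear_cpx smooth_on_Pair[OF assms]] by simp

context rsurface
begin

text \<open>The transition map is holomorphic, so the chain rule reduces to multiplication by its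
  complex derivative.\<close>

lemma d_dz_chart_change:
  assumes c: "(U,z) \<in> A" "(U',z') \<in> A" and q: "q \<in> U" "q \<in> U'" and d: "in_chart U z v differentiable (at (z q))"
  shows "d_dz (in_chart U' z' v) (z' q) = chart_deriv U z U' z' q *s d_dz (in_chart U z v) (z q)"
proof -
  define \<delta> where "\<delta> = chart_deriv U z U' z' q"
  have e: "dir_deriv u (in_chart U' z' v) (z' q)
      = Re (\<delta> * u) *\<^sub>R dir_deriv 1 (in_chart U z v) (z q) + Im (\<delta> * u) *\<^sub>R dir_deriv \<i> (in_chart U z v) (z q)" for u
    unfolding \<delta>_def dir_deriv_chart_change[OF c q d] by (rule dir_deriv_expand[OF d])
  have s: "r *\<^sub>R x = complex_of_real r *s x" for r and x :: "complex^'b"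
    by (simp add: vec_eq_iff complex_eq_iff)
  show ?thesis unfolding d_dz_def e \<delta>_def[symmetric] s
    by (cases \<delta>) (simp add: vec_eq_iff complex_eq_iff field_simps)
qed

text \<open>A section is \<open>k\<close> times \<open>l\<close> with \<open>k\<close> a Hermitian
  quotient, hence differentiable; modulo the line its complex derivative is \<open>k\<close> times
  \<open>m\<close>, up to the chart factor. Conversely, constant multiples of \<open>l\<close>
  already realise the whole line spanned by \<open>m\<close>.\<close>

lemma dz_image_line:
  fixes L :: "'a \<Rightarrow> (complex^'n) set"
  assumes c: "(U,z) \<in> A" and p: "p \<in> U"
    and L: "\<And>q. q \<in> U \<Longrightarrow> L q = range (\<lambda>c. c *s l (z q))" and sm: "smooth_on (z ` U) l"
    and nz: "\<And>q. q \<in> U \<Longrightarrow> l (z q) \<noteq> 0"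
    and m: "d_dz l (z p) = a *s l (z p) + m" "herm m (l (z p)) = 0"
  shows "dz_image X A L p = range (\<lambda>c. c *s m)"
proof (intro set_eqI iffI)
  note op = chart(2)[OF c]
  have zp: "z p \<in> z ` U" using p by blast
  fix x
  {
    assume "x \<in> dz_image X A L p"
    then obtain U' z' V v where v: "x = herm_perp_proj (L p) (d_dz (in_chart U' z' v) (z' p))"
      "(U',z') \<in> A" "p \<in> U'" "p \<in> V" "local_section X A L V v" unfolding dz_image_def by blast
    have V: "openin X V" "smooth_map_on A V v" "\<And>q. q \<in> V \<Longrightarrow> v q \<in> L q"
      using v(5) unfolding local_section_def by auto
    define v0 where "v0 = in_chart U z v"
    define T where "T = z ` (U \<inter> V)"
    have T: "open T" "z p \<in> T" "T \<subseteq> z ` U"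
      unfolding T_def using open_chart_image[OF c V(1)] p v(4) by auto
    have smv: "smooth_on T v0" unfolding T_def v0_def by (rule smooth_map_onD[OF V(2) c])
    have dv: "v0 differentiable (at (z p))" by (rule smooth_on_differentiable[OF smv T(2)])
    have dl: "l differentiable (at (z p))" by (rule smooth_on_differentiable[OF sm zp])
    define k where "k w = herm (v0 w) (l w) / herm (l w) (l w)" for w
    have kv: "v0 w = k w *s l w" if w: "w \<in> T" for w
    proof -
      obtain q where q: "q \<in> U" "q \<in> V" "w = z q" using w unfolding T_def by blast
      obtain b where "v q = b *s l w" using V(3)[OF q(2)] L[OF q(1)] q(3) by auto
      moreover have "v0 w = v q" unfolding v0_def q(3) by (rule in_chart_at[OF c q(1)])
      moreover have "herm (l w) (l w) \<noteq> 0" using nz[OF q(1)] q(3) by (simp add: herm_self_eq_0)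
      ultimately show ?thesis by (simp add: k_def herm_linear)
    qed
    have "k differentiable (at (z p))"
      unfolding k_def using nz[OF p]
      by (intro differentiable_divide bounded_bilinear_differentiable[OF bounded_bilinear_herm] dv dl)
        (simp add: herm_self_eq_0)
    then obtain b where "d_dz (\<lambda>w. k w *s l w) (z p) = b *s l (z p) + k (z p) *s d_dz l (z p)"
      using d_dz_scale[OF _ dl] by blast
    then have 1: "d_dz v0 (z p) = b *s l (z p) + k (z p) *s d_dz l (z p)"
      using d_dz_cong[OF T(1,2) kv] by simp
    define \<delta> where "\<delta> = chart_deriv U z U' z' p"
    have "d_dz (in_chart U' z' v) (z' p) = \<delta> *s d_dz v0 (z p)"
      unfolding \<delta>_def v0_def by (rule d_dz_chart_change[OF c v(2) p v(3) dv[unfolded v0_def]])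
    also have "\<dots> = (\<delta> * (b + k (z p) * a)) *s l (z p) + (\<delta> * k (z p)) *s m"
      unfolding 1 m(1) by (simp add: vec_eq_iff algebra_simps)
    finally have "x = (\<delta> * k (z p)) *s m"
      unfolding v(1) L[OF p] using m(2) by (simp add: herm_perp_proj_line[OF nz[OF p]] herm_linear)
    then show "x \<in> range (\<lambda>c. c *s m)" by blast
  }
  assume "x \<in> range (\<lambda>c. c *s m)"
  then obtain k where k: "x = k *s m" by blast
  define v where "v q = k *s l (z q)" for q
  have iv: "in_chart U z v w = k *s l w" if "w \<in> z ` U" for w
    using that c by (auto simp: v_def)
  have smk: "smooth_on (z ` U) (\<lambda>w. k *s l w)"
    by (rule smooth_on_bilinear[OF op bounded_bilinear_vector_scale smooth_on_const sm])
  have "smooth_on (z ` U) (in_chart U z v)" by (rule smooth_on_eqI[OF op smk iv])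
  then have "smooth_map_on A U v" by (rule smooth_map_onI[OF c chart(1)[OF c] order_refl])
  then have sec: "local_section X A L U v"
    unfolding local_section_def using chart(1)[OF c] L by (auto simp: v_def)
  have "d_dz (in_chart U z v) (z p) = d_dz (\<lambda>w. k *s l w) (z p)"
    by (rule d_dz_cong[OF op zp iv])
  also have "\<dots> = k *s d_dz l (z p)"
    unfolding d_dz_def using dir_deriv_bilinear[OF bounded_bilinear_vector_scale differentiable_const smooth_on_differentiable[OF sm zp], of _ k]
    by (simp add: vec_eq_iff algebra_simps)
  also have "\<dots> = (k * a) *s l (z p) + k *s m" unfolding m(1) by (simp add: vec_eq_iff algebra_simps)
  finally have "herm_perp_proj (L p) (d_dz (in_chart U z v) (z p)) = k *s m"
    unfolding L[OF p] using m(2) by (simp add: herm_perp_proj_line[OF nz[OF p]] herm_linear)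
  then show "x \<in> dz_image X A L p" unfolding dz_image_def using c p sec k
    by (intro CollectI exI[of _ U] exI[of _ z] exI[of _ U] exI[of _ v]) simp
qed

end

lemma range_vector_scale:
  fixes x :: "complex^'n"
  assumes "k \<noteq> 0" shows "range (\<lambda>c. c *s (k *s x)) = range (\<lambda>c. c *s x)"
proof (intro set_eqI iffI)
  fix y assume "y \<in> range (\<lambda>c. c *s x)"
  then obtain c where "y = c *s x" by blast
  then have "y = (c / k) *s (k *s x)" using assms by simp
  then show "y \<in> range (\<lambda>c. c *s (k *s x))" by blast
qed auto

text \<open>Closure under differences yields uniqueness of the projection, and it is the property
  that can be verified for the extended fibres.\<close>

lemma herm_perp_proj_mem:
  assumes "x \<in> L" "\<And>a b. a \<in> L \<Longrightarrow> b \<in> L \<Longrightarrow> a - b \<in> L"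
  shows "herm_perp_proj L x = 0"
  unfolding herm_perp_proj_def
proof (rule the_equality)
  show "(\<forall>l\<in>L. herm 0 l = 0) \<and> x - 0 \<in> L" using assms(1) by (simp add: herm_def)
  fix n assume n: "(\<forall>l\<in>L. herm n l = 0) \<and> x - n \<in> L"
  then have "x - (x - n) \<in> L" using assms by blast
  then have "herm n n = 0" using n by simp
  then show "n = 0" by (simp add: herm_self_eq_0)
qed

text \<open>Makes the limit fibres of \<open>extend_bundle\<close> closed under differences.\<close>

lemma infdist_diff_le:
  fixes E :: "'b::real_normed_vector set"
  assumes "E \<noteq> {}" "\<And>a b. a \<in> E \<Longrightarrow> b \<in> E \<Longrightarrow> a - b \<in> E"
  shows "infdist (x - y) E \<le> infdist x E + infdist y E"
proof (rule field_le_epsilon)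
  fix e :: real assume e: "e > 0"
  have near: "\<exists>a\<in>E. dist v a < infdist v E + e / 2" for v
  proof -
    have "infdist v E < infdist v E + e / 2" using e by simp
    then show ?thesis unfolding infdist_notempty[OF assms(1)]
      using cInf_lessD[of "dist v ` E"] assms(1) by (auto simp: image_iff)
  qed
  obtain a b where ab: "a \<in> E" "dist x a < infdist x E + e / 2" "b \<in> E" "dist y b < infdist y E + e / 2"
    using near[of x] near[of y] by blast
  have "infdist (x - y) E \<le> dist (x - y) (a - b)" using ab assms(2) by (intro infdist_le) auto
  also have "\<dots> \<le> dist x a + dist y b"
    using norm_triangle_ineq4[of "x - a" "y - b"] by (simp add: dist_norm algebra_simps)
  finally show "infdist (x - y) E \<le> infdist x E + infdist y E + e" using ab by simp
qed

section \<open>The harmonic sequence of a conformal harmonic immersion\<close>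

locale minimal_surface = rsurface X A
  for X :: "'a topology" and A :: "'a chart set" +
  fixes \<phi> :: "'a \<Rightarrow> real^7"
  assumes in_sphere: "\<phi> ` topspace X \<subseteq> sphere 0 1"
    and smooth: "smooth_map_on A (topspace X) \<phi>"
    and conformal: "conformal_immersion A \<phi>"
    and harm: "sphere_harmonic A \<phi>"
begin

lemma chart_conformal_harmonic:
  assumes c: "(U,z) \<in> A" shows "conformal_harmonic (z ` U) (in_chart U z \<phi>)"
proof
  show "open (z ` U)" by (rule chart(2)[OF c])
  show sm: "smooth_on (z ` U) (in_chart U z \<phi>)" by (rule smooth_map_on_chart[OF smooth c])
  fix w assume w: "w \<in> z ` U"
  then obtain p where p: "p \<in> U" "w = z p" by blast
  have "norm (\<phi> p) = 1" using in_sphere p chart(4)[OF c] by (auto simp: image_subset_iff subset_iff)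
  then show "in_chart U z \<phi> w \<bullet> in_chart U z \<phi> w = 1" using c p by (simp add: dot_square_norm)
  have "\<forall>(U,z)\<in>A. \<forall>p\<in>U. inj (\<lambda>u. dir_deriv u (in_chart U z \<phi>) (z p)) \<and>
      (\<exists>c. \<forall>u v. first_form (in_chart U z \<phi>) (z p) u v = c * (u \<bullet> v))"
    using conformal unfolding conformal_immersion_def pointwise_def .
  then have inj: "inj (\<lambda>u. dir_deriv u (in_chart U z \<phi>) w)" and
    "\<exists>c. \<forall>u v. first_form (in_chart U z \<phi>) w u v = c * (u \<bullet> v)" using c p by blast+
  then obtain k where k: "first_form (in_chart U z \<phi>) w u v = k * (u \<bullet> v)" for u v by blast
  show "dir_deriv \<i> (in_chart U z \<phi>) w \<bullet> dir_deriv \<i> (in_chart U z \<phi>) w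
      = dir_deriv 1 (in_chart U z \<phi>) w \<bullet> dir_deriv 1 (in_chart U z \<phi>) w"
    "dir_deriv 1 (in_chart U z \<phi>) w \<bullet> dir_deriv \<i> (in_chart U z \<phi>) w = 0"
    using k[of 1 1] k[of \<i> \<i>] k[of 1 \<i>] unfolding first_form_def by simp_all
  have "dir_deriv 0 (in_chart U z \<phi>) w = 0"
    using dir_deriv_expand[OF smooth_on_differentiable[OF sm w], of 0] by simp
  then show "dir_deriv 1 (in_chart U z \<phi>) w \<noteq> 0" using injD[OF inj, of 1 0] by auto
  show "sphere_tangential (in_chart U z \<phi> w)
     (dir_deriv 1 (dir_deriv 1 (in_chart U z \<phi>)) w + dir_deriv \<i> (dir_deriv \<i> (in_chart U z \<phi>)) w) = 0"
    using harm c p unfolding sphere_harmonic_def pointwise_def by blast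
qed

abbreviation "chP U z \<equiv> conformal_harmonic.P (in_chart U z \<phi>)"
abbreviation "chQ U z \<equiv> conformal_harmonic.Q (in_chart U z \<phi>)"
abbreviation "chM U z w \<equiv> cpx (chP U z w) (- chQ U z w)"

abbreviation "hs \<equiv> harmonic_sequence X A \<phi>"

text \<open>\<open>\<phi>\<^sub>2\<close> before its extension across isolated zeros\<close>

definition "pre2 = dz_image X A (hs (Suc 0))"

text \<open>The complex derivative of \<open>\<phi>\<close> is half of
  \<open>\<phi>\<^sub>x - \<i> \<phi>\<^sub>y\<close> and already orthogonal to
  \<open>\<phi>\<close>, so the projection does nothing; it never vanishes since
  \<open>\<phi>\<close> is an immersion, so no extension takes place.\<close>

lemma hs1:
  assumes c: "(U,z) \<in> A" and p: "p \<in> U"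
  shows "hs (Suc 0) p
    = range (\<lambda>c. c *s cpx (dir_deriv 1 (in_chart U z \<phi>) (z p)) (- dir_deriv \<i> (in_chart U z \<phi>) (z p)))"
proof -
  interpret ch: conformal_harmonic "z ` U" "in_chart U z \<phi>" by (rule chart_conformal_harmonic[OF c])
  have zp: "z p \<in> z ` U" using p by blast
  define l where "l w = cpx (in_chart U z \<phi> w) 0" for w
  define m where "m = (1/2) *s cpx (ch.fx (z p)) (- ch.fy (z p))"
  have "dz_image X A (hs 0) p = range (\<lambda>c. c *s m)"
  proof (rule dz_image_line[OF c p])
    have "cpx (\<phi> q) 0 = (\<chi> i. complex_of_real (vec_nth (\<phi> q) i))" for q
      by (simp add: vec_eq_iff complex_eq_iff)
    then show "hs 0 q = range (\<lambda>c. c *s l (z q))" if "q \<in> U" for q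
      using that c by (simp add: l_def)
    show "smooth_on (z ` U) l" unfolding l_def
      by (intro smooth_on_cpx ch.open_S ch.smooth_f smooth_on_const)
    show "l (z q) \<noteq> 0" if "q \<in> U" for q using ch.unit[of "z q"] that by (auto simp: l_def)
    show "d_dz l (z p) = 0 *s l (z p) + m"
      unfolding l_def m_def by (simp add: d_dz_cpx smooth_on_differentiable[OF ch.smooth_f zp])
    show "herm m (l (z p)) = 0"
      unfolding m_def l_def herm_linear herm_cpx using zp by (simp add: complex_eq_iff)
  qed
  then have e: "dz_image X A (hs 0) p = range (\<lambda>c. c *s cpx (ch.fx (z p)) (- ch.fy (z p)))"
    unfolding m_def by (rule trans) (rule range_vector_scale, simp)
  have ne: "dz_image X A (hs 0) p \<noteq> {0}"
  proof
    assume a: "dz_image X A (hs 0) p = {0}"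
    have "1 *s cpx (ch.fx (z p)) (- ch.fy (z p)) \<in> {0}" unfolding a[symmetric] e by blast
    then show False using ch.immersed[OF zp] by simp
  qed
  show ?thesis unfolding harmonic_sequence.simps(2) extend_bundle_def if_not_P[OF ne] by (rule e)
qed

text \<open>By the structure equations the complex derivative of
  \<open>\<phi>\<^sub>x - \<i> \<phi>\<^sub>y\<close> is \<open>al - \<i> be\<close> times this
  vector plus the normal vector \<open>P - \<i> Q\<close>.\<close>

lemma pre2_eq:
  assumes c: "(U,z) \<in> A" and p: "p \<in> U"
  shows "pre2 p = range (\<lambda>c. c *s chM U z (z p))"
  unfolding pre2_def
proof (rule dz_image_line[OF c p, where l = "\<lambda>w. cpx (dir_deriv 1 (in_chart U z \<phi>) w) (- dir_deriv \<i> (in_chart U z \<phi>) w)"])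
  interpret ch: conformal_harmonic "z ` U" "in_chart U z \<phi>" by (rule chart_conformal_harmonic[OF c])
  have zp: "z p \<in> z ` U" using p by blast
  note smy = smooth_on_uminus[OF ch.open_S ch.smooth_fy]
  show "hs (Suc 0) q = range (\<lambda>c. c *s cpx (ch.fx (z q)) (- ch.fy (z q)))" if "q \<in> U" for q
    by (rule hs1[OF c that])
  show "smooth_on (z ` U) (\<lambda>w. cpx (ch.fx w) (- ch.fy w))"
    by (rule smooth_on_cpx[OF ch.open_S ch.smooth_fx smy])
  show "cpx (ch.fx (z q)) (- ch.fy (z q)) \<noteq> 0" if "q \<in> U" for q using ch.immersed[of "z q"] that by auto
  have "d_dz (\<lambda>w. cpx (ch.fx w) (- ch.fy w)) (z p)
      = (1/2) *s cpx (ch.fxx (z p) - ch.fyy (z p)) (- ch.fxy (z p) - ch.fxy (z p))"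
    using d_dz_cpx[OF smooth_on_differentiable[OF ch.smooth_fx zp] smooth_on_differentiable[OF smy zp]]
      dir_deriv_uminus[OF smooth_on_differentiable[OF ch.smooth_fy zp]] ch.fyx[OF zp] by simp
  also have "\<dots> = Complex (ch.al (z p)) (- ch.be (z p)) *s cpx (ch.fx (z p)) (- ch.fy (z p)) + chM U z (z p)"
    unfolding ch.structure_eqs[OF zp] half_scale_cpx Complex_scale_cpx cpx_add
    by (rule arg_cong2[where f = cpx]; rule vector_eq_rdot[THEN iffD1], rule allI,
        simp only: inner_add_left inner_diff_left inner_minus_left inner_scaleR_left; simp add: algebra_simps)
  finally show "d_dz (\<lambda>w. cpx (ch.fx w) (- ch.fy w)) (z p)
      = Complex (ch.al (z p)) (- ch.be (z p)) *s cpx (ch.fx (z p)) (- ch.fy (z p)) + chM U z (z p)" .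
  show "herm (chM U z (z p)) (cpx (ch.fx (z p)) (- ch.fy (z p))) = 0"
    using zp by (simp add: herm_cpx complex_eq_iff)
qed

lemma hs2: "hs 2 = extend_bundle X pre2"
  by (simp add: numeral_2_eq_2 pre2_def)

lemma pre2_zero_iff:
  assumes "(U,z) \<in> A" "p \<in> U" shows "pre2 p = {0} \<longleftrightarrow> chP U z (z p) = 0 \<and> chQ U z (z p) = 0"
proof
  assume "pre2 p = {0}"
  moreover have "1 *s chM U z (z p) \<in> pre2 p" unfolding pre2_eq[OF assms] by blast
  ultimately have "chM U z (z p) = 0" by simp
  then show "chP U z (z p) = 0 \<and> chQ U z (z p) = 0" by simp
next
  assume "chP U z (z p) = 0 \<and> chQ U z (z p) = 0"
  then have "chM U z (z p) = 0" by simp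
  then show "pre2 p = {0}" unfolding pre2_eq[OF assms] by auto
qed

lemma pre2_subspace:
  assumes "p \<in> topspace X"
  shows "0 \<in> pre2 p" "a \<in> pre2 p \<Longrightarrow> b \<in> pre2 p \<Longrightarrow> a - b \<in> pre2 p"
proof -
  obtain U z where c: "(U,z) \<in> A" "p \<in> U" using chart_at[OF assms] .
  have "0 *s chM U z (z p) \<in> pre2 p" unfolding pre2_eq[OF c] by blast
  then show "0 \<in> pre2 p" by simp
  assume "a \<in> pre2 p" "b \<in> pre2 p"
  then obtain x y where "a = x *s chM U z (z p)" "b = y *s chM U z (z p)" unfolding pre2_eq[OF c] by blast
  then have "a - b = (x - y) *s chM U z (z p)" by (simp add: vector_sub_rdistrib)
  then show "a - b \<in> pre2 p" unfolding pre2_eq[OF c] by blast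
qed

lemma atin_topspace: "p \<in> topspace X \<Longrightarrow> \<forall>\<^sub>F q in atin X p. q \<in> topspace X"
  unfolding eventually_atin by (intro disjI2 exI[of _ "topspace X"]) auto

lemma atin_nontrivial:
  assumes "p \<in> topspace X" shows "atin X p \<noteq> bot"
proof
  assume "atin X p = bot"
  then have "eventually (\<lambda>q. False) (atin X p)" by simp
  then obtain V where "openin X V" "p \<in> V" "\<forall>q\<in>V - {p}. False" using assms unfolding eventually_atin by blast
  then show False using not_isolated[of V p] by blast
qed

text \<open>At a zero of \<open>pre2\<close> the fibre consists of limits, and distances to nearby
  fibres add up under differences; this covers accumulating zeros as well.\<close>

lemma hs2_subspace:
  assumes p: "p \<in> topspace X"
  shows "pre2 p \<subseteq> hs 2 p" "a \<in> hs 2 p \<Longrightarrow> b \<in> hs 2 p \<Longrightarrow> a - b \<in> hs 2 p"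
proof -
  show "pre2 p \<subseteq> hs 2 p"
  proof (cases "pre2 p = {0}")
    case True
    have "\<forall>\<^sub>F q in atin X p. infdist 0 (pre2 q) = 0"
      using atin_topspace[OF p] by eventually_elim (simp add: pre2_subspace(1))
    then have "((\<lambda>q. infdist 0 (pre2 q)) \<longlongrightarrow> 0) (atin X p)" by (rule tendsto_eventually)
    then show ?thesis unfolding hs2 extend_bundle_def using True by simp
  qed (simp add: hs2 extend_bundle_def)
  assume ab: "a \<in> hs 2 p" "b \<in> hs 2 p"
  show "a - b \<in> hs 2 p"
  proof (cases "pre2 p = {0}")
    case True
    then have lim: "((\<lambda>q. infdist a (pre2 q)) \<longlongrightarrow> 0) (atin X p)" "((\<lambda>q. infdist b (pre2 q)) \<longlongrightarrow> 0) (atin X p)"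
      using ab unfolding hs2 extend_bundle_def by auto
    have "((\<lambda>q. infdist (a - b) (pre2 q)) \<longlongrightarrow> 0) (atin X p)"
    proof (rule tendsto_sandwich[OF _ _ tendsto_const tendsto_add_zero[OF lim]])
      show "\<forall>\<^sub>F q in atin X p. infdist (a - b) (pre2 q) \<le> infdist a (pre2 q) + infdist b (pre2 q)"
        using atin_topspace[OF p]
        by eventually_elim (intro infdist_diff_le, use pre2_subspace in \<open>blast+\<close>)
    qed (simp add: infdist_nonneg)
    then show ?thesis unfolding hs2 extend_bundle_def using True by simp
  next
    case False
    then show ?thesis using ab pre2_subspace(2)[OF p] unfolding hs2 extend_bundle_def by simp
  qed
qed

lemma smooth_chM: "(U,z) \<in> A \<Longrightarrow> smooth_on (z ` U) (chM U z)"
  using conformal_harmonic.smooth_P[OF chart_conformal_harmonic] conformal_harmonic.smooth_Q[OF chart_conformal_harmonic]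
    chart(2) by (intro smooth_on_cpx smooth_on_uminus) auto

lemma cdot_chM: "cdot (chM U z w) (chM U z w) = 0 \<longleftrightarrow> conformal_harmonic.iso_at (in_chart U z \<phi>) w"
  if "(U,z) \<in> A"
  unfolding conformal_harmonic.iso_at_def[OF chart_conformal_harmonic[OF that]] cdot_cpx
  by (auto simp: complex_eq_iff inner_commute)

text \<open>One direction evaluates the bilinear square on the local section
  \<open>P - \<i> Q\<close>, getting \<open>P \<bullet> P - Q \<bullet> Q\<close> and
  \<open>- 2 * (P \<bullet> Q)\<close> as real and imaginary parts. For the other, fibres at zeros
  of \<open>pre2\<close> are limits of nearby fibres, and the isotropic vectors form a closed
  cone.\<close>

theorem isotropic_bundle_iff:
  "isotropic_bundle X A (hs 2)
    \<longleftrightarrow> (\<forall>(U,z)\<in>A. \<forall>p\<in>U. conformal_harmonic.iso_at (in_chart U z \<phi>) (z p))"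
proof
  assume iso: "isotropic_bundle X A (hs 2)"
  show "\<forall>(U,z)\<in>A. \<forall>p\<in>U. conformal_harmonic.iso_at (in_chart U z \<phi>) (z p)"
  proof (clarify)
    fix U z p assume c: "(U,z) \<in> A" and p: "p \<in> U"
    define s where "s q = chM U z (z q)" for q
    have "smooth_on (z ` U) (in_chart U z s)"
      by (rule smooth_on_eqI[OF chart(2)[OF c] smooth_chM[OF c]]) (use c in \<open>auto simp: s_def\<close>)
    then have "smooth_map_on A U s" by (rule smooth_map_onI[OF c chart(1)[OF c] order_refl])
    moreover have "s q \<in> hs 2 q" if q: "q \<in> U" for q
    proof -
      have "1 *s s q \<in> pre2 q" unfolding pre2_eq[OF c q] s_def by blast
      then show ?thesis using hs2_subspace(1)[of q] chart(4)[OF c] q by auto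
    qed
    ultimately have "local_section X A (hs 2) U s"
      unfolding local_section_def using chart(1)[OF c] by blast
    then have "cdot (s p) (s p) = 0" using iso p unfolding isotropic_bundle_def by blast
    then show "conformal_harmonic.iso_at (in_chart U z \<phi>) (z p)" by (simp add: s_def cdot_chM[OF c])
  qed
next
  assume iso: "\<forall>(U,z)\<in>A. \<forall>p\<in>U. conformal_harmonic.iso_at (in_chart U z \<phi>) (z p)"
  have pre: "cdot v v = 0" if q: "q \<in> topspace X" and v: "v \<in> pre2 q" for q v
  proof -
    obtain U z where c: "(U,z) \<in> A" "q \<in> U" using chart_at[OF q] .
    then have "cdot (chM U z (z q)) (chM U z (z q)) = 0" using iso cdot_chM[OF c(1)] by blast
    then show ?thesis using v unfolding pre2_eq[OF c] by (auto simp: cdot_scale)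
  qed
  define C where "C = {v :: complex^7. cdot v v = 0}"
  have "continuous_on UNIV (\<lambda>v :: complex^7. cdot v v)"
    unfolding cdot_def by (intro continuous_intros)
  then have closed: "closed C" unfolding C_def
    using continuous_closed_vimage[of "{0}" "\<lambda>v :: complex^7. cdot v v"]
    by (simp add: vimage_def continuous_on_eq_continuous_at)
  have "cdot v v = 0" if q: "q \<in> topspace X" and v: "v \<in> hs 2 q" for q v
  proof (cases "pre2 q = {0}")
    case True
    then have lim: "((\<lambda>r. infdist v (pre2 r)) \<longlongrightarrow> 0) (atin X q)"
      using v unfolding hs2 extend_bundle_def by auto
    have "\<forall>\<^sub>F r in atin X q. infdist v C \<le> infdist v (pre2 r)"
      using atin_topspace[OF q]
      by eventually_elim (intro infdist_mono, use pre pre2_subspace(1) in \<open>auto simp: C_def\<close>)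
    then have "infdist v C \<le> 0" by (rule tendsto_lowerbound[OF lim _ atin_nontrivial[OF q]])
    then have "infdist v C = 0" using infdist_nonneg[of v C] by linarith
    moreover have "C \<noteq> {}" using pre[OF q pre2_subspace(1)[OF q]] unfolding C_def by blast
    ultimately have "v \<in> C" using closed in_closed_iff_infdist_zero by blast
    then show ?thesis by (simp add: C_def)
  next
    case False
    then show ?thesis using v pre[OF q] unfolding hs2 extend_bundle_def by simp
  qed
  then show "isotropic_bundle X A (hs 2)"
    unfolding isotropic_bundle_def local_section_def by (meson openin_subset subsetD)
qed

text \<open>Off the zeros of \<open>pre2\<close> a section of the second bundle is a multiple of
  \<open>P - \<i> Q\<close>, so \<open>parallel\<close> keeps its complex derivative in the fibre;
  at an isolated zero that derivative is a limit of such vectors and lies in the extended fibre.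
  Hence the third bundle vanishes.\<close>

lemma superminimalI:
  assumes isolated: "\<And>p. p \<in> topspace X \<Longrightarrow> \<exists>V. openin X V \<and> p \<in> V \<and> (\<forall>q\<in>V - {p}. pre2 q \<noteq> {0})"
    and parallel: "\<And>U z q. (U,z) \<in> A \<Longrightarrow> q \<in> U \<Longrightarrow> pre2 q \<noteq> {0} \<Longrightarrow> \<exists>\<delta>. d_dz (chM U z) (z q) = \<delta> *s chM U z (z q)"
  shows "superminimal X A \<phi>"
proof -
  have in_pre2: "d_dz (in_chart U z v) (z q) \<in> pre2 q"
    if c: "(U,z) \<in> A" and q: "q \<in> U" "q \<in> V" and v: "local_section X A (hs 2) V v" and nz: "pre2 q \<noteq> {0}" for U z q V v
  proof -
    have V: "openin X V" "smooth_map_on A V v" "\<And>q. q \<in> V \<Longrightarrow> v q \<in> hs 2 q"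
      using v unfolding local_section_def by auto
    define T where "T = z ` (U \<inter> V)"
    define M where "M = chM U z"
    define v0 where "v0 = in_chart U z v"
    have T: "open T" "z q \<in> T" "T \<subseteq> z ` U" unfolding T_def using open_chart_image[OF c V(1)] q by auto
    have smv: "smooth_on T v0" unfolding T_def v0_def by (rule smooth_map_onD[OF V(2) c])
    have smM: "smooth_on T M" unfolding M_def using smooth_chM[OF c] T(3) by (rule smooth_on_subset)
    have Mq: "M (z q) \<noteq> 0" using nz pre2_zero_iff[OF c q(1)] by (simp add: M_def)
    define T' where "T' = {w \<in> T. M w \<noteq> 0}"
    have "open T'" unfolding T'_def
      using continuous_open_preimage[OF smooth_on_continuous[OF smM] T(1), of "- {0}"]
      by (simp add: vimage_def Int_def open_Compl)
    moreover have qT': "z q \<in> T'" using T Mq by (simp add: T'_def)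
    moreover define k where "k w = herm (v0 w) (M w) / herm (M w) (M w)" for w
    have kv: "v0 w = k w *s M w" if w: "w \<in> T'" for w
    proof -
      obtain r where r: "r \<in> U" "r \<in> V" "w = z r" using w unfolding T'_def T_def by blast
      have Mw: "M w \<noteq> 0" using w by (simp add: T'_def)
      then have "pre2 r \<noteq> {0}" using pre2_zero_iff[OF c r(1)] r(3) by (auto simp: M_def)
      then have "v r \<in> pre2 r" using V(3)[OF r(2)] unfolding hs2 extend_bundle_def by simp
      then obtain b where "v r = b *s M w" unfolding pre2_eq[OF c r(1)] M_def r(3) by blast
      moreover have "v0 w = v r" unfolding v0_def r(3) by (rule in_chart_at[OF c r(1)])
      ultimately show ?thesis using Mw by (simp add: k_def herm_linear herm_self_eq_0)
    qed
    have dM: "M differentiable (at (z q))" by (rule smooth_on_differentiable[OF smM T(2)])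
    have "k differentiable (at (z q))"
      unfolding k_def using Mq
      by (intro differentiable_divide bounded_bilinear_differentiable[OF bounded_bilinear_herm] dM
          smooth_on_differentiable[OF smv T(2)]) (simp add: herm_self_eq_0)
    then obtain b where "d_dz (\<lambda>w. k w *s M w) (z q) = b *s M (z q) + k (z q) *s d_dz M (z q)"
      using d_dz_scale[OF _ dM] by blast
    moreover obtain \<delta> where "d_dz M (z q) = \<delta> *s M (z q)" using parallel[OF c q(1) nz] by (auto simp: M_def)
    ultimately have "d_dz v0 (z q) = (b + k (z q) * \<delta>) *s M (z q)"
      using d_dz_cong[OF \<open>open T'\<close> qT' kv] by (simp add: vec_eq_iff algebra_simps)
    then show ?thesis unfolding pre2_eq[OF c q(1)] v0_def M_def by blast
  qed
  have in_hs2: "d_dz (in_chart U z v) (z p) \<in> hs 2 p"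
    if c: "(U,z) \<in> A" and p: "p \<in> U" "p \<in> V" and v: "local_section X A (hs 2) V v" for U z p V v
  proof (cases "pre2 p = {0}")
    case False
    then show ?thesis using in_pre2[OF c p v] hs2_subspace(1)[of p] chart(4)[OF c] p by blast
  next
    case True
    have pX: "p \<in> topspace X" using chart(4)[OF c] p by blast
    have V: "openin X V" "smooth_map_on A V v" using v unfolding local_section_def by auto
    define T where "T = z ` (U \<inter> V)"
    define y where "y = d_dz (in_chart U z v)"
    have T: "open T" "z p \<in> T" unfolding T_def using open_chart_image[OF c V(1)] p by auto
    have smv: "smooth_on T (in_chart U z v)" unfolding T_def by (rule smooth_map_onD[OF V(2) c])
    have "smooth_on T y" unfolding y_def d_dz_def[abs_def]
      by (intro smooth_on_bilinear[OF T(1) bounded_bilinear_vector_scale] smooth_on_diff[OF T(1)] smooth_on_const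
          smooth_on_dir_deriv_basis smv)
    from smooth_on_continuous[OF this] have "isCont y (z p)"
      using T by (simp add: continuous_on_eq_continuous_at)
    then have lim: "(y \<longlongrightarrow> y (z p)) (nhds (z p))" by (simp add: isCont_def tendsto_nhds_iff)
    obtain V1 where V1: "openin X V1" "p \<in> V1" "\<forall>q\<in>V1 - {p}. pre2 q \<noteq> {0}" using isolated[OF pX] by blast
    have "((\<lambda>q. infdist (y (z p)) (pre2 q)) \<longlongrightarrow> 0) (atin X p)"
    proof (rule tendstoI)
      fix e :: real assume "e > 0"
      then have "\<forall>\<^sub>F w in nhds (z p). dist (y w) (y (z p)) < e" using lim by (rule tendstoD[rotated])
      from eventually_chart_nhds[OF c p(1) this]
      obtain V2 where V2: "openin X V2" "p \<in> V2" "V2 \<subseteq> U" "\<And>q. q \<in> V2 \<Longrightarrow> dist (y (z q)) (y (z p)) < e" by blast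
      have "dist (infdist (y (z p)) (pre2 q)) 0 < e" if q: "q \<in> V \<inter> V1 \<inter> V2 - {p}" for q
      proof -
        have "y (z q) \<in> pre2 q" unfolding y_def using in_pre2[OF c _ _ v, of q] q V1 V2 by blast
        then have "infdist (y (z p)) (pre2 q) \<le> dist (y (z p)) (y (z q))" by (rule infdist_le)
        then show ?thesis using V2(4)[of q] q infdist_nonneg[of "y (z p)" "pre2 q"] by (simp add: dist_commute)
      qed
      then show "\<forall>\<^sub>F q in atin X p. dist (infdist (y (z p)) (pre2 q)) 0 < e"
        unfolding eventually_atin using V(1) V1 V2 p(2)
        by (intro disjI2 exI[of _ "V \<inter> V1 \<inter> V2"]) (auto intro: openin_Int)
    qed
    then show ?thesis unfolding hs2 extend_bundle_def y_def using True by simp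
  qed
  have zero: "herm_perp_proj (hs 2 p) x = 0" if "p \<in> topspace X" "x \<in> hs 2 p" for p x
    using herm_perp_proj_mem[OF that(2) hs2_subspace(2)[OF that(1)]] .
  have dz2: "dz_image X A (hs 2) p = {0}" if p: "p \<in> topspace X" for p
  proof (intro set_eqI iffI)
    fix x assume "x \<in> dz_image X A (hs 2) p"
    then obtain U z V v where "x = herm_perp_proj (hs 2 p) (d_dz (in_chart U z v) (z p))"
      "(U,z) \<in> A" "p \<in> U" "p \<in> V" "local_section X A (hs 2) V v" unfolding dz_image_def by blast
    then show "x \<in> {0}" using zero[OF p in_hs2] by simp
  next
    fix x :: "complex^7" assume x: "x \<in> {0}"
    obtain U z where c: "(U,z) \<in> A" "p \<in> U" using chart_at[OF p] .
    define v where "v q = (0 :: complex^7)" for q :: 'a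
    have iv: "in_chart U z v = (\<lambda>w. 0)" by (simp add: in_chart_def v_def fun_eq_iff)
    have "smooth_map_on A U v"
      by (rule smooth_map_onI[OF c(1) chart(1)[OF c(1)] order_refl]) (simp add: iv smooth_on_const)
    then have sec: "local_section X A (hs 2) U v"
      unfolding local_section_def using chart(1,4)[OF c(1)] hs2_subspace(1) pre2_subspace(1) by (auto simp: v_def)
    have "x = herm_perp_proj (hs 2 p) (d_dz (in_chart U z v) (z p))"
      using x zero[OF p in_hs2[OF c c(2) sec]] by simp
    then show "x \<in> dz_image X A (hs 2) p" unfolding dz_image_def using c sec
      by (intro CollectI exI[of _ U] exI[of _ z] exI[of _ U] exI[of _ v]) simp
  qed
  \<comment> \<open>The extension adds nothing here: the nearby fibres are \<open>{0}\<close> too,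
    so the distance of \<open>v\<close> to them is \<open>norm v\<close>.\<close>
  have "hs (Suc 2) p = {0}" if p: "p \<in> topspace X" for p
  proof -
    have "hs (Suc 2) p = {v. ((\<lambda>q. infdist v (dz_image X A (hs 2) q)) \<longlongrightarrow> 0) (atin X p)}"
      unfolding harmonic_sequence.simps(2) extend_bundle_def using dz2[OF p] by simp
    also have "\<dots> = {v. ((\<lambda>q. norm v) \<longlongrightarrow> 0) (atin X p)}"
    proof -
      have "\<forall>\<^sub>F q in atin X p. infdist v (dz_image X A (hs 2) q) = norm v" for v
        using atin_topspace[OF p] by eventually_elim (simp add: dz2)
      then show ?thesis using tendsto_cong by (intro Collect_cong) fast
    qed
    also have "\<dots> = {0}" by (simp add: tendsto_const_iff[OF atin_nontrivial[OF p]])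
    finally show ?thesis .
  qed
  then show ?thesis unfolding superminimal_def by blast
qed

end

subsection \<open>Local classification\<close>

text \<open>A pointwise relative of \<open>jet_dominated\<close> for systems that prescribe both
  partial derivatives.\<close>

definition locally_dominated :: "complex \<Rightarrow> (complex \<Rightarrow> 'b::real_normed_vector) \<Rightarrow> (complex \<Rightarrow> 'c::real_normed_vector) \<Rightarrow> bool"
  where "locally_dominated w0 y h \<longleftrightarrow> (\<exists>C\<ge>0. \<forall>\<^sub>F w in nhds w0. norm (h w) \<le> C * norm (y w))"

lemma locally_dominated_le:
  assumes "\<And>w. norm (h w) \<le> norm (y w)" shows "locally_dominated w0 y h"
  unfolding locally_dominated_def using assms by (intro exI[of _ 1]) simp

lemma locally_dominated_add:
  assumes "locally_dominated w0 y h" "locally_dominated w0 y k"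
  shows "locally_dominated w0 y (\<lambda>w. h w + k w)"
proof -
  obtain C C' where C: "C \<ge> 0" "\<forall>\<^sub>F w in nhds w0. norm (h w) \<le> C * norm (y w)"
    "C' \<ge> 0" "\<forall>\<^sub>F w in nhds w0. norm (k w) \<le> C' * norm (y w)"
    using assms unfolding locally_dominated_def by blast
  from C(2,4) have "\<forall>\<^sub>F w in nhds w0. norm (h w + k w) \<le> (C + C') * norm (y w)"
    by eventually_elim (rule order_trans[OF norm_triangle_ineq], simp add: algebra_simps)
  then show ?thesis unfolding locally_dominated_def using C by (intro exI[of _ "C + C'"]) auto
qed

lemma locally_dominated_uminus: "locally_dominated w0 y h \<Longrightarrow> locally_dominated w0 y (\<lambda>w. - h w)"
  unfolding locally_dominated_def by simp

lemma locally_dominated_diff: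
  assumes "locally_dominated w0 y h" "locally_dominated w0 y k"
  shows "locally_dominated w0 y (\<lambda>w. h w - k w)"
  using locally_dominated_add[OF assms(1) locally_dominated_uminus[OF assms(2)]] by simp

lemma locally_dominated_scaleR:
  fixes k :: "complex \<Rightarrow> real"
  assumes "open S" "w0 \<in> S" "continuous_on S k" "locally_dominated w0 y h"
  shows "locally_dominated w0 y (\<lambda>w. k w *\<^sub>R h w)"
proof -
  obtain C where C: "C \<ge> 0" "\<forall>\<^sub>F w in nhds w0. norm (h w) \<le> C * norm (y w)"
    using assms(4) unfolding locally_dominated_def by blast
  have "\<forall>\<^sub>F w in nhds w0. norm (k w) \<le> norm (k w0) + 1" by (rule eventually_norm_bounded[OF assms(1-3)])
  with C(2) have "\<forall>\<^sub>F w in nhds w0. norm (k w *\<^sub>R h w) \<le> ((norm (k w0) + 1) * C) * norm (y w)"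
  proof eventually_elim
    case (elim w)
    have "norm (k w *\<^sub>R h w) = norm (k w) * norm (h w)" by simp
    also have "\<dots> \<le> (norm (k w0) + 1) * (C * norm (y w))" using elim C by (intro mult_mono) auto
    finally show ?case by (simp add: mult_ac)
  qed
  then show ?thesis unfolding locally_dominated_def using C by (intro exI[of _ "(norm (k w0) + 1) * C"]) auto
qed

lemmas locally_dominated_mult = locally_dominated_scaleR[where 'b = real, unfolded real_scaleR_def]

lemma locally_dominated_Pair:
  assumes "locally_dominated w0 y h" "locally_dominated w0 y k"
  shows "locally_dominated w0 y (\<lambda>w. (h w, k w))"
proof -
  have "locally_dominated w0 y (\<lambda>w. (h w, 0))" "locally_dominated w0 y (\<lambda>w. (0, k w))"
    using assms unfolding locally_dominated_def by simp_all
  from locally_dominated_add[OF this] show ?thesis by simp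
qed

lemma locally_dominated_cong:
  assumes "open S" "w0 \<in> S" "\<And>w. w \<in> S \<Longrightarrow> h w = k w" "locally_dominated w0 y k"
  shows "locally_dominated w0 y h"
proof -
  obtain C where C: "C \<ge> 0" "\<forall>\<^sub>F w in nhds w0. norm (k w) \<le> C * norm (y w)"
    using assms(4) unfolding locally_dominated_def by blast
  have "\<forall>\<^sub>F w in nhds w0. w \<in> S" using assms by (simp add: eventually_nhds_in_open)
  with C(2) have "\<forall>\<^sub>F w in nhds w0. norm (h w) \<le> C * norm (y w)" by eventually_elim (simp add: assms(3))
  then show ?thesis using C(1) unfolding locally_dominated_def by blast
qed

lemma norm_tuple5:
  fixes a b c d e :: real
  shows "norm a \<le> norm (a, b, c, d, e)" "norm b \<le> norm (a, b, c, d, e)" "norm c \<le> norm (a, b, c, d, e)"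
    "norm d \<le> norm (a, b, c, d, e)" "norm e \<le> norm (a, b, c, d, e)"
  using norm_fst_le[of a "(b, c, d, e)"] norm_snd_le[of "(b, c, d, e)" a] norm_fst_le[of b "(c, d, e)"]
    norm_snd_le[of "(c, d, e)" b] norm_fst_le[of c "(d, e)"] norm_snd_le[of "(d, e)" c] norm_fst_le[of d e] norm_snd_le[of e d]
  by linarith+

text \<open>On a disc with \<open>(C + C') * r < 1\<close> the mean value inequality bounds the
  maximum of \<open>norm y\<close> by a strictly smaller multiple of itself.\<close>

lemma gronwall_zero:
  fixes y :: "complex \<Rightarrow> 'b::real_normed_vector"
  assumes S: "open S" "w0 \<in> S" and y: "smooth_on S y" "y w0 = 0"
    and d: "locally_dominated w0 y (dir_deriv 1 y)" "locally_dominated w0 y (dir_deriv \<i> y)"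
  shows "\<forall>\<^sub>F w in nhds w0. y w = 0"
proof -
  obtain C C' where C: "C \<ge> 0" "\<forall>\<^sub>F w in nhds w0. norm (dir_deriv 1 y w) \<le> C * norm (y w)"
    "C' \<ge> 0" "\<forall>\<^sub>F w in nhds w0. norm (dir_deriv \<i> y w) \<le> C' * norm (y w)"
    using d unfolding locally_dominated_def by blast
  have "\<forall>\<^sub>F w in nhds w0. w \<in> S" using S by (simp add: eventually_nhds_in_open)
  with C(2,4) have "\<forall>\<^sub>F w in nhds w0. w \<in> S \<and> norm (dir_deriv 1 y w) \<le> C * norm (y w)
      \<and> norm (dir_deriv \<i> y w) \<le> C' * norm (y w)" by eventually_elim simp
  then obtain e where e: "e > 0" "\<And>w. dist w w0 < e \<Longrightarrow> w \<in> S \<and> norm (dir_deriv 1 y w) \<le> C * norm (y w)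
      \<and> norm (dir_deriv \<i> y w) \<le> C' * norm (y w)"
    unfolding eventually_nhds_metric by blast
  define r where "r = min (e / 2) (1 / (2 * (C + C' + 1)))"
  have r: "r > 0" "r < e" using e(1) C by (auto simp: r_def)
  have "r \<le> 1 / (2 * (C + C' + 1))" by (simp add: r_def)
  then have Cr: "(C + C') * r < 1"
  proof -
    have "(C + C') * r \<le> (C + C' + 1) * (1 / (2 * (C + C' + 1)))"
      using C r by (intro mult_mono) (auto simp: r_def)
    also have "\<dots> < 1" using C by simp
    finally show ?thesis .
  qed
  have inS: "w \<in> S" "norm (dir_deriv 1 y w) \<le> C * norm (y w)" "norm (dir_deriv \<i> y w) \<le> C' * norm (y w)"
    if "w \<in> cball w0 r" for w
    using e(2)[of w] that r by (auto simp: dist_commute)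
  have "continuous_on (cball w0 r) (\<lambda>w. norm (y w))"
    using inS(1) by (intro continuous_on_norm continuous_on_subset[OF smooth_on_continuous[OF y(1)]]) auto
  then obtain m where m: "m \<in> cball w0 r" "\<And>w. w \<in> cball w0 r \<Longrightarrow> norm (y w) \<le> norm (y m)"
    using continuous_attains_sup[of "cball w0 r" "\<lambda>w. norm (y w)"] r by auto
  have "norm (y m - y w0) \<le> ((C + C') * norm (y m)) * norm (m - w0)"
  proof (rule differentiable_bound[of "cball w0 r" y "\<lambda>x u. dir_deriv u y x"])
    fix x assume x: "x \<in> cball w0 r"
    note dy = smooth_on_differentiable[OF y(1) inS(1)[OF x]]
    show "(y has_derivative (\<lambda>u. dir_deriv u y x)) (at x within cball w0 r)"
      using has_derivative_dir_deriv[OF dy] has_derivative_at_withinI by blast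
    show "onorm (\<lambda>u. dir_deriv u y x) \<le> (C + C') * norm (y m)"
    proof (rule onorm_le)
      fix u
      have "norm (dir_deriv u y x) \<le> \<bar>Re u\<bar> * norm (dir_deriv 1 y x) + \<bar>Im u\<bar> * norm (dir_deriv \<i> y x)"
        using norm_triangle_ineq[of "Re u *\<^sub>R dir_deriv 1 y x" "Im u *\<^sub>R dir_deriv \<i> y x"]
        unfolding dir_deriv_expand[OF dy, of u] by simp
      also have "\<dots> \<le> norm u * (C * norm (y m)) + norm u * (C' * norm (y m))"
        using inS[OF x] m(2)[OF x] C
        by (intro add_mono mult_mono abs_Re_le_cmod abs_Im_le_cmod) (auto intro: order_trans mult_left_mono)
      finally show "norm (dir_deriv u y x) \<le> (C + C') * norm (y m) * norm u" by (simp add: algebra_simps)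
    qed
  qed (use m r in auto)
  also have "\<dots> \<le> ((C + C') * norm (y m)) * r"
    using m(1) C by (intro mult_left_mono) (auto simp: dist_norm norm_minus_commute)
  finally have "norm (y m) * (1 - (C + C') * r) \<le> 0" using y(2) by (simp add: algebra_simps)
  then have "norm (y m) \<le> 0" using Cr by (simp add: mult_le_0_iff)
  then have "y w = 0" if "dist w w0 < r" for w
    using m(2)[of w] that by (simp add: dist_commute)
  then show ?thesis unfolding eventually_nhds_metric using r by blast
qed

lemma deriv_zero_const_on_ball:
  fixes a :: "complex \<Rightarrow> 'b::real_normed_vector"
  assumes "\<And>w. w \<in> ball w0 r \<Longrightarrow> a differentiable (at w) \<and> dir_deriv 1 a w = 0 \<and> dir_deriv \<i> a w = 0"
    and w: "w \<in> ball w0 r"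
  shows "a w = a w0"
proof (rule has_derivative_zero_unique[of "ball w0 r" a w w0])
  show "(a has_derivative (\<lambda>h. 0)) (at x within ball w0 r)" if x: "x \<in> ball w0 r" for x
  proof -
    have "(a has_derivative (\<lambda>u. dir_deriv u a x)) (at x)"
      using assms(1)[OF x] by (intro has_derivative_dir_deriv) blast
    moreover have "(\<lambda>u. dir_deriv u a x) = (\<lambda>u. 0)"
      using assms(1)[OF x] dir_deriv_expand[of a x] by (auto simp: fun_eq_iff)
    ultimately show ?thesis using has_derivative_at_withinI by fastforce
  qed
qed (use w in \<open>auto intro: order_le_less_trans[OF zero_le_dist]\<close>)

section \<open>The derivatives of \<open>P\<close> relative to the span of
  \<open>f, fx, fy, P, Q\<close>\<close>

context conformal_harmonic
begin

lemma restrict: "open T \<Longrightarrow> T \<subseteq> S \<Longrightarrow> conformal_harmonic T f"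
  using smooth_on_subset[OF smooth_f] unit conf1 conf2 immersed harmonic
  by unfold_locales auto

text \<open>If \<open>f \<times>\<^sub>7 eta\<close> vanishes, then \<open>eta\<close> is a multiple
  of \<open>f\<close>, and lengths leave only the factors \<open>E\<close> and \<open>- E\<close>;
  multiplication by \<open>fx\<close> turns these into the almost complex equations of the two
  orientations.\<close>

lemma nu_zero_cases:
  assumes w: "w \<in> S" and "nu w = 0"
  shows "D1 w = 0 \<or> fy w + f w \<times>\<^sub>7 fx w = 0"
proof -
  define t where "t = f w \<bullet> eta w"
  have "f w \<times>\<^sub>7 nu w = t *\<^sub>R f w - eta w"
    unfolding nu_def cross7_double t_def using unit[OF w] by simp
  then have eta: "eta w = t *\<^sub>R f w" using assms(2) by (simp add: cross7.zero_right)
  have "eta w \<times>\<^sub>7 fx w = E w *\<^sub>R fy w"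
    unfolding eta_def cross7_skew[of "fx w \<times>\<^sub>7 fy w"] cross7_double using w by simp
  then have 1: "t *\<^sub>R (f w \<times>\<^sub>7 fx w) = E w *\<^sub>R fy w" unfolding eta cross7.scaleR_left .
  have "t * t = E w * E w" using eta_inner(1)[OF w] unfolding eta by (simp add: unit[OF w])
  then have "t = E w \<or> t = - E w" by (simp add: square_eq_iff)
  then show ?thesis
  proof
    assume "t = E w"
    then have "f w \<times>\<^sub>7 fx w = fy w" using 1 E_pos[OF w] by simp
    then show ?thesis by (simp add: D1_def)
  next
    assume "t = - E w"
    then have "E w *\<^sub>R fy w = - (E w *\<^sub>R (f w \<times>\<^sub>7 fx w))" using 1 by simp
    then have "E w *\<^sub>R (fy w + f w \<times>\<^sub>7 fx w) = 0" by (simp add: scaleR_add_right)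
    then have "fy w + f w \<times>\<^sub>7 fx w = 0" using E_pos[OF w] by simp
    then show ?thesis ..
  qed
qed

text \<open>\<open>r1\<close> and \<open>r2\<close> are the components of \<open>P\<^sub>x\<close> and \<open>P\<^sub>y\<close> orthogonal to \<open>\<phi>, \<phi>\<^sub>x, \<phi>\<^sub>y, P, Q\<close>, provided that
  \<open>iso_at\<close> holds throughout and \<open>P\<close> does not vanish.\<close>

definition "pp w = P w \<bullet> P w"
definition "r1 w = dir_deriv 1 P w + (pp w / E w) *\<^sub>R fx w
  - ((dir_deriv 1 P w \<bullet> P w) / pp w) *\<^sub>R P w - ((dir_deriv 1 P w \<bullet> Q w) / pp w) *\<^sub>R Q w"
definition "r2 w = dir_deriv \<i> P w - (pp w / E w) *\<^sub>R fy w
  - ((dir_deriv \<i> P w \<bullet> P w) / pp w) *\<^sub>R P w - ((dir_deriv \<i> P w \<bullet> Q w) / pp w) *\<^sub>R Q w"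

lemma perp_deriv:
  assumes "smooth_on S a" "\<And>x. x \<in> S \<Longrightarrow> a x \<bullet> c = 0" "w \<in> S"
  shows "dir_deriv u a w \<bullet> c = 0"
  using inner_const_deriv[OF open_S assms(1) smooth_on_const assms(2,3), of u] by simp

lemma perp_all:
  assumes "\<And>x. x \<in> S \<Longrightarrow> f x \<bullet> c = 0" "w \<in> S"
  shows "fx w \<bullet> c = 0" "fy w \<bullet> c = 0" "P w \<bullet> c = 0" "Q w \<bullet> c = 0" "dir_deriv u P w \<bullet> c = 0"
proof -
  have fx: "dir_deriv u f x \<bullet> c = 0" if "x \<in> S" for u x
    by (rule perp_deriv[OF smooth_f assms(1) that])
  have fxx: "dir_deriv v (dir_deriv u f) x \<bullet> c = 0" if "x \<in> S" for u v x
    by (rule perp_deriv[OF smooth_on_dir_deriv[OF open_S smooth_f] fx that])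
  have P: "P x \<bullet> c = 0" if "x \<in> S" for x
    using fx[OF that] fxx[OF that] assms(1)[OF that] by (simp add: P_def inner_add_left inner_diff_left)
  show "fx w \<bullet> c = 0" "fy w \<bullet> c = 0" "P w \<bullet> c = 0" using fx P assms(2) by auto
  show "Q w \<bullet> c = 0"
    using fx[OF assms(2)] fxx[OF assms(2)] by (simp add: Q_def inner_diff_left)
  show "dir_deriv u P w \<bullet> c = 0" by (rule perp_deriv[OF smooth_P P assms(2)])
qed

context
  assumes iso: "\<And>w. w \<in> S \<Longrightarrow> iso_at w"
begin

lemma QQ: "w \<in> S \<Longrightarrow> Q w \<bullet> Q w = pp w" and PQ: "w \<in> S \<Longrightarrow> P w \<bullet> Q w = 0"
  and QP: "w \<in> S \<Longrightarrow> Q w \<bullet> P w = 0"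
  using iso by (auto simp: iso_at_def pp_def inner_commute)

lemma pp_zero: "w \<in> S \<Longrightarrow> P w \<noteq> 0 \<Longrightarrow> pp w \<noteq> 0 \<and> Q w \<noteq> 0"
  using QQ[of w] by (auto simp: pp_def)

lemma kap_eq: "w \<in> S \<Longrightarrow> kap w = 2 * pp w / E w"
  using QQ[of w] by (simp add: kap_def pp_def)

lemma r_orth:
  assumes w: "w \<in> S" and P: "P w \<noteq> 0"
  shows "r1 w \<bullet> f w = 0" "r1 w \<bullet> fx w = 0" "r1 w \<bullet> fy w = 0" "r1 w \<bullet> P w = 0" "r1 w \<bullet> Q w = 0"
    "r2 w \<bullet> f w = 0" "r2 w \<bullet> fx w = 0" "r2 w \<bullet> fy w = 0" "r2 w \<bullet> P w = 0" "r2 w \<bullet> Q w = 0"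
  using pp_zero[OF w P] w E_pos[OF w] P_deriv_tangential[OF w] QQ[OF w] PQ[OF w] QP[OF w]
  by (simp_all add: r1_def r2_def inner_add_left inner_diff_left pp_def)

text \<open>The derivatives of \<open>P\<close>, and by Codazzi those of \<open>Q\<close>, stay in
  the span. Differentiating the two isotropy relations forces \<open>d = a\<close> and
  \<open>c = - b\<close> on their coefficients, which makes \<open>a + \<i> b\<close> the factor of
  \<open>P - \<i> Q\<close>; the tangential parts cancel.\<close>

lemma parallel_if_r_zero:
  assumes w: "w \<in> S" and P: "P w \<noteq> 0" and r: "r1 w = 0" "r2 w = 0"
  shows "\<exists>\<delta>. d_dz (\<lambda>w. cpx (P w) (- Q w)) w = \<delta> *s cpx (P w) (- Q w)"
proof -
  define a b c d where "a = (dir_deriv 1 P w \<bullet> P w) / pp w" and "b = (dir_deriv 1 P w \<bullet> Q w) / pp w"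
    and "c = (dir_deriv \<i> P w \<bullet> P w) / pp w" and "d = (dir_deriv \<i> P w \<bullet> Q w) / pp w"
  have Px: "dir_deriv 1 P w = - (pp w / E w) *\<^sub>R fx w + a *\<^sub>R P w + b *\<^sub>R Q w"
    using r(1) by (simp add: r1_def a_def b_def algebra_simps)
  have Py: "dir_deriv \<i> P w = (pp w / E w) *\<^sub>R fy w + c *\<^sub>R P w + d *\<^sub>R Q w"
    using r(2) by (simp add: r2_def c_def d_def algebra_simps)
  have half: "2 * pp w / E w = pp w / E w + pp w / E w" by simp
  have Qy: "dir_deriv \<i> Q w = - (pp w / E w) *\<^sub>R fx w - a *\<^sub>R P w - b *\<^sub>R Q w"
    unfolding codazzi(1)[OF w] Px kap_eq[OF w] half
    by (rule vector_eq_rdot[THEN iffD1], rule allI, simp only: inner_add_left inner_diff_left inner_minus_left inner_scaleR_left)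
      (simp add: algebra_simps)
  have Qx: "dir_deriv 1 Q w = - (pp w / E w) *\<^sub>R fy w + c *\<^sub>R P w + d *\<^sub>R Q w"
    unfolding codazzi(2)[OF w] Py kap_eq[OF w] half
    by (rule vector_eq_rdot[THEN iffD1], rule allI, simp only: inner_add_left inner_diff_left inner_minus_left inner_scaleR_left)
      (simp add: algebra_simps)
  have cross: "dir_deriv u P w \<bullet> Q w = - (dir_deriv u Q w \<bullet> P w)" for u
    using inner_const_deriv[OF open_S smooth_P smooth_Q PQ w, of u] by (simp add: inner_commute)
  have "dir_deriv u (\<lambda>w. P w \<bullet> P w) w = dir_deriv u (\<lambda>w. Q w \<bullet> Q w) w" for u
    by (rule dir_deriv_cong[OF open_S w]) (use iso in \<open>auto simp: iso_at_def\<close>)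
  then have sq: "dir_deriv u P w \<bullet> P w = dir_deriv u Q w \<bullet> Q w" for u
    unfolding dir_deriv_inner_smooth[OF smooth_P smooth_P w] dir_deriv_inner_smooth[OF smooth_Q smooth_Q w]
    by (simp add: inner_commute)
  have ppw: "P w \<bullet> P w = pp w" "pp w \<noteq> 0" using pp_zero[OF w P] by (simp_all add: pp_def)
  have 1: "d = a"
    using sq[of 1] unfolding Px Qx using w ppw QQ[OF w] PQ[OF w] QP[OF w] by (simp add: inner_add_left inner_diff_left)
  have 2: "c = - b"
    using cross[of 1] unfolding Px Qx using w ppw QQ[OF w] PQ[OF w] QP[OF w]
    by (simp add: inner_add_left inner_diff_left) (simp add: eq_neg_iff_add_eq_0 distrib_right[symmetric] minus_equation_iff)
  have "d_dz (\<lambda>w. cpx (P w) (- Q w)) w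
      = (1/2) *s cpx (dir_deriv 1 P w - dir_deriv \<i> Q w) (- dir_deriv 1 Q w - dir_deriv \<i> P w)"
    using d_dz_cpx[OF smooth_on_differentiable[OF smooth_P w] smooth_on_differentiable[OF smooth_on_uminus[OF open_S smooth_Q] w]]
      dir_deriv_uminus[OF smooth_on_differentiable[OF smooth_Q w]] by simp
  also have "\<dots> = Complex a b *s cpx (P w) (- Q w)"
    unfolding Px Py Qx Qy 1 2 half_scale_cpx Complex_scale_cpx
    by (rule arg_cong2[where f = cpx]; rule vector_eq_rdot[THEN iffD1], rule allI,
        simp only: inner_add_left inner_diff_left inner_minus_left inner_scaleR_left; simp add: algebra_simps)
  finally show ?thesis by blast
qed

text \<open>The constants complete \<open>f, fx, fy, P, Q\<close> to an orthogonal frame of seven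
  vectors. Being built from derivatives of a map into their complement, \<open>r1\<close> and
  \<open>r2\<close> are orthogonal to all of it.\<close>

lemma parallel_if_perp_two:
  assumes perp: "\<And>w. w \<in> S \<Longrightarrow> f w \<bullet> c1 = 0 \<and> f w \<bullet> c2 = 0" and c: "c1 \<noteq> 0" "c2 \<noteq> 0" "c1 \<bullet> c2 = 0"
    and w: "w \<in> S" and P: "P w \<noteq> 0"
  shows "r1 w = 0" "r2 w = 0"
proof -
  note pa = perp_all[of c1, OF _ w] perp_all[of c2, OF _ w]
  have fn: "f w \<noteq> 0" using unit[OF w] by auto
  have fyn: "fy w \<noteq> 0" using fy_fy[OF w] E_pos[OF w] by auto
  have z: "x = 0" if "x \<bullet> f w = 0" "x \<bullet> fx w = 0" "x \<bullet> fy w = 0" "x \<bullet> P w = 0" "x \<bullet> Q w = 0" "x \<bullet> c1 = 0" "x \<bullet> c2 = 0" for x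
  proof (rule orthogonal_seven_zero[of "[f w, fx w, fy w, P w, Q w, c1, c2]"])
    show "\<forall>i<7. \<forall>j<i. [f w, fx w, fy w, P w, Q w, c1, c2] ! i \<bullet> [f w, fx w, fy w, P w, Q w, c1, c2] ! j = 0"
      using w perp pa c(3) PQ[OF w] QP[OF w] by (simp add: numeral_eq_Suc All_less_Suc inner_commute)
  qed (use that fn fyn immersed[OF w] pp_zero[OF w P] P c in auto)
  have rc: "r1 w \<bullet> c1 = 0" "r1 w \<bullet> c2 = 0" "r2 w \<bullet> c1 = 0" "r2 w \<bullet> c2 = 0"
    using perp pa by (simp_all add: r1_def r2_def inner_add_left inner_diff_left)
  show "r1 w = 0" "r2 w = 0" by (rule z; rule r_orth[OF w P] rc)+
qed

text \<open>\<open>iso_at\<close> and \<open>umb_at\<close> make \<open>f, fx, fy, P, Q, nu\<close>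
  orthogonal, so a single direction \<open>n\<close> remains; later arguments compare components
  along it.\<close>

lemma normal_frame:
  assumes w: "w \<in> S" and P: "P w \<noteq> 0" and nu: "nu w \<noteq> 0" and umb: "umb_at w"
  obtains n where "norm n = 1" "n \<bullet> f w = 0" "n \<bullet> fx w = 0" "n \<bullet> fy w = 0" "n \<bullet> P w = 0" "n \<bullet> Q w = 0" "n \<bullet> nu w = 0"
    "\<And>x. x \<bullet> f w = 0 \<Longrightarrow> x \<bullet> fx w = 0 \<Longrightarrow> x \<bullet> fy w = 0 \<Longrightarrow> x \<bullet> P w = 0 \<Longrightarrow> x \<bullet> Q w = 0 \<Longrightarrow> x \<bullet> nu w = 0
      \<Longrightarrow> x = (x \<bullet> n) *\<^sub>R n"
proof -
  have fn: "f w \<noteq> 0" using unit[OF w] by auto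
  have fyn: "fy w \<noteq> 0" using fy_fy[OF w] E_pos[OF w] by auto
  let ?bs = "[f w, fx w, fy w, P w, Q w, nu w]"
  have "\<forall>i<6. \<forall>j<i. ?bs ! i \<bullet> ?bs ! j = 0"
    using w umb PQ[OF w] QP[OF w] nu_orth[OF w] by (simp add: numeral_eq_Suc All_less_Suc inner_commute umb_at_def)
  moreover have "\<forall>b\<in>set ?bs. b \<noteq> 0" using fn fyn immersed[OF w] pp_zero[OF w P] P nu by simp
  ultimately obtain n where n: "norm n = 1" "\<And>b. b \<in> set ?bs \<Longrightarrow> n \<bullet> b = 0"
    "\<And>x. (\<forall>b\<in>set ?bs. x \<bullet> b = 0) \<Longrightarrow> x = (x \<bullet> n) *\<^sub>R n"
    using orthogonal_six_line[of ?bs] by auto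
  show ?thesis by (rule that[of n]) (use n in auto)
qed

text \<open>The products of \<open>c\<close> with \<open>f, fx, fy, P, Q\<close> satisfy a closed
  homogeneous linear system in both directions, so their vanishing at \<open>w0\<close> propagates
  by \<open>gronwall_zero\<close>.\<close>

lemma perp_const_if_r_zero:
  assumes w0: "w0 \<in> S" and P: "\<And>w. w \<in> S \<Longrightarrow> P w \<noteq> 0" and r: "\<And>w. w \<in> S \<Longrightarrow> r1 w = 0 \<and> r2 w = 0"
    and c: "f w0 \<bullet> c = 0" "fx w0 \<bullet> c = 0" "fy w0 \<bullet> c = 0" "P w0 \<bullet> c = 0" "Q w0 \<bullet> c = 0"
  shows "\<forall>\<^sub>F w in nhds w0. f w \<bullet> c = 0"
proof -
  define L where "L p = (fst p \<bullet> c, fst (snd p) \<bullet> c, fst (snd (snd p)) \<bullet> c, fst (snd (snd (snd p))) \<bullet> c, snd (snd (snd (snd p))) \<bullet> c)"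
    for p :: "(real^7) \<times> (real^7) \<times> (real^7) \<times> (real^7) \<times> (real^7)"
  have L: "bounded_linear L" unfolding L_def
    by (intro bounded_linear_Pair bounded_linear_compose[OF bounded_linear_inner_left]
        bounded_linear_compose[OF bounded_linear_fst] bounded_linear_compose[OF bounded_linear_snd]
        bounded_linear_fst bounded_linear_snd)
  define F where "F w = (f w, fx w, fy w, P w, Q w)" for w
  define y where "y w = L (F w)" for w
  note smP = smooth_on_Pair[OF open_S]
  have smF: "smooth_on S F" unfolding F_def
    by (intro smP smooth_f smooth_fx smooth_fy smooth_P smooth_Q)
  have smy: "smooth_on S y" unfolding y_def by (rule smooth_on_linear[OF open_S L smF])
  have dF: "dir_deriv u F w = (dir_deriv u f w, dir_deriv u fx w, dir_deriv u fy w, dir_deriv u P w, dir_deriv u Q w)"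
    if w: "w \<in> S" for u w
  proof -
    have d: "f differentiable (at w)" "fx differentiable (at w)" "fy differentiable (at w)" "P differentiable (at w)" "Q differentiable (at w)"
      using w smooth_f smooth_fx smooth_fy smooth_P smooth_Q by (auto intro: smooth_on_differentiable)
    have p: "(\<lambda>w. (P w, Q w)) differentiable (at w)" "(\<lambda>w. (fy w, P w, Q w)) differentiable (at w)"
      "(\<lambda>w. (fx w, fy w, P w, Q w)) differentiable (at w)"
      by (rule smooth_on_differentiable[OF _ w], intro smP smooth_f smooth_fx smooth_fy smooth_P smooth_Q)+
    show ?thesis unfolding F_def
      using dir_deriv_Pair[OF d(1) p(3), of u] dir_deriv_Pair[OF d(2) p(2), of u] dir_deriv_Pair[OF d(3) p(1), of u]
        dir_deriv_Pair[OF d(4,5), of u] by simp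
  qed
  have dy: "dir_deriv u y w = L (dir_deriv u f w, dir_deriv u fx w, dir_deriv u fy w, dir_deriv u P w, dir_deriv u Q w)"
    if w: "w \<in> S" for u w
    unfolding y_def dir_deriv_linear[OF L smooth_on_differentiable[OF smF w]] dF[OF w] ..
  define a where "a u w = (dir_deriv u P w \<bullet> P w) / pp w" for u w
  define b where "b u w = (dir_deriv u P w \<bullet> Q w) / pp w" for u w
  have smpp: "smooth_on S pp" unfolding pp_def[abs_def] by (intro smooth_on_inner open_S smooth_P)
  have smab: "continuous_on S (a u)" "continuous_on S (b u)" for u
    unfolding a_def b_def using pp_zero P
    by (intro smooth_on_continuous smooth_on_divide smooth_on_inner smooth_on_dir_deriv smooth_P smooth_Q open_S smpp; force)+
  define k where "k w = pp w / E w" for w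
  have "smooth_on S k" unfolding k_def using E_pos by (intro smooth_on_divide open_S smpp smooth_E) force
  then have ck: "continuous_on S k" by (rule smooth_on_continuous)
  have cc: "continuous_on S E" "continuous_on S al" "continuous_on S be"
    by (intro smooth_on_continuous smooth_E smooth_al smooth_be)+
  have Px: "dir_deriv 1 P w = - k w *\<^sub>R fx w + a 1 w *\<^sub>R P w + b 1 w *\<^sub>R Q w" if "w \<in> S" for w
    using r[OF that] by (simp add: r1_def a_def b_def k_def algebra_simps)
  have Py: "dir_deriv \<i> P w = k w *\<^sub>R fy w + a \<i> w *\<^sub>R P w + b \<i> w *\<^sub>R Q w" if "w \<in> S" for w
    using r[OF that] by (simp add: r2_def a_def b_def k_def algebra_simps)
  have kk: "kap w = 2 * k w" if "w \<in> S" for w using kap_eq[OF that] by (simp add: k_def)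
  have comp: "locally_dominated w0 y (\<lambda>w. f w \<bullet> c)" "locally_dominated w0 y (\<lambda>w. fx w \<bullet> c)"
    "locally_dominated w0 y (\<lambda>w. fy w \<bullet> c)" "locally_dominated w0 y (\<lambda>w. P w \<bullet> c)" "locally_dominated w0 y (\<lambda>w. Q w \<bullet> c)"
  proof -
    have "y w = (f w \<bullet> c, fx w \<bullet> c, fy w \<bullet> c, P w \<bullet> c, Q w \<bullet> c)" for w
      by (simp add: y_def F_def L_def)
    then show "locally_dominated w0 y (\<lambda>w. f w \<bullet> c)" "locally_dominated w0 y (\<lambda>w. fx w \<bullet> c)"
      "locally_dominated w0 y (\<lambda>w. fy w \<bullet> c)" "locally_dominated w0 y (\<lambda>w. P w \<bullet> c)" "locally_dominated w0 y (\<lambda>w. Q w \<bullet> c)"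
      by (intro locally_dominated_le; simp only: norm_tuple5)+
  qed
  note ld = locally_dominated_Pair locally_dominated_add locally_dominated_diff locally_dominated_uminus comp
    locally_dominated_mult[OF open_S w0] smab ck cc
  have "locally_dominated w0 y (dir_deriv 1 y)"
  proof (rule locally_dominated_cong[OF open_S w0])
    show "dir_deriv 1 y w = (fx w \<bullet> c,
       - (E w * (f w \<bullet> c)) + al w * (fx w \<bullet> c) - be w * (fy w \<bullet> c) + P w \<bullet> c,
       be w * (fx w \<bullet> c) + al w * (fy w \<bullet> c) + Q w \<bullet> c,
       - (k w * (fx w \<bullet> c)) + a 1 w * (P w \<bullet> c) + b 1 w * (Q w \<bullet> c),
       - (k w * (fy w \<bullet> c)) + a \<i> w * (P w \<bullet> c) + b \<i> w * (Q w \<bullet> c))" if w: "w \<in> S" for w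
      unfolding dy[OF w] L_def fyx[OF w] codazzi[OF w] Px[OF w] Py[OF w] structure_eqs[OF w] kk[OF w]
      by (simp add: inner_add_left inner_diff_left)
  qed (intro ld)
  moreover have "locally_dominated w0 y (dir_deriv \<i> y)"
  proof (rule locally_dominated_cong[OF open_S w0])
    show "dir_deriv \<i> y w = (fy w \<bullet> c,
       be w * (fx w \<bullet> c) + al w * (fy w \<bullet> c) + Q w \<bullet> c,
       - (E w * (f w \<bullet> c)) - al w * (fx w \<bullet> c) + be w * (fy w \<bullet> c) - P w \<bullet> c,
       k w * (fy w \<bullet> c) + a \<i> w * (P w \<bullet> c) + b \<i> w * (Q w \<bullet> c),
       - (k w * (fx w \<bullet> c)) - a 1 w * (P w \<bullet> c) - b 1 w * (Q w \<bullet> c))" if w: "w \<in> S" for w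
      unfolding dy[OF w] L_def codazzi[OF w] Px[OF w] Py[OF w] structure_eqs[OF w] kk[OF w]
      by (simp add: inner_add_left inner_diff_left)
  qed (intro ld)
  moreover have "y w0 = 0" using c by (simp add: y_def L_def F_def zero_prod_def)
  ultimately have "\<forall>\<^sub>F w in nhds w0. y w = 0" using gronwall_zero[OF open_S w0 smy] by blast
  then show ?thesis by eventually_elim (simp add: y_def L_def F_def zero_prod_def)
qed

end

end

text \<open>On the complement of \<open>v\<close>, with \<open>v \<times>\<^sub>7\<close> as complex
  structure, the product is conjugate-linear in each factor under these orthogonality conditions
  (steps \<open>1\<close> and \<open>2\<close>). Rotating both factors by \<open>d\<close> therefore
  rotates it by \<open>- 2 * d\<close>.\<close>

lemma rot7_double:
  assumes v: "v \<bullet> v = 1" and x: "x \<bullet> v = 0" and y: "y \<bullet> v = 0" and xy: "x \<bullet> y = 0" "v \<bullet> (x \<times>\<^sub>7 y) = 0"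
  shows "(cos d *\<^sub>R x + sin d *\<^sub>R (v \<times>\<^sub>7 x)) \<times>\<^sub>7 (cos d *\<^sub>R y + sin d *\<^sub>R (v \<times>\<^sub>7 y))
    = cos (2 * d) *\<^sub>R (x \<times>\<^sub>7 y) - sin (2 * d) *\<^sub>R (v \<times>\<^sub>7 (x \<times>\<^sub>7 y))"
proof -
  have vx: "v \<bullet> x = 0" "v \<bullet> y = 0" using x y by (simp_all add: inner_commute)
  have 1: "x \<times>\<^sub>7 (v \<times>\<^sub>7 y) = - (v \<times>\<^sub>7 (x \<times>\<^sub>7 y))"
    unfolding cross7_polar[of x v y] using x vx xy by simp
  have vJ: "v \<bullet> (v \<times>\<^sub>7 x) = 0" "(v \<times>\<^sub>7 x) \<bullet> v = 0" by simp_all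
  have 2: "(v \<times>\<^sub>7 x) \<times>\<^sub>7 y = - (v \<times>\<^sub>7 (x \<times>\<^sub>7 y))"
  proof -
    have "y \<times>\<^sub>7 (v \<times>\<^sub>7 x) = - (v \<times>\<^sub>7 (y \<times>\<^sub>7 x))"
      unfolding cross7_polar[of y v x] using y vx xy by (simp add: inner_commute)
    then show ?thesis
      unfolding cross7_skew[of "v \<times>\<^sub>7 x" y] cross7_skew[of x y] by (simp add: cross7.minus_right)
  qed
  have J: "(v \<times>\<^sub>7 x) \<bullet> y = 0" using xy(2) cross7_cycle[of v x y] by (simp add: inner_commute)
  have 3: "(v \<times>\<^sub>7 x) \<times>\<^sub>7 (v \<times>\<^sub>7 y) = - (x \<times>\<^sub>7 y)"
  proof -
    have "(v \<times>\<^sub>7 x) \<times>\<^sub>7 (v \<times>\<^sub>7 y) = - (v \<times>\<^sub>7 ((v \<times>\<^sub>7 x) \<times>\<^sub>7 y))"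
      unfolding cross7_polar[of "v \<times>\<^sub>7 x" v y] using vJ vx J by simp
    also have "\<dots> = v \<times>\<^sub>7 (v \<times>\<^sub>7 (x \<times>\<^sub>7 y))" unfolding 2 by (simp add: cross7.minus_right)
    finally show ?thesis unfolding cross7_double using xy(2) v by simp
  qed
  have "(cos d *\<^sub>R x + sin d *\<^sub>R (v \<times>\<^sub>7 x)) \<times>\<^sub>7 (cos d *\<^sub>R y + sin d *\<^sub>R (v \<times>\<^sub>7 y))
    = (cos d * cos d - sin d * sin d) *\<^sub>R (x \<times>\<^sub>7 y) - (2 * (sin d * cos d)) *\<^sub>R (v \<times>\<^sub>7 (x \<times>\<^sub>7 y))"
    unfolding cross7.add_left cross7.add_right cross7.scaleR_left cross7.scaleR_right 1 2 3
    by (rule vector_eq_rdot[THEN iffD1], rule allI,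
        simp only: inner_add_left inner_diff_left inner_minus_left inner_scaleR_left)
      (simp add: algebra_simps)
  then show ?thesis by (simp add: cos_double sin_double power2_eq_square mult.assoc)
qed

section \<open>Constancy of the direction of \<open>nu\<close> and the rotation angle\<close>

context conformal_harmonic
begin

context
  assumes iso: "\<And>w. w \<in> S \<Longrightarrow> iso_at w" and umb: "\<And>w. w \<in> S \<Longrightarrow> umb_at w"
begin

text \<open>\<open>Z\<close>, the derivative of \<open>nu\<close> without its
  \<open>nu\<close>-part, lies on the line of \<open>n\<close>, as do \<open>r1\<close> and
  \<open>r2\<close>. Differentiating once more the orthogonality of \<open>nu\<close> to the
  derivatives of \<open>P\<close> and \<open>Q\<close>, and using symmetry of second derivatives,
  gives two linear equations for the \<open>n\<close>-components of \<open>Z\<close>, with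
  determinant \<open>m1 * m1 + m2 * m2\<close>.\<close>

lemma nu_deriv_parallel:
  assumes w: "w \<in> S" and P: "P w \<noteq> 0" and nu: "nu w \<noteq> 0" and r: "r1 w \<noteq> 0 \<or> r2 w \<noteq> 0"
  shows "dir_deriv 1 nu w = ((dir_deriv 1 nu w \<bullet> nu w) / (nu w \<bullet> nu w)) *\<^sub>R nu w"
    "dir_deriv \<i> nu w = ((dir_deriv \<i> nu w \<bullet> nu w) / (nu w \<bullet> nu w)) *\<^sub>R nu w"
proof -
  obtain n where n: "norm n = 1" and
    line: "\<And>x. x \<bullet> f w = 0 \<Longrightarrow> x \<bullet> fx w = 0 \<Longrightarrow> x \<bullet> fy w = 0 \<Longrightarrow> x \<bullet> P w = 0 \<Longrightarrow> x \<bullet> Q w = 0 \<Longrightarrow> x \<bullet> nu w = 0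
      \<Longrightarrow> x = (x \<bullet> n) *\<^sub>R n"
    using normal_frame[OF iso w P nu umb[OF w]] by metis
  have nn: "n \<bullet> n = 1" using n by (simp add: dot_square_norm)
  have uu: "P x \<bullet> nu x = 0" "Q x \<bullet> nu x = 0" if "x \<in> S" for x using umb[OF that] by (auto simp: umb_at_def)
  have pd: "dir_deriv 1 P x \<bullet> nu x = 0" "dir_deriv \<i> P x \<bullet> nu x = 0"
    "dir_deriv 1 Q x \<bullet> nu x = 0" "dir_deriv \<i> Q x \<bullet> nu x = 0" if "x \<in> S" for x
    using nu_orth_deriv[OF iso umb that] by simp_all
  have ortho: "r1 w \<bullet> f w = 0" "r1 w \<bullet> fx w = 0" "r1 w \<bullet> fy w = 0" "r1 w \<bullet> P w = 0" "r1 w \<bullet> Q w = 0"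
    "r2 w \<bullet> f w = 0" "r2 w \<bullet> fx w = 0" "r2 w \<bullet> fy w = 0" "r2 w \<bullet> P w = 0" "r2 w \<bullet> Q w = 0"
    using r_orth[OF iso w P] by simp_all
  define a where "a u = (dir_deriv u nu w \<bullet> nu w) / (nu w \<bullet> nu w)" for u
  define Z where "Z u = dir_deriv u nu w - a u *\<^sub>R nu w" for u
  have nun: "nu w \<bullet> f w = 0" "nu w \<bullet> fx w = 0" "nu w \<bullet> fy w = 0" "nu w \<bullet> P w = 0" "nu w \<bullet> Q w = 0"
    using nu_orth[OF w] uu[OF w] by (simp_all add: inner_commute)
  have dnu: "dir_deriv u nu w \<bullet> b w = - (nu w \<bullet> dir_deriv u b w)"
    if "smooth_on S b" "\<And>x. x \<in> S \<Longrightarrow> nu x \<bullet> b x = 0" for u and b :: "complex \<Rightarrow> real^7"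
    using inner_const_deriv[OF open_S smooth_nu that(1,2) w, of u] by simp
  have PQnu: "nu x \<bullet> P x = 0" "nu x \<bullet> Q x = 0" if "x \<in> S" for x using uu[OF that] by (simp_all add: inner_commute)
  have Zo: "Z u \<bullet> f w = 0" "Z u \<bullet> fx w = 0" "Z u \<bullet> fy w = 0" "Z u \<bullet> P w = 0" "Z u \<bullet> Q w = 0" "Z u \<bullet> nu w = 0"
    if u: "u = 1 \<or> u = \<i>" for u
  proof -
    have d: "nu w \<bullet> dir_deriv u f w = 0" "nu w \<bullet> dir_deriv u fx w = 0" "nu w \<bullet> dir_deriv u fy w = 0"
      "nu w \<bullet> dir_deriv u P w = 0" "nu w \<bullet> dir_deriv u Q w = 0"
      using u nun pd[OF w] by (auto simp: fyx[OF w] structure_eqs[OF w] inner_add_right inner_diff_right inner_commute)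
    show "Z u \<bullet> f w = 0" "Z u \<bullet> fx w = 0" "Z u \<bullet> fy w = 0" "Z u \<bullet> P w = 0" "Z u \<bullet> Q w = 0"
      unfolding Z_def inner_diff_left inner_scaleR_left nun
      using dnu[OF smooth_f nu_orth(1), of u] dnu[OF smooth_fx nu_orth(2), of u] dnu[OF smooth_fy nu_orth(3), of u]
        dnu[OF smooth_P PQnu(1), of u] dnu[OF smooth_Q PQnu(2), of u] d by simp_all
    show "Z u \<bullet> nu w = 0" using nu by (simp add: Z_def a_def inner_diff_left)
  qed
  have rnu: "r1 w \<bullet> nu w = 0" "r2 w \<bullet> nu w = 0"
    using pd[OF w] uu[OF w] nun(2,3)[unfolded inner_commute[of "nu w"]]
    by (simp_all add: r1_def r2_def inner_add_left inner_diff_left)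
  define m1 m2 where "m1 = r1 w \<bullet> n" and "m2 = r2 w \<bullet> n"
  have R: "r1 w = m1 *\<^sub>R n" "r2 w = m2 *\<^sub>R n"
    unfolding m1_def m2_def by (rule line; (rule ortho rnu))+
  define z where "z u = Z u \<bullet> n" for u
  have ZZ: "Z u = z u *\<^sub>R n" if "u = 1 \<or> u = \<i>" for u
    unfolding z_def by (rule line; rule Zo[OF that])
  have dP: "dir_deriv u nu w \<bullet> dir_deriv u' P w = Z u \<bullet> dir_deriv u' P w" if "u' = 1 \<or> u' = \<i>" for u u'
    using pd[OF w, unfolded inner_commute[of _ "nu w"]] that by (auto simp: Z_def inner_diff_left)
  have ZP: "Z u \<bullet> dir_deriv 1 P w = Z u \<bullet> r1 w" "Z u \<bullet> dir_deriv \<i> P w = Z u \<bullet> r2 w" if "u = 1 \<or> u = \<i>" for u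
    using Zo[OF that] by (simp_all add: r1_def r2_def inner_add_right inner_diff_right)
  have cP: "dir_deriv \<i> nu w \<bullet> dir_deriv 1 P w = dir_deriv 1 nu w \<bullet> dir_deriv \<i> P w"
  proof -
    have "nu w \<bullet> dir_deriv \<i> (dir_deriv 1 P) w = - (dir_deriv \<i> nu w \<bullet> dir_deriv 1 P w)"
      by (rule inner_const_deriv[OF open_S smooth_nu smooth_on_dir_deriv_basis(1)[OF smooth_P] _ w, of 0])
        (use pd(1) in \<open>simp add: inner_commute\<close>)
    moreover have "nu w \<bullet> dir_deriv 1 (dir_deriv \<i> P) w = - (dir_deriv 1 nu w \<bullet> dir_deriv \<i> P w)"
      by (rule inner_const_deriv[OF open_S smooth_nu smooth_on_dir_deriv_basis(2)[OF smooth_P] _ w, of 0])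
        (use pd(2) in \<open>simp add: inner_commute\<close>)
    ultimately show ?thesis using dir_deriv_commute[OF open_S smooth_P w, of \<i> 1] by simp
  qed
  have cQ: "dir_deriv \<i> nu w \<bullet> dir_deriv 1 Q w = dir_deriv 1 nu w \<bullet> dir_deriv \<i> Q w"
  proof -
    have "nu w \<bullet> dir_deriv \<i> (dir_deriv 1 Q) w = - (dir_deriv \<i> nu w \<bullet> dir_deriv 1 Q w)"
      by (rule inner_const_deriv[OF open_S smooth_nu smooth_on_dir_deriv_basis(1)[OF smooth_Q] _ w, of 0])
        (use pd(3) in \<open>simp add: inner_commute\<close>)
    moreover have "nu w \<bullet> dir_deriv 1 (dir_deriv \<i> Q) w = - (dir_deriv 1 nu w \<bullet> dir_deriv \<i> Q w)"
      by (rule inner_const_deriv[OF open_S smooth_nu smooth_on_dir_deriv_basis(2)[OF smooth_Q] _ w, of 0])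
        (use pd(4) in \<open>simp add: inner_commute\<close>)
    ultimately show ?thesis using dir_deriv_commute[OF open_S smooth_Q w, of \<i> 1] by simp
  qed
  have dnut: "dir_deriv u nu w \<bullet> fx w = 0" "dir_deriv u nu w \<bullet> fy w = 0" if "u = 1 \<or> u = \<i>" for u
    using Zo(2,3)[OF that] nun by (simp_all add: Z_def inner_diff_left)
  have "dir_deriv \<i> nu w \<bullet> dir_deriv 1 P w = Z \<i> \<bullet> r1 w" "dir_deriv 1 nu w \<bullet> dir_deriv \<i> P w = Z 1 \<bullet> r2 w"
    "dir_deriv \<i> nu w \<bullet> dir_deriv \<i> P w = Z \<i> \<bullet> r2 w" "dir_deriv 1 nu w \<bullet> dir_deriv 1 P w = Z 1 \<bullet> r1 w"
    using dP ZP[of 1] ZP[of \<i>] by simp_all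
  \<comment> \<open>Codazzi turns the relation \<open>cQ\<close> into one for \<open>P\<close>; the
    tangential terms drop out by \<open>dnut\<close>.\<close>
  then have "Z \<i> \<bullet> r1 w = Z 1 \<bullet> r2 w" "Z \<i> \<bullet> r2 w = - (Z 1 \<bullet> r1 w)"
    using cP cQ dnut unfolding codazzi[OF w] by (simp_all add: inner_diff_right)
  then have e1: "z \<i> * m1 = z 1 * m2" and e2: "z \<i> * m2 = - (z 1 * m1)"
    unfolding R using ZZ[of 1] ZZ[of \<i>] by (simp_all add: nn mult.commute)
  have "m1 \<noteq> 0 \<or> m2 \<noteq> 0" using r unfolding R by auto
  then have pos: "m1 * m1 + m2 * m2 \<noteq> 0" by (simp add: sum_squares_eq_zero_iff)
  have "z 1 * (m1 * m1 + m2 * m2) = m2 * (z 1 * m2) + m1 * (z 1 * m1)" by (simp add: algebra_simps)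
  also have "\<dots> = m2 * (z \<i> * m1) + m1 * (- (z \<i> * m2))" using e1 e2 by simp
  finally have "z 1 = 0" using pos by auto
  moreover have "z \<i> * (m1 * m1 + m2 * m2) = m1 * (z \<i> * m1) + m2 * (z \<i> * m2)" by (simp add: algebra_simps)
  then have "z \<i> * (m1 * m1 + m2 * m2) = 0" unfolding e1 e2 by simp
  then have "z \<i> = 0" using pos by auto
  ultimately have "Z 1 = 0" "Z \<i> = 0" using ZZ[of 1] ZZ[of \<i>] by simp_all
  then show "dir_deriv 1 nu w = ((dir_deriv 1 nu w \<bullet> nu w) / (nu w \<bullet> nu w)) *\<^sub>R nu w"
    "dir_deriv \<i> nu w = ((dir_deriv \<i> nu w \<bullet> nu w) / (nu w \<bullet> nu w)) *\<^sub>R nu w"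
    by (simp_all add: Z_def a_def)
qed

text \<open>By \<open>nu_deriv_parallel\<close> the component of \<open>nu\<close> orthogonal to
  \<open>nu w0\<close> has derivatives proportional to itself, so it stays zero; continuity keeps
  the remaining component positive.\<close>

lemma nu_direction_constant:
  assumes w0: "w0 \<in> S" and P: "\<And>w. w \<in> S \<Longrightarrow> P w \<noteq> 0" and nu: "\<And>w. w \<in> S \<Longrightarrow> nu w \<noteq> 0"
    and r: "\<And>w. w \<in> S \<Longrightarrow> r1 w \<noteq> 0 \<or> r2 w \<noteq> 0"
  obtains v where "v \<bullet> v = 1" "\<forall>\<^sub>F w in nhds w0. nu w = (nu w \<bullet> v) *\<^sub>R v \<and> nu w \<bullet> v > 0"
proof -
  define v where "v = (1 / norm (nu w0)) *\<^sub>R nu w0"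
  have nn: "norm (nu w0) > 0" using nu[OF w0] by simp
  have vv: "v \<bullet> v = 1" using nn by (simp add: v_def dot_square_norm power2_eq_square)
  have v0: "nu w0 \<bullet> v = norm (nu w0)" using nn by (simp add: v_def dot_square_norm power2_eq_square)
  define L where "L x = x - (x \<bullet> v) *\<^sub>R v" for x
  have L: "bounded_linear L" unfolding L_def
    by (intro bounded_linear_sub bounded_linear_ident bounded_linear_compose[OF bounded_linear_scaleR_left] bounded_linear_inner_left)
  define y where "y w = L (nu w)" for w
  have sm: "smooth_on S y" unfolding y_def by (rule smooth_on_linear[OF open_S L smooth_nu])
  have y0: "y w0 = 0" unfolding y_def L_def v0 using nn by (simp add: v_def)
  have Ls: "L (k *\<^sub>R x) = k *\<^sub>R L x" for k x by (simp add: L_def scaleR_diff_right)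
  have dom: "locally_dominated w0 y (dir_deriv u y)" if u: "u = 1 \<or> u = \<i>" for u
  proof (rule locally_dominated_cong[OF open_S w0])
    show "dir_deriv u y w = ((dir_deriv u nu w \<bullet> nu w) / (nu w \<bullet> nu w)) *\<^sub>R y w" if w: "w \<in> S" for w
    proof -
      have "dir_deriv u y w = L (dir_deriv u nu w)"
        unfolding y_def by (rule dir_deriv_linear[OF L smooth_on_differentiable[OF smooth_nu w]])
      then show ?thesis using nu_deriv_parallel[OF w P[OF w] nu[OF w] r[OF w]] u Ls unfolding y_def by metis
    qed
    show "locally_dominated w0 y (\<lambda>w. ((dir_deriv u nu w \<bullet> nu w) / (nu w \<bullet> nu w)) *\<^sub>R y w)"
      using nu by (intro locally_dominated_scaleR[OF open_S w0] smooth_on_continuous smooth_on_divide smooth_on_inner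
          smooth_on_dir_deriv smooth_nu open_S locally_dominated_le) auto
  qed
  have "\<forall>\<^sub>F w in nhds w0. y w = 0" by (intro gronwall_zero[OF open_S w0 sm y0] dom) auto
  moreover have "\<forall>\<^sub>F w in nhds w0. nu w \<bullet> v > 0"
  proof -
    have "isCont nu w0" using smooth_on_continuous[OF smooth_nu] open_S w0 by (simp add: continuous_on_eq_continuous_at)
    then have "(nu \<longlongrightarrow> nu w0) (nhds w0)" by (simp add: isCont_def tendsto_nhds_iff)
    then have "((\<lambda>w. nu w \<bullet> v) \<longlongrightarrow> nu w0 \<bullet> v) (nhds w0)" by (intro tendsto_intros)
    then show ?thesis using nn v0 by (intro order_tendstoD) auto
  qed
  ultimately have "\<forall>\<^sub>F w in nhds w0. nu w = (nu w \<bullet> v) *\<^sub>R v \<and> nu w \<bullet> v > 0"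
    by eventually_elim (simp add: y_def L_def)
  then show ?thesis using that vv by blast
qed

text \<open>Since \<open>nu\<close> is a multiple of \<open>v\<close>, \<open>eta\<close> is a
  combination of \<open>f\<close> and \<open>v \<times>\<^sub>7 f\<close>, and
  \<open>f \<times>\<^sub>7 fx\<close> is \<open>fy\<close> rotated about \<open>v\<close> by an
  angle with cosine \<open>a\<close> and sine \<open>s\<close>. The angle is constant:
  \<open>v \<times>\<^sub>7 fx\<close> is orthogonal to \<open>fy\<close>, and the derivative of
  this relation makes that of \<open>a\<close> vanish.\<close>

lemma rotation_angle:
  assumes w0: "w0 \<in> S" and v: "v \<bullet> v = 1" and fv: "\<And>w. w \<in> S \<Longrightarrow> f w \<bullet> v = 0"
    and nu: "\<And>w. w \<in> S \<Longrightarrow> nu w = (nu w \<bullet> v) *\<^sub>R v \<and> nu w \<bullet> v > 0"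
  obtains d where "\<forall>\<^sub>F w in nhds w0. cos d *\<^sub>R fy w + sin d *\<^sub>R (v \<times>\<^sub>7 fy w)
     = (cos d *\<^sub>R f w + sin d *\<^sub>R (v \<times>\<^sub>7 f w)) \<times>\<^sub>7 (cos d *\<^sub>R fx w + sin d *\<^sub>R (v \<times>\<^sub>7 fx w))"
proof -
  define a where "a w = (f w \<bullet> eta w) / E w" for w
  define s where "s w = (nu w \<bullet> v) / E w" for w
  have s_pos: "s w > 0" if "w \<in> S" for w using nu[OF that] E_pos[OF that] by (simp add: s_def)
  have nu_s: "nu w = (E w * s w) *\<^sub>R v" if "w \<in> S" for w using nu[OF that] E_pos[OF that] by (simp add: s_def)
  have pv: "fx w \<bullet> v = 0" "fy w \<bullet> v = 0" "P w \<bullet> v = 0" "Q w \<bullet> v = 0" if "w \<in> S" for w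
    using perp_all[of v, OF fv that] by auto
  have f_eta: "f w \<bullet> eta w = E w * a w" if "w \<in> S" for w using E_pos[OF that] by (simp add: a_def)
  have eta_eq: "eta w = (E w * a w) *\<^sub>R f w + (E w * s w) *\<^sub>R (v \<times>\<^sub>7 f w)" if w: "w \<in> S" for w
  proof -
    have "f w \<times>\<^sub>7 nu w = (f w \<bullet> eta w) *\<^sub>R f w - eta w"
      unfolding nu_def cross7_double using unit[OF w] by simp
    then have "eta w = (E w * a w) *\<^sub>R f w - f w \<times>\<^sub>7 nu w" by (simp add: f_eta[OF w])
    then show ?thesis unfolding nu_s[OF w] cross7.scaleR_right cross7_skew[of "f w" v] by simp
  qed
  have a2: "(a w)\<^sup>2 + (s w)\<^sup>2 = 1" if w: "w \<in> S" for w
  proof -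
    have "(v \<times>\<^sub>7 f w) \<bullet> (v \<times>\<^sub>7 f w) = 1"
      using cross7_inner_square[of v "f w"] v unit[OF w] fv[OF w] by (simp add: inner_commute)
    then have "E w * E w = (E w * a w)\<^sup>2 + (E w * s w)\<^sup>2"
      using eta_inner(1)[OF w] unit[OF w] unfolding eta_eq[OF w]
      by (simp add: inner_add_left inner_add_right power2_eq_square)
    then have "E w * E w * ((a w)\<^sup>2 + (s w)\<^sup>2) = E w * E w * 1" by (simp add: power2_eq_square algebra_simps)
    then show ?thesis using E_pos[OF w] by simp
  qed
  have tri: "fy w \<times>\<^sub>7 (f w \<times>\<^sub>7 fx w) = nu w" "fx w \<times>\<^sub>7 (fy w \<times>\<^sub>7 f w) = nu w" if w: "w \<in> S" for w
  proof -
    have "fy w \<times>\<^sub>7 (f w \<times>\<^sub>7 fx w) = - (f w \<times>\<^sub>7 (fy w \<times>\<^sub>7 fx w))"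
      unfolding cross7_polar[of "fy w" "f w" "fx w"] using w by simp
    then show 1: "fy w \<times>\<^sub>7 (f w \<times>\<^sub>7 fx w) = nu w"
      unfolding cross7_skew[of "fy w" "fx w"] by (simp add: nu_def eta_def cross7.minus_right)
    have "fx w \<times>\<^sub>7 (fy w \<times>\<^sub>7 f w) = - (fy w \<times>\<^sub>7 (fx w \<times>\<^sub>7 f w))"
      unfolding cross7_polar[of "fx w" "fy w" "f w"] using w by simp
    then show "fx w \<times>\<^sub>7 (fy w \<times>\<^sub>7 f w) = nu w"
      using 1 unfolding cross7_skew[of "fx w" "f w"] by (simp add: cross7.minus_right)
  qed
  have ffx: "f w \<times>\<^sub>7 fx w = a w *\<^sub>R fy w + s w *\<^sub>R (v \<times>\<^sub>7 fy w)"
    and fyf: "fy w \<times>\<^sub>7 f w = a w *\<^sub>R fx w + s w *\<^sub>R (v \<times>\<^sub>7 fx w)" if w: "w \<in> S" for w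
  proof -
    note Ep = E_pos[OF w]
    have c: "fy w \<bullet> (f w \<times>\<^sub>7 fx w) = E w * a w" "fx w \<bullet> (fy w \<times>\<^sub>7 f w) = E w * a w"
      using f_eta[OF w] cross7_cycle[of "fx w" "fy w" "f w"] cross7_cycle[of "fy w" "f w" "fx w"]
      by (simp_all add: eta_def inner_commute)
    have "fy w \<times>\<^sub>7 nu w = (E w * a w) *\<^sub>R fy w - E w *\<^sub>R (f w \<times>\<^sub>7 fx w)"
      unfolding tri(1)[OF w, symmetric] cross7_double c using w by simp
    then have "E w *\<^sub>R (f w \<times>\<^sub>7 fx w) = E w *\<^sub>R (a w *\<^sub>R fy w + s w *\<^sub>R (v \<times>\<^sub>7 fy w))"
      unfolding nu_s[OF w] cross7.scaleR_right cross7_skew[of "fy w" v] by (simp add: algebra_simps)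
    then show "f w \<times>\<^sub>7 fx w = a w *\<^sub>R fy w + s w *\<^sub>R (v \<times>\<^sub>7 fy w)" using Ep by simp
    have "fx w \<times>\<^sub>7 nu w = (E w * a w) *\<^sub>R fx w - E w *\<^sub>R (fy w \<times>\<^sub>7 f w)"
      unfolding tri(2)[OF w, symmetric] cross7_double c using w by simp
    then have "E w *\<^sub>R (fy w \<times>\<^sub>7 f w) = E w *\<^sub>R (a w *\<^sub>R fx w + s w *\<^sub>R (v \<times>\<^sub>7 fx w))"
      unfolding nu_s[OF w] cross7.scaleR_right cross7_skew[of "fx w" v] by (simp add: algebra_simps)
    then show "fy w \<times>\<^sub>7 f w = a w *\<^sub>R fx w + s w *\<^sub>R (v \<times>\<^sub>7 fx w)" using Ep by simp
  qed
  have vv: "(v \<times>\<^sub>7 x) \<bullet> y = - ((v \<times>\<^sub>7 y) \<bullet> x)" for x y by (rule cross7_swap)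
  \<comment> \<open>The span of \<open>f, fx, fy\<close> is isotropic for the two-form
    \<open>(v \<times>\<^sub>7 x) \<bullet> y\<close>: by \<open>eta_eq\<close>, \<open>eta\<close>
    is orthogonal to \<open>v\<close>, and its orthogonality to \<open>fx\<close> and
    \<open>fy\<close> gives the rest.\<close>
  have lag: "(v \<times>\<^sub>7 fx w) \<bullet> fy w = 0" "(v \<times>\<^sub>7 f w) \<bullet> fy w = 0" "(v \<times>\<^sub>7 f w) \<bullet> fx w = 0" if w: "w \<in> S" for w
  proof -
    have e: "eta w \<bullet> fx w = 0" "eta w \<bullet> fy w = 0" by (simp_all add: eta_def)
    then have "(E w * s w) * ((v \<times>\<^sub>7 f w) \<bullet> fx w) = 0" "(E w * s w) * ((v \<times>\<^sub>7 f w) \<bullet> fy w) = 0"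
      using w unfolding eta_eq[OF w] by (simp_all add: inner_add_left)
    then show "(v \<times>\<^sub>7 f w) \<bullet> fy w = 0" "(v \<times>\<^sub>7 f w) \<bullet> fx w = 0" using E_pos[OF w] s_pos[OF w] by auto
    have "eta w \<bullet> v = 0" using fv[OF w] unfolding eta_eq[OF w] by (simp add: inner_add_left)
    then show "(v \<times>\<^sub>7 fx w) \<bullet> fy w = 0" using cross7_cycle[of v "fx w" "fy w"] by (simp add: eta_def)
  qed
  have sm_v: "smooth_on S (\<lambda>w. v \<times>\<^sub>7 fx w)"
    by (rule smooth_on_cross7[OF open_S smooth_on_const smooth_fx])
  have dlag: "(v \<times>\<^sub>7 fx w) \<bullet> dir_deriv u fy w = - ((v \<times>\<^sub>7 dir_deriv u fx w) \<bullet> fy w)" if w: "w \<in> S" for u w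
    using inner_const_deriv[OF open_S sm_v smooth_fy lag(1) w, of u]
      dir_deriv_cross7_smooth[OF smooth_on_const smooth_fx w, of u v] by (simp add: cross7.zero_left)
  \<comment> \<open>The derivatives of \<open>lag\<close> leave just these normal terms, the
    combinations that occur in the derivatives of \<open>a\<close>.\<close>
  have sym1: "(v \<times>\<^sub>7 fx w) \<bullet> Q w = (v \<times>\<^sub>7 fy w) \<bullet> P w"
    and sym2: "(v \<times>\<^sub>7 fx w) \<bullet> P w = - ((v \<times>\<^sub>7 fy w) \<bullet> Q w)" if w: "w \<in> S" for w
  proof -
    have z: "(v \<times>\<^sub>7 fx w) \<bullet> f w = 0" "(v \<times>\<^sub>7 fy w) \<bullet> f w = 0" "(v \<times>\<^sub>7 fy w) \<bullet> fx w = 0"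
      using lag[OF w] vv[of "fx w" "f w"] vv[of "fy w" "f w"] vv[of "fy w" "fx w"] by simp_all
    show "(v \<times>\<^sub>7 fx w) \<bullet> Q w = (v \<times>\<^sub>7 fy w) \<bullet> P w"
      using dlag[OF w, of 1] vv[of "fxx w" "fy w"] lag[OF w] z
      unfolding fyx[OF w] structure_eqs[OF w] by (simp add: inner_add_right inner_diff_right)
    show "(v \<times>\<^sub>7 fx w) \<bullet> P w = - ((v \<times>\<^sub>7 fy w) \<bullet> Q w)"
      using dlag[OF w, of \<i>] vv[of "fxy w" "fy w"] lag[OF w] z
      unfolding structure_eqs[OF w] by (simp add: inner_add_right inner_diff_right)
  qed
  have sm_fe: "smooth_on S (\<lambda>w. f w \<bullet> eta w)" by (intro smooth_on_inner open_S smooth_f smooth_eta)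
  have smE': "smooth_on S (\<lambda>w. inverse (E w))"
    by (rule smooth_on_inverse[OF open_S _ smooth_E]) (use E_pos in force)
  have sm_a: "smooth_on S a" unfolding a_def divide_inverse by (rule smooth_on_mult[OF open_S sm_fe smE'])
  have da: "dir_deriv 1 a w = 0" "dir_deriv \<i> a w = 0" if w: "w \<in> S" for w
  proof -
    have dfe: "dir_deriv u (\<lambda>w. f w \<bullet> eta w) w = E w * dir_deriv u a w + dir_deriv u E w * a w" for u
    proof -
      have "dir_deriv u (\<lambda>w. f w \<bullet> eta w) w = dir_deriv u (\<lambda>w. E w * a w) w"
        by (rule dir_deriv_cong[OF open_S w f_eta])
      then show ?thesis
        using dir_deriv_bilinear[OF bounded_bilinear_mult smooth_on_differentiable[OF smooth_E w] smooth_on_differentiable[OF sm_a w], of u]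
        by simp
    qed
    have ex: "fx w \<bullet> eta w = 0" "fy w \<bullet> eta w = 0" by (simp_all add: eta_def)
    have rots: "f w \<bullet> (P w \<times>\<^sub>7 fy w) = P w \<bullet> (fy w \<times>\<^sub>7 f w)" "f w \<bullet> (fx w \<times>\<^sub>7 Q w) = Q w \<bullet> (f w \<times>\<^sub>7 fx w)"
      "f w \<bullet> (Q w \<times>\<^sub>7 fy w) = Q w \<bullet> (fy w \<times>\<^sub>7 f w)" "f w \<bullet> (fx w \<times>\<^sub>7 P w) = P w \<bullet> (f w \<times>\<^sub>7 fx w)"
      using cross7_cycle[of "P w" "fy w" "f w"] cross7_cycle[of "f w" "fx w" "Q w"]
        cross7_cycle[of "Q w" "fy w" "f w"] cross7_cycle[of "f w" "fx w" "P w"]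
      by (simp_all add: inner_commute)
    have "dir_deriv 1 (\<lambda>w. f w \<bullet> eta w) w = 2 * al w * (f w \<bullet> eta w)
        + s w * (P w \<bullet> (v \<times>\<^sub>7 fx w) + Q w \<bullet> (v \<times>\<^sub>7 fy w))"
      unfolding dir_deriv_inner_smooth[OF smooth_f smooth_eta w] eta_deriv[OF w] ex
      using w by (simp add: inner_add_right inner_diff_right rots ffx[OF w] fyf[OF w] algebra_simps)
    then have "E w * dir_deriv 1 a w = 0"
      using sym2[OF w] unfolding dfe E_deriv[OF w] f_eta[OF w] by (simp add: inner_commute)
    then show "dir_deriv 1 a w = 0" using E_pos[OF w] by simp
    have "dir_deriv \<i> (\<lambda>w. f w \<bullet> eta w) w = 2 * be w * (f w \<bullet> eta w)
        + s w * (Q w \<bullet> (v \<times>\<^sub>7 fx w) - P w \<bullet> (v \<times>\<^sub>7 fy w))"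
      unfolding dir_deriv_inner_smooth[OF smooth_f smooth_eta w] eta_deriv[OF w] ex
      using w by (simp add: inner_add_right inner_diff_right rots ffx[OF w] fyf[OF w] algebra_simps)
    then have "E w * dir_deriv \<i> a w = 0"
      using sym1[OF w] unfolding dfe E_deriv[OF w] f_eta[OF w] by (simp add: inner_commute)
    then show "dir_deriv \<i> a w = 0" using E_pos[OF w] by simp
  qed
  obtain \<rho> where \<rho>: "\<rho> > 0" "ball w0 \<rho> \<subseteq> S" using open_S w0 openE by blast
  have a_const: "a w = a w0" if "w \<in> ball w0 \<rho>" for w
    using da \<rho>(2) smooth_on_differentiable[OF sm_a] that by (intro deriv_zero_const_on_ball[of w0 \<rho> a w]) auto
  \<comment> \<open>Positivity of \<open>s\<close> places the angle in the range of
    \<open>arccos\<close>, so that its sine is \<open>s\<close> and not \<open>- s\<close>.\<close>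
  define \<gamma> where "\<gamma> = arccos (a w0)"
  have "(a w0)\<^sup>2 \<le> 1" using a2[OF w0] zero_le_power2[of "s w0"] by linarith
  then have a1: "\<bar>a w0\<bar> \<le> 1" by (simp add: abs_square_le_1)
  have \<gamma>: "cos \<gamma> = a w" "sin \<gamma> = s w" if w: "w \<in> ball w0 \<rho>" for w
  proof -
    have wS: "w \<in> S" using w \<rho> by blast
    show "cos \<gamma> = a w" unfolding \<gamma>_def a_const[OF w] using a1 by (simp add: cos_arccos_abs)
    have "sin \<gamma> = sqrt (1 - (a w)\<^sup>2)" unfolding \<gamma>_def a_const[OF w] using a1 by (simp add: sin_arccos_abs)
    also have "\<dots> = sqrt ((s w)\<^sup>2)" using a2[OF wS] by (metis add_diff_cancel_left')
    also have "\<dots> = s w" using s_pos[OF wS] by simp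
    finally show "sin \<gamma> = s w" .
  qed
  \<comment> \<open>Rotating both factors by \<open>d\<close> changes the angle
    \<open>\<gamma>\<close> of their product into \<open>\<gamma> - 2 * d\<close>, while the
    left-hand side is rotated by \<open>d\<close>; a third of \<open>\<gamma>\<close> makes the two
    agree.\<close>
  define d where "d = \<gamma> / 3"
  have "cos d *\<^sub>R fy w + sin d *\<^sub>R (v \<times>\<^sub>7 fy w)
     = (cos d *\<^sub>R f w + sin d *\<^sub>R (v \<times>\<^sub>7 f w)) \<times>\<^sub>7 (cos d *\<^sub>R fx w + sin d *\<^sub>R (v \<times>\<^sub>7 fx w))" if w: "w \<in> ball w0 \<rho>" for w
  proof -
    have wS: "w \<in> S" using w \<rho> by blast
    have vfy: "v \<bullet> fy w = 0" using pv(2)[OF wS] by (simp add: inner_commute)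
    have g: "f w \<times>\<^sub>7 fx w = cos \<gamma> *\<^sub>R fy w + sin \<gamma> *\<^sub>R (v \<times>\<^sub>7 fy w)" unfolding \<gamma>[OF w] by (rule ffx[OF wS])
    have "v \<bullet> (f w \<times>\<^sub>7 fx w) = 0" unfolding g using vfy by (simp add: inner_add_right)
    then have "(cos d *\<^sub>R f w + sin d *\<^sub>R (v \<times>\<^sub>7 f w)) \<times>\<^sub>7 (cos d *\<^sub>R fx w + sin d *\<^sub>R (v \<times>\<^sub>7 fx w))
      = cos (2 * d) *\<^sub>R (f w \<times>\<^sub>7 fx w) - sin (2 * d) *\<^sub>R (v \<times>\<^sub>7 (f w \<times>\<^sub>7 fx w))"
      using wS by (intro rot7_double v fv pv) auto
    also have "v \<times>\<^sub>7 (f w \<times>\<^sub>7 fx w) = cos \<gamma> *\<^sub>R (v \<times>\<^sub>7 fy w) - sin \<gamma> *\<^sub>R fy w"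
      unfolding g cross7.add_right cross7.scaleR_right cross7_double using v vfy by simp
    also have "cos (2 * d) *\<^sub>R (f w \<times>\<^sub>7 fx w) - sin (2 * d) *\<^sub>R (cos \<gamma> *\<^sub>R (v \<times>\<^sub>7 fy w) - sin \<gamma> *\<^sub>R fy w)
      = (cos \<gamma> * cos (2 * d) + sin \<gamma> * sin (2 * d)) *\<^sub>R fy w + (sin \<gamma> * cos (2 * d) - cos \<gamma> * sin (2 * d)) *\<^sub>R (v \<times>\<^sub>7 fy w)"
      unfolding g by (simp add: algebra_simps)
    also have "\<dots> = cos (\<gamma> - 2 * d) *\<^sub>R fy w + sin (\<gamma> - 2 * d) *\<^sub>R (v \<times>\<^sub>7 fy w)"
      by (simp add: cos_diff sin_diff)
    also have "\<gamma> - 2 * d = d" by (simp add: d_def)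
    finally show ?thesis by simp
  qed
  then have "\<forall>\<^sub>F w in nhds w0. cos d *\<^sub>R fy w + sin d *\<^sub>R (v \<times>\<^sub>7 fy w)
     = (cos d *\<^sub>R f w + sin d *\<^sub>R (v \<times>\<^sub>7 f w)) \<times>\<^sub>7 (cos d *\<^sub>R fx w + sin d *\<^sub>R (v \<times>\<^sub>7 fx w))"
    unfolding eventually_nhds_metric using \<rho>(1) by (intro exI[of _ \<rho>]) (auto simp: dist_commute)
  then show ?thesis by (rule that)
qed

end

end

section \<open>Almost complex points and fullness\<close>

context conformal_harmonic
begin

text \<open>The equation in direction 1 implies the one in direction \<open>\<i>\<close> because
  \<open>D2\<close> equals \<open>f \<times>\<^sub>7 D1\<close>; real linearity gives the rest. This
  form is independent of the holomorphic coordinate.\<close>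

lemma D1_zero_iff:
  assumes w: "w \<in> S"
  shows "D1 w = 0 \<longleftrightarrow> (\<forall>u. dir_deriv (\<i> * u) f w = f w \<times>\<^sub>7 dir_deriv u f w)"
proof
  assume D: "D1 w = 0"
  then have 1: "f w \<times>\<^sub>7 fx w = fy w" by (simp add: D1_def)
  have "D2 w = 0" using D2_eq[OF w] D by (simp add: cross7.zero_right)
  then have 2: "f w \<times>\<^sub>7 fy w = - fx w" by (simp add: D2_def eq_neg_iff_add_eq_0 add.commute)
  note d = smooth_on_differentiable[OF smooth_f w]
  show "\<forall>u. dir_deriv (\<i> * u) f w = f w \<times>\<^sub>7 dir_deriv u f w"
  proof
    fix u
    show "dir_deriv (\<i> * u) f w = f w \<times>\<^sub>7 dir_deriv u f w"
      unfolding dir_deriv_expand[OF d, of u] dir_deriv_expand[OF d, of "\<i> * u"]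
      by (simp add: cross7.add_right cross7.scaleR_right 1 2)
  qed
next
  assume "\<forall>u. dir_deriv (\<i> * u) f w = f w \<times>\<^sub>7 dir_deriv u f w"
  from this[rule_format, of 1] show "D1 w = 0" by (simp add: D1_def)
qed

text \<open>Orthogonality to \<open>f, fx, fy, P, Q, nu\<close> makes \<open>c\<close> a multiple of
  \<open>n\<close>; but one of \<open>r1\<close>, \<open>r2\<close> is a non-zero multiple of
  \<open>n\<close>, and both are orthogonal to \<open>c\<close>.\<close>

lemma full_in_perp:
  assumes iso: "\<And>w. w \<in> S \<Longrightarrow> iso_at w" and umb: "\<And>w. w \<in> S \<Longrightarrow> umb_at w"
    and w: "w \<in> S" and P: "P w \<noteq> 0" and nu: "nu w \<noteq> 0" and r: "r1 w \<noteq> 0 \<or> r2 w \<noteq> 0"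
    and perp: "\<And>w. w \<in> S \<Longrightarrow> f w \<bullet> c = 0" and cnu: "nu w \<bullet> c = 0"
  shows "c = 0"
proof -
  obtain n where n: "norm n = 1" and
    line: "\<And>x. x \<bullet> f w = 0 \<Longrightarrow> x \<bullet> fx w = 0 \<Longrightarrow> x \<bullet> fy w = 0 \<Longrightarrow> x \<bullet> P w = 0 \<Longrightarrow> x \<bullet> Q w = 0 \<Longrightarrow> x \<bullet> nu w = 0
      \<Longrightarrow> x = (x \<bullet> n) *\<^sub>R n"
    using normal_frame[OF iso w P nu umb[OF w]] by metis
  have nn: "n \<bullet> n = 1" using n by (simp add: dot_square_norm)
  note pa = perp_all[of c, OF perp w]
  have c: "c = (c \<bullet> n) *\<^sub>R n" by (rule line) (use pa perp[OF w] cnu in \<open>simp_all add: inner_commute\<close>)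
  have o: "r1 w \<bullet> f w = 0" "r1 w \<bullet> fx w = 0" "r1 w \<bullet> fy w = 0" "r1 w \<bullet> P w = 0" "r1 w \<bullet> Q w = 0"
    "r2 w \<bullet> f w = 0" "r2 w \<bullet> fx w = 0" "r2 w \<bullet> fy w = 0" "r2 w \<bullet> P w = 0" "r2 w \<bullet> Q w = 0"
    using r_orth[OF iso w P] by simp_all
  have pd: "dir_deriv 1 P w \<bullet> nu w = 0" "dir_deriv \<i> P w \<bullet> nu w = 0" "P w \<bullet> nu w = 0" "Q w \<bullet> nu w = 0"
    using nu_orth_deriv[OF iso umb w] umb[OF w] by (simp_all add: umb_at_def)
  have rnu: "r1 w \<bullet> nu w = 0" "r2 w \<bullet> nu w = 0"
    using pd nu_orth(2,3)[OF w, unfolded inner_commute[of "nu w"]]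
    by (simp_all add: r1_def r2_def inner_add_left inner_diff_left)
  have rc: "r1 w \<bullet> c = 0" "r2 w \<bullet> c = 0"
    using pa by (simp_all add: r1_def r2_def inner_add_left inner_diff_left)
  have R: "r1 w = (r1 w \<bullet> n) *\<^sub>R n" "r2 w = (r2 w \<bullet> n) *\<^sub>R n"
    by (rule line; rule o rnu)+
  have "(r1 w \<bullet> n) * (c \<bullet> n) = 0" "(r2 w \<bullet> n) * (c \<bullet> n) = 0"
    using rc by (metis R(1) inner_commute inner_scaleR_left, metis R(2) inner_commute inner_scaleR_left)
  moreover have "r1 w \<bullet> n \<noteq> 0 \<or> r2 w \<bullet> n \<noteq> 0" using r R by auto
  ultimately have "c \<bullet> n = 0" by auto
  then show "c = 0" using c by simp
qed

end

subsection \<open>Global classification\<close>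

context rsurface
begin

lemma isolated_chart:
  assumes "(U,z) \<in> A" "p \<in> U" "openin X V" "p \<in> V" "\<And>q. q \<in> U \<Longrightarrow> q \<in> V \<Longrightarrow> q \<noteq> p \<Longrightarrow> Pr (z q)"
  shows "\<forall>\<^sub>F w in at (z p). Pr w"
  unfolding eventually_at_filter
  by (rule eventually_nhds_chart[OF assms(1-4)]) (use assms(5) in auto)

end

context minimal_surface
begin

abbreviation "chD U z \<equiv> conformal_harmonic.D1 (in_chart U z \<phi>)"

lemma D1_chart_change:
  assumes c: "(U,z) \<in> A" "(U',z') \<in> A" and q: "q \<in> U" "q \<in> U'" and D: "chD U z (z q) = 0"
  shows "chD U' z' (z' q) = 0"
proof -
  interpret c1: conformal_harmonic "z ` U" "in_chart U z \<phi>" by (rule chart_conformal_harmonic[OF c(1)])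
  interpret c2: conformal_harmonic "z' ` U'" "in_chart U' z' \<phi>" by (rule chart_conformal_harmonic[OF c(2)])
  have zq: "z q \<in> z ` U" "z' q \<in> z' ` U'" using q by auto
  have d: "dir_deriv u (in_chart U' z' \<phi>) (z' q) = dir_deriv (chart_deriv U z U' z' q * u) (in_chart U z \<phi>) (z q)" for u
    by (rule dir_deriv_chart_change[OF c q smooth_on_differentiable[OF c1.smooth_f zq(1)]])
  have D': "\<forall>u. dir_deriv (\<i> * u) (in_chart U z \<phi>) (z q) = in_chart U z \<phi> (z q) \<times>\<^sub>7 dir_deriv u (in_chart U z \<phi>) (z q)"
    using D unfolding c1.D1_zero_iff[OF zq(1)] .
  show ?thesis unfolding c2.D1_zero_iff[OF zq(2)]
  proof
    fix u
    have e: "chart_deriv U z U' z' q * (\<i> * u) = \<i> * (chart_deriv U z U' z' q * u)" by simp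
    show "dir_deriv (\<i> * u) (in_chart U' z' \<phi>) (z' q) = in_chart U' z' \<phi> (z' q) \<times>\<^sub>7 dir_deriv u (in_chart U' z' \<phi>) (z' q)"
      unfolding d e in_chart_at[OF c(2) q(2)]
      using D'[rule_format, of "chart_deriv U z U' z' q * u"] unfolding in_chart_at[OF c(1) q(1)] .
  qed
qed

lemma D1_dichotomy:
  "(\<forall>(U,z)\<in>A. \<forall>p\<in>U. chD U z (z p) = 0) \<or> (\<forall>(U,z)\<in>A. \<forall>p\<in>U. \<forall>\<^sub>F w in at (z p). chD U z w \<noteq> 0)"
proof -
  define Pr where "Pr p \<longleftrightarrow> (\<exists>(U,z)\<in>A. p \<in> U \<and> chD U z (z p) = 0)" for p
  have Pr: "Pr p \<longleftrightarrow> chD U z (z p) = 0" if "(U,z) \<in> A" "p \<in> U" for U z p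
    unfolding Pr_def using D1_chart_change that by blast
  have "(\<exists>V. openin X V \<and> p \<in> V \<and> (\<forall>q\<in>V. Pr q)) \<or> (\<exists>V. openin X V \<and> p \<in> V \<and> (\<forall>q\<in>V - {p}. \<not> Pr q))"
    if p: "p \<in> topspace X" for p
  proof -
    obtain U z where c: "(U,z) \<in> A" "p \<in> U" using chart_at[OF p] .
    interpret ch: conformal_harmonic "z ` U" "in_chart U z \<phi>" by (rule chart_conformal_harmonic[OF c(1)])
    have zp: "z p \<in> z ` U" using c by blast
    from ch.D1_isolated_or_zero[OF zp] show ?thesis
    proof
      assume "\<forall>\<^sub>F w in nhds (z p). ch.D1 w = 0"
      from eventually_chart_nhds[OF c this] obtain V where V: "openin X V" "p \<in> V" "V \<subseteq> U" "\<And>q. q \<in> V \<Longrightarrow> ch.D1 (z q) = 0"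
        by blast
      then have "\<forall>q\<in>V. Pr q" using Pr[OF c(1)] by blast
      then show ?thesis using V by blast
    next
      assume "\<forall>\<^sub>F w in at (z p). ch.D1 w \<noteq> 0"
      from eventually_chart_at[OF c this] obtain V where V: "openin X V" "p \<in> V" "V \<subseteq> U"
        "\<And>q. q \<in> V \<Longrightarrow> q \<noteq> p \<Longrightarrow> ch.D1 (z q) \<noteq> 0" by blast
      then have "\<forall>q\<in>V - {p}. \<not> Pr q" using Pr[OF c(1)] by blast
      then show ?thesis using V by blast
    qed
  qed
  from everywhere_or_isolated[of Pr, OF this] show ?thesis
  proof
    assume a: "\<forall>p\<in>topspace X. Pr p"
    have "chD U z (z p) = 0" if "(U,z) \<in> A" "p \<in> U" for U z p
      using a Pr[OF that] chart(4)[OF that(1)] that(2) by blast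
    then show ?thesis by blast
  next
    assume a: "\<forall>p\<in>topspace X. \<exists>V. openin X V \<and> p \<in> V \<and> (\<forall>q\<in>V - {p}. \<not> Pr q)"
    have "\<forall>\<^sub>F w in at (z p). chD U z w \<noteq> 0" if c: "(U,z) \<in> A" "p \<in> U" for U z p
    proof -
      obtain V where V: "openin X V" "p \<in> V" "\<forall>q\<in>V - {p}. \<not> Pr q" using a chart(4)[OF c(1)] c(2) by blast
      show ?thesis by (rule isolated_chart[OF c V(1,2)]) (use V(3) Pr[OF c(1)] in blast)
    qed
    then show ?thesis by blast
  qed
qed

lemma pre2_dichotomy:
  "(\<forall>p\<in>topspace X. pre2 p = {0}) \<or> (\<forall>p\<in>topspace X. \<exists>V. openin X V \<and> p \<in> V \<and> (\<forall>q\<in>V - {p}. pre2 q \<noteq> {0}))"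
proof (rule everywhere_or_isolated)
  fix p assume p: "p \<in> topspace X"
  obtain U z where c: "(U,z) \<in> A" "p \<in> U" using chart_at[OF p] .
  interpret ch: conformal_harmonic "z ` U" "in_chart U z \<phi>" by (rule chart_conformal_harmonic[OF c(1)])
  have zp: "z p \<in> z ` U" using c by blast
  from ch.PQ_isolated_or_zero[OF zp]
  show "(\<exists>V. openin X V \<and> p \<in> V \<and> (\<forall>q\<in>V. pre2 q = {0})) \<or> (\<exists>V. openin X V \<and> p \<in> V \<and> (\<forall>q\<in>V - {p}. pre2 q \<noteq> {0}))"
  proof
    assume "\<forall>\<^sub>F w in nhds (z p). ch.P w = 0 \<and> ch.Q w = 0"
    from eventually_chart_nhds[OF c this] obtain V where V: "openin X V" "p \<in> V" "V \<subseteq> U" "\<And>q. q \<in> V \<Longrightarrow> ch.P (z q) = 0 \<and> ch.Q (z q) = 0"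
      by blast
    then have "\<forall>q\<in>V. pre2 q = {0}" using pre2_zero_iff[OF c(1)] by blast
    then show ?thesis using V by blast
  next
    assume "\<forall>\<^sub>F w in at (z p). \<not> (ch.P w = 0 \<and> ch.Q w = 0)"
    from eventually_chart_at[OF c this] obtain V where V: "openin X V" "p \<in> V" "V \<subseteq> U"
      "\<And>q. q \<in> V \<Longrightarrow> q \<noteq> p \<Longrightarrow> \<not> (ch.P (z q) = 0 \<and> ch.Q (z q) = 0)" by blast
    then have "\<forall>q\<in>V - {p}. pre2 q \<noteq> {0}" using pre2_zero_iff[OF c(1)] by blast
    then show ?thesis using V by blast
  qed
qed

lemma perp_unique_continuation:
  assumes c0: "(U0,z0) \<in> A" "p0 \<in> U0" and zero: "\<forall>\<^sub>F w in nhds (z0 p0). in_chart U0 z0 \<phi> w \<bullet> c = 0"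
    and p: "p \<in> topspace X"
  shows "\<phi> p \<bullet> c = 0"
proof -
  \<comment> \<open>Vanishing near \<open>p\<close> and not merely at \<open>p\<close>: then the
    gradient vanishes as well, which is what \<open>inner_isolated_or_zero\<close> can exclude at
    neighbouring points.\<close>
  define Pr where "Pr p \<longleftrightarrow> (\<exists>V. openin X V \<and> p \<in> V \<and> (\<forall>q\<in>V. \<phi> q \<bullet> c = 0))" for p
  from eventually_chart_nhds[OF c0 zero] obtain V0 where V0: "openin X V0" "p0 \<in> V0" "V0 \<subseteq> U0"
    "\<And>q. q \<in> V0 \<Longrightarrow> in_chart U0 z0 \<phi> (z0 q) \<bullet> c = 0" by blast
  have "\<phi> q \<bullet> c = 0" if "q \<in> V0" for q
    using V0(4)[OF that] in_chart_at[OF c0(1) subsetD[OF V0(3) that], of \<phi>] by simp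
  then have Pr0: "\<forall>q\<in>V0. Pr q" unfolding Pr_def using V0 by blast
  have "(\<exists>V. openin X V \<and> p \<in> V \<and> (\<forall>q\<in>V. Pr q)) \<or> (\<exists>V. openin X V \<and> p \<in> V \<and> (\<forall>q\<in>V - {p}. \<not> Pr q))"
    if p: "p \<in> topspace X" for p
  proof -
    obtain U z where ch: "(U,z) \<in> A" "p \<in> U" using chart_at[OF p] .
    interpret ch: conformal_harmonic "z ` U" "in_chart U z \<phi>" by (rule chart_conformal_harmonic[OF ch(1)])
    have zp: "z p \<in> z ` U" using ch by blast
    from ch.inner_isolated_or_zero[OF zp, of c] show ?thesis
    proof
      assume "\<forall>\<^sub>F w in nhds (z p). in_chart U z \<phi> w \<bullet> c = 0"
      from eventually_chart_nhds[OF ch this] obtain V where V: "openin X V" "p \<in> V" "V \<subseteq> U"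
        "\<And>q. q \<in> V \<Longrightarrow> in_chart U z \<phi> (z q) \<bullet> c = 0" by blast
      have "\<phi> q \<bullet> c = 0" if "q \<in> V" for q
        using V(4)[OF that] in_chart_at[OF ch(1) subsetD[OF V(3) that], of \<phi>] by simp
      then show ?thesis unfolding Pr_def using V by blast
    next
      assume "\<forall>\<^sub>F w in at (z p). \<not> (in_chart U z \<phi> w \<bullet> c = 0 \<and> ch.fx w \<bullet> c = 0 \<and> ch.fy w \<bullet> c = 0)"
      from eventually_chart_at[OF ch this] obtain V where V: "openin X V" "p \<in> V" "V \<subseteq> U"
        "\<And>q. q \<in> V \<Longrightarrow> q \<noteq> p \<Longrightarrow> \<not> (in_chart U z \<phi> (z q) \<bullet> c = 0 \<and> ch.fx (z q) \<bullet> c = 0 \<and> ch.fy (z q) \<bullet> c = 0)" by blast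
      have "\<not> Pr q" if q: "q \<in> V" "q \<noteq> p" for q
      proof
        assume "Pr q"
        then obtain V' where V': "openin X V'" "q \<in> V'" "\<forall>q\<in>V'. \<phi> q \<bullet> c = 0" unfolding Pr_def by blast
        define T where "T = z ` (U \<inter> V')"
        have T: "open T" "z q \<in> T" "T \<subseteq> z ` U"
          unfolding T_def using open_chart_image[OF ch(1) V'(1)] V' V(3) q by auto
        have fT: "in_chart U z \<phi> w \<bullet> c = 0" if "w \<in> T" for w using that V'(3) ch(1) unfolding T_def by auto
        interpret cT: conformal_harmonic T "in_chart U z \<phi>" by (rule ch.restrict[OF T(1,3)])
        show False using V(4)[OF q] fT[OF T(2)] cT.perp_all(1,2)[OF fT T(2)] by blast
      qed
      then show ?thesis using V by blast
    qed
  qed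
  from everywhere_or_isolated[of Pr, OF this] show ?thesis
  proof
    assume "\<forall>p\<in>topspace X. Pr p"
    then show ?thesis using p unfolding Pr_def by blast
  next
    assume "\<forall>p\<in>topspace X. \<exists>V. openin X V \<and> p \<in> V \<and> (\<forall>q\<in>V - {p}. \<not> Pr q)"
    then obtain V where V: "openin X V" "p0 \<in> V" "\<forall>q\<in>V - {p0}. \<not> Pr q"
      using chart(4)[OF c0(1)] c0(2) by blast
    obtain q where "q \<in> V \<inter> V0" "q \<noteq> p0" using not_isolated[of "V \<inter> V0" p0] V V0 by blast
    then show ?thesis using V(3) Pr0 by blast
  qed
qed

text \<open>Used for the antipodal map, with \<open>v = 0\<close>, and for rotations about
  \<open>v\<close>; it makes the dichotomies available for the new maps.\<close>

lemma isometric_image: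
  assumes L: "bounded_linear L" and perp: "\<And>p. p \<in> topspace X \<Longrightarrow> \<phi> p \<bullet> v = 0"
    and isom: "\<And>x y. x \<bullet> v = 0 \<Longrightarrow> y \<bullet> v = 0 \<Longrightarrow> L x \<bullet> L y = x \<bullet> y"
  shows "minimal_surface X A (\<lambda>p. L (\<phi> p))"
proof -
  interpret L: bounded_linear L by (rule L)
  have ic: "in_chart U z (\<lambda>p. L (\<phi> p)) = (\<lambda>w. L (in_chart U z \<phi> w))" for U z
    by (simp add: in_chart_def fun_eq_iff)
  have key: "(\<forall>u. dir_deriv u (\<lambda>w. L (in_chart U z \<phi> w)) w = L (dir_deriv u (in_chart U z \<phi>) w)
      \<and> dir_deriv u (in_chart U z \<phi>) w \<bullet> v = 0) \<and> in_chart U z \<phi> w \<bullet> v = 0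
    \<and> (\<forall>u t. dir_deriv t (dir_deriv u (\<lambda>w. L (in_chart U z \<phi> w))) w = L (dir_deriv t (dir_deriv u (in_chart U z \<phi>)) w)
      \<and> dir_deriv t (dir_deriv u (in_chart U z \<phi>)) w \<bullet> v = 0)"
    if c: "(U,z) \<in> A" and w: "w \<in> z ` U" for U z w
  proof -
    interpret ch: conformal_harmonic "z ` U" "in_chart U z \<phi>" by (rule chart_conformal_harmonic[OF c])
    have f0: "in_chart U z \<phi> x \<bullet> v = 0" if "x \<in> z ` U" for x
      using that c perp chart(4)[OF c] by auto
    have d: "dir_deriv u (\<lambda>w. L (in_chart U z \<phi> w)) x = L (dir_deriv u (in_chart U z \<phi>) x)" if "x \<in> z ` U" for u x
      by (rule dir_deriv_linear[OF L smooth_on_differentiable[OF ch.smooth_f that]])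
    have df: "dir_deriv u (in_chart U z \<phi>) x \<bullet> v = 0" if "x \<in> z ` U" for u x
      by (rule ch.perp_deriv[OF ch.smooth_f f0 that])
    have dd: "dir_deriv t (dir_deriv u (\<lambda>w. L (in_chart U z \<phi> w))) w = L (dir_deriv t (dir_deriv u (in_chart U z \<phi>)) w)" for t u
    proof -
      have "dir_deriv t (dir_deriv u (\<lambda>w. L (in_chart U z \<phi> w))) w = dir_deriv t (\<lambda>x. L (dir_deriv u (in_chart U z \<phi>) x)) w"
        by (rule dir_deriv_cong[OF ch.open_S w d])
      also have "\<dots> = L (dir_deriv t (dir_deriv u (in_chart U z \<phi>)) w)"
        by (rule dir_deriv_linear[OF L smooth_on_differentiable[OF smooth_on_dir_deriv[OF ch.open_S ch.smooth_f] w]])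
      finally show ?thesis .
    qed
    have ddf: "dir_deriv t (dir_deriv u (in_chart U z \<phi>)) w \<bullet> v = 0" for t u
      by (rule ch.perp_deriv[OF smooth_on_dir_deriv[OF ch.open_S ch.smooth_f] df w])
    show ?thesis using f0[OF w] d[OF w] df[OF w] dd ddf by blast
  qed
  show ?thesis
  proof
    show "(\<lambda>p. L (\<phi> p)) ` topspace X \<subseteq> sphere 0 1"
    proof clarify
      fix p assume p: "p \<in> topspace X"
      have "norm (\<phi> p) = 1" using in_sphere p by auto
      then have "norm (L (\<phi> p)) = 1" using isom[OF perp[OF p] perp[OF p]] by (simp add: norm_eq_sqrt_inner)
      then show "L (\<phi> p) \<in> sphere 0 1" by simp
    qed
    show "smooth_map_on A (topspace X) (\<lambda>p. L (\<phi> p))"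
      unfolding smooth_map_on_def ic
    proof clarify
      fix U z assume c: "(U,z) \<in> A"
      show "smooth_on (z ` (U \<inter> topspace X)) (\<lambda>w. L (in_chart U z \<phi> w))"
        by (rule smooth_on_linear[OF _ L smooth_map_onD[OF smooth c]]) (intro open_chart_image[OF c] openin_topspace)
    qed
    show "conformal_immersion A (\<lambda>p. L (\<phi> p))"
      unfolding conformal_immersion_def pointwise_def ic
    proof clarify
      fix U z p assume c: "(U,z) \<in> A" and p: "p \<in> U"
      interpret ch: conformal_harmonic "z ` U" "in_chart U z \<phi>" by (rule chart_conformal_harmonic[OF c])
      have zp: "z p \<in> z ` U" using p by blast
      note k = key[OF c zp]
      note d = smooth_on_differentiable[OF ch.smooth_f zp]
      have ff: "dir_deriv u (\<lambda>w. L (in_chart U z \<phi> w)) (z p) \<bullet> dir_deriv t (\<lambda>w. L (in_chart U z \<phi> w)) (z p)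
          = ch.E (z p) * (u \<bullet> t)" for u t
      proof -
        have "dir_deriv u (\<lambda>w. L (in_chart U z \<phi> w)) (z p) \<bullet> dir_deriv t (\<lambda>w. L (in_chart U z \<phi> w)) (z p)
          = dir_deriv u (in_chart U z \<phi>) (z p) \<bullet> dir_deriv t (in_chart U z \<phi>) (z p)"
          using k isom by simp
        also have "\<dots> = ch.E (z p) * (u \<bullet> t)"
          unfolding dir_deriv_expand[OF d, of u] dir_deriv_expand[OF d, of t]
          using zp by (simp add: inner_add_left inner_add_right inner_complex_def algebra_simps)
        finally show ?thesis .
      qed
      have "inj (\<lambda>u. dir_deriv u (\<lambda>w. L (in_chart U z \<phi> w)) (z p))"
      proof (rule injI)
        fix x y assume xy: "dir_deriv x (\<lambda>w. L (in_chart U z \<phi> w)) (z p) = dir_deriv y (\<lambda>w. L (in_chart U z \<phi> w)) (z p)"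
        have "ch.E (z p) * (x \<bullet> t) = ch.E (z p) * (y \<bullet> t)" for t
          unfolding ff[symmetric] xy ..
        then have "x \<bullet> t = y \<bullet> t" for t using ch.E_pos[OF zp] by simp
        then show "x = y" using vector_eq_rdot[of x y] by blast
      qed
      then show "inj (\<lambda>u. dir_deriv u (\<lambda>w. L (in_chart U z \<phi> w)) (z p)) \<and>
        (\<exists>c. \<forall>u t. first_form (\<lambda>w. L (in_chart U z \<phi> w)) (z p) u t = c * (u \<bullet> t))"
        unfolding first_form_def ff by blast
    qed
    show "sphere_harmonic A (\<lambda>p. L (\<phi> p))"
      unfolding sphere_harmonic_def pointwise_def ic
    proof clarify
      fix U z p assume c: "(U,z) \<in> A" and p: "p \<in> U"
      interpret ch: conformal_harmonic "z ` U" "in_chart U z \<phi>" by (rule chart_conformal_harmonic[OF c])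
      have zp: "z p \<in> z ` U" using p by blast
      note k = key[OF c zp]
      define d where "d = ch.fxx (z p) + ch.fyy (z p)"
      have dv: "d \<bullet> v = 0" using k by (simp add: d_def inner_add_left)
      have "sphere_tangential (L (in_chart U z \<phi> (z p))) (L d) = L (sphere_tangential (in_chart U z \<phi> (z p)) d)"
        unfolding sphere_tangential_def using isom[OF dv, of "in_chart U z \<phi> (z p)"] k by (simp add: L.diff L.scaleR)
      also have "\<dots> = 0" using ch.harmonic[OF zp] by (simp add: d_def L.zero)
      finally show "sphere_tangential (L (in_chart U z \<phi> (z p)))
         (dir_deriv 1 (dir_deriv 1 (\<lambda>w. L (in_chart U z \<phi> w))) (z p)
          + dir_deriv \<i> (dir_deriv \<i> (\<lambda>w. L (in_chart U z \<phi> w))) (z p)) = 0"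
        using k by (simp add: d_def L.add)
    qed
  qed
qed

lemma not_constant: "\<not> (\<exists>c. \<forall>p\<in>topspace X. \<phi> p = c)"
proof
  assume "\<exists>c. \<forall>p\<in>topspace X. \<phi> p = c"
  then obtain k where k: "\<forall>p\<in>topspace X. \<phi> p = k" by blast
  obtain p where p: "p \<in> topspace X" using surface unfolding riemann_surface_def by blast
  obtain U z where c: "(U,z) \<in> A" "p \<in> U" using chart_at[OF p] .
  interpret ch: conformal_harmonic "z ` U" "in_chart U z \<phi>" by (rule chart_conformal_harmonic[OF c(1)])
  have zp: "z p \<in> z ` U" using c by blast
  have "in_chart U z \<phi> w = k" if "w \<in> z ` U" for w using that c(1) k chart(4)[OF c(1)] by auto
  then have "ch.fx (z p) = 0" by (rule dir_deriv_eq_zero[OF ch.open_S zp])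
  then show False using ch.immersed[OF zp] by simp
qed

lemma almost_complex_if_D1:
  assumes "\<forall>(U,z)\<in>A. \<forall>p\<in>U. chD U z (z p) = 0"
  shows "almost_complex_curve X A \<phi>"
  unfolding almost_complex_curve_def
proof (intro conjI in_sphere smooth not_constant)
  have "\<forall>u. dir_deriv (\<i> * u) (in_chart U z \<phi>) (z p) = in_chart U z \<phi> (z p) \<times>\<^sub>7 dir_deriv u (in_chart U z \<phi>) (z p)"
    if "(U,z) \<in> A" "p \<in> U" for U z p
    using conformal_harmonic.D1_zero_iff[OF chart_conformal_harmonic[OF that(1)], of "z p"] assms that by blast
  then show "pointwise A (\<lambda>g w. \<forall>u. dir_deriv (\<i> * u) g w = g w \<times>\<^sub>7 dir_deriv u g w) \<phi>"
    unfolding pointwise_def by blast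
qed

text \<open>Conjugate charts reverse the imaginary direction. Passing to \<open>- \<phi>\<close>
  reverses the equation as well, its left side being linear and its right side quadratic in the
  map.\<close>

lemma almost_complex_conj:
  assumes ac: "almost_complex_curve X A (\<lambda>p. - \<phi> p)"
  shows "almost_complex_curve X (conj_atlas A) \<phi>"
  unfolding almost_complex_curve_def
proof (intro conjI in_sphere not_constant)
  have "inv_into U (cnj \<circ> z) w = inv_into U z (cnj w)" for U and z :: "'a \<Rightarrow> complex" and w
    unfolding inv_into_def by (rule arg_cong[where f = Eps]) (auto simp: fun_eq_iff)
  then have ic: "in_chart U (cnj \<circ> z) \<phi> = (\<lambda>w. in_chart U z \<phi> (cnj w))" for U z
    by (simp add: in_chart_def fun_eq_iff)
  have dcnj: "cnj differentiable (at w)" "dir_deriv u cnj w = cnj u" for u w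
  proof -
    have D: "(cnj has_derivative cnj) (at w)"
      using bounded_linear.has_derivative[OF bounded_linear_cnj has_derivative_ident] by simp
    then show "cnj differentiable (at w)" using differentiable_def by blast
    show "dir_deriv u cnj w = cnj u" by (rule dir_deriv_unique[OF D])
  qed
  show "smooth_map_on (conj_atlas A) (topspace X) \<phi>"
    unfolding smooth_map_on_def conj_atlas_def
  proof (clarsimp simp: ic)
    fix U z assume c: "(U,z) \<in> A"
    define T where "T = z ` (U \<inter> topspace X)"
    have T: "open T" unfolding T_def by (intro open_chart_image[OF c] openin_topspace)
    have "cnj ` T = cnj -` T"
    proof (intro set_eqI iffI)
      fix x assume "x \<in> cnj -` T"
      then have "cnj (cnj x) \<in> cnj ` T" by (intro imageI) simp
      then show "x \<in> cnj ` T" by simp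
    qed auto
    then have img: "(cnj \<circ> z) ` (U \<inter> topspace X) = cnj -` T"
      unfolding T_def by (simp add: image_comp)
    have "open (cnj -` T)" using T by (intro open_vimage continuous_intros)
    then have "smooth_on (cnj -` T) (\<lambda>w. in_chart U z \<phi> (cnj w))"
      by (rule smooth_on_compose[OF _ T _ smooth_on_cnj smooth_map_onD[OF smooth c, folded T_def]]) auto
    then show "smooth_on ((\<lambda>x. cnj (z x)) ` (U \<inter> topspace X)) (\<lambda>w. in_chart U z \<phi> (cnj w))"
      using img by (simp add: image_comp o_def)
  qed
  show "pointwise (conj_atlas A) (\<lambda>g w. \<forall>u. dir_deriv (\<i> * u) g w = g w \<times>\<^sub>7 dir_deriv u g w) \<phi>"
    unfolding pointwise_def conj_atlas_def
  proof (clarsimp simp: ic)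
    fix U z p u assume c: "(U,z) \<in> A" and p: "p \<in> U"
    define g where "g = in_chart U z \<phi>"
    have g: "g differentiable (at (z p))"
      using smooth_on_differentiable[OF smooth_map_on_chart[OF smooth c]] p by (simp add: g_def)
    have d: "dir_deriv t (\<lambda>w. g (cnj w)) (cnj (z p)) = dir_deriv (cnj t) g (z p)" for t
      using dir_deriv_compose[OF dcnj(1), of g "cnj (z p)" t] g by (simp add: dcnj(2))
    have neg: "in_chart U z (\<lambda>p. - \<phi> p) = (\<lambda>w. - g w)" by (simp add: in_chart_def g_def fun_eq_iff)
    have "\<forall>u. dir_deriv (\<i> * u) (in_chart U z (\<lambda>p. - \<phi> p)) (z p)
        = in_chart U z (\<lambda>p. - \<phi> p) (z p) \<times>\<^sub>7 dir_deriv u (in_chart U z (\<lambda>p. - \<phi> p)) (z p)"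
      using ac c p unfolding almost_complex_curve_def pointwise_def by blast
    then have "dir_deriv (\<i> * t) (\<lambda>w. - g w) (z p) = (- g (z p)) \<times>\<^sub>7 dir_deriv t (\<lambda>w. - g w) (z p)" for t
      unfolding neg by blast
    then have "- dir_deriv (\<i> * t) g (z p) = g (z p) \<times>\<^sub>7 dir_deriv t g (z p)" for t
      by (simp add: dir_deriv_uminus[OF g] cross7.minus_left cross7.minus_right)
    moreover have "dir_deriv (cnj (\<i> * u)) g (z p) = - dir_deriv (\<i> * cnj u) g (z p)"
      unfolding dir_deriv_expand[OF g, of "cnj (\<i> * u)"] dir_deriv_expand[OF g, of "\<i> * cnj u"] by simp
    ultimately have "dir_deriv (\<i> * u) (\<lambda>w. g (cnj w)) (cnj (z p))
        = g (z p) \<times>\<^sub>7 dir_deriv u (\<lambda>w. g (cnj w)) (cnj (z p))" unfolding d by simp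
    then show "dir_deriv (\<i> * u) (\<lambda>w. in_chart U z \<phi> (cnj w)) (cnj (z p))
        = \<phi> p \<times>\<^sub>7 dir_deriv u (\<lambda>w. in_chart U z \<phi> (cnj w)) (cnj (z p))"
      using c p by (simp add: g_def)
  qed
qed

end

text \<open>For openness of the set where \<open>r1\<close> or \<open>r2\<close> is
  non-zero.\<close>

lemma (in conformal_harmonic) continuous_r:
  assumes "\<And>w. w \<in> S \<Longrightarrow> P w \<noteq> 0"
  shows "continuous_on S r1" "continuous_on S r2"
proof -
  have nz: "\<forall>w\<in>S. pp w \<noteq> 0" "\<forall>w\<in>S. E w \<noteq> 0" using assms E_pos by (force simp: pp_def)+
  have cP: "continuous_on S P" and cQ: "continuous_on S Q" and cE: "continuous_on S E"
    and cx: "continuous_on S fx" and cy: "continuous_on S fy"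
    by (rule smooth_on_continuous, rule smooth_P smooth_Q smooth_E smooth_fx smooth_fy)+
  have cpp: "continuous_on S pp" unfolding pp_def[abs_def] by (rule continuous_on_inner[OF cP cP])
  have pE: "continuous_on S (\<lambda>w. pp w / E w)" by (rule continuous_on_divide[OF cpp cE nz(2)])
  have tang: "continuous_on S (\<lambda>w. ((a w \<bullet> P w) / pp w) *\<^sub>R P w)" "continuous_on S (\<lambda>w. ((a w \<bullet> Q w) / pp w) *\<^sub>R Q w)"
    if "continuous_on S a" for a
    by (rule continuous_on_scaleR continuous_on_divide continuous_on_inner that cP cQ cpp nz(1))+
  have d: "continuous_on S (dir_deriv 1 P)" "continuous_on S (dir_deriv \<i> P)"
    by (rule smooth_on_continuous, rule smooth_on_dir_deriv_basis, rule smooth_P)+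
  show "continuous_on S r1" unfolding r1_def[abs_def]
    by (rule continuous_on_diff[OF continuous_on_diff[OF continuous_on_add[OF d(1) continuous_on_scaleR[OF pE cx]] tang(1)[OF d(1)]] tang(2)[OF d(1)]])
  show "continuous_on S r2" unfolding r2_def[abs_def]
    by (rule continuous_on_diff[OF continuous_on_diff[OF continuous_on_diff[OF d(2) continuous_on_scaleR[OF pE cy]] tang(1)[OF d(2)]] tang(2)[OF d(2)]])
qed

section \<open>The rotation on the orthogonal complement of its axis\<close>

lemma bounded_linear_rot7: "bounded_linear (rot7 v \<beta>)"
  using linear_rot7 linear_conv_bounded_linear by blast

lemma rot7_isometry:
  assumes v: "v \<bullet> v = 1" and x: "x \<bullet> v = 0" and y: "y \<bullet> v = 0"
  shows "rot7 v d x \<bullet> rot7 v d y = x \<bullet> y"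
proof -
  have J: "(v \<times>\<^sub>7 x) \<bullet> (v \<times>\<^sub>7 y) = x \<bullet> y" using v x by (simp add: cross7_inner_left inner_commute)
  have K: "x \<bullet> (v \<times>\<^sub>7 y) = - ((v \<times>\<^sub>7 x) \<bullet> y)" using cross7_swap[of v y x] by (simp add: inner_commute)
  have "(a *\<^sub>R x + b *\<^sub>R (v \<times>\<^sub>7 x)) \<bullet> (a *\<^sub>R y + b *\<^sub>R (v \<times>\<^sub>7 y)) = (a\<^sup>2 + b\<^sup>2) * (x \<bullet> y)" for a b
    by (simp add: inner_add_left inner_add_right J K power2_eq_square algebra_simps)
  from this[of "cos d" "sin d"] show ?thesis unfolding rot7_orthogonal[OF x] rot7_orthogonal[OF y] by simp
qed

lemma rot7_perp: "x \<bullet> v = 0 \<Longrightarrow> rot7 v d x \<bullet> v = 0"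
  by (simp add: rot7_orthogonal inner_add_left)

lemma rot7_inverse:
  assumes v: "v \<bullet> v = 1" and x: "x \<bullet> v = 0"
  shows "rot7 v (- d) (rot7 v d x) = x"
proof -
  have vx: "v \<bullet> x = 0" using x by (simp add: inner_commute)
  have "a *\<^sub>R (a *\<^sub>R x + b *\<^sub>R (v \<times>\<^sub>7 x)) - b *\<^sub>R (v \<times>\<^sub>7 (a *\<^sub>R x + b *\<^sub>R (v \<times>\<^sub>7 x))) = (a\<^sup>2 + b\<^sup>2) *\<^sub>R x" for a b
    by (simp add: cross7.add_right cross7.scaleR_right cross7_double v vx power2_eq_square algebra_simps)
  from this[of "cos d" "sin d"] show ?thesis
    unfolding rot7_orthogonal[OF rot7_perp[OF x]] unfolding rot7_orthogonal[OF x] by simp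
qed

lemma rot7_adjoint:
  assumes "x \<bullet> v = 0" "c \<bullet> v = 0"
  shows "rot7 v d x \<bullet> c = x \<bullet> rot7 v (- d) c"
proof -
  have "x \<bullet> (v \<times>\<^sub>7 c) = - ((v \<times>\<^sub>7 x) \<bullet> c)" using cross7_swap[of v c x] by (simp add: inner_commute)
  then show ?thesis unfolding rot7_orthogonal[OF assms(1)] rot7_orthogonal[OF assms(2)]
    by (simp add: inner_add_left inner_diff_right)
qed

lemma dim_orthogonal_comp:
  fixes B :: "'b::euclidean_space set"
  assumes "pairwise orthogonal B" "0 \<notin> B" "finite B"
  shows "subspace (orthogonal_comp B)" "dim (orthogonal_comp B) + card B = DIM('b)"
proof -
  show "subspace (orthogonal_comp B)" by (rule subspace_orthogonal_comp)
  have oc: "orthogonal_comp B = {y \<in> UNIV. \<forall>x\<in>span B. orthogonal x y}"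
  proof (intro set_eqI iffI)
    fix y assume y: "y \<in> orthogonal_comp B"
    have "orthogonal x y" if "x \<in> span B" for x
      using that by (induction rule: span_induct_alt)
        (use y in \<open>auto simp: orthogonal_comp_def orthogonal_def inner_add_left\<close>)
    then show "y \<in> {y \<in> UNIV. \<forall>x\<in>span B. orthogonal x y}" by simp
  next
    fix y assume "y \<in> {y \<in> UNIV. \<forall>x\<in>span B. orthogonal x y}"
    then show "y \<in> orthogonal_comp B" using span_base[of _ B] by (auto simp: orthogonal_comp_def)
  qed
  have "independent B" using assms(1,2) by (rule pairwise_orthogonal_independent)
  then have "dim (span B) = card B" by (simp add: dim_span dim_eq_card_independent)
  then show "dim (orthogonal_comp B) + card B = DIM('b)"
    using dim_subspace_orthogonal_to_vectors[of "span B" UNIV] unfolding oc by simp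
qed

section \<open>The alternatives and their assembly\<close>

context minimal_surface
begin

text \<open>The rotated map is again minimal, so its almost complex equation, known near one point,
  holds everywhere by the dichotomy for \<open>D1\<close>. A vector orthogonal to its image is
  carried by the adjoint rotation to one orthogonal to the image of \<open>\<phi>\<close>, whence
  fullness.\<close>

lemma type_III_rotation:
  assumes v: "v \<bullet> v = 1" and perp: "\<And>p. p \<in> topspace X \<Longrightarrow> \<phi> p \<bullet> v = 0"
    and full: "\<And>c. c \<bullet> v = 0 \<Longrightarrow> (\<And>p. p \<in> topspace X \<Longrightarrow> \<phi> p \<bullet> c = 0) \<Longrightarrow> c = 0"
    and c0: "(U0,z0) \<in> A" "p0 \<in> U0"
    and rot: "\<forall>\<^sub>F w in nhds (z0 p0). rot7 v d (dir_deriv \<i> (in_chart U0 z0 \<phi>) w)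
       = rot7 v d (in_chart U0 z0 \<phi> w) \<times>\<^sub>7 rot7 v d (dir_deriv 1 (in_chart U0 z0 \<phi>) w)"
  shows "\<exists>v \<beta> \<psi>. norm v = 1 \<and> almost_complex_type_III X A \<psi> \<and>
    \<psi> ` topspace X \<subseteq> sphere 0 1 \<inter> orthogonal_comp {v} \<and> (\<forall>p\<in>topspace X. \<phi> p = rot7 v \<beta> (\<psi> p))"
proof -
  define \<psi> where "\<psi> p = rot7 v d (\<phi> p)" for p
  interpret rotated: minimal_surface X A "\<lambda>p. rot7 v d (\<phi> p)"
    by (rule isometric_image[OF bounded_linear_rot7 perp]) (use rot7_isometry[OF v] in auto)
  have nv: "norm v = 1" using v by (simp add: norm_eq_sqrt_inner)
  interpret c: conformal_harmonic "z0 ` U0" "in_chart U0 z0 \<phi>" by (rule chart_conformal_harmonic[OF c0(1)])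
  have ic: "in_chart U0 z0 (\<lambda>p. rot7 v d (\<phi> p)) = (\<lambda>w. rot7 v d (in_chart U0 z0 \<phi> w))"
    by (simp add: in_chart_def fun_eq_iff)
  have zp: "z0 p0 \<in> z0 ` U0" using c0 by blast
  have "\<forall>\<^sub>F w in nhds (z0 p0). w \<in> z0 ` U0" using c.open_S zp by (simp add: eventually_nhds_in_open)
  with rot have D0: "\<forall>\<^sub>F w in nhds (z0 p0). rotated.chD U0 z0 w = 0"
  proof eventually_elim
    case (elim w)
    interpret r: conformal_harmonic "z0 ` U0" "in_chart U0 z0 (\<lambda>p. rot7 v d (\<phi> p))"
      by (rule rotated.chart_conformal_harmonic[OF c0(1)])
    note dl = dir_deriv_linear[OF bounded_linear_rot7 smooth_on_differentiable[OF c.smooth_f elim(2)], of _ v d]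
    show ?case unfolding r.D1_def unfolding ic dl using elim(1) by simp
  qed
  have "\<not> (\<forall>(U,z)\<in>A. \<forall>p\<in>U. \<forall>\<^sub>F w in at (z p). rotated.chD U z w \<noteq> 0)"
  proof
    assume "\<forall>(U,z)\<in>A. \<forall>p\<in>U. \<forall>\<^sub>F w in at (z p). rotated.chD U z w \<noteq> 0"
    then have "\<forall>\<^sub>F w in at (z0 p0). rotated.chD U0 z0 w \<noteq> 0" using c0 by blast
    moreover have "\<forall>\<^sub>F w in at (z0 p0). rotated.chD U0 z0 w = 0"
      using D0 by (auto simp: eventually_at_filter elim: eventually_mono)
    ultimately have "\<forall>\<^sub>F w in at (z0 p0). False" by eventually_elim simp
    then show False by simp
  qed
  then have ac: "almost_complex_curve X A \<psi>"
    using rotated.D1_dichotomy rotated.almost_complex_if_D1 unfolding \<psi>_def by blast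
  have pos: "\<psi> p \<bullet> v = 0" if "p \<in> topspace X" for p unfolding \<psi>_def by (rule rot7_perp[OF perp[OF that]])
  have sub: "\<psi> ` topspace X \<subseteq> orthogonal_comp {v}"
    using pos by (auto simp: orthogonal_comp_def orthogonal_def inner_commute)
  have vn: "v \<noteq> 0" using v by auto
  have d6: "subspace (orthogonal_comp {v})" "dim (orthogonal_comp {v}) = 6"
    using dim_orthogonal_comp[of "{v}"] vn by simp_all
  have "linearly_full_in (orthogonal_comp {v}) (\<psi> ` topspace X)"
    unfolding linearly_full_in_def
  proof (intro conjI d6(1) sub notI)
    assume "\<exists>U'. subspace U' \<and> U' \<subset> orthogonal_comp {v} \<and> \<psi> ` topspace X \<subseteq> U'"
    then obtain U' where U': "subspace U'" "U' \<subset> orthogonal_comp {v}" "\<psi> ` topspace X \<subseteq> U'" by blast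
    then have "span U' \<subset> span (orthogonal_comp {v})"
      unfolding span_eq_iff[THEN iffD2, OF d6(1)] span_eq_iff[THEN iffD2, OF U'(1)] by blast
    then obtain c where c: "c \<noteq> 0" "c \<in> span (orthogonal_comp {v})" "\<And>y. y \<in> span U' \<Longrightarrow> orthogonal c y"
      using orthogonal_to_subspace_exists_gen by blast
    then have cv: "c \<bullet> v = 0"
      unfolding span_eq_iff[THEN iffD2, OF d6(1)] by (simp add: orthogonal_comp_def orthogonal_def inner_commute)
    have "\<phi> p \<bullet> rot7 v (- d) c = 0" if p: "p \<in> topspace X" for p
    proof -
      have "\<psi> p \<in> span U'" using U'(3) p span_base by blast
      then have "\<psi> p \<bullet> c = 0" using c(3)[of "\<psi> p"] by (simp add: orthogonal_def inner_commute)
      then show ?thesis unfolding \<psi>_def rot7_adjoint[OF perp[OF p] cv] .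
    qed
    then have "rot7 v (- d) c = 0" by (intro full rot7_perp[OF cv])
    then have "c \<bullet> c = 0" using rot7_isometry[OF v cv cv, of "- d"] by simp
    then show False using c(1) by simp
  qed
  then have "almost_complex_type_III X A \<psi>"
    unfolding almost_complex_type_III_def using ac d6(2) by blast
  moreover have "\<psi> ` topspace X \<subseteq> sphere 0 1 \<inter> orthogonal_comp {v}"
    using sub rotated.in_sphere unfolding \<psi>_def by blast
  moreover have "\<forall>p\<in>topspace X. \<phi> p = rot7 v (- d) (\<psi> p)"
    unfolding \<psi>_def using rot7_inverse[OF v perp] by simp
  ultimately show ?thesis using nv by blast
qed

text \<open>\<open>parallel_if_perp_two\<close> and \<open>parallel_if_r_zero\<close> supply the
  hypothesis of \<open>superminimalI\<close>, and the five-dimensional space is the complement of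
  the two constants.\<close>

lemma superminimal_case:
  assumes iso: "\<And>U z p. (U,z) \<in> A \<Longrightarrow> p \<in> U \<Longrightarrow> conformal_harmonic.iso_at (in_chart U z \<phi>) (z p)"
    and isolated: "\<forall>p\<in>topspace X. \<exists>V. openin X V \<and> p \<in> V \<and> (\<forall>q\<in>V - {p}. pre2 q \<noteq> {0})"
    and c: "c1 \<noteq> 0" "c2 \<noteq> 0" "c1 \<bullet> c2 = 0"
    and perp: "\<And>p. p \<in> topspace X \<Longrightarrow> \<phi> p \<bullet> c1 = 0 \<and> \<phi> p \<bullet> c2 = 0"
  shows "\<exists>W. subspace W \<and> dim W = 5 \<and> \<phi> ` topspace X \<subseteq> W \<and> superminimal X A \<phi>"
proof -
  have "superminimal X A \<phi>"
  proof (rule superminimalI)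
    show "\<exists>V. openin X V \<and> p \<in> V \<and> (\<forall>q\<in>V - {p}. pre2 q \<noteq> {0})" if "p \<in> topspace X" for p
      using isolated that by blast
    fix U z q assume ch: "(U,z) \<in> A" and q: "q \<in> U" and nz: "pre2 q \<noteq> {0}"
    interpret ch: conformal_harmonic "z ` U" "in_chart U z \<phi>" by (rule chart_conformal_harmonic[OF ch])
    have zq: "z q \<in> z ` U" using q by blast
    have isS: "ch.iso_at w" if "w \<in> z ` U" for w using that iso[OF ch] by blast
    have "ch.P (z q) \<noteq> 0" using nz isS[OF zq] unfolding pre2_zero_iff[OF ch q] ch.iso_at_def by auto
    moreover have pw: "in_chart U z \<phi> w \<bullet> c1 = 0 \<and> in_chart U z \<phi> w \<bullet> c2 = 0" if "w \<in> z ` U" for w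
      using that perp chart(4)[OF ch] ch by auto
    ultimately have "ch.r1 (z q) = 0" "ch.r2 (z q) = 0"
      using ch.parallel_if_perp_two[OF isS pw c zq] by simp_all
    then show "\<exists>\<delta>. d_dz (chM U z) (z q) = \<delta> *s chM U z (z q)"
      using ch.parallel_if_r_zero[OF isS zq \<open>ch.P (z q) \<noteq> 0\<close>] by simp
  qed
  moreover have "c1 \<noteq> c2" using c by auto
  then have "subspace (orthogonal_comp {c1, c2})" "dim (orthogonal_comp {c1, c2}) = 5"
    using dim_orthogonal_comp[of "{c1, c2}"] c by (auto simp: pairwise_insert orthogonal_def inner_commute)
  moreover have "\<phi> ` topspace X \<subseteq> orthogonal_comp {c1, c2}"
    using perp by (auto simp: orthogonal_comp_def orthogonal_def inner_commute)
  ultimately show ?thesis by blast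
qed

text \<open>The dichotomies for \<open>\<phi>\<close> and \<open>- \<phi>\<close> leave a generic
  case in which all degenerate points are isolated, so that a single chart with a good point in it
  decides between the two remaining alternatives.\<close>

theorem classification:
  assumes iso: "\<And>U z p. (U,z) \<in> A \<Longrightarrow> p \<in> U \<Longrightarrow> conformal_harmonic.iso_at (in_chart U z \<phi>) (z p)"
    and umb: "\<And>U z p. (U,z) \<in> A \<Longrightarrow> p \<in> U \<Longrightarrow> conformal_harmonic.umb_at (in_chart U z \<phi>) (z p)"
  shows "almost_complex_curve X A \<phi> \<or> almost_complex_curve X (conj_atlas A) \<phi> \<or>
     (\<exists>v \<beta> \<psi>. norm v = 1 \<and> almost_complex_type_III X A \<psi> \<and>
        \<psi> ` topspace X \<subseteq> sphere 0 1 \<inter> orthogonal_comp {v} \<and> (\<forall>p\<in>topspace X. \<phi> p = rot7 v \<beta> (\<psi> p))) \<or>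
     sphere_totally_geodesic A \<phi> \<or>
     (\<exists>W. subspace W \<and> dim W = 5 \<and> \<phi> ` topspace X \<subseteq> W \<and> superminimal X A \<phi>)"
proof -
  interpret neg: minimal_surface X A "\<lambda>p. - \<phi> p"
    by (rule isometric_image[of uminus 0]) (auto intro: bounded_linear_minus[OF bounded_linear_ident])
  consider (ac) "\<forall>(U,z)\<in>A. \<forall>p\<in>U. chD U z (z p) = 0"
    | (conj) "\<forall>(U,z)\<in>A. \<forall>p\<in>U. neg.chD U z (z p) = 0"
    | (geodesic) "\<forall>p\<in>topspace X. pre2 p = {0}"
    | (generic) "\<forall>(U,z)\<in>A. \<forall>p\<in>U. \<forall>\<^sub>F w in at (z p). chD U z w \<noteq> 0"
        "\<forall>(U,z)\<in>A. \<forall>p\<in>U. \<forall>\<^sub>F w in at (z p). neg.chD U z w \<noteq> 0"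
        "\<forall>p\<in>topspace X. \<exists>V. openin X V \<and> p \<in> V \<and> (\<forall>q\<in>V - {p}. pre2 q \<noteq> {0})"
    using D1_dichotomy neg.D1_dichotomy pre2_dichotomy by blast
  then show ?thesis
  proof cases
    case ac
    then show ?thesis using almost_complex_if_D1 by blast
  next
    case conj
    then have "almost_complex_curve X A (\<lambda>p. - \<phi> p)" by (rule neg.almost_complex_if_D1)
    then show ?thesis using almost_complex_conj by blast
  next
    case geodesic
    have "sphere_totally_geodesic A \<phi>"
      unfolding sphere_totally_geodesic_def pointwise_def
    proof clarify
      fix U z p u t assume c: "(U,z) \<in> A" and p: "p \<in> U"
      interpret ch: conformal_harmonic "z ` U" "in_chart U z \<phi>" by (rule chart_conformal_harmonic[OF c])
      have "ch.P (z p) = 0" "ch.Q (z p) = 0"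
        using geodesic pre2_zero_iff[OF c p] chart(4)[OF c] p by auto
      then show "normal_part (tangent_plane (in_chart U z \<phi>) (z p))
          (sphere_tangential (in_chart U z \<phi> (z p)) (dir_deriv u (dir_deriv t (in_chart U z \<phi>)) (z p))) = 0"
        using p by (intro ch.totally_geodesic_at) auto
    qed
    then show ?thesis by blast
  next
    case generic
    obtain p where p: "p \<in> topspace X" using surface unfolding riemann_surface_def by blast
    obtain U z where c: "(U,z) \<in> A" "p \<in> U" using chart_at[OF p] .
    define g where "g = in_chart U z \<phi>"
    interpret ch: conformal_harmonic "z ` U" g unfolding g_def by (rule chart_conformal_harmonic[OF c(1)])
    have isS: "ch.iso_at w" and um: "ch.umb_at w" if "w \<in> z ` U" for w
      using that iso[OF c(1)] umb[OF c(1)] unfolding g_def by blast+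
    have zp: "z p \<in> z ` U" using c by blast
    have neg_D1: "neg.chD U z w = - (ch.fy w + g w \<times>\<^sub>7 ch.fx w)" if w: "w \<in> z ` U" for w
    proof -
      interpret n: conformal_harmonic "z ` U" "in_chart U z (\<lambda>p. - \<phi> p)" by (rule neg.chart_conformal_harmonic[OF c(1)])
      have ic: "in_chart U z (\<lambda>p. - \<phi> p) = (\<lambda>w. - g w)" by (simp add: in_chart_def g_def fun_eq_iff)
      show ?thesis unfolding n.D1_def
        unfolding ic dir_deriv_uminus[OF smooth_on_differentiable[OF ch.smooth_f w]]
        by (simp add: cross7.minus_left cross7.minus_right)
    qed
    obtain V where V: "openin X V" "p \<in> V" "\<forall>q\<in>V - {p}. pre2 q \<noteq> {0}" using generic(3) p by blast
    have "\<forall>\<^sub>F w in at (z p). \<not> (ch.P w = 0 \<and> ch.Q w = 0)"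
      by (rule isolated_chart[OF c V(1,2)]) (use V(3) pre2_zero_iff[OF c(1)] in \<open>auto simp: g_def\<close>)
    moreover have "\<forall>\<^sub>F w in at (z p). ch.D1 w \<noteq> 0" using generic(1) c unfolding g_def by blast
    moreover have "\<forall>\<^sub>F w in at (z p). neg.chD U z w \<noteq> 0" using generic(2) c by blast
    moreover have "\<forall>\<^sub>F w in at (z p). w \<in> z ` U" using zp ch.open_S by (rule eventually_at_in_open'[rotated])
    ultimately have "\<forall>\<^sub>F w in at (z p). w \<in> z ` U \<and> ch.P w \<noteq> 0 \<and> ch.nu w \<noteq> 0"
    proof eventually_elim
      case (elim w)
      have "ch.P w \<noteq> 0" using elim(1) isS[OF elim(4)] unfolding ch.iso_at_def by auto
      moreover have "ch.nu w \<noteq> 0"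
      proof
        assume "ch.nu w = 0"
        then have "ch.fy w + g w \<times>\<^sub>7 ch.fx w = 0" using ch.nu_zero_cases[OF elim(4)] elim(2) by blast
        then have "neg.chD U z w = 0" unfolding neg_D1[OF elim(4)] by (simp only: minus_zero)
        then show False using elim(3) by simp
      qed
      ultimately show ?case using elim(4) by blast
    qed
    then obtain w1 where w1: "w1 \<in> z ` U" "ch.P w1 \<noteq> 0" "ch.nu w1 \<noteq> 0"
      using eventually_happens'[OF at_neq_bot] by blast
    \<comment> \<open>The local lemmas ask for their conditions throughout an open set, so the chart
      is restricted to its good points; \<open>T2\<close> and \<open>T3\<close> below shrink it
      further.\<close>
    define T where "T = {w \<in> z ` U. ch.P w \<noteq> 0 \<and> ch.nu w \<noteq> 0}"
    have T: "open T"
    proof -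
      have "T = (z ` U \<inter> ch.P -` (- {0})) \<inter> (z ` U \<inter> ch.nu -` (- {0}))" unfolding T_def by auto
      then show ?thesis
        using continuous_open_preimage[OF smooth_on_continuous[OF ch.smooth_P] ch.open_S, of "- {0}"]
          continuous_open_preimage[OF smooth_on_continuous[OF ch.smooth_nu] ch.open_S, of "- {0}"]
        by (simp add: open_Int open_Compl)
    qed
    have sub: "T \<subseteq> z ` U" by (auto simp: T_def)
    interpret t: conformal_harmonic T g by (rule ch.restrict[OF T sub])
    have isT: "ch.iso_at w" and umT: "ch.umb_at w" if "w \<in> T" for w using that sub isS um by blast+
    have PT: "ch.P w \<noteq> 0" and nuT: "ch.nu w \<noteq> 0" if "w \<in> T" for w using that by (auto simp: T_def)
    show ?thesis
    proof (cases "\<forall>w\<in>T. ch.r1 w = 0 \<and> ch.r2 w = 0")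
      \<comment> \<open>Here \<open>nu w1\<close> and \<open>n\<close> span the complement of a
        parallel five-dimensional space and serve as the two constant vectors orthogonal to
        \<open>\<phi>\<close>.\<close>
      case True
      have w1T: "w1 \<in> T" using w1 by (simp add: T_def)
      then obtain q1 where q1: "q1 \<in> U" "w1 = z q1" using sub by blast
      obtain n where n: "norm n = 1" "n \<bullet> g w1 = 0" "n \<bullet> ch.fx w1 = 0" "n \<bullet> ch.fy w1 = 0" "n \<bullet> ch.P w1 = 0"
        "n \<bullet> ch.Q w1 = 0" "n \<bullet> ch.nu w1 = 0"
        using t.normal_frame[OF isT w1T PT[OF w1T] nuT[OF w1T] umT[OF w1T]] by metis
      have nuo: "ch.P w1 \<bullet> ch.nu w1 = 0" "ch.Q w1 \<bullet> ch.nu w1 = 0" using umT[OF w1T] by (auto simp: ch.umb_at_def)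
      have "\<forall>\<^sub>F w in nhds w1. g w \<bullet> ch.nu w1 = 0"
        by (rule t.perp_const_if_r_zero[OF isT w1T PT])
          (use True t.nu_orth[OF w1T] nuo in \<open>auto simp: inner_commute\<close>)
      then have "\<phi> p \<bullet> ch.nu w1 = 0" if "p \<in> topspace X" for p
        using perp_unique_continuation[OF c(1) q1(1) _ that] unfolding g_def q1(2) by blast
      moreover have "\<forall>\<^sub>F w in nhds w1. g w \<bullet> n = 0"
        by (rule t.perp_const_if_r_zero[OF isT w1T PT]) (use True n in \<open>auto simp: inner_commute\<close>)
      then have "\<phi> p \<bullet> n = 0" if "p \<in> topspace X" for p
        using perp_unique_continuation[OF c(1) q1(1) _ that] unfolding g_def q1(2) by blast
      moreover have "n \<noteq> 0" using n(1) by auto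
      ultimately show ?thesis
        using superminimal_case[OF iso generic(3), of n "ch.nu w1"] n(7) nuT[OF w1T] by blast
    next
      case False
      then obtain w2 where w2: "w2 \<in> T" "ch.r1 w2 \<noteq> 0 \<or> ch.r2 w2 \<noteq> 0" by blast
      define T2 where "T2 = {w \<in> T. ch.r1 w \<noteq> 0 \<or> ch.r2 w \<noteq> 0}"
      have T2: "open T2"
      proof -
        note cont = t.continuous_r[OF PT]
        have "T2 = (T \<inter> ch.r1 -` (- {0})) \<union> (T \<inter> ch.r2 -` (- {0}))" unfolding T2_def by auto
        then show ?thesis
          using continuous_open_preimage[OF cont(1) T, of "- {0}"] continuous_open_preimage[OF cont(2) T, of "- {0}"]
          by (simp add: open_Un open_Compl)
      qed
      have sub2: "T2 \<subseteq> T" by (auto simp: T2_def)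
      interpret t2: conformal_harmonic T2 g by (rule t.restrict[OF T2 sub2])
      have isT2: "ch.iso_at w" and umT2: "ch.umb_at w" and PT2: "ch.P w \<noteq> 0" and nuT2: "ch.nu w \<noteq> 0"
        and rT2: "ch.r1 w \<noteq> 0 \<or> ch.r2 w \<noteq> 0" if "w \<in> T2" for w
        using that sub2 isT umT PT nuT by (auto simp: T2_def)
      have w2T2: "w2 \<in> T2" using w2 by (simp add: T2_def)
      obtain v where v: "v \<bullet> v = 1" "\<forall>\<^sub>F w in nhds w2. ch.nu w = (ch.nu w \<bullet> v) *\<^sub>R v \<and> ch.nu w \<bullet> v > 0"
        by (rule t2.nu_direction_constant[OF isT2 umT2 w2T2 PT2 nuT2 rT2])
      have "\<forall>\<^sub>F w in nhds w2. w \<in> T2" using T2 w2T2 by (simp add: eventually_nhds_in_open)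
      with v(2) have "\<forall>\<^sub>F w in nhds w2. w \<in> T2 \<and> ch.nu w = (ch.nu w \<bullet> v) *\<^sub>R v \<and> ch.nu w \<bullet> v > 0"
        by eventually_elim simp
      then obtain T3 where T3: "open T3" "w2 \<in> T3"
        "\<And>w. w \<in> T3 \<Longrightarrow> w \<in> T2 \<and> ch.nu w = (ch.nu w \<bullet> v) *\<^sub>R v \<and> ch.nu w \<bullet> v > 0"
        unfolding eventually_nhds by blast
      have sub3: "T3 \<subseteq> T2" using T3(3) by blast
      interpret t3: conformal_harmonic T3 g by (rule t2.restrict[OF T3(1) sub3])
      \<comment> \<open>\<open>nu\<close> is orthogonal to \<open>f\<close> and its direction is
        constant here, so this piece lies in the hyperplane orthogonal to \<open>v\<close>; unique
        continuation then extends this to the surface.\<close>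
      have gv: "g w \<bullet> v = 0" if w: "w \<in> T3" for w
      proof -
        have "((ch.nu w \<bullet> v) *\<^sub>R v) \<bullet> g w = 0" using t3.nu_orth(1)[OF w] T3(3)[OF w] by metis
        then show ?thesis using T3(3)[OF w] by (simp add: inner_commute)
      qed
      obtain q2 where q2: "q2 \<in> U" "w2 = z q2" using w2 sub by blast
      have "\<forall>\<^sub>F w in nhds w2. g w \<bullet> v = 0"
        unfolding eventually_nhds using T3 gv by blast
      then have perp: "\<phi> p \<bullet> v = 0" if "p \<in> topspace X" for p
        using perp_unique_continuation[OF c(1) q2(1) _ that] unfolding g_def q2(2) by blast
      have isT3: "ch.iso_at w" and umT3: "ch.umb_at w" if "w \<in> T3" for w using that sub3 isT2 umT2 by blast+
      obtain d where d: "\<forall>\<^sub>F w in nhds w2. cos d *\<^sub>R ch.fy w + sin d *\<^sub>R (v \<times>\<^sub>7 ch.fy w)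
         = (cos d *\<^sub>R g w + sin d *\<^sub>R (v \<times>\<^sub>7 g w)) \<times>\<^sub>7 (cos d *\<^sub>R ch.fx w + sin d *\<^sub>R (v \<times>\<^sub>7 ch.fx w))"
        by (rule t3.rotation_angle[OF isT3 umT3 T3(2) v(1) gv]) (use T3(3) in blast)+
      have "\<forall>\<^sub>F w in nhds w2. w \<in> T3" using T3 by (simp add: eventually_nhds_in_open)
      with d have rot: "\<forall>\<^sub>F w in nhds w2. rot7 v d (ch.fy w) = rot7 v d (g w) \<times>\<^sub>7 rot7 v d (ch.fx w)"
      proof eventually_elim
        case (elim w)
        then show ?case
          using rot7_orthogonal[OF gv[OF elim(2)], of d] rot7_orthogonal[OF t3.perp_all(1)[OF gv elim(2)], of d]
            rot7_orthogonal[OF t3.perp_all(2)[OF gv elim(2)], of d] by simp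
      qed
      have full: "k = 0" if k: "k \<bullet> v = 0" "\<And>p. p \<in> topspace X \<Longrightarrow> \<phi> p \<bullet> k = 0" for k
      proof (rule t2.full_in_perp[OF isT2 umT2 w2T2 PT2[OF w2T2] nuT2[OF w2T2] rT2[OF w2T2]])
        show "g w \<bullet> k = 0" if w: "w \<in> T2" for w
        proof -
          obtain q where q: "q \<in> U" "w = z q" using w sub2 sub by blast
          then show ?thesis using k(2)[of q] chart(4)[OF c(1)] c(1) unfolding g_def by auto
        qed
        show "ch.nu w2 \<bullet> k = 0"
          using T3(3)[OF T3(2)] k(1) by (metis inner_commute inner_scaleR_left mult_zero_right)
      qed
      from type_III_rotation[OF v(1) perp full c(1) q2(1), of d] rot
      show ?thesis unfolding g_def q2(2) by blast
    qed
  qed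
qed

end

theorem theorem5:
  fixes X :: "'a topology" and A :: "'a chart set" and \<phi> F :: "'a \<Rightarrow> real^7"
  assumes "riemann_surface X A"
    and "\<phi> ` topspace X \<subseteq> sphere 0 1"
    and "smooth_map_on A (topspace X) \<phi>"
    and "conformal_immersion A \<phi>"
    and "sphere_harmonic A \<phi>"
    and "smooth_map_on A (topspace X) F"
    and "cross_star_primitive A \<phi> F"
  shows "(isotropic_immersion A F \<longleftrightarrow>
            pseudo_umbilical X A F \<and> isotropic_bundle X A (harmonic_sequence X A \<phi> 2)) \<and>
         (isotropic_immersion A F \<longrightarrow>
            (\<exists>B\<in>{A, conj_atlas A}.
               almost_complex_curve X B \<phi> \<or>
               (\<exists>v \<beta> \<psi>. norm v = 1 \<and> almost_complex_type_III X B \<psi> \<and>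
                  \<psi> ` topspace X \<subseteq> sphere 0 1 \<inter> orthogonal_comp {v} \<and>
                  (\<forall>p\<in>topspace X. \<phi> p = rot7 v \<beta> (\<psi> p))) \<or>
               sphere_totally_geodesic B \<phi> \<or>
               (\<exists>W. subspace W \<and> dim W = 5 \<and> \<phi> ` topspace X \<subseteq> W \<and> superminimal X B \<phi>)))"
proof -
  interpret minimal_surface X A \<phi>
    by unfold_locales (rule assms)+
  define iso where "iso \<longleftrightarrow> (\<forall>(U,z)\<in>A. \<forall>p\<in>U. conformal_harmonic.iso_at (in_chart U z \<phi>) (z p))"
  define umb where "umb \<longleftrightarrow> (\<forall>(U,z)\<in>A. \<forall>p\<in>U. conformal_harmonic.umb_at (in_chart U z \<phi>) (z p))"
  have F: "smooth_on (z ` U) (in_chart U z F)"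
    "w \<in> z ` U \<Longrightarrow> dir_deriv 1 (in_chart U z F) w = in_chart U z \<phi> w \<times>\<^sub>7 dir_deriv \<i> (in_chart U z \<phi>) w"
    "w \<in> z ` U \<Longrightarrow> dir_deriv \<i> (in_chart U z F) w = - (in_chart U z \<phi> w \<times>\<^sub>7 dir_deriv 1 (in_chart U z \<phi>) w)"
    if c: "(U,z) \<in> A" for U z w
  proof -
    show "smooth_on (z ` U) (in_chart U z F)" by (rule smooth_map_on_chart[OF assms(6) c])
    assume "w \<in> z ` U"
    then obtain p where p: "p \<in> U" "w = z p" by blast
    have "dir_deriv 1 (in_chart U z F) (z p) = \<phi> p \<times>\<^sub>7 dir_deriv \<i> (in_chart U z \<phi>) (z p) \<and>
        dir_deriv \<i> (in_chart U z F) (z p) = - (\<phi> p \<times>\<^sub>7 dir_deriv 1 (in_chart U z \<phi>) (z p))"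
      using assms(7) c p(1) unfolding cross_star_primitive_def by blast
    then show "dir_deriv 1 (in_chart U z F) w = in_chart U z \<phi> w \<times>\<^sub>7 dir_deriv \<i> (in_chart U z \<phi>) w"
      "dir_deriv \<i> (in_chart U z F) w = - (in_chart U z \<phi> w \<times>\<^sub>7 dir_deriv 1 (in_chart U z \<phi>) w)"
      using c p by simp_all
  qed
  have isotropic: "isotropic_immersion A F \<longleftrightarrow> iso \<and> umb"
  proof -
    define Q where "Q U z p \<longleftrightarrow> (\<exists>r. \<forall>u. first_form (in_chart U z F) (z p) u u = 1 \<longrightarrow>
      norm (second_form (in_chart U z F) (z p) u u) = r)" for U z and p :: 'a
    have Q: "Q U z p \<longleftrightarrow> conformal_harmonic.iso_at (in_chart U z \<phi>) (z p) \<and> conformal_harmonic.umb_at (in_chart U z \<phi>) (z p)"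
      if "(U,z) \<in> A" "p \<in> U" for U z p
      unfolding Q_def
      using conformal_harmonic.G_isotropic[OF chart_conformal_harmonic[OF that(1)] F[OF that(1)]] that(2) by simp
    have "isotropic_immersion A F \<longleftrightarrow> (\<forall>(U,z)\<in>A. \<forall>p\<in>U. Q U z p)"
      unfolding isotropic_immersion_def pointwise_def Q_def ..
    also have "\<dots> \<longleftrightarrow> (\<forall>(U,z)\<in>A. \<forall>p\<in>U. conformal_harmonic.iso_at (in_chart U z \<phi>) (z p)
        \<and> conformal_harmonic.umb_at (in_chart U z \<phi>) (z p))"
      by (intro ball_cong refl, clarify, intro ball_cong refl Q)
    also have "\<dots> \<longleftrightarrow> iso \<and> umb" unfolding iso_def umb_def by blast
    finally show ?thesis .
  qed
  have umbilical: "pseudo_umbilical X A F \<longleftrightarrow> umb"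
  proof
    assume "pseudo_umbilical X A F"
    then obtain \<mu> where \<mu>: "\<forall>(U,z)\<in>A. \<forall>p\<in>U. \<forall>u v.
           second_form (in_chart U z F) (z p) u v \<bullet> mean_curvature (in_chart U z F) (z p)
           = \<mu> p * first_form (in_chart U z F) (z p) u v" unfolding pseudo_umbilical_def by blast
    have "conformal_harmonic.umb_at (in_chart U z \<phi>) (z p)" if c: "(U,z) \<in> A" "p \<in> U" for U z p
      using conformal_harmonic.G_umbilical(2)[OF chart_conformal_harmonic[OF c(1)] F[OF c(1)], of "z p" "\<mu> p"] \<mu> c by blast
    then show umb unfolding umb_def by blast
  next
    \<comment> \<open>The multiplier is the constant 1, since the mean curvature vector has unit
      length.\<close>
    assume umb
    have "\<forall>(U,z)\<in>A. \<forall>p\<in>U. \<forall>u v.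
           second_form (in_chart U z F) (z p) u v \<bullet> mean_curvature (in_chart U z F) (z p)
           = 1 * first_form (in_chart U z F) (z p) u v"
    proof clarify
      fix U z p u v assume c: "(U,z) \<in> A" and p: "p \<in> U"
      have "conformal_harmonic.umb_at (in_chart U z \<phi>) (z p)" using \<open>umb\<close> c p unfolding umb_def by blast
      then show "second_form (in_chart U z F) (z p) u v \<bullet> mean_curvature (in_chart U z F) (z p)
           = 1 * first_form (in_chart U z F) (z p) u v"
        using conformal_harmonic.G_umbilical(1)[OF chart_conformal_harmonic[OF c] F[OF c]] p by simp
    qed
    moreover have "smooth_map_on A (topspace X) (\<lambda>p. 1 :: real)"
      unfolding smooth_map_on_def in_chart_def o_def by (auto intro: smooth_on_const)
    ultimately show "pseudo_umbilical X A F" unfolding pseudo_umbilical_def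
      by (intro exI[of _ "\<lambda>p. 1"] conjI)
  qed
  have "isotropic_bundle X A (harmonic_sequence X A \<phi> 2) \<longleftrightarrow> iso"
    unfolding iso_def by (rule isotropic_bundle_iff)
  then have first: "isotropic_immersion A F \<longleftrightarrow>
      pseudo_umbilical X A F \<and> isotropic_bundle X A (harmonic_sequence X A \<phi> 2)"
    using isotropic umbilical by blast
  \<comment> \<open>The conjugate atlas occurs in the almost complex case alone; the other
    alternatives are obtained for \<open>A\<close> itself.\<close>
  have "iso \<Longrightarrow> umb \<Longrightarrow> almost_complex_curve X A \<phi> \<or> almost_complex_curve X (conj_atlas A) \<phi> \<or>
     (\<exists>v \<beta> \<psi>. norm v = 1 \<and> almost_complex_type_III X A \<psi> \<and>
        \<psi> ` topspace X \<subseteq> sphere 0 1 \<inter> orthogonal_comp {v} \<and> (\<forall>p\<in>topspace X. \<phi> p = rot7 v \<beta> (\<psi> p))) \<or>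
     sphere_totally_geodesic A \<phi> \<or>
     (\<exists>W. subspace W \<and> dim W = 5 \<and> \<phi> ` topspace X \<subseteq> W \<and> superminimal X A \<phi>)"
    by (rule classification) (unfold iso_def umb_def, blast+)
  then show ?thesis using first isotropic by blast
qed

end
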